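(* Let $\Omega=(0,1)^2$, $1\le p,q\le 2$, $\nu_1,\nu_2>0$, $f\in L_2(\Omega)$, and let $\mathbf D'=(D_1,\dots,D_J)$ with $D_j=\partial^{\alpha_j}$, $\alpha_j\in\mathbb N_0^2\setminus\{0\}$, $s_j=|\alpha_j|$, $s=\max_j s_j$, and $\mathbf D''v=(D_iv_j)_{1\le i,j\le J}$. Let $A:L_2(\Omega)\to L_2(\Omega)$ be a linear operator and $\mathbf A_n$ linear operators on $\mathbb R^{\mathbf K_n}$ such that $\lim_{n\to\infty}\|\mathbf T_nAu-\mathbf A_n\mathbf T_nu\|_{\ell_2(\mathbf K_n)}=0$ for all $u\in L_2(\Omega)$. Then one can select a tensor-product B-spline tight wavelet frame system and framelets $\psi_1,\dots,\psi_J$ in it such that $D_j$ is the differential operator associated with $\psi_j$ for each $j$. With the weighted wavelet frame transforms $\mathbf W_n',\mathbf W_n''$ built from these (as defined in the context), put, for $u\in W_{2s}^p(\Omega)$ and $v\in W_s^q(\Omega;\mathbb R^J)$, $$E_n(u,v)=\nu_1\|\mathbf W_n'\mathbf T_nu-\mathbf S_nv\|^p_{\ell_p(\mathbf K_n;\ell_2(\mathbb R^J))}+\nu_2\|\mathbf W_n''\mathbf S_nv\|^q_{\ell_q(\mathbf K_n;\ell_2(\mathbb R^{J^2}))}+\tfrac12\|\mathbf A_n\mathbf T_nu-\mathbf T_nf\|^2_{\ell_2(\mathbf K_n)},$$ $$E(u,v)=\nu_1\|\mathbf D'u-v\|^p_{L_p(\Omega;\ell_2(\mathbb R^J))}+\nu_2\|\mathbf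 D''v\|^q_{L_q(\Omega;\ell_2(\mathbb R^{J^2}))}+\tfrac12\|Au-f\|^2_{L_2(\Omega)}.$$ Then, for every sequence $(u_n,v_n)\to(u,v)$ in $W_{2s}^p(\Omega)\times W_s^q(\Omega;\mathbb R^J)$, we have $\lim_{n\to\infty}E_n(u_n,v_n)=E(u,v)$. Consequently, $E_n$ $\Gamma$-converges to $E$ in $W_{2s}^p(\Omega)\times W_s^q(\Omega;\mathbb R^J)$.
   Context: **Spaces.** $W_r^p(\Omega)$ is the Sobolev space of functions with weak derivatives up to order $r$ in $L_p(\Omega)$; $W_r^q(\Omega;\mathbb R^J)$ is its $\mathbb R^J$-valued version. $\|g\|_{L_p(\Omega;\ell_2)}=\big(\int_\Omega|g(x)|_2^p\,dx\big)^{1/p}$ with $|\cdot|_2$ the Euclidean norm. For an $\mathbb R^M$-valued array $\mathbf a$ on a finite index set $\mathbf K_n$ (below), $\|\mathbf a\|_{\ell_p(\mathbf K_n;\ell_2(\mathbb R^M))}=\big(2^{-2n}\sum_{\mathbf k\in\mathbf K_n}|\mathbf a[\mathbf k]|_2^p\big)^{1/p}$; $\ell_2(\mathbf K_n)$ is the case $M=1$, $p=2$. **B-spline framelets.** For an integer $m\ge1$ let $\kappa\in\{0,1\}$ have the parity of $m$, let $B_m$ be the B-spline with $\widehat B_m(\omega)=e^{-i\kappa\omega/2}\big(\tfrac{\sin(\omega/2)}{\omega/2}\big)^m$, and for $0\le r\le m$ let $q_r$ be the finite real filter with $\sum_kq_r[k]e^{-ik\omega}=i^r\sqrt{\tbinom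 mr}\,e^{-i\kappa\omega/2}\cos^{m-r}(\omega/2)\sin^r(\omega/2)$ (up to a sign, which is immaterial). Put $\phi=B_m\otimes B_m$, $\mathbf q^{(0)}=q_0\otimes q_0$. The framelets of the tensor-product B-spline tight wavelet frame system of order $m$ are $\psi=4\sum_{\mathbf k\in\mathbb Z^2}\mathbf q[\mathbf k]\phi(2\cdot-\mathbf k)$ with $\mathbf q=q_{r_1}\otimes q_{r_2}$, $(r_1,r_2)\ne(0,0)$, $0\le r_1,r_2\le m$; the differential operator associated with such $\psi$ is $\partial_1^{r_1}\partial_2^{r_2}$. Given framelets $\psi_1,\dots,\psi_J$ with filters $\mathbf q^{(1)},\dots,\mathbf q^{(J)}$ and associated operators $D_1,\dots,D_J$ of orders $s_1,\dots,s_J$: - $\varphi_j$ is the compactly supported function with $D_j\varphi_j=\psi_j$; $c_j=\int\varphi_j\neq0$. - $\varphi_{ij}$ is the compactly supported function with $D_i\varphi_{ij}=4c_j^{-1}\sum_{\mathbf m\in\mathbb Z^2}\mathbf q^{(i)}[\mathbf m]\,\varphi_j(2\cdot-\mathbf m/2)$; $c_{ij}=\int\varphi_{ij}\ne0$. - $\phi_{n,\mathbf k}=2^n\phi(2^n\cdot-\mathbf k)$, $\varphi_{j,n-1,\mathbf k}=2^{n-2}\varphi_j(2^{n-1}\cdot-\mathbf k/2)$. **Index sets.** $\mathbf M_n=\{\mathbf k\in\mathbb Z^2:\operatorname{supp}\phi_{n,\mathbf k}\subset\overline\Omega\}$ and $\mathbf K_n=\{\mathbf k\in\mathbf M_n:\mathbf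 k+C\cdot\operatorname{supp}(\mathbf q^{(j)})\subset\mathbf M_n\text{ for all }0\le j\le J\}$, where $C$ is a fixed positive integer, independent of $n$, large enough that for $\mathbf k\in\mathbf K_n$ all sampling functions entering the formulas below are supported in $\overline\Omega$ (so no boundary condition is active in the convolutions). **Sampling.** $(\mathbf T_ng)[\mathbf k]=2^n\langle g,\phi_{n,\mathbf k}\rangle_{L_2(\Omega)}$ for $g\in L_2(\Omega)$, and $(\mathbf S_nv)[j;\mathbf k]=2^n\langle v_j,c_j^{-1}\varphi_{j,n-1,\mathbf k}\rangle_{L_2(\Omega)}$ for $v\in L_2(\Omega;\mathbb R^J)$. These are taken at all indices $\mathbf k$ whose sampling function is supported in $\overline\Omega$; where an array on $\mathbf K_n$ is needed (as an argument of $\mathbf A_n$ and inside norms) they are restricted to $\mathbf K_n$. **Weighted transforms.** For $\mathbf k\in\mathbf K_n$, $$(\mathbf W_n'\mathbf u)[j;\mathbf k]=c_j^{-1}(-1)^{s_j}2^{(n-1)s_j}\sum_{\mathbf l}\mathbf q^{(j)}[\mathbf l-\mathbf k]\mathbf u[\mathbf l],\qquad(\mathbf W_n''\mathbf v)[i,j;\mathbf k]=c_{ij}^{-1}(-1)^{s_i}2^{(n-2)s_i}\sum_{\mathbf l}\mathbf q^{(i)}[\mathbf l-\mathbf k]\mathbf v[j;\mathbf l],\quad 1\le i,j\le J.$$ **$\Gamma$-convergence.** Functionals $E_n$ on a Banach space $B$ $\Gamma$-converge to $E$ if (1) $\liminf_{n\to\infty}E_n(w_n)\ge E(w)$ whenever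 $w_n\to w$ in $B$; (2) for every $w\in B$ there is a sequence $w_n'\to w$ in $B$ with $\limsup_{n\to\infty}E_n(w_n')\le E(w)$. *)

theory Defs
  imports "HOL-Analysis.Analysis" "HOL-Probability.Sinc_Integral"
begin

type_synonym plane = "real \<times> real"
type_synonym fn = "plane \<Rightarrow> real"
type_synonym array = "int \<times> int \<Rightarrow> real"
type_synonym multi_index = "nat \<times> nat"

definition Omega :: "plane set" where
  "Omega = {0<..<1} \<times> {0<..<1}"

definition order_of :: "multi_index \<Rightarrow> nat" where
  "order_of a = fst a + snd a"


section \<open>Lebesgue spaces, weak derivatives, Sobolev spaces\<close>

text \<open>
  Elements of function spaces are represented by functions on the plane; only their values
  almost everywhere on the domain matter.
\<close>

definition Lp_space :: "plane set \<Rightarrow> real \<Rightarrow> fn set" where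
  "Lp_space U p = {f. f \<in> borel_measurable (lebesgue_on U) \<and>
                      integrable (lebesgue_on U) (\<lambda>x. \<bar>f x\<bar> powr p)}"

definition Lp_norm :: "plane set \<Rightarrow> real \<Rightarrow> fn \<Rightarrow> real" where
  "Lp_norm U p f = (LINT x|lebesgue_on U. \<bar>f x\<bar> powr p) powr (1 / p)"

text \<open>The \<open>\<ell>\<^sub>2\<close>-valued norm of a finite family of functions.\<close>
definition Lp_vnorm :: "plane set \<Rightarrow> real \<Rightarrow> 'i set \<Rightarrow> ('i \<Rightarrow> fn) \<Rightarrow> real" where
  "Lp_vnorm U p I g = Lp_norm U p (\<lambda>x. L2_set (\<lambda>i. g i x) I)"

definition inner_L2 :: "plane set \<Rightarrow> fn \<Rightarrow> fn \<Rightarrow> real" where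
  "inner_L2 U f g = (LINT x|lebesgue_on U. f x * g x)"

definition dir_deriv :: "plane \<Rightarrow> fn \<Rightarrow> fn" where
  "dir_deriv e f = (\<lambda>x. frechet_derivative f (at x) e)"

definition mixed_partial :: "multi_index \<Rightarrow> fn \<Rightarrow> fn" where
  "mixed_partial a f = (dir_deriv (1, 0) ^^ fst a) ((dir_deriv (0, 1) ^^ snd a) f)"

primrec C_k :: "nat \<Rightarrow> fn \<Rightarrow> bool" where
  "C_k 0 f \<longleftrightarrow> continuous_on UNIV f"
| "C_k (Suc k) f \<longleftrightarrow> f differentiable_on UNIV \<and> C_k k (dir_deriv (1, 0) f) \<and> C_k k (dir_deriv (0, 1) f)"

definition test_functions :: "plane set \<Rightarrow> fn set" where
  "test_functions U = {h. (\<forall>k. C_k k h) \<and> compact (closure {x. h x \<noteq> 0}) \<and> closure {x. h x \<noteq> 0} \<subseteq> U}"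

definition locally_integrable :: "plane set \<Rightarrow> fn \<Rightarrow> bool" where
  "locally_integrable U f \<longleftrightarrow> (\<forall>K. compact K \<and> K \<subseteq> U \<longrightarrow> integrable (lebesgue_on K) f)"

definition is_weak_deriv :: "plane set \<Rightarrow> multi_index \<Rightarrow> fn \<Rightarrow> fn \<Rightarrow> bool" where
  "is_weak_deriv U a f g \<longleftrightarrow> locally_integrable U f \<and> locally_integrable U g \<and>
     (\<forall>h \<in> test_functions U.
        (LINT x|lebesgue_on U. f x * mixed_partial a h x)
          = (-1) ^ order_of a * (LINT x|lebesgue_on U. g x * h x))"

text \<open>The weak derivative is unique up to null sets; any representative will do.\<close>
definition weak_deriv :: "plane set \<Rightarrow> multi_index \<Rightarrow> fn \<Rightarrow> fn" where
  "weak_deriv U a f = (SOME g. is_weak_deriv U a f g)"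

definition sobolev_space :: "plane set \<Rightarrow> nat \<Rightarrow> real \<Rightarrow> fn set" where
  "sobolev_space U r p = {f \<in> Lp_space U p.
     \<forall>a. order_of a \<le> r \<longrightarrow> (\<exists>g \<in> Lp_space U p. is_weak_deriv U a f g)}"

definition sobolev_norm :: "plane set \<Rightarrow> nat \<Rightarrow> real \<Rightarrow> fn \<Rightarrow> real" where
  "sobolev_norm U r p f =
     (\<Sum>a | order_of a \<le> r. Lp_norm U p (weak_deriv U a f) powr p) powr (1 / p)"

text \<open>The \<open>\<real>\<^sup>J\<close>-valued versions; components are numbered \<open>1, \<dots>, J\<close>.\<close>
definition sobolev_vspace :: "plane set \<Rightarrow> nat \<Rightarrow> real \<Rightarrow> nat \<Rightarrow> (nat \<Rightarrow> fn) set" where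
  "sobolev_vspace U r p J = {v. \<forall>j \<in> {1..J}. v j \<in> sobolev_space U r p}"

definition sobolev_vnorm :: "plane set \<Rightarrow> nat \<Rightarrow> real \<Rightarrow> nat \<Rightarrow> (nat \<Rightarrow> fn) \<Rightarrow> real" where
  "sobolev_vnorm U r p J v =
     (\<Sum>a | order_of a \<le> r. Lp_vnorm U p {1..J} (\<lambda>j. weak_deriv U a (v j)) powr p) powr (1 / p)"

text \<open>
  A linear operator on \<open>L\<^sub>2(U)\<close>, given on representatives: it respects equality almost everywhere
  and is linear up to equality almost everywhere. Boundedness is not required.
\<close>
definition linear_operator_L2 :: "plane set \<Rightarrow> (fn \<Rightarrow> fn) \<Rightarrow> bool" where
  "linear_operator_L2 U A \<longleftrightarrow>
     (\<forall>f \<in> Lp_space U 2. A f \<in> Lp_space U 2) \<and>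
     (\<forall>f \<in> Lp_space U 2. \<forall>g \<in> Lp_space U 2.
        (AE x in lebesgue_on U. f x = g x) \<longrightarrow> (AE x in lebesgue_on U. A f x = A g x)) \<and>
     (\<forall>f \<in> Lp_space U 2. \<forall>g \<in> Lp_space U 2. \<forall>b c.
        AE x in lebesgue_on U. A (\<lambda>y. b * f y + c * g y) x = b * A f x + c * A g x)"

text \<open>
  The support of a function that is only determined almost everywhere: the complement of the largest
  open set on which it vanishes almost everywhere.
\<close>
definition ess_support :: "fn \<Rightarrow> plane set" where
  "ess_support f = - \<Union>{V. open V \<and> (AE x in lebesgue. x \<in> V \<longrightarrow> f x = 0)}"


section \<open>B-splines, filters and framelets\<close>

definition parity :: "nat \<Rightarrow> nat" where
  "parity m = m mod 2"

text \<open>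
  The Fourier transform determines the B-spline up to null sets, and only integrals against it and
  its essential support are used.
\<close>
definition bspline :: "nat \<Rightarrow> real \<Rightarrow> real" where
  "bspline m = (SOME B. integrable lborel B \<and>
     (\<forall>w. (LINT x|lborel. complex_of_real (B x) * cis (- (w * x)))
            = cis (- (real (parity m) * w / 2)) * complex_of_real (sinc (w / 2) ^ m)))"

definition bspline_filter :: "nat \<Rightarrow> nat \<Rightarrow> int \<Rightarrow> real" where
  "bspline_filter m r = (THE q. finite {k. q k \<noteq> 0} \<and>
     (\<forall>w. (\<Sum>k | q k \<noteq> 0. complex_of_real (q k) * cis (- (real_of_int k * w)))
            = \<i> ^ r * complex_of_real (sqrt (real (m choose r)))
              * cis (- (real (parity m) * w / 2))
              * complex_of_real (cos (w / 2) ^ (m - r) * sin (w / 2) ^ r)))"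

definition scaling_fn :: "nat \<Rightarrow> fn" where
  "scaling_fn m = (\<lambda>(x, y). bspline m x * bspline m y)"

definition tensor_filter :: "nat \<Rightarrow> multi_index \<Rightarrow> array" where
  "tensor_filter m r = (\<lambda>(k, l). bspline_filter m (fst r) k * bspline_filter m (snd r) l)"

definition filter_support :: "array \<Rightarrow> (int \<times> int) set" where
  "filter_support q = {k. q k \<noteq> 0}"

definition ivec :: "int \<times> int \<Rightarrow> plane" where
  "ivec k = (real_of_int (fst k), real_of_int (snd k))"

definition framelet :: "nat \<Rightarrow> multi_index \<Rightarrow> fn" where
  "framelet m r = (\<lambda>x. 4 * (\<Sum>k \<in> filter_support (tensor_filter m r).
     tensor_filter m r k * scaling_fn m (2 *\<^sub>R x - ivec k)))"

text \<open>
  \<open>framelet_with_operator m a \<psi>\<close>: \<open>\<psi>\<close> is a framelet of the tensor-product B-spline tight wavelet frame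
  system of order \<open>m\<close>, and the differential operator associated with it is \<open>\<partial>\<^sup>a\<close>; that is, \<open>\<psi>\<close> has the
  filter \<open>tensor_filter m a\<close>.
\<close>
definition framelet_with_operator :: "nat \<Rightarrow> multi_index \<Rightarrow> fn \<Rightarrow> bool" where
  "framelet_with_operator m a psi \<longleftrightarrow>
     a \<noteq> (0, 0) \<and> fst a \<le> m \<and> snd a \<le> m \<and> psi = framelet m a"

text \<open>The compactly supported function \<open>f\<close> with \<open>\<partial>\<^sup>a f = g\<close>, unique up to null sets.\<close>
definition compact_primitive :: "multi_index \<Rightarrow> fn \<Rightarrow> fn" where
  "compact_primitive a g = (SOME f. integrable lebesgue f \<and> compact (ess_support f) \<and>
     is_weak_deriv UNIV a f g)"

text \<open>
  From here on, \<open>al j\<close> is the multi-index of \<open>D\<^sub>j\<close> and \<open>psi j\<close> the framelet \<open>\<psi>\<^sub>j\<close>, for \<open>1 \<le> j \<le> J\<close>;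
  index \<open>0\<close> denotes the low-pass filter.
\<close>
definition filt :: "nat \<Rightarrow> (nat \<Rightarrow> multi_index) \<Rightarrow> nat \<Rightarrow> array" where
  "filt m al j = tensor_filter m (if j = 0 then (0, 0) else al j)"

text \<open>\<open>\<phi>\<^sub>j\<close> and \<open>c\<^sub>j\<close>\<close>
definition prim1 :: "(nat \<Rightarrow> multi_index) \<Rightarrow> (nat \<Rightarrow> fn) \<Rightarrow> nat \<Rightarrow> fn" where
  "prim1 al psi j = compact_primitive (al j) (psi j)"

definition mean1 :: "(nat \<Rightarrow> multi_index) \<Rightarrow> (nat \<Rightarrow> fn) \<Rightarrow> nat \<Rightarrow> real" where
  "mean1 al psi j = (LINT x|lebesgue. prim1 al psi j x)"

text \<open>\<open>\<phi>\<^sub>i\<^sub>j\<close> and \<open>c\<^sub>i\<^sub>j\<close>\<close>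
definition prim2 :: "nat \<Rightarrow> (nat \<Rightarrow> multi_index) \<Rightarrow> (nat \<Rightarrow> fn) \<Rightarrow> nat \<Rightarrow> nat \<Rightarrow> fn" where
  "prim2 m al psi i j = compact_primitive (al i)
     (\<lambda>x. 4 * inverse (mean1 al psi j) *
        (\<Sum>k \<in> filter_support (filt m al i).
           filt m al i k * prim1 al psi j (2 *\<^sub>R x - (1 / 2) *\<^sub>R ivec k)))"

definition mean2 :: "nat \<Rightarrow> (nat \<Rightarrow> multi_index) \<Rightarrow> (nat \<Rightarrow> fn) \<Rightarrow> nat \<Rightarrow> nat \<Rightarrow> real" where
  "mean2 m al psi i j = (LINT x|lebesgue. prim2 m al psi i j x)"

definition scaling_fn_at :: "nat \<Rightarrow> nat \<Rightarrow> int \<times> int \<Rightarrow> fn" where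
  "scaling_fn_at m n k = (\<lambda>x. 2 ^ n * scaling_fn m (2 ^ n *\<^sub>R x - ivec k))"

text \<open>
  The scale is shifted: \<open>prim1_at al psi j n k\<close> is the sampling function with indices \<open>j, n - 1, k\<close>.
  The exponents are integers, so nothing is truncated for small \<open>n\<close>.
\<close>
definition prim1_at :: "(nat \<Rightarrow> multi_index) \<Rightarrow> (nat \<Rightarrow> fn) \<Rightarrow> nat \<Rightarrow> nat \<Rightarrow> int \<times> int \<Rightarrow> fn" where
  "prim1_at al psi j n k = (\<lambda>x. 2 powi (int n - 2) *
     prim1 al psi j ((2 powi (int n - 1)) *\<^sub>R x - (1 / 2) *\<^sub>R ivec k))"


section \<open>Index sets, sampling and weighted transforms\<close>

definition M_set :: "nat \<Rightarrow> nat \<Rightarrow> (int \<times> int) set" where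
  "M_set m n = {k. ess_support (scaling_fn_at m n k) \<subseteq> closure Omega}"

definition K_set :: "nat \<Rightarrow> (nat \<Rightarrow> multi_index) \<Rightarrow> nat \<Rightarrow> nat \<Rightarrow> nat \<Rightarrow> (int \<times> int) set" where
  "K_set m al J C n = {k \<in> M_set m n. \<forall>j \<le> J.
     \<forall>l \<in> filter_support (filt m al j). k + (int C * fst l, int C * snd l) \<in> M_set m n}"

text \<open>
  The margin \<open>C\<close> is large enough: every sampling function that enters \<open>T\<^sub>n\<close>, \<open>S\<^sub>n\<close> and the two
  transforms at an index of \<open>K_set\<close> is supported in the closure of the domain.
\<close>
definition admissible_margin ::
  "nat \<Rightarrow> (nat \<Rightarrow> multi_index) \<Rightarrow> (nat \<Rightarrow> fn) \<Rightarrow> nat \<Rightarrow> nat \<Rightarrow> bool" where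
  "admissible_margin m al psi J C \<longleftrightarrow> C > 0 \<and>
     (\<forall>n. \<forall>k \<in> K_set m al J C n.
        \<forall>l \<in> insert k (\<Union>i \<in> {1..J}. (+) k ` filter_support (filt m al i)).
          ess_support (scaling_fn_at m n l) \<subseteq> closure Omega \<and>
          (\<forall>j \<in> {1..J}. ess_support (prim1_at al psi j n l) \<subseteq> closure Omega))"

text \<open>
  Sampling is given by a formula at every index; for an admissible margin only indices whose
  sampling function is supported in the closure of the domain are used below.
\<close>
definition T_op :: "nat \<Rightarrow> nat \<Rightarrow> fn \<Rightarrow> array" where
  "T_op m n g k = 2 ^ n * inner_L2 Omega g (scaling_fn_at m n k)"

definition S_op :: "(nat \<Rightarrow> multi_index) \<Rightarrow> (nat \<Rightarrow> fn) \<Rightarrow> nat \<Rightarrow> (nat \<Rightarrow> fn) \<Rightarrow> nat \<Rightarrow> array" where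
  "S_op al psi n v j k = 2 ^ n *
     inner_L2 Omega (v j) (\<lambda>x. inverse (mean1 al psi j) * prim1_at al psi j n k x)"

definition W1_op ::
  "nat \<Rightarrow> (nat \<Rightarrow> multi_index) \<Rightarrow> (nat \<Rightarrow> fn) \<Rightarrow> nat \<Rightarrow> array \<Rightarrow> nat \<Rightarrow> array" where
  "W1_op m al psi n u j k =
     inverse (mean1 al psi j) * (-1) ^ order_of (al j)
       * 2 powi ((int n - 1) * int (order_of (al j)))
       * (\<Sum>l | filt m al j (l - k) \<noteq> 0. filt m al j (l - k) * u l)"

definition W2_op ::
  "nat \<Rightarrow> (nat \<Rightarrow> multi_index) \<Rightarrow> (nat \<Rightarrow> fn) \<Rightarrow> nat \<Rightarrow> (nat \<Rightarrow> array) \<Rightarrow> nat \<times> nat \<Rightarrow> array" where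
  "W2_op m al psi n v = (\<lambda>(i, j) k.
     inverse (mean2 m al psi i j) * (-1) ^ order_of (al i)
       * 2 powi ((int n - 2) * int (order_of (al i)))
       * (\<Sum>l | filt m al i (l - k) \<noteq> 0. filt m al i (l - k) * v j l))"

definition arr_norm :: "nat \<Rightarrow> (int \<times> int) set \<Rightarrow> real \<Rightarrow> array \<Rightarrow> real" where
  "arr_norm n K p a = (2 powi (- 2 * int n) * (\<Sum>k\<in>K. \<bar>a k\<bar> powr p)) powr (1 / p)"

definition arr_vnorm :: "nat \<Rightarrow> (int \<times> int) set \<Rightarrow> real \<Rightarrow> 'i set \<Rightarrow> ('i \<Rightarrow> array) \<Rightarrow> real" where
  "arr_vnorm n K p I a = arr_norm n K p (\<lambda>k. L2_set (\<lambda>i. a i k) I)"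

text \<open>Arrays on \<open>K\<close> are represented by arrays that vanish outside \<open>K\<close>.\<close>
definition restrict_array :: "(int \<times> int) set \<Rightarrow> array \<Rightarrow> array" where
  "restrict_array K a = (\<lambda>k. if k \<in> K then a k else 0)"

definition linear_on_arrays :: "(int \<times> int) set \<Rightarrow> (array \<Rightarrow> array) \<Rightarrow> bool" where
  "linear_on_arrays K L \<longleftrightarrow>
     (\<forall>a b. \<forall>c d :: real. (\<forall>k. k \<notin> K \<longrightarrow> a k = 0 \<and> b k = 0) \<longrightarrow>
        (\<forall>k \<in> K. L (\<lambda>l. c * a l + d * b l) k = c * L a k + d * L b k))"

definition consistent_discretization ::
  "nat \<Rightarrow> (nat \<Rightarrow> (int \<times> int) set) \<Rightarrow> (fn \<Rightarrow> fn) \<Rightarrow> (nat \<Rightarrow> array \<Rightarrow> array) \<Rightarrow> bool" where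
  "consistent_discretization m K A An \<longleftrightarrow>
     (\<forall>u \<in> Lp_space Omega 2.
        (\<lambda>n. arr_norm n (K n) 2
               (\<lambda>k. T_op m n (A u) k - An n (restrict_array (K n) (T_op m n u)) k))
          \<longlonglongrightarrow> 0)"


section \<open>The functionals and Gamma-convergence\<close>

definition E_discrete ::
  "real \<Rightarrow> real \<Rightarrow> real \<Rightarrow> real \<Rightarrow> fn \<Rightarrow> nat \<Rightarrow> (nat \<Rightarrow> multi_index) \<Rightarrow>
   nat \<Rightarrow> (nat \<Rightarrow> fn) \<Rightarrow> (nat \<Rightarrow> (int \<times> int) set) \<Rightarrow> (nat \<Rightarrow> array \<Rightarrow> array) \<Rightarrow>
   nat \<Rightarrow> fn \<times> (nat \<Rightarrow> fn) \<Rightarrow> real" where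
  "E_discrete p q nu1 nu2 f J al m psi K An n = (\<lambda>(u, v).
     nu1 * arr_vnorm n (K n) p {1..J}
       (\<lambda>j k. W1_op m al psi n (T_op m n u) j k - S_op al psi n v j k) powr p
   + nu2 * arr_vnorm n (K n) q ({1..J} \<times> {1..J}) (W2_op m al psi n (S_op al psi n v)) powr q
   + 1 / 2 * (arr_norm n (K n) 2
       (\<lambda>k. An n (restrict_array (K n) (T_op m n u)) k - T_op m n f k))\<^sup>2)"

definition E_continuous ::
  "real \<Rightarrow> real \<Rightarrow> real \<Rightarrow> real \<Rightarrow> fn \<Rightarrow> nat \<Rightarrow> (nat \<Rightarrow> multi_index) \<Rightarrow> (fn \<Rightarrow> fn) \<Rightarrow>
   fn \<times> (nat \<Rightarrow> fn) \<Rightarrow> real" where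
  "E_continuous p q nu1 nu2 f J al A = (\<lambda>(u, v).
     nu1 * Lp_vnorm Omega p {1..J} (\<lambda>j x. weak_deriv Omega (al j) u x - v j x) powr p
   + nu2 * Lp_vnorm Omega q ({1..J} \<times> {1..J}) (\<lambda>(i, j). weak_deriv Omega (al i) (v j)) powr q
   + 1 / 2 * (Lp_norm Omega 2 (\<lambda>x. A u x - f x))\<^sup>2)"

definition max_order :: "nat \<Rightarrow> (nat \<Rightarrow> multi_index) \<Rightarrow> nat" where
  "max_order J al = Max ((\<lambda>j. order_of (al j)) ` {1..J})"

definition UV_space :: "nat \<Rightarrow> real \<Rightarrow> real \<Rightarrow> nat \<Rightarrow> (fn \<times> (nat \<Rightarrow> fn)) set" where
  "UV_space s p q J = sobolev_space Omega (2 * s) p \<times> sobolev_vspace Omega s q J"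

definition UV_dist ::
  "nat \<Rightarrow> real \<Rightarrow> real \<Rightarrow> nat \<Rightarrow> fn \<times> (nat \<Rightarrow> fn) \<Rightarrow> fn \<times> (nat \<Rightarrow> fn) \<Rightarrow> real" where
  "UV_dist s p q J w w' =
     sobolev_norm Omega (2 * s) p (\<lambda>x. fst w x - fst w' x)
   + sobolev_vnorm Omega s q J (\<lambda>j x. snd w j x - snd w' j x)"

definition converges_in :: "'b set \<Rightarrow> ('b \<Rightarrow> 'b \<Rightarrow> real) \<Rightarrow> (nat \<Rightarrow> 'b) \<Rightarrow> 'b \<Rightarrow> bool" where
  "converges_in B d ws w \<longleftrightarrow> (\<forall>n. ws n \<in> B) \<and> w \<in> B \<and> (\<lambda>n. d (ws n) w) \<longlonglongrightarrow> 0"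

text \<open>
  Gamma-convergence on a space given by a set of representatives and the (pseudo-)distance of its norm.
\<close>
definition gamma_converges ::
  "'b set \<Rightarrow> ('b \<Rightarrow> 'b \<Rightarrow> real) \<Rightarrow> (nat \<Rightarrow> 'b \<Rightarrow> real) \<Rightarrow> ('b \<Rightarrow> real) \<Rightarrow> bool" where
  "gamma_converges B d En E \<longleftrightarrow>
     (\<forall>ws w. converges_in B d ws w \<longrightarrow> liminf (\<lambda>n. ereal (En n (ws n))) \<ge> ereal (E w)) \<and>
     (\<forall>w \<in> B. \<exists>ws. converges_in B d ws w \<and> limsup (\<lambda>n. ereal (En n (ws n))) \<le> ereal (E w))"

end

theory Submission
  imports Defs "HOL-Real_Asymp.Real_Asymp" "HOL-Probability.Levy"
begin

text \<open>
  The B-spline of order \<open>m\<close> is the \<open>m\<close>-fold convolution of the unit box, and its filters are polynomials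
  in the unit translation. Hence the compactly supported primitives of the framelets are products of
  nonnegative splines, and summation against a filter followed by integration by parts turns
  \<open>W'\<^sub>n T\<^sub>n u\<close> and \<open>W''\<^sub>n S\<^sub>n v\<close> into samples of the weak derivatives \<open>D\<^sub>j u\<close> and \<open>D\<^sub>i v\<^sub>j\<close>
  against kernels of mass one. Extended to piecewise constant functions on the dyadic cells, such samples
  are bounded in \<open>L\<^sub>p\<close> uniformly in \<open>n\<close> (Jensen) and converge for continuous functions, so they converge
  in \<open>L\<^sub>p\<close> for convergent sequences of functions; this settles the first two terms of the functional.

  In the third term neither \<open>A\<close> nor the family \<open>A\<^sub>n\<close> is assumed bounded, but consistency makes
  the seminorms \<open>\<parallel>A\<^sub>n T\<^sub>n h\<parallel>\<close> pointwise bounded on \<open>L\<^sub>2\<close>, and the uniform boundedness principle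
  applies. Convergence \<open>u\<^sub>n \<rightarrow> u\<close> in \<open>L\<^sub>2\<close> comes from the embedding of \<open>W\<^sub>1\<^sup>1\<close> into \<open>L\<^sub>2\<close>
  in dimension two, which is obtained by sampling from its discrete counterpart. Finally, convergence of
  \<open>E\<^sub>n\<close> along all convergent sequences gives Gamma-convergence with constant recovery sequences.
\<close>

section \<open>Smooth functions of one variable\<close>

text \<open>The sampling functions are given by choice operators that fix them at best up to null
  sets, so each is pinned down by an explicit candidate and a uniqueness argument: Fourier
  transforms for the B-spline, test functions for primitives and weak derivatives. A primitive of a
  framelet lives at twice the scale of its argument, which the dilation by 2^(n-1) and the
  half-integer shifts undo; all three families thus become kernels on the grid of width 2^-n,
  displaced by 1, 2 and 3 times \<open>m div 2\<close>. The order \<open>m\<close> of the system is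
  free and is taken at least 2, which makes all kernels continuous, and at least as large as every
  entry of the multi-indices. The obstacle to integration by parts is that the kernels have finitely
  many derivatives and may touch the boundary of the square, while test functions are smooth with
  compact support inside. Contraction towards the centre followed by mollification bridges the gap.
  The embedding into L_2 serves twice: the first term of the functional measures v with exponent p
  although convergence of v is given with exponent q.\<close>

coinductive smooth :: "(real \<Rightarrow> real) \<Rightarrow> bool" where
  smoothI: "(\<And>x. (f has_real_derivative f' x) (at x)) \<Longrightarrow> smooth f' \<Longrightarrow> smooth f"

text \<open>Unrolling the coinductive predicate yields derivatives of all orders without an index. A
  proof of smoothness therefore only has to exhibit a set of functions that is closed under
  differentiation.\<close>

lemma smooth_coinduct_set:
  assumes "f \<in> X" and "\<And>g. g \<in> X \<Longrightarrow> \<exists>g'\<in>X. \<forall>x. (g has_real_derivative g' x) (at x)"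
  shows "smooth f"
  using assms(1)
proof (coinduction arbitrary: f)
  case smooth
  with assms(2) show ?case by blast
qed

lemma smoothD:
  assumes "smooth f"
  shows "(f has_real_derivative deriv f x) (at x)" "smooth (deriv f)"
proof -
  from assms obtain f' where f': "\<And>x. (f has_real_derivative f' x) (at x)" "smooth f'"
    by (metis smooth.cases)
  then have "deriv f = f'" by (auto intro: DERIV_imp_deriv)
  with f' show "(f has_real_derivative deriv f x) (at x)" "smooth (deriv f)" by auto
qed

lemma smooth_deriv_iter: "smooth f \<Longrightarrow> smooth ((deriv ^^ n) f)"
  by (induction n) (auto intro: smoothD)

lemma smooth_continuous: "smooth f \<Longrightarrow> continuous_on S f"
  by (meson DERIV_continuous continuous_at_imp_continuous_on smoothD(1))

lemma smooth_linear_comp: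
  assumes "smooth f" shows "smooth (\<lambda>x. a * f (c * x + t))"
proof (rule smooth_coinduct_set[where X = "{\<lambda>x. a * f (c * x + t) | a f. smooth f}"])
  fix g assume "g \<in> {\<lambda>x. a * f (c * x + t) | a f. smooth f}"
  then obtain a f where g: "g = (\<lambda>x. a * f (c * x + t))" "smooth f" by auto
  have "(g has_real_derivative (a * c) * deriv f (c * x + t)) (at x)" for x
    unfolding g by (auto intro!: derivative_eq_intros DERIV_chain2[OF smoothD(1)[OF g(2)]])
  with g smoothD(2)[OF g(2)] show "\<exists>g'\<in>{\<lambda>x. a * f (c * x + t) | a f. smooth f}. \<forall>x. (g has_real_derivative g' x) (at x)"
    by (intro bexI[of _ "\<lambda>x. (a * c) * deriv f (c * x + t)"]) auto
qed (use assms in auto)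

text \<open>Single products are not closed under differentiation, but finite sums of products are:
  the Leibniz rule replaces one pair by two. The lists of pairs encode such sums.\<close>

lemma smooth_mult:
  assumes "smooth f" "smooth g" shows "smooth (\<lambda>x. f x * g x)"
proof -
  define X where "X = {\<lambda>x. \<Sum>(u, v)\<leftarrow>L. u x * v x | L :: ((real \<Rightarrow> real) \<times> (real \<Rightarrow> real)) list.
     \<forall>(u, v) \<in> set L. smooth u \<and> smooth v}"
  have X: "\<exists>h'\<in>X. \<forall>x. ((\<lambda>x. \<Sum>(u, v)\<leftarrow>L. u x * v x) has_real_derivative h' x) (at x)"
    if "\<forall>(u, v) \<in> set L. smooth u \<and> smooth v" for L :: "((real \<Rightarrow> real) \<times> (real \<Rightarrow> real)) list"
    using that
  proof (induction L)
    case Nil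
    show ?case by (rule bexI[of _ "\<lambda>x. 0"]) (auto simp: X_def intro!: exI[of _ "[]"])
  next
    case (Cons p L)
    obtain u v where p: "p = (u, v)" "smooth u" "smooth v" using Cons.prems by (cases p) auto
    obtain h' where h': "h' \<in> X" "\<And>x. ((\<lambda>x. \<Sum>(u, v)\<leftarrow>L. u x * v x) has_real_derivative h' x) (at x)"
      using Cons by force
    obtain M where M: "h' = (\<lambda>x. \<Sum>(u, v)\<leftarrow>M. u x * v x)" "\<forall>(u, v) \<in> set M. smooth u \<and> smooth v"
      using h'(1) by (auto simp: X_def)
    define M' where "M' = (u, deriv v) # (deriv u, v) # M"
    have "(\<lambda>x. \<Sum>(u, v)\<leftarrow>M'. u x * v x) \<in> X"
      unfolding X_def M'_def using M p by (auto intro!: exI[of _ "(u, deriv v) # (deriv u, v) # M"] smoothD)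
    moreover have "((\<lambda>x. \<Sum>(u, v)\<leftarrow>p # L. u x * v x) has_real_derivative (\<Sum>(u, v)\<leftarrow>M'. u x * v x)) (at x)" for x
      unfolding M'_def p using h'(2)[of x] M(1) smoothD(1)[OF p(2), of x] smoothD(1)[OF p(3), of x]
      by (auto intro!: derivative_eq_intros)
    ultimately show ?case by (intro bexI[of _ "\<lambda>x. \<Sum>(u, v)\<leftarrow>M'. u x * v x"]) auto
  qed
  show ?thesis
  proof (rule smooth_coinduct_set[where X = X])
    show "(\<lambda>x. f x * g x) \<in> X" using assms by (auto simp: X_def intro!: exI[of _ "[(f, g)]"])
    show "\<exists>h'\<in>X. \<forall>x. (h has_real_derivative h' x) (at x)" if "h \<in> X" for h
      using that X unfolding X_def by blast
  qed
qed

lemma smooth_diff: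
  assumes "smooth f" "smooth g" shows "smooth (\<lambda>x. f x - g x)"
proof (rule smooth_coinduct_set[where X = "{\<lambda>x. f x - g x | f g. smooth f \<and> smooth g}"])
  fix h assume "h \<in> {\<lambda>x. f x - g x | f g. smooth f \<and> smooth g}"
  then obtain f g where h: "h = (\<lambda>x. f x - g x)" "smooth f" "smooth g" by auto
  show "\<exists>g'\<in>{\<lambda>x. f x - g x | f g. smooth f \<and> smooth g}. \<forall>x. (h has_real_derivative g' x) (at x)"
  proof (rule bexI)
    show "\<forall>x. (h has_real_derivative deriv f x - deriv g x) (at x)"
      unfolding h(1) using h by (auto intro!: DERIV_diff smoothD)
    show "(\<lambda>x. deriv f x - deriv g x) \<in> {\<lambda>x. f x - g x | f g. smooth f \<and> smooth g}"
      using h by (blast intro: smoothD)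
  qed
qed (use assms in auto)

lemma deriv_iter_diff:
  assumes "smooth f" "smooth g"
  shows "(deriv ^^ n) (\<lambda>x. f x - g x) = (\<lambda>x. (deriv ^^ n) f x - (deriv ^^ n) g x)"
proof (induction n)
  case (Suc n)
  show ?case
    unfolding funpow.simps comp_def Suc
    by (intro ext DERIV_imp_deriv DERIV_diff smoothD smooth_deriv_iter assms)
qed auto

lemma deriv_iter_linear_comp:
  assumes "smooth f"
  shows "(deriv ^^ n) (\<lambda>x. a * f (c * x + t)) = (\<lambda>x. a * c ^ n * (deriv ^^ n) f (c * x + t))"
proof (induction n)
  case (Suc n)
  note D = smoothD(1)[OF smooth_deriv_iter[OF assms, of n]]
  show ?case
    unfolding funpow.simps comp_def Suc
    by (intro ext DERIV_imp_deriv) (auto intro!: derivative_eq_intros DERIV_chain2[OF D])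
qed auto

section \<open>Smooth cutoffs on intervals\<close>

definition flat :: "real \<Rightarrow> real" where "flat t = (if t > 0 then exp (- 1 / t) else 0)"

text \<open>The substitution y = 1 / t turns this into the decay of a polynomial times exp (- y) at
  infinity.\<close>

lemma poly_exp_flat_tendsto:
  fixes p :: "real poly"
  shows "((\<lambda>t. poly p (1 / t) * exp (- 1 / t)) \<longlongrightarrow> 0) (at_right 0)"
proof -
  have "((\<lambda>y. poly p y * exp (- y)) \<longlongrightarrow> 0) at_top"
  proof -
    have "((\<lambda>y. \<Sum>i\<le>degree p. coeff p i * (y ^ i / exp y)) \<longlongrightarrow> (\<Sum>i\<le>degree p. coeff p i * 0)) at_top"
      by (intro tendsto_sum tendsto_mult tendsto_const tendsto_power_div_exp_0)
    then show ?thesis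
      by (simp add: poly_altdef sum_distrib_right exp_minus divide_inverse mult.assoc)
  qed
  from filterlim_compose[OF this filterlim_inverse_at_top_right]
  show ?thesis by (simp add: divide_inverse)
qed

text \<open>The functions p (1 / t) exp (- 1 / t), extended by zero to the left half line, form a
  set closed under differentiation. Only the origin needs care, where both one-sided difference
  quotients tend to zero.\<close>

lemma smooth_flat: "smooth flat"
proof (rule smooth_coinduct_set[where X = "{\<lambda>t. if t > 0 then poly p (1 / t) * exp (- 1 / t) else 0 | p. True}"])
  show "flat \<in> {\<lambda>t. if t > 0 then poly p (1 / t) * exp (- 1 / t) else 0 | p. True}"
    by (auto simp: flat_def fun_eq_iff intro!: exI[of _ 1])
  fix g :: "real \<Rightarrow> real" assume "g \<in> {\<lambda>t. if t > 0 then poly p (1 / t) * exp (- 1 / t) else 0 | p. True}"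
  then obtain p where g: "g = (\<lambda>t. if t > 0 then poly p (1 / t) * exp (- 1 / t) else 0)" by auto
  \<comment> \<open>The chain rule contributes 1 / t^2, so \<open>p\<close> is replaced by X^2 (p -
    p').\<close>
  define g' where "g' = (\<lambda>t::real. if t > 0 then poly ([:0, 0, 1:] * (p - pderiv p)) (1 / t) * exp (- 1 / t) else 0)"
  have "(g has_real_derivative g' x) (at x)" for x
  proof (cases "x = 0")
    case False
    define h where "h = (if x > 0 then (\<lambda>t. poly p (1 / t) * exp (- 1 / t)) else (\<lambda>t. 0))"
    have "(h has_real_derivative g' x) (at x)"
      unfolding h_def g'_def using False
      by (auto intro!: derivative_eq_intros DERIV_chain2[OF poly_DERIV] simp: field_simps power2_eq_square)
    moreover have "eventually (\<lambda>t. g t = h t) (nhds x)"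
      using False eventually_nhds_in_open[of "{0<..}" x] eventually_nhds_in_open[of "{..<0}" x]
      by (cases "x > 0") (auto elim!: eventually_mono simp: g h_def)
    ultimately show ?thesis using DERIV_cong_ev[OF refl _ refl] by metis
  next
    case True
    \<comment> \<open>Dividing by \<open>h\<close> amounts to multiplying \<open>p\<close> by
      X.\<close>
    have "((\<lambda>h. (g (0 + h) - g 0) / h) \<longlongrightarrow> 0) (at_right 0)"
      by (rule Lim_transform_eventually[OF poly_exp_flat_tendsto[of "[:0, 1:] * p"]])
         (auto simp: eventually_at_right_less g eventually_at_filter field_simps)
    moreover have "((\<lambda>h. (g (0 + h) - g 0) / h) \<longlongrightarrow> 0) (at_left 0)"
      by (rule Lim_transform_eventually[OF tendsto_const]) (auto simp: g eventually_at_filter)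
    ultimately show ?thesis
      by (simp add: True DERIV_def filterlim_at_split g'_def)
  qed
  then show "\<exists>g'\<in>{\<lambda>t. if t > 0 then poly p (1 / t) * exp (- 1 / t) else 0 | p. True}.
      \<forall>x. (g has_real_derivative g' x) (at x)"
    by (intro bexI[of _ g']) (auto simp: g'_def)
qed

text \<open>The factor \<open>Suc k\<close> steepens both flanks: for growing \<open>k\<close> the
  bumps tend to the indicator of the open interval while staying between 0 and 1. This lets
  dominated convergence pass from smooth tests to boxes.\<close>

definition bump :: "real \<Rightarrow> real \<Rightarrow> nat \<Rightarrow> real \<Rightarrow> real" where
  "bump a b k x = flat (real (Suc k) * (x - a)) * flat (real (Suc k) * (b - x))"

lemma smooth_bump: "smooth (bump a b k)"
proof -
  have "smooth (\<lambda>x. (1 * flat (real (Suc k) * x + (- real (Suc k) * a))) * (1 * flat ((- real (Suc k)) * x + real (Suc k) * b)))"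
    by (intro smooth_mult smooth_linear_comp smooth_flat)
  then show ?thesis by (simp add: bump_def[abs_def] algebra_simps)
qed

lemma bump_bounds: "0 \<le> bump a b k x" "bump a b k x \<le> 1"
  by (auto simp: bump_def flat_def intro!: mult_le_one)

lemma bump_zero: "x \<notin> {a<..<b} \<Longrightarrow> bump a b k x = 0"
  by (auto simp: bump_def flat_def zero_less_mult_iff)

lemma bump_pos: "x \<in> {a<..<b} \<Longrightarrow> bump a b k x > 0"
  by (auto simp: bump_def flat_def zero_less_mult_iff)

lemma bump_tendsto: "(\<lambda>k. bump a b k x) \<longlonglongrightarrow> indicator {a<..<b} x"
proof (cases "x \<in> {a<..<b}")
  case True
  have "(\<lambda>k. exp (- 1 / (real (Suc k) * t))) \<longlonglongrightarrow> 1" if "t > 0" for t :: real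
    using that by real_asymp
  from tendsto_mult[OF this[of "x - a"] this[of "b - x"]] show ?thesis
    using True by (simp add: bump_def flat_def)
qed (auto simp: bump_zero)

section \<open>Moving window integrals and primitives of bounded support\<close>

lemma window_integral_deriv:
  fixes g :: "real \<Rightarrow> real"
  assumes g: "continuous_on UNIV g" and "\<tau> \<ge> 0"
  shows "((\<lambda>x. integral {x - \<tau>..x} g) has_real_derivative g x - g (x - \<tau>)) (at x)"
proof -
  have int: "g integrable_on {a..b}" for a b
    by (intro integrable_continuous_real continuous_on_subset[OF g]) auto
  \<comment> \<open>A base point to the left of every window that ends near \<open>x\<close>; the
    window integral is then a difference of two integrals with the same lower limit.\<close>
  define a where "a = x - \<tau> - 1"
  have D: "((\<lambda>y. integral {a..y} g) has_real_derivative g y) (at y)" if "y \<in> {a<..<x + 1}" for y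
    using integral_has_real_derivative[OF continuous_on_subset[OF g], of a "x + 1" y] that
    by (simp add: at_within_Icc_at)
  have "((\<lambda>y. integral {a..y} g - integral {a..y - \<tau>} g) has_real_derivative g x - g (x - \<tau>) * 1) (at x)"
    by (intro DERIV_diff D DERIV_chain2[where g = "\<lambda>y. y - \<tau>"])
       (use \<open>\<tau> \<ge> 0\<close> in \<open>auto simp: a_def intro!: derivative_eq_intros\<close>)
  moreover have "eventually (\<lambda>y. integral {y - \<tau>..y} g = integral {a..y} g - integral {a..y - \<tau>} g) (nhds x)"
  proof -
    have "eventually (\<lambda>y. y \<in> {x - 1<..}) (nhds x)" by (intro eventually_nhds_in_open) auto
    then show ?thesis
    proof eventually_elim
      case (elim y)
      have "integral {a..y - \<tau>} g + integral {y - \<tau>..y} g = integral {a..y} g"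
        by (rule Henstock_Kurzweil_Integration.integral_combine) (use elim \<open>\<tau> \<ge> 0\<close> int in \<open>auto simp: a_def\<close>)
      then show ?case by simp
    qed
  qed
  ultimately show ?thesis
    by (simp add: DERIV_cong_ev[OF refl _ refl])
qed

lemma continuous_bounded_support_integrable:
  fixes f :: "'a::euclidean_space \<Rightarrow> real"
  assumes f: "continuous_on UNIV f" and S: "bounded S" "\<And>x. x \<notin> S \<Longrightarrow> f x = 0"
  shows "integrable lborel f"
proof -
  obtain a where a: "S \<subseteq> cbox (-a) a" using bounded_subset_cbox_symmetric[OF S(1)] by auto
  have "integrable lborel (\<lambda>x. indicator (cbox (-a) a) x *\<^sub>R f x)"
    by (intro borel_integrable_compact continuous_on_subset[OF f]) auto
  also have "(\<lambda>x. indicator (cbox (-a) a) x *\<^sub>R f x) = f"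
    using a S(2) by (auto simp: fun_eq_iff indicator_def)
  finally show ?thesis .
qed

lemma integral_Icc_eq_lborel:
  fixes f :: "real \<Rightarrow> real"
  assumes f: "continuous_on UNIV f" and S: "\<And>x. x \<notin> {a..b} \<Longrightarrow> f x = 0"
  shows "integral {a..b} f = (LINT x|lborel. f x)"
proof -
  have "set_integrable lborel {a..b} f"
    unfolding set_integrable_def by (intro borel_integrable_compact continuous_on_subset[OF f]) auto
  from set_borel_integral_eq_integral(2)[OF this]
  have "integral {a..b} f = (LINT x:{a..b}|lborel. f x)" by simp
  also have "\<dots> = (LINT x|lborel. f x)"
    unfolding set_lebesgue_integral_def by (intro Bochner_Integration.integral_cong) (use S in \<open>auto simp: indicator_def\<close>)
  finally show ?thesis .
qed

lemma integral_deriv_bounded_support: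
  fixes F f :: "real \<Rightarrow> real"
  assumes F: "\<And>x. (F has_real_derivative f x) (at x)" and f: "continuous_on UNIV f"
    and S: "\<And>x. x \<notin> {a..b} \<Longrightarrow> F x = 0"
  shows "(LINT x|lborel. f x) = 0"
proof -
  \<comment> \<open>Enlarging by one on each side puts the endpoints where \<open>F\<close>
    vanishes, whatever the order of \<open>a\<close> and \<open>b\<close>.\<close>
  define A B where "A = min a b - 1" and "B = max a b + 1"
  have f0: "f x = 0" if "x \<notin> {a..b}" for x
  proof -
    have "eventually (\<lambda>y. F y = 0) (nhds x)"
      by (rule eventually_mono[OF eventually_nhds_in_open[of "- {a..b}" x]]) (use that in \<open>auto intro: S\<close>)
    then have "(F has_real_derivative 0) (at x)"
      using DERIV_cong_ev[OF refl _ refl, of F "\<lambda>_. 0" x] by auto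
    with F show ?thesis by (metis DERIV_unique)
  qed
  have "(f has_integral (F B - F A)) {A..B}"
    by (rule fundamental_theorem_of_calculus)
       (auto simp: A_def B_def has_real_derivative_iff_has_vector_derivative[symmetric] intro!: has_field_derivative_at_within F)
  then have "integral {A..B} f = 0" proof -
    have "F A = 0" by (rule S) (auto simp: A_def)
    moreover have "F B = 0" by (rule S) (auto simp: B_def)
    ultimately show ?thesis using \<open>(f has_integral (F B - F A)) {A..B}\<close> by (simp add: integral_unique)
  qed
  moreover have "integral {A..B} f = (LINT x|lborel. f x)"
    by (rule integral_Icc_eq_lborel[OF f]) (auto simp: A_def B_def intro: f0)
  ultimately show ?thesis by simp
qed

lemma window_integral_smooth:
  assumes b: "smooth b" and "\<tau> \<ge> 0"
  shows "smooth (\<lambda>x. integral {x - \<tau>..x} b)"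
    "deriv (\<lambda>x. integral {x - \<tau>..x} b) = (\<lambda>x. b x - b (x - \<tau>))"
proof -
  have D: "((\<lambda>x. integral {x - \<tau>..x} b) has_real_derivative b x - b (x - \<tau>)) (at x)" for x
    by (intro window_integral_deriv smooth_continuous b assms)
  have "smooth (\<lambda>x. b x - b (x - \<tau>))"
    using smooth_diff[OF b smooth_linear_comp[OF b, of 1 1 "-\<tau>"]] by simp
  with D show "smooth (\<lambda>x. integral {x - \<tau>..x} b)" by (rule smoothI)
  show "deriv (\<lambda>x. integral {x - \<tau>..x} b) = (\<lambda>x. b x - b (x - \<tau>))"
    using D by (auto intro: DERIV_imp_deriv)
qed

text \<open>A primitive of bounded support exists only for functions of integral zero. Integrating
  over a moving window forces this by subtracting a copy of the function shifted far to the right,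
  which is why the derivative agrees with \<open>b\<close> only up to \<open>R\<close>.\<close>

lemma smooth_iterated_primitive:
  assumes b: "smooth b" "\<And>x. x \<notin> {-R..R} \<Longrightarrow> b x = 0" and R: "R > 0"
  shows "\<exists>h. smooth h \<and> (\<exists>R'. \<forall>x. x \<notin> {-R..R'} \<longrightarrow> h x = 0) \<and> (\<forall>x\<le>R. (deriv ^^ n) h x = b x)"
proof (induction n)
  case 0
  show ?case using b by (intro exI[of _ b]) auto
next
  case (Suc n)
  then obtain h R' where h: "smooth h" "\<And>x. x \<notin> {-R..R'} \<Longrightarrow> h x = 0" "\<And>x. x \<le> R \<Longrightarrow> (deriv ^^ n) h x = b x"
    by blast
  \<comment> \<open>Any length above \<open>2 * R\<close> works: for \<open>x \<le> R\<close> the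
    shifted copy is evaluated left of \<open>-R\<close>, where \<open>b\<close> vanishes.\<close>
  define \<tau> where "\<tau> = 3 * R"
  have \<tau>: "\<tau> \<ge> 0" using R by (simp add: \<tau>_def)
  let ?H = "\<lambda>x. integral {x - \<tau>..x} h"
  have "(deriv ^^ Suc n) ?H x = b x" if "x \<le> R" for x
  proof -
    have "(deriv ^^ Suc n) ?H x = (deriv ^^ n) (\<lambda>x. h x - 1 * h (1 * x + (-\<tau>))) x"
      by (simp only: funpow_Suc_right comp_def window_integral_smooth(2)[OF h(1) \<tau>]) simp
    also have "\<dots> = (deriv ^^ n) h x - (deriv ^^ n) h (x - \<tau>)"
      by (subst deriv_iter_diff[OF h(1) smooth_linear_comp[OF h(1)]], subst deriv_iter_linear_comp[OF h(1)]) simp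
    also have "\<dots> = b x" using that R h(3)[of x] h(3)[of "x - \<tau>"] b(2)[of "x - \<tau>"] by (auto simp: \<tau>_def)
    finally show ?thesis .
  qed
  moreover have "?H x = 0" if "x \<notin> {-R..max R' (-R) + \<tau>}" for x
  proof -
    have "?H x = integral {x - \<tau>..x} (\<lambda>x. 0)"
      by (rule integral_cong) (use that \<tau> in \<open>auto intro!: h(2)\<close>)
    then show ?thesis by simp
  qed
  ultimately show ?case using window_integral_smooth(1)[OF h(1) \<tau>] by blast
qed

text \<open>The derivatives are listed explicitly instead of being iterates of \<open>deriv\<close>,
  because those of a spline are known in closed form. The last member is only asked to be
  continuous.\<close>

definition Cchain :: "nat \<Rightarrow> (nat \<Rightarrow> real \<Rightarrow> real) \<Rightarrow> bool" where
  "Cchain r F \<longleftrightarrow> (\<forall>i<r. \<forall>x. (F i has_real_derivative F (Suc i) x) (at x)) \<and> continuous_on UNIV (F r)"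

lemma Cchain_continuous:
  assumes "Cchain r F" "i \<le> r" shows "continuous_on UNIV (F i)"
proof (cases "i = r")
  case False
  with assms have "\<And>x. isCont (F i) x" unfolding Cchain_def by (meson DERIV_isCont le_neq_implies_less)
  then show ?thesis by (simp add: continuous_at_imp_continuous_on)
qed (use assms in \<open>auto simp: Cchain_def\<close>)

text \<open>Differentiation under the integral sign puts all derivatives on the smooth factor. The
  division by \<open>c\<close> accommodates a dilation of \<open>\<Phi>\<close> along with the
  convolution.\<close>

lemma convolution_smooth:
  assumes \<Phi>: "continuous_on UNIV \<Phi>" and g: "smooth g"
  shows "smooth (\<lambda>x. integral {0..1} (\<lambda>s. \<Phi> s * g (x - s / c)))"
    "(deriv ^^ n) (\<lambda>x. integral {0..1} (\<lambda>s. \<Phi> s * g (x - s / c))) =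
       (\<lambda>x. integral {0..1} (\<lambda>s. \<Phi> s * (deriv ^^ n) g (x - s / c)))"
proof -
  have D: "((\<lambda>x. integral {0..1} (\<lambda>s. \<Phi> s * g (x - s / c))) has_real_derivative
      integral {0..1} (\<lambda>s. \<Phi> s * deriv g (x - s / c))) (at x)" if g: "smooth g" for g x
  proof -
    have "((\<lambda>x. integral (cbox 0 1) (\<lambda>s. \<Phi> s * g (x - s / c))) has_field_derivative
      integral (cbox 0 1) (\<lambda>s. \<Phi> s * deriv g (x - s / c))) (at x within UNIV)"
    proof (rule leibniz_rule_field_derivative)
      show "((\<lambda>x. \<Phi> t * g (x - t / c)) has_real_derivative \<Phi> t * deriv g (x - t / c)) (at x within UNIV)" for x t
        by (auto intro!: derivative_eq_intros DERIV_chain2[OF smoothD(1)[OF g]])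
      show "(\<lambda>s. \<Phi> s * g (x - s / c)) integrable_on cbox 0 1" for x
        unfolding divide_inverse
        by (intro integrable_continuous continuous_intros continuous_on_subset[OF \<Phi>]
            continuous_on_compose2[OF smooth_continuous[OF g, of UNIV]]) auto
      show "continuous_on (UNIV \<times> cbox 0 1) (\<lambda>(x, t). \<Phi> t * deriv g (x - t / c))"
        unfolding split_beta divide_inverse
        by (intro continuous_intros continuous_on_compose2[OF \<Phi>]
            continuous_on_compose2[OF smooth_continuous[OF smoothD(2)[OF g], of UNIV]]) auto
    qed auto
    then show ?thesis by simp
  qed
  show "smooth (\<lambda>x. integral {0..1} (\<lambda>s. \<Phi> s * g (x - s / c)))"
  proof (rule smooth_coinduct_set[where X = "(\<lambda>g x. integral {0..1} (\<lambda>s. \<Phi> s * g (x - s / c))) ` Collect smooth"])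
    fix h assume "h \<in> (\<lambda>g x. integral {0..1} (\<lambda>s. \<Phi> s * g (x - s / c))) ` Collect smooth"
    then obtain g where g: "smooth g" and h: "h = (\<lambda>x. integral {0..1} (\<lambda>s. \<Phi> s * g (x - s / c)))" by auto
    show "\<exists>h'\<in>(\<lambda>g x. integral {0..1} (\<lambda>s. \<Phi> s * g (x - s / c))) ` Collect smooth.
        \<forall>x. (h has_real_derivative h' x) (at x)"
      unfolding h
      by (rule bexI[of _ "\<lambda>x. integral {0..1} (\<lambda>s. \<Phi> s * deriv g (x - s / c))"]) (use D g smoothD(2)[OF g] in auto)
  qed (use g in auto)
  show "(deriv ^^ n) (\<lambda>x. integral {0..1} (\<lambda>s. \<Phi> s * g (x - s / c))) =
       (\<lambda>x. integral {0..1} (\<lambda>s. \<Phi> s * (deriv ^^ n) g (x - s / c)))"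
    by (induction n) (auto intro!: ext DERIV_imp_deriv D smooth_deriv_iter g)
qed

text \<open>Each integration by parts moves one derivative from \<open>g\<close> to the chain. The
  inner derivative - 1 / c explains the power of \<open>c\<close>, and there are no boundary terms
  since the chain vanishes outside the unit interval.\<close>

lemma Cchain_ibp:
  assumes F: "Cchain r F" "\<And>i x. i \<le> r \<Longrightarrow> x \<notin> {0..1} \<Longrightarrow> F i x = 0" and g: "smooth g" and c: "c \<noteq> 0"
  shows "integral {0..1} (\<lambda>s. F 0 s * (deriv ^^ r) g (x - s / c)) =
         c ^ r * integral {0..1} (\<lambda>s. F r s * g (x - s / c))"
proof -
  have "integral {0..1} (\<lambda>s. F 0 s * (deriv ^^ r) g (x - s / c)) =
        c ^ i * integral {0..1} (\<lambda>s. F i s * (deriv ^^ (r - i)) g (x - s / c))" if "i \<le> r" for i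
    using that
  proof (induction i)
    case (Suc i)
    define G where "G = (deriv ^^ (r - Suc i)) g"
    have G: "smooth G" unfolding G_def by (intro smooth_deriv_iter g)
    have G': "(deriv ^^ (r - i)) g = deriv G"
      using Suc.prems by (simp add: G_def Suc_diff_Suc[symmetric])
    have cont: "continuous_on UNIV (\<lambda>s. F j s * G' (x - s / c))" if "j \<le> r" "smooth G'" for j G'
      unfolding divide_inverse
      by (intro continuous_intros Cchain_continuous[OF F(1)] that
          continuous_on_compose2[OF smooth_continuous[OF that(2), of UNIV]]) auto
    have int: "integrable lborel (\<lambda>s. F j s * G' (x - s / c))" if "j \<le> r" "smooth G'" for j G'
      by (rule continuous_bounded_support_integrable[OF cont[OF that], of "{0..1}"]) (use F(2) that in auto)
    have eq: "integral {0..1} (\<lambda>s. F j s * G' (x - s / c)) = (LINT s|lborel. F j s * G' (x - s / c))"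
      if "j \<le> r" "smooth G'" for j G'
      by (rule integral_Icc_eq_lborel[OF cont[OF that]]) (use F(2) that in auto)
    have "(LINT s|lborel. F (Suc i) s * G (x - s / c) - (F i s * deriv G (x - s / c)) / c) = 0"
    proof (rule integral_deriv_bounded_support)
      fix s
      have "((\<lambda>s. G (x - s / c)) has_real_derivative deriv G (x - s / c) * (0 - 1 / c)) (at s)"
        by (rule DERIV_chain2[OF smoothD(1)[OF G]]) (use c in \<open>auto intro!: derivative_eq_intros\<close>)
      moreover have "(F i has_real_derivative F (Suc i) s) (at s)" using F(1) Suc.prems by (auto simp: Cchain_def)
      ultimately show "((\<lambda>s. F i s * G (x - s / c)) has_real_derivative
          F (Suc i) s * G (x - s / c) - (F i s * deriv G (x - s / c)) / c) (at s)"
        using c by (auto intro!: derivative_eq_intros simp: field_simps)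
      show "continuous_on UNIV (\<lambda>s. F (Suc i) s * G (x - s / c) - (F i s * deriv G (x - s / c)) / c)"
        unfolding divide_inverse[of _ c] using Suc.prems
        by (intro continuous_on_diff continuous_on_mult[OF _ continuous_on_const] cont[unfolded divide_inverse] G smoothD) auto
      show "F i s * G (x - s / c) = 0" if "s \<notin> {0..1}" for s using F(2) Suc.prems that by auto
    qed
    then have "(LINT s|lborel. F (Suc i) s * G (x - s / c)) - (LINT s|lborel. F i s * deriv G (x - s / c)) / c = 0"
      using Suc.prems by (subst (asm) Bochner_Integration.integral_diff) (auto intro!: int G smoothD)
    then have "(LINT s|lborel. F i s * deriv G (x - s / c)) = c * (LINT s|lborel. F (Suc i) s * G (x - s / c))"
      using c by (simp add: field_simps)
    then show ?case
      using Suc unfolding G' G_def[symmetric] by (simp add: eq G smoothD)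
  qed simp
  from this[of r] show ?thesis by simp
qed

text \<open>A chain supported in the closed unit interval becomes accessible to test functions of
  the open interval: contract it towards the midpoint, then mollify at a scale smaller than the gap
  this creates. Uniform bounds and pointwise limits, for the function and its top derivative, are
  what dominated convergence will require.\<close>

lemma Cchain_smooth_approximation:
  assumes F: "Cchain r F" "\<And>i x. i \<le> r \<Longrightarrow> x \<notin> {0..1} \<Longrightarrow> F i x = 0"
  shows "\<exists>b M. (\<forall>k::nat. smooth (b k) \<and> (\<exists>\<delta>>0. \<forall>x. x \<notin> {\<delta>..1-\<delta>} \<longrightarrow> b k x = 0)
      \<and> (\<forall>x. \<bar>b k x\<bar> \<le> M \<and> \<bar>(deriv ^^ r) (b k) x\<bar> \<le> M))
    \<and> (\<forall>x. (\<lambda>k. b k x) \<longlonglongrightarrow> F 0 x \<and> (\<lambda>k. (deriv ^^ r) (b k) x) \<longlonglongrightarrow> F r x)"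
proof -
  define Z where "Z = (LINT t|lborel. bump (-1) 1 0 t)"
  have bint: "integrable lborel (bump (-1) 1 0)"
    by (rule continuous_bounded_support_integrable[OF smooth_continuous[OF smooth_bump], of "{-1..1}"]) (auto intro: bump_zero)
  have "Z \<ge> 0" unfolding Z_def by (intro Bochner_Integration.integral_nonneg bump_bounds)
  moreover have "Z \<noteq> 0"
  proof
    assume "Z = 0"
    then have "AE t in lborel. bump (-1) 1 0 t = 0"
      using integral_nonneg_eq_0_iff_AE[OF bint] bump_bounds by (simp add: Z_def)
    then have "AE t in lborel. t \<notin> {-1<..<1::real}"
      by eventually_elim (use bump_pos[of _ "-1" 1 0] in force)
    then have "emeasure lborel {-1<..<1::real} = 0"
      by (subst (asm) AE_iff_measurable[where N = "{-1<..<1}"]) auto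
    then show False by (simp del: greaterThanLessThan_iff)
  qed
  ultimately have Z: "Z > 0" by simp
  define \<rho> where "\<rho> t = (1 / Z) * bump (-1) 1 0 (1 * t + 0)" for t
  have \<rho>: "smooth \<rho>" unfolding \<rho>_def[abs_def] by (rule smooth_linear_comp[OF smooth_bump])
  have \<rho>0: "\<rho> t \<ge> 0" for t using Z bump_bounds by (simp add: \<rho>_def)
  have \<rho>_supp: "\<rho> t = 0" if "t \<notin> {-1..1}" for t using that bump_zero[of t "-1" 1] by (auto simp: \<rho>_def)
  have \<rho>_int: "integrable lborel \<rho>" "(LINT t|lborel. \<rho> t) = 1"
    using bint Z by (auto simp: \<rho>_def[abs_def] Z_def)
  \<comment> \<open>Dilating the argument by \<open>c k\<close> contracts the unit interval to
    half-width 1/2 - 2 \<open>\<delta> k\<close>; mollification with radius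
    \<open>\<delta> k\<close> still leaves a margin \<open>\<delta> k\<close> at both ends.\<close>
  define c where "c k = 1 + 1 / real (Suc k)" for k
  define \<delta> where "\<delta> k = 1 / (4 * real (k + 2))" for k
  have c\<delta>: "c k > 0" "\<delta> k > 0" for k by (auto simp: c_def \<delta>_def add_pos_nonneg)
  have c2: "c k \<le> 2" for k by (simp add: c_def)
  have cinv: "1 / (2 * c k) = 1 / 2 - 2 * \<delta> k" for k by (simp add: c_def \<delta>_def field_simps)
  define m where "m \<Phi> k x = (LINT t|lborel. \<Phi> (1/2 + c k * (x - 1/2) - c k * \<delta> k * t) * \<rho> t)" for \<Phi> :: "real \<Rightarrow> real" and k x
  \<comment> \<open>The mollifier rewritten as a convolution kernel. Under the substitution s = 1/2
    + c (x - 1/2) - c \<delta> t the argument x - s / c becomes 1/2 - 1 / (2 c) + \<delta> t, and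
    the affine map inside \<rho> recovers t from it.\<close>
  define g' where "g' k z = (1 / (c k * \<delta> k)) * \<rho> ((1 / \<delta> k) * z + (1 / (2 * c k) - 1 / 2) / \<delta> k)" for k z
  have g': "smooth (g' k)" for k unfolding g'_def[abs_def] by (rule smooth_linear_comp[OF \<rho>])
  have conv: "integral {0..1} (\<lambda>s. \<Phi> s * g' k (x - s / c k)) = m \<Phi> k x"
    if "continuous_on UNIV \<Phi>" "\<And>x. x \<notin> {0..1} \<Longrightarrow> \<Phi> x = 0" for \<Phi> k x
  proof -
    have "integral {0..1} (\<lambda>s. \<Phi> s * g' k (x - s / c k)) = (LINT s|lborel. \<Phi> s * g' k (x - s / c k))"
      unfolding divide_inverse
      by (rule integral_Icc_eq_lborel)
         (use that in \<open>auto intro!: continuous_intros continuous_on_compose2[OF smooth_continuous[OF g', of UNIV]]\<close>)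
    also have "\<dots> = \<bar>- (c k * \<delta> k)\<bar> *\<^sub>R (LINT t|lborel.
        \<Phi> ((1/2 + c k * (x - 1/2)) + (- (c k * \<delta> k)) * t) * g' k (x - ((1/2 + c k * (x - 1/2)) + (- (c k * \<delta> k)) * t) / c k))"
      by (rule lborel_integral_real_affine) (use c\<delta>[of k] in auto)
    also have "\<dots> = (LINT t|lborel. \<bar>c k * \<delta> k\<bar> * (\<Phi> ((1/2 + c k * (x - 1/2)) + (- (c k * \<delta> k)) * t)
        * g' k (x - ((1/2 + c k * (x - 1/2)) + (- (c k * \<delta> k)) * t) / c k)))"
      by simp
    also have "\<dots> = m \<Phi> k x"
      unfolding m_def
    proof (intro Bochner_Integration.integral_cong refl)
      fix t
      have "(1 / \<delta> k) * (x - ((1/2 + c k * (x - 1/2)) + (- (c k * \<delta> k)) * t) / c k) + (1 / (2 * c k) - 1 / 2) / \<delta> k = t"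
        using c\<delta>[of k] by (simp add: field_simps)
      then show "\<bar>c k * \<delta> k\<bar> * (\<Phi> ((1/2 + c k * (x - 1/2)) + (- (c k * \<delta> k)) * t)
        * g' k (x - ((1/2 + c k * (x - 1/2)) + (- (c k * \<delta> k)) * t) / c k)) =
        \<Phi> (1/2 + c k * (x - 1/2) - c k * \<delta> k * t) * \<rho> t"
        unfolding g'_def using c\<delta>[of k] by (simp only:) (simp add: abs_mult)
    qed
    finally show ?thesis .
  qed
  have bounded: "\<exists>M. \<forall>x. \<bar>\<Phi> x\<bar> \<le> M" if "continuous_on UNIV \<Phi>" "\<And>x. x \<notin> {0..1} \<Longrightarrow> \<Phi> x = 0" for \<Phi> :: "real \<Rightarrow> real"
  proof -
    have "bounded (\<Phi> ` {0..1})"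
      by (intro compact_imp_bounded compact_continuous_image continuous_on_subset[OF that(1)]) auto
    then obtain M where M: "\<And>x. x \<in> {0..1} \<Longrightarrow> \<bar>\<Phi> x\<bar> \<le> M" unfolding bounded_iff by fastforce
    moreover have "M \<ge> 0" using M[of 0] by auto
    ultimately show ?thesis using that(2) by (metis abs_zero)
  qed
  have m_bound: "\<bar>m \<Phi> k x\<bar> \<le> M" and m_lim: "(\<lambda>k. m \<Phi> k x) \<longlonglongrightarrow> \<Phi> x"
    if \<Phi>: "continuous_on UNIV \<Phi>" "\<And>x. \<bar>\<Phi> x\<bar> \<le> M" for \<Phi> M k x
  proof -
    note [measurable] = borel_measurable_continuous_onI[OF \<Phi>(1)] borel_measurable_continuous_onI[OF smooth_continuous[OF \<rho>]]
    have bd: "\<bar>\<Phi> y * \<rho> t\<bar> \<le> M * \<rho> t" for y t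
      using \<Phi>(2)[of y] \<rho>0[of t] by (simp add: abs_mult mult_right_mono)
    have int: "integrable lborel (\<lambda>t. \<Phi> (1/2 + c k * (x - 1/2) - c k * \<delta> k * t) * \<rho> t)" for k
      by (rule Bochner_Integration.integrable_bound[of _ "\<lambda>t. M * \<rho> t"])
         (use \<rho>_int bd in \<open>auto intro: order_trans[OF bd abs_ge_self]\<close>)
    have "\<bar>m \<Phi> k x\<bar> \<le> (LINT t|lborel. M * \<rho> t)"
      unfolding m_def by (rule integral_abs_bound_integral[OF int]) (use \<rho>_int bd in auto)
    then show "\<bar>m \<Phi> k x\<bar> \<le> M" using \<rho>_int by simp
    have "(\<lambda>k. m \<Phi> k x) \<longlonglongrightarrow> (LINT t|lborel. \<Phi> x * \<rho> t)"
      unfolding m_def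
    proof (rule integral_dominated_convergence[where w = "\<lambda>t. M * \<rho> t"])
      show "AE t in lborel. (\<lambda>k. \<Phi> (1/2 + c k * (x - 1/2) - c k * \<delta> k * t) * \<rho> t) \<longlonglongrightarrow> \<Phi> x * \<rho> t"
      proof (rule AE_I2, intro tendsto_mult tendsto_const)
        fix t
        have "(\<lambda>k. 1/2 + c k * (x - 1/2) - c k * \<delta> k * t) \<longlonglongrightarrow> x"
          unfolding c_def \<delta>_def by real_asymp
        then show "(\<lambda>k. \<Phi> (1/2 + c k * (x - 1/2) - c k * \<delta> k * t)) \<longlonglongrightarrow> \<Phi> x"
          using \<Phi>(1) by (auto intro: continuous_on_tendsto_compose)
      qed
    qed (use \<rho>_int bd in auto)
    then show "(\<lambda>k. m \<Phi> k x) \<longlonglongrightarrow> \<Phi> x" using \<rho>_int by simp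
  qed
  obtain M0 Mr where M: "\<And>x. \<bar>F 0 x\<bar> \<le> M0" "\<And>x. \<bar>F r x\<bar> \<le> Mr"
    using bounded[OF Cchain_continuous[OF F(1), of 0]] bounded[OF Cchain_continuous[OF F(1), of r]] F(2) by force
  note C0 = Cchain_continuous[OF F(1), of 0, simplified] and Cr = Cchain_continuous[OF F(1), of r, simplified]
  define b where "b k = m (F 0) k" for k
  have b_eq: "b k = (\<lambda>x. integral {0..1} (\<lambda>s. F 0 s * g' k (x - s / c k)))" for k
    unfolding b_def by (rule ext, rule conv[symmetric]) (use C0 F(2) in auto)
  have b_smooth: "smooth (b k)" for k
    unfolding b_eq by (rule convolution_smooth(1)[OF C0 g'])
  have b_deriv: "(deriv ^^ r) (b k) x = c k ^ r * m (F r) k x" for k x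
  proof -
    have "(deriv ^^ r) (b k) x = c k ^ r * integral {0..1} (\<lambda>s. F r s * g' k (x - s / c k))"
      unfolding b_eq convolution_smooth(2)[OF C0 g'] by (rule Cchain_ibp[OF F g']) (use c\<delta>[of k] in auto)
    also have "integral {0..1} (\<lambda>s. F r s * g' k (x - s / c k)) = m (F r) k x"
      by (rule conv) (use Cr F(2) in auto)
    finally show ?thesis .
  qed
  have b_supp: "b k x = 0" if "x \<notin> {\<delta> k..1 - \<delta> k}" for k x
  proof -
    have z: "F 0 (1/2 + c k * (x - 1/2) - c k * \<delta> k * t) * \<rho> t = 0" for t
    proof (cases "t \<in> {-1..1}")
      case True
      have "1/2 + c k * (x - 1/2) - c k * \<delta> k * t \<notin> {0..1}"
      proof
        assume "1/2 + c k * (x - 1/2) - c k * \<delta> k * t \<in> {0..1}"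
        then have "\<bar>c k * (x - 1/2 - \<delta> k * t)\<bar> \<le> 1 / 2" by (auto simp: algebra_simps abs_if)
        then have "c k * \<bar>x - 1/2 - \<delta> k * t\<bar> \<le> 1 / 2" using c\<delta>[of k] by (simp add: abs_mult)
        then have "\<bar>x - 1/2 - \<delta> k * t\<bar> \<le> 1 / (2 * c k)" using c\<delta>[of k] by (simp add: field_simps)
        moreover have "\<bar>\<delta> k * t\<bar> \<le> \<delta> k * 1"
          using True c\<delta>[of k] by (simp add: abs_mult mult_left_le abs_le_iff)
        ultimately have "\<bar>x - 1/2\<bar> \<le> 1/2 - \<delta> k" unfolding cinv by linarith
        with that show False by (auto simp: abs_le_iff)
      qed
      then show ?thesis using F(2) by auto
    qed (use \<rho>_supp in auto)
    show ?thesis unfolding b_def m_def by (simp only: z Bochner_Integration.integral_zero)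
  qed
  have Mnn: "M0 \<ge> 0" "Mr \<ge> 0" using M[of 0] by auto
  have dbound: "\<bar>(deriv ^^ r) (b k) x\<bar> \<le> 2 ^ r * Mr" for k x
  proof -
    have "\<bar>c k\<bar> ^ r * \<bar>m (F r) k x\<bar> \<le> 2 ^ r * Mr"
      by (intro mult_mono power_mono m_bound[OF Cr M(2)]) (use c\<delta>[of k] c2[of k] Mnn in auto)
    then show ?thesis by (simp add: b_deriv abs_mult power_abs)
  qed
  have "(\<lambda>k. c k ^ r * m (F r) k x) \<longlonglongrightarrow> 1 ^ r * F r x" for x
  proof (intro tendsto_mult tendsto_power m_lim[OF Cr M(2)])
    show "c \<longlonglongrightarrow> 1" unfolding c_def by real_asymp
  qed
  then have dlim: "(\<lambda>k. (deriv ^^ r) (b k) x) \<longlonglongrightarrow> F r x" for x by (simp add: b_deriv)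
  have "\<bar>b k x\<bar> \<le> max M0 (2 ^ r * Mr)" "\<bar>(deriv ^^ r) (b k) x\<bar> \<le> max M0 (2 ^ r * Mr)" for k x
    using m_bound[OF C0 M(1), of k x] dbound[of k x] by (auto simp: b_def)
  moreover have "\<exists>\<delta>>0. \<forall>x. x \<notin> {\<delta>..1-\<delta>} \<longrightarrow> b k x = 0" for k
    using b_supp c\<delta>(2)[of k] by blast
  moreover have "(\<lambda>k. b k x) \<longlonglongrightarrow> F 0 x" for x unfolding b_def by (rule m_lim[OF C0 M(1)])
  ultimately show ?thesis
    using b_smooth dlim by (intro exI[of _ b] exI[of _ "max M0 (2 ^ r * Mr)"]) blast
qed

section \<open>Weak derivatives on the unit square\<close>

definition tensor :: "(real \<Rightarrow> real) \<Rightarrow> (real \<Rightarrow> real) \<Rightarrow> fn" where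
  "tensor f g = (\<lambda>z. f (fst z) * g (snd z))"

lemma tensor_has_derivative:
  assumes "(f has_real_derivative f') (at (fst z))" "(g has_real_derivative g') (at (snd z))"
  shows "(tensor f g has_derivative (\<lambda>h. f (fst z) * (g' * snd h) + (f' * fst h) * g (snd z))) (at z)"
  unfolding tensor_def
  by (rule has_derivative_mult)
     (rule has_derivative_compose[OF bounded_linear_imp_has_derivative[OF bounded_linear_fst] assms(1)[unfolded has_field_derivative_def]]
           has_derivative_compose[OF bounded_linear_imp_has_derivative[OF bounded_linear_snd] assms(2)[unfolded has_field_derivative_def]])+

lemma dir_deriv_tensor:
  assumes "smooth f" "smooth g"
  shows "dir_deriv (1, 0) (tensor f g) = tensor (deriv f) g"
    "dir_deriv (0, 1) (tensor f g) = tensor f (deriv g)"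
  using frechet_derivative_at[OF tensor_has_derivative[OF smoothD(1)[OF assms(1)] smoothD(1)[OF assms(2)]], symmetric]
  by (auto simp: dir_deriv_def tensor_def fun_eq_iff)

lemma C_k_tensor: "smooth f \<Longrightarrow> smooth g \<Longrightarrow> C_k k (tensor f g)"
proof (induction k arbitrary: f g)
  case 0
  then show ?case
    unfolding C_k.simps tensor_def
    by (intro continuous_on_mult continuous_on_compose2[OF smooth_continuous[of f UNIV]]
        continuous_on_compose2[OF smooth_continuous[of g UNIV]] continuous_on_fst continuous_on_snd continuous_on_id) auto
next
  case (Suc k)
  then have "tensor f g differentiable_on UNIV"
    unfolding differentiable_on_def differentiable_def
    using tensor_has_derivative[OF smoothD(1) smoothD(1), OF Suc.prems] by blast
  with Suc show ?case by (simp add: dir_deriv_tensor smoothD)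
qed

lemma mixed_partial_tensor:
  assumes "smooth f" "smooth g"
  shows "mixed_partial a (tensor f g) = tensor ((deriv ^^ fst a) f) ((deriv ^^ snd a) g)"
proof -
  have "(dir_deriv (0, 1) ^^ n) (tensor f g) = tensor f ((deriv ^^ n) g)" for n
    by (induction n) (use assms in \<open>auto simp: dir_deriv_tensor smooth_deriv_iter\<close>)
  moreover have "(dir_deriv (1, 0) ^^ n) (tensor f h) = tensor ((deriv ^^ n) f) h" if "smooth h" for n h
    by (induction n) (use assms that in \<open>auto simp: dir_deriv_tensor smooth_deriv_iter\<close>)
  ultimately show ?thesis using assms by (simp add: mixed_partial_def smooth_deriv_iter)
qed

lemma tensor_test_function:
  assumes "smooth f" "smooth g" "\<And>x. x \<notin> {a..b} \<Longrightarrow> f x = 0" "\<And>x. x \<notin> {c..d} \<Longrightarrow> g x = 0"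
    and U: "{a..b} \<times> {c..d} \<subseteq> U"
  shows "tensor f g \<in> test_functions U"
proof -
  have "closure {z. tensor f g z \<noteq> 0} \<subseteq> {a..b} \<times> {c..d}"
    by (rule closure_minimal) (use assms(3,4) in \<open>force simp: tensor_def closed_Times\<close>)+
  moreover have "compact ({a..b} \<times> {c..d})" by (intro compact_Times) auto
  ultimately have "compact (closure {z. tensor f g z \<noteq> 0})" "closure {z. tensor f g z \<noteq> 0} \<subseteq> U"
    using U by (meson bounded_subset closed_closure compact_eq_bounded_closed) (use U \<open>closure _ \<subseteq> _\<close> in blast)
  then show ?thesis
    unfolding test_functions_def using C_k_tensor[OF assms(1,2)] by blast
qed

text \<open>Open boxes are stable under intersection and generate the Borel sets, and the sets over
  which \<open>F\<close> integrates to zero form a Dynkin system. Taking the sets where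
  \<open>F\<close> is positive and where it is negative annihilates the integral of its
  modulus.\<close>

lemma AE_zero_if_box_integrals_zero:
  fixes F :: "plane \<Rightarrow> real"
  assumes F: "integrable lborel F" and box: "\<And>a b. (LINT x:box a b|lborel. F x) = 0"
  shows "AE x in lborel. F x = 0"
proof -
  have si: "set_integrable lborel A F" if "A \<in> sets borel" for A
    unfolding set_integrable_def using F that by (intro integrable_mult_indicator) auto
  \<comment> \<open>Passing to complements needs the integral over the whole plane, which growing
    boxes exhaust.\<close>
  have UNIV: "(LINT x|lborel. F x) = 0"
  proof -
    define v where "v n = (real n, real n)" for n
    have "(\<lambda>n. LINT x:box (- v n) (v n)|lborel. F x) \<longlonglongrightarrow> (LINT x|lborel. F x)"
      unfolding set_lebesgue_integral_def
    proof (rule integral_dominated_convergence[where w = "\<lambda>x. \<bar>F x\<bar>"])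
      show "AE x in lborel. (\<lambda>n. indicator (box (- v n) (v n)) x *\<^sub>R F x) \<longlonglongrightarrow> F x"
      proof (rule AE_I2, rule tendsto_eventually)
        fix x :: plane
        have "eventually (\<lambda>n. real n > \<bar>fst x\<bar> \<and> real n > \<bar>snd x\<bar>) sequentially"
          by (intro eventually_conj filterlim_real_sequentially[THEN filterlim_at_top_dense[THEN iffD1], rule_format])
        then show "eventually (\<lambda>n. indicator (box (- v n) (v n)) x *\<^sub>R F x = F x) sequentially"
          by eventually_elim (auto simp: box_prod v_def indicator_def mem_Times_iff)
      qed
    qed (use F in \<open>auto simp: indicator_def\<close>)
    then show ?thesis by (simp add: box LIMSEQ_const_iff)
  qed
  have zero: "(LINT x:A|lborel. F x) = 0" if A: "A \<in> sets borel" for A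
  proof -
    have "Int_stable (range (\<lambda>(a, b). box a b :: plane set))"
      unfolding Int_stable_def
    proof (clarify)
      fix a1 a2 b1 b2 c1 c2 d1 d2 :: real
      have "box (a1, a2) (b1, b2) \<inter> box (c1, c2) (d1, d2) = box (max a1 c1, max a2 c2) (min b1 d1, min b2 d2)"
        by (auto simp: box_prod)
      then show "box (a1, a2) (b1, b2) \<inter> box (c1, c2) (d1, d2) \<in> range (\<lambda>(a, b). box a b)" by auto
    qed
    moreover have "range (\<lambda>(a, b). box a b :: plane set) \<subseteq> Pow UNIV" by simp
    moreover have "A \<in> sigma_sets UNIV (range (\<lambda>(a, b). box a b :: plane set))"
      using A by (simp add: borel_eq_box)
    ultimately show ?thesis
    proof (induction rule: sigma_sets_induct_disjoint)
      case (compl A)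
      then have A: "A \<in> sets borel" by (simp add: borel_eq_box)
      have "(LINT x:A \<union> (UNIV - A)|lborel. F x) = (LINT x:A|lborel. F x) + (LINT x:UNIV - A|lborel. F x)"
        by (intro set_integral_Un si) (use A in auto)
      then show ?case using compl UNIV by (simp add: set_lebesgue_integral_def)
    next
      case (union A)
      then have A: "A i \<in> sets borel" for i by (auto simp: borel_eq_box)
      have "(LINT x:(\<Union>i. A i)|lborel. F x) = (\<Sum>i. LINT x:A i|lborel. F x)"
        by (intro lebesgue_integral_countable_add si) (use A union in \<open>auto simp: disjoint_family_on_def\<close>)
      with union show ?case by simp
    qed (use box in \<open>auto simp: set_lebesgue_integral_def\<close>)
  qed
  have Fm: "F \<in> borel_measurable borel" using F by auto
  then have P: "{x. F x > 0} \<in> sets borel" "{x. F x < 0} \<in> sets borel" by auto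
  have "(LINT x|lborel. indicator {x. F x > 0} x * F x) - (LINT x|lborel. indicator {x. F x < 0} x * F x) = 0"
    using zero[OF P(1)] zero[OF P(2)] by (simp add: set_lebesgue_integral_def)
  also have "(LINT x|lborel. indicator {x. F x > 0} x * F x) - (LINT x|lborel. indicator {x. F x < 0} x * F x) =
     (LINT x|lborel. indicator {x. F x > 0} x * F x - indicator {x. F x < 0} x * F x)"
    using si[OF P(1)] si[OF P(2)] by (subst Bochner_Integration.integral_diff) (auto simp: set_integrable_def)
  also have "\<dots> = (LINT x|lborel. \<bar>F x\<bar>)"
    by (intro Bochner_Integration.integral_cong) (auto simp: indicator_def)
  finally show ?thesis
    using integral_nonneg_eq_0_iff_AE[of lborel "\<lambda>x. \<bar>F x\<bar>"] F by auto
qed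

lemma bump_tensor_integral_tendsto:
  assumes F: "integrable lebesgue F"
  shows "(\<lambda>k. LINT x|lebesgue. F x * tensor (bump a b k) (bump c d k) x) \<longlonglongrightarrow> (LINT x:box (a, c) (b, d)|lebesgue. F x)"
  unfolding set_lebesgue_integral_def
proof (rule integral_dominated_convergence[where w = "\<lambda>x. \<bar>F x\<bar>"])
  have m: "tensor (bump a b k) (bump c d k) \<in> borel_measurable lebesgue" for k
  proof -
    have "continuous_on UNIV (tensor (bump a b k) (bump c d k))"
      using C_k_tensor[OF smooth_bump smooth_bump, of 0] by simp
    then have "tensor (bump a b k) (bump c d k) \<in> borel_measurable lborel"
      by (auto intro: borel_measurable_continuous_onI)
    then show ?thesis by (rule measurable_completion)
  qed
  show "(\<lambda>x. F x * tensor (bump a b k) (bump c d k) x) \<in> borel_measurable lebesgue" for k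
    using m F by measurable
  show "AE x in lebesgue. (\<lambda>k. F x * tensor (bump a b k) (bump c d k) x) \<longlonglongrightarrow> indicator (box (a, c) (b, d)) x *\<^sub>R F x"
  proof (rule AE_I2)
    fix x :: plane
    have "(\<lambda>k. F x * (bump a b k (fst x) * bump c d k (snd x))) \<longlonglongrightarrow>
          F x * (indicator {a<..<b} (fst x) * indicator {c<..<d} (snd x))"
      by (intro tendsto_intros bump_tendsto)
    then show "(\<lambda>k. F x * tensor (bump a b k) (bump c d k) x) \<longlonglongrightarrow> indicator (box (a, c) (b, d)) x *\<^sub>R F x"
      by (simp add: tensor_def box_prod indicator_times mult_ac)
  qed
  show "AE x in lebesgue. norm (F x * tensor (bump a b k) (bump c d k) x) \<le> \<bar>F x\<bar>" for k
    by (auto simp: tensor_def abs_mult bump_bounds intro!: mult_left_le mult_le_one)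
  have [measurable]: "box (a, c) (b, d) \<in> sets lebesgue" by auto
  show "(\<lambda>x. indicator (box (a, c) (b, d)) x *\<^sub>R F x) \<in> borel_measurable lebesgue"
    using borel_measurable_integrable[OF F] by measurable
qed (use F in auto)

text \<open>Tensor bumps approximate the indicators of boxes inside the large box, and an arbitrary
  box may be intersected with the large one because \<open>F\<close> vanishes outside it.\<close>

lemma AE_zero_if_bump_integrals_zero:
  fixes F :: "plane \<Rightarrow> real"
  assumes F: "integrable lebesgue F" and U: "\<And>x. x \<notin> box (p1, q1) (p2, q2) \<Longrightarrow> F x = 0"
    and bump: "\<And>a b c d k. p1 \<le> a \<Longrightarrow> a < b \<Longrightarrow> b \<le> p2 \<Longrightarrow> q1 \<le> c \<Longrightarrow> c < d \<Longrightarrow> d \<le> q2 \<Longrightarrow>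
      (LINT x|lebesgue. F x * tensor (bump a b k) (bump c d k) x) = 0"
  shows "AE x in lebesgue. F x = 0"
proof -
  have box: "(LINT x:box (a, c) (b, d)|lebesgue. F x) = 0" if "p1 \<le> a" "b \<le> p2" "q1 \<le> c" "d \<le> q2" for a b c d
  proof (cases "a < b \<and> c < d")
    case True
    then show ?thesis
      using bump_tensor_integral_tendsto[OF F, of a b c d] bump[of a b c d] that by (simp add: LIMSEQ_const_iff)
  next
    case False
    then have "box (a, c) (b, d) = {}" by (auto simp: box_prod)
    then show ?thesis by (simp add: set_lebesgue_integral_def)
  qed
  have box': "(LINT x:box u v|lebesgue. F x) = 0" for u v :: plane
  proof -
    have "box u v \<inter> box (p1, q1) (p2, q2) =
        box (max (fst u) p1, max (snd u) q1) (min (fst v) p2, min (snd v) q2)"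
      by (auto simp: box_prod)
    then have "(LINT x:box u v|lebesgue. F x) =
       (LINT x:box (max (fst u) p1, max (snd u) q1) (min (fst v) p2, min (snd v) q2)|lebesgue. F x)"
      unfolding set_lebesgue_integral_def
      by (intro Bochner_Integration.integral_cong refl) (use U in \<open>auto simp: indicator_def set_eq_iff\<close>)
    also have "\<dots> = 0" by (rule box) auto
    finally show ?thesis .
  qed
  \<comment> \<open>The box criterion speaks of integrals with respect to \<open>lborel\<close>, so
    a Borel representative takes the place of \<open>F\<close>.\<close>
  obtain G where G: "G \<in> borel_measurable lborel" "AE x in lborel. F x = G x"
    using completion_ex_borel_measurable_real[of F lborel] F by auto
  have FG: "AE x in lebesgue. F x = G x" using G(2) by (rule AE_completion)
  have GM: "G \<in> borel_measurable lebesgue" using G(1) by (rule measurable_completion)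
  have "integrable lebesgue G"
    by (rule Bochner_Integration.integrable_cong_AE[THEN iffD1, OF _ _ FG F]) (use F GM in auto)
  then have G_int: "integrable lborel G" using G(1) integrable_completion by blast
  have "(LINT x:box u v|lborel. G x) = 0" for u v
  proof -
    have "(LINT x:box u v|lborel. G x) = (LINT x:box u v|lebesgue. G x)"
      unfolding set_lebesgue_integral_def by (rule integral_completion[symmetric]) (use G(1) in measurable)
    also have "\<dots> = (LINT x:box u v|lebesgue. F x)"
      unfolding set_lebesgue_integral_def
    proof (rule integral_cong_AE)
      have [measurable]: "box u v \<in> sets lebesgue" by auto
      note [measurable] = GM borel_measurable_integrable[OF F]
      show "(\<lambda>x. indicat_real (box u v) x *\<^sub>R G x) \<in> borel_measurable lebesgue"
        "(\<lambda>x. indicat_real (box u v) x *\<^sub>R F x) \<in> borel_measurable lebesgue" by measurable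
    qed (use FG in auto)
    finally show ?thesis using box' by simp
  qed
  from AE_zero_if_box_integrals_zero[OF G_int this] have "AE x in lebesgue. G x = 0" by (rule AE_completion)
  with FG show ?thesis by eventually_elim simp
qed

lemma test_function_continuous: "h \<in> test_functions U \<Longrightarrow> continuous_on UNIV h"
  by (auto simp: test_functions_def dest: spec[of _ 0])

lemma continuous_imp_lebesgue_measurable:
  fixes h :: "plane \<Rightarrow> real"
  assumes "continuous_on UNIV h" shows "h \<in> borel_measurable lebesgue"
proof -
  have "h \<in> borel_measurable lborel" using assms by (auto intro: borel_measurable_continuous_onI)
  then show ?thesis by (rule measurable_completion)
qed

text \<open>The continuous factor is bounded on the compact set outside of which it vanishes, which
  reduces the product to integrability of \<open>f\<close> on that set.\<close>

lemma locally_integrable_mult_integrable: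
  fixes f h :: fn
  assumes f: "locally_integrable U f" and U: "U \<in> sets lebesgue" and K: "compact K" "K \<subseteq> U"
    and h: "continuous_on UNIV h" "\<And>x. x \<notin> K \<Longrightarrow> h x = 0"
  shows "integrable (lebesgue_on U) (\<lambda>x. f x * h x)"
proof -
  have Ks: "K \<in> sets lebesgue" using K(1) by (simp add: lmeasurable_compact fmeasurableD)
  have "integrable (lebesgue_on K) f" using f K by (auto simp: locally_integrable_def)
  then have i: "integrable lebesgue (\<lambda>x. indicator K x *\<^sub>R f x)"
    using Ks by (subst (asm) integrable_restrict_space) auto
  obtain B where B: "\<And>x. x \<in> K \<Longrightarrow> \<bar>h x\<bar> \<le> B"
    using compact_imp_bounded[OF compact_continuous_image[OF continuous_on_subset[OF h(1)] K(1)]]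
    unfolding bounded_iff by fastforce
  have "integrable lebesgue (\<lambda>x. B * (indicator K x *\<^sub>R f x))" using i by simp
  then have "integrable lebesgue (\<lambda>x. (indicator K x *\<^sub>R f x) * h x)"
  proof (rule Bochner_Integration.integrable_bound)
    show "(\<lambda>x. (indicator K x *\<^sub>R f x) * h x) \<in> borel_measurable lebesgue"
      using borel_measurable_integrable[OF i] continuous_imp_lebesgue_measurable[OF h(1)] by (rule borel_measurable_times)
    show "AE x in lebesgue. norm ((indicator K x *\<^sub>R f x) * h x) \<le> norm (B * (indicator K x *\<^sub>R f x))"
    proof (rule AE_I2)
      fix x
      show "norm ((indicator K x *\<^sub>R f x) * h x) \<le> norm (B * (indicator K x *\<^sub>R f x))"
      proof (cases "x \<in> K")
        case True
        then have "\<bar>h x\<bar> \<le> \<bar>B\<bar>" using B by fastforce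
        then have "\<bar>f x\<bar> * \<bar>h x\<bar> \<le> \<bar>f x\<bar> * \<bar>B\<bar>" by (intro mult_left_mono) auto
        then show ?thesis by (simp add: True abs_mult mult.commute)
      qed simp
    qed
  qed
  also have "(\<lambda>x. (indicator K x *\<^sub>R f x) * h x) = (\<lambda>x. indicator U x *\<^sub>R (f x * h x))"
    using h(2) K(2) by (auto simp: fun_eq_iff indicator_def)
  finally show ?thesis using U by (subst integrable_restrict_space) auto
qed

lemma test_function_mult_integrable:
  assumes "locally_integrable U f" "U \<in> sets lebesgue" "h \<in> test_functions U"
  shows "integrable (lebesgue_on U) (\<lambda>x. f x * h x)"
  by (rule locally_integrable_mult_integrable[OF assms(1,2), of "closure {x. h x \<noteq> 0}"])
     (use assms(3) closure_subset[of "{x. h x \<noteq> 0}"] test_function_continuous[OF assms(3)] in \<open>auto simp: test_functions_def\<close>)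

lemma open_Omega: "open Omega"
  by (simp add: Omega_def open_Times)

lemma Omega_sets [measurable, simp]: "Omega \<in> sets lebesgue"
  using open_Omega by (intro sets_completionI_sets) auto

lemma AE_Omega_iff: "(AE x in lebesgue_on Omega. P x) \<longleftrightarrow> (AE x in lebesgue. x \<in> Omega \<longrightarrow> P x)"
  by (rule AE_restrict_space_iff) simp

lemma integral_Omega: "(LINT x|lebesgue_on Omega. f x) = (LINT x|lebesgue. indicator Omega x * f x)" for f :: fn
  by (subst integral_restrict_space) auto

lemma Omega_exhaustion:
  assumes "x \<in> Omega"
  shows "eventually (\<lambda>n. x \<in> box (1 / real (n + 3), 1 / real (n + 3)) (1 - 1 / real (n + 3), 1 - 1 / real (n + 3))) sequentially"
proof -
  have lim: "(\<lambda>n. 1 / real (n + 3)) \<longlonglongrightarrow> 0" by real_asymp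
  have "eventually (\<lambda>n. 1 / real (n + 3) < t) sequentially" if "t > 0" for t
    using order_tendstoD(2)[OF lim that] .
  from this[of "fst x"] this[of "snd x"] this[of "1 - fst x"] this[of "1 - snd x"]
  have "eventually (\<lambda>n. 1 / real (n + 3) < fst x) sequentially" "eventually (\<lambda>n. 1 / real (n + 3) < snd x) sequentially"
    "eventually (\<lambda>n. 1 / real (n + 3) < 1 - fst x) sequentially" "eventually (\<lambda>n. 1 / real (n + 3) < 1 - snd x) sequentially"
    using assms by (auto simp: Omega_def)
  then show ?thesis by eventually_elim (auto simp: box_prod mem_Times_iff)
qed

text \<open>The fundamental lemma of the calculus of variations. Local integrability controls
  \<open>f\<close> only on closed inner squares, so the bump criterion is applied on each of an
  exhausting sequence of them, and countably many null sets are united.\<close>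

lemma AE_Omega_zero_if_test_integrals_zero:
  assumes f: "locally_integrable Omega f"
    and test: "\<And>h. h \<in> test_functions Omega \<Longrightarrow> (LINT x|lebesgue_on Omega. f x * h x) = 0"
  shows "AE x in lebesgue_on Omega. f x = 0"
proof -
  \<comment> \<open>The offset 3 makes the inner square nonempty for every \<open>n\<close>.\<close>
  define e where "e n = 1 / real (n + 3)" for n
  have e: "0 < e n" "e n < 1 - e n" for n by (auto simp: e_def field_simps)
  define U where "U n = box (e n, e n) (1 - e n, 1 - e n)" for n
  have AE: "AE x in lebesgue. indicator (U n) x * f x = 0" for n
  proof (rule AE_zero_if_bump_integrals_zero[where ?p1.0 = "e n" and ?q1.0 = "e n" and ?p2.0 = "1 - e n" and ?q2.0 = "1 - e n"])
    let ?K = "cbox (e n, e n) (1 - e n, 1 - e n)"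
    have K: "?K \<subseteq> Omega" using e[of n] by (auto simp: cbox_Pair_eq Omega_def)
    then have "integrable (lebesgue_on ?K) f" using f by (auto simp: locally_integrable_def)
    then have "integrable lebesgue (\<lambda>x. indicator ?K x *\<^sub>R f x)"
      by (subst (asm) integrable_restrict_space) auto
    then have "integrable lebesgue (\<lambda>x. indicator (U n) x *\<^sub>R (indicator ?K x *\<^sub>R f x))"
      by (rule integrable_mult_indicator[rotated]) (auto simp: U_def)
    also have "(\<lambda>x. indicator (U n) x *\<^sub>R (indicator ?K x *\<^sub>R f x)) = (\<lambda>x. indicator (U n) x * f x)"
      using box_subset_cbox[of "(e n, e n)" "(1 - e n, 1 - e n)"] by (auto simp: fun_eq_iff U_def indicator_def)
    finally show "integrable lebesgue (\<lambda>x. indicator (U n) x * f x)" .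
    show "indicator (U n) x * f x = 0" if "x \<notin> box (e n, e n) (1 - e n, 1 - e n)" for x
      using that by (simp add: U_def)
    fix a b c d k assume *: "e n \<le> a" "a < b" "b \<le> 1 - e n" "e n \<le> c" "c < d" "d \<le> 1 - e n"
    have h: "tensor (bump a b k) (bump c d k) \<in> test_functions Omega"
      by (rule tensor_test_function[where a = a and b = b and c = c and d = d])
         (use * e[of n] in \<open>auto intro!: smooth_bump bump_zero simp: Omega_def\<close>)
    have "(LINT x|lebesgue. indicator (U n) x * f x * tensor (bump a b k) (bump c d k) x) =
          (LINT x|lebesgue_on Omega. f x * tensor (bump a b k) (bump c d k) x)"
      unfolding integral_Omega
    proof (intro Bochner_Integration.integral_cong refl)
      fix x :: plane
      show "indicator (U n) x * f x * tensor (bump a b k) (bump c d k) x =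
            indicator Omega x * (f x * tensor (bump a b k) (bump c d k) x)"
      proof (cases "fst x \<in> {a<..<b} \<and> snd x \<in> {c<..<d}")
        case True
        then have "x \<in> U n" "x \<in> Omega" using * e[of n] by (auto simp: U_def box_prod Omega_def mem_Times_iff)
        then show ?thesis by simp
      qed (auto simp: tensor_def bump_zero)
    qed
    with test[OF h] show "(LINT x|lebesgue. indicator (U n) x * f x * tensor (bump a b k) (bump c d k) x) = 0" by simp
  qed
  then have "AE x in lebesgue. \<forall>n. indicator (U n) x * f x = 0" by (subst AE_all_countable) blast
  then show ?thesis
    unfolding AE_Omega_iff
  proof eventually_elim
    case (elim x)
    show ?case
    proof
      assume "x \<in> Omega"
      from eventually_happens'[OF _ Omega_exhaustion[OF this]] obtain n where "x \<in> U n" by (auto simp: U_def e_def)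
      with elim show "f x = 0" by (auto simp: indicator_def dest: spec[of _ n])
    qed
  qed
qed

section \<open>Linearity and uniqueness of weak derivatives\<close>

lemma locally_integrable_diff:
  "locally_integrable U f \<Longrightarrow> locally_integrable U g \<Longrightarrow> locally_integrable U (\<lambda>x. f x - g x)"
  by (auto simp: locally_integrable_def)

lemma mixed_partial_C_k:
  assumes "\<forall>k. C_k k h" shows "\<forall>k. C_k k (mixed_partial a h)"
proof -
  have "\<forall>k. C_k k ((dir_deriv (0, 1) ^^ n) h)" for n by (induction n) (use assms in \<open>auto dest: spec[of _ "Suc _"]\<close>)
  moreover have "\<forall>k. C_k k ((dir_deriv (1, 0) ^^ n) g)" if "\<forall>k. C_k k g" for n g
    by (induction n) (use that in \<open>auto dest: spec[of _ "Suc _"]\<close>)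
  ultimately show ?thesis by (simp add: mixed_partial_def)
qed

lemma dir_deriv_zero_outside:
  assumes "closed K" "\<And>x. x \<notin> K \<Longrightarrow> h x = 0" "x \<notin> K"
  shows "dir_deriv e h x = 0"
proof -
  have "((\<lambda>x. 0) has_derivative (\<lambda>x. 0)) (at x)" by simp
  then have "(h has_derivative (\<lambda>x. 0)) (at x)"
    by (rule has_derivative_transform_within_open[of _ _ _ _ "- K"]) (use assms in auto)
  from frechet_derivative_at[OF this] show ?thesis unfolding dir_deriv_def by metis
qed

lemma mixed_partial_zero_outside:
  assumes "closed K" "\<And>x. x \<notin> K \<Longrightarrow> h x = 0" "x \<notin> K"
  shows "mixed_partial a h x = 0"
proof -
  have 1: "\<forall>x. x \<notin> K \<longrightarrow> (dir_deriv e ^^ n) g x = 0" if "\<forall>x. x \<notin> K \<longrightarrow> g x = 0" for e n and g :: fn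
    by (induction n) (use that assms(1) in \<open>auto intro!: dir_deriv_zero_outside\<close>)
  show ?thesis unfolding mixed_partial_def using 1[of "(dir_deriv (0, 1) ^^ snd a) h"] 1[of h] assms by blast
qed

lemma test_function_mixed_partial:
  assumes h: "h \<in> test_functions U" shows "mixed_partial a h \<in> test_functions U"
proof -
  define K where "K = closure {x. h x \<noteq> 0}"
  have K: "compact K" "K \<subseteq> U" "\<And>x. x \<notin> K \<Longrightarrow> h x = 0"
    using h closure_subset[of "{x. h x \<noteq> 0}"] by (auto simp: K_def test_functions_def)
  have sub: "closure {x. mixed_partial a h x \<noteq> 0} \<subseteq> K"
  proof (rule closure_minimal)
    show "{x. mixed_partial a h x \<noteq> 0} \<subseteq> K"
      using mixed_partial_zero_outside[OF compact_imp_closed[OF K(1)], of h _ a] K(3) by blast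
  qed (rule compact_imp_closed[OF K(1)])
  then have "compact (closure {x. mixed_partial a h x \<noteq> 0})"
    using K(1) by (meson bounded_subset closed_closure compact_eq_bounded_closed)
  with sub K(2) h show ?thesis
    using mixed_partial_C_k[of h a] by (auto simp: test_functions_def)
qed

lemma is_weak_deriv_diff:
  assumes "is_weak_deriv U a f g" "is_weak_deriv U a f' g'" and U: "U \<in> sets lebesgue"
  shows "is_weak_deriv U a (\<lambda>x. f x - f' x) (\<lambda>x. g x - g' x)"
proof -
  have l: "locally_integrable U f" "locally_integrable U g" "locally_integrable U f'" "locally_integrable U g'"
    using assms by (auto simp: is_weak_deriv_def)
  have "(LINT x|lebesgue_on U. (f x - f' x) * mixed_partial a h x) = (- 1) ^ order_of a * (LINT x|lebesgue_on U. (g x - g' x) * h x)"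
    if h: "h \<in> test_functions U" for h
  proof -
    have "(LINT x|lebesgue_on U. (f x - f' x) * mixed_partial a h x) =
       (LINT x|lebesgue_on U. f x * mixed_partial a h x) - (LINT x|lebesgue_on U. f' x * mixed_partial a h x)"
      unfolding left_diff_distrib
      by (intro Bochner_Integration.integral_diff test_function_mult_integrable l U test_function_mixed_partial h)
    also have "\<dots> = (- 1) ^ order_of a * ((LINT x|lebesgue_on U. g x * h x) - (LINT x|lebesgue_on U. g' x * h x))"
      using assms h by (simp add: is_weak_deriv_def right_diff_distrib)
    also have "(LINT x|lebesgue_on U. g x * h x) - (LINT x|lebesgue_on U. g' x * h x) = (LINT x|lebesgue_on U. (g x - g' x) * h x)"
      unfolding left_diff_distrib
      by (intro Bochner_Integration.integral_diff[symmetric] test_function_mult_integrable l U h)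
    finally show ?thesis .
  qed
  with l show ?thesis by (auto simp: is_weak_deriv_def intro: locally_integrable_diff)
qed

lemma is_weak_deriv_unique:
  assumes "is_weak_deriv Omega a f g" "is_weak_deriv Omega a f g'"
  shows "AE x in lebesgue_on Omega. g x = g' x"
proof -
  have "is_weak_deriv Omega a (\<lambda>x. f x - f x) (\<lambda>x. g x - g' x)"
    by (rule is_weak_deriv_diff[OF assms]) simp
  then have "AE x in lebesgue_on Omega. g x - g' x = 0"
    by (intro AE_Omega_zero_if_test_integrals_zero) (auto simp: is_weak_deriv_def)
  then show ?thesis by eventually_elim simp
qed

text \<open>Local integrability gives measurability on compact subsets only; on the open square
  \<open>f\<close> is the pointwise limit of its truncations to closed inner squares.\<close>

lemma locally_integrable_Omega_measurable:
  assumes "locally_integrable Omega f" shows "f \<in> borel_measurable (lebesgue_on Omega)"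
proof -
  let ?K = "\<lambda>n. cbox (1 / real (n + 3), 1 / real (n + 3)) (1 - 1 / real (n + 3), 1 - 1 / real (n + 3))"
  have m: "(\<lambda>x. indicator (?K n) x *\<^sub>R f x) \<in> borel_measurable lebesgue" for n
  proof -
    define e where "e = 1 / real (n + 3)"
    have "e > 0" by (simp add: e_def)
    then have "?K n \<subseteq> Omega" unfolding e_def[symmetric] by (auto simp: cbox_Pair_eq Omega_def)
    then have "integrable (lebesgue_on (?K n)) f" using assms by (auto simp: locally_integrable_def)
    then have "integrable lebesgue (\<lambda>x. indicator (?K n) x *\<^sub>R f x)"
      by (subst (asm) integrable_restrict_space) auto
    then show ?thesis by simp
  qed
  have "f \<in> borel_measurable (restrict_space lebesgue Omega)"
  proof (rule borel_measurable_LIMSEQ_metric)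
    show "(\<lambda>x. indicator (?K n) x *\<^sub>R f x) \<in> borel_measurable (restrict_space lebesgue Omega)" for n
      using m by (rule measurable_restrict_space1)
    show "(\<lambda>n. indicator (?K n) x *\<^sub>R f x) \<longlonglongrightarrow> f x" if "x \<in> space (restrict_space lebesgue Omega)" for x
    proof (rule tendsto_eventually)
      from that have "x \<in> Omega" by (simp add: space_restrict_space)
      from Omega_exhaustion[OF this] show "eventually (\<lambda>n. indicator (?K n) x *\<^sub>R f x = f x) sequentially"
        by eventually_elim (use box_subset_cbox in \<open>force simp: indicator_def\<close>)
    qed
  qed
  then show ?thesis .
qed

lemma order_of_power: "(-1 :: real) ^ order_of a = (-1) ^ fst a * (-1) ^ snd a"
  by (simp add: order_of_def power_add)

text \<open>The defining identity, known for test functions, is extended to tensors of finite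
  smoothness supported in the closed square. Both sides pass to the limit along the smooth
  approximations, dominated by multiples of |u| and |g|. Sampling kernels that reach the boundary
  are covered in this way.\<close>

lemma is_weak_deriv_tensor_Cchain:
  assumes wd: "is_weak_deriv Omega a u g" and u: "integrable (lebesgue_on Omega) u" and g: "integrable (lebesgue_on Omega) g"
    and F: "Cchain (fst a) F" "\<And>i x. i \<le> fst a \<Longrightarrow> x \<notin> {0..1} \<Longrightarrow> F i x = 0"
    and G: "Cchain (snd a) G" "\<And>i x. i \<le> snd a \<Longrightarrow> x \<notin> {0..1} \<Longrightarrow> G i x = 0"
  shows "(LINT x|lebesgue_on Omega. u x * tensor (F (fst a)) (G (snd a)) x) =
    (-1) ^ order_of a * (LINT x|lebesgue_on Omega. g x * tensor (F 0) (G 0) x)"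
proof -
  obtain b M where b: "\<And>k::nat. smooth (b k)" "\<And>k. \<exists>\<delta>>0. \<forall>x. x \<notin> {\<delta>..1-\<delta>} \<longrightarrow> b k x = 0"
    "\<And>k x. \<bar>b k x\<bar> \<le> M" "\<And>k x. \<bar>(deriv ^^ fst a) (b k) x\<bar> \<le> M"
    "\<And>x. (\<lambda>k. b k x) \<longlonglongrightarrow> F 0 x" "\<And>x. (\<lambda>k. (deriv ^^ fst a) (b k) x) \<longlonglongrightarrow> F (fst a) x"
    using Cchain_smooth_approximation[OF F] by blast
  obtain c N where c: "\<And>k::nat. smooth (c k)" "\<And>k. \<exists>\<delta>>0. \<forall>x. x \<notin> {\<delta>..1-\<delta>} \<longrightarrow> c k x = 0"
    "\<And>k x. \<bar>c k x\<bar> \<le> N" "\<And>k x. \<bar>(deriv ^^ snd a) (c k) x\<bar> \<le> N"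
    "\<And>x. (\<lambda>k. c k x) \<longlonglongrightarrow> G 0 x" "\<And>x. (\<lambda>k. (deriv ^^ snd a) (c k) x) \<longlonglongrightarrow> G (snd a) x"
    using Cchain_smooth_approximation[OF G] by blast
  have test: "tensor (b k) (c k) \<in> test_functions Omega" for k
  proof -
    obtain d e where d: "d > 0" "\<And>x. x \<notin> {d..1-d} \<Longrightarrow> b k x = 0" and e: "e > 0" "\<And>x. x \<notin> {e..1-e} \<Longrightarrow> c k x = 0"
      using b(2)[of k] c(2)[of k] by blast
    show ?thesis
      by (rule tensor_test_function[OF b(1) c(1) d(2) e(2)]) (use d(1) e(1) in \<open>auto simp: Omega_def\<close>)
  qed
  have cont: "tensor \<phi> \<psi> \<in> borel_measurable (lebesgue_on Omega)" if "continuous_on UNIV \<phi>" "continuous_on UNIV \<psi>" for \<phi> \<psi>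
  proof -
    have "continuous_on UNIV (tensor \<phi> \<psi>)"
      unfolding tensor_def
      by (intro continuous_on_mult continuous_on_compose2[OF that(1)]
        continuous_on_compose2[OF that(2)] continuous_on_fst continuous_on_snd continuous_on_id) auto
    then show ?thesis by (intro measurable_restrict_space1 continuous_imp_lebesgue_measurable)
  qed
  have lim: "(\<lambda>k. LINT x|lebesgue_on Omega. w x * tensor (\<phi> k) (\<psi> k) x) \<longlonglongrightarrow> (LINT x|lebesgue_on Omega. w x * tensor \<phi>' \<psi>' x)"
    if w: "integrable (lebesgue_on Omega) w" and "\<And>k. smooth (\<phi> k)" "\<And>k. smooth (\<psi> k)"
      "continuous_on UNIV \<phi>'" "continuous_on UNIV \<psi>'"
      "\<And>x. (\<lambda>k. \<phi> k x) \<longlonglongrightarrow> \<phi>' x" "\<And>x. (\<lambda>k. \<psi> k x) \<longlonglongrightarrow> \<psi>' x"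
      "\<And>k x. \<bar>\<phi> k x\<bar> \<le> M" "\<And>k x. \<bar>\<psi> k x\<bar> \<le> N" for w \<phi> \<psi> \<phi>' \<psi>'
  proof (rule integral_dominated_convergence[where w = "\<lambda>x. \<bar>w x\<bar> * (M * N)"])
    note [measurable] = borel_measurable_integrable[OF w]
    have [measurable]: "tensor \<phi>' \<psi>' \<in> borel_measurable (lebesgue_on Omega)"
      "tensor (\<phi> k) (\<psi> k) \<in> borel_measurable (lebesgue_on Omega)" for k
      using that by (auto intro!: cont smooth_continuous)
    show "(\<lambda>x. w x * tensor \<phi>' \<psi>' x) \<in> borel_measurable (lebesgue_on Omega)"
      "(\<lambda>x. w x * tensor (\<phi> k) (\<psi> k) x) \<in> borel_measurable (lebesgue_on Omega)" for k by measurable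
    show "integrable (lebesgue_on Omega) (\<lambda>x. \<bar>w x\<bar> * (M * N))" using w by auto
    show "AE x in lebesgue_on Omega. (\<lambda>k. w x * tensor (\<phi> k) (\<psi> k) x) \<longlonglongrightarrow> w x * tensor \<phi>' \<psi>' x"
      using that by (intro AE_I2) (auto simp: tensor_def intro!: tendsto_intros)
    show "AE x in lebesgue_on Omega. norm (w x * tensor (\<phi> k) (\<psi> k) x) \<le> \<bar>w x\<bar> * (M * N)" for k
    proof (rule AE_I2)
      fix x
      have "0 \<le> M" using that(8)[of 0 0] by linarith
      then have "\<bar>\<phi> k (fst x)\<bar> * \<bar>\<psi> k (snd x)\<bar> \<le> M * N" by (intro mult_mono that) auto
      then show "norm (w x * tensor (\<phi> k) (\<psi> k) x) \<le> \<bar>w x\<bar> * (M * N)"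
        by (auto simp: tensor_def abs_mult intro!: mult_left_mono)
    qed
  qed
  have 1: "(\<lambda>k. LINT x|lebesgue_on Omega. u x * tensor ((deriv ^^ fst a) (b k)) ((deriv ^^ snd a) (c k)) x) \<longlonglongrightarrow>
      (LINT x|lebesgue_on Omega. u x * tensor (F (fst a)) (G (snd a)) x)"
    by (rule lim) (use b c in \<open>auto intro!: u smooth_deriv_iter Cchain_continuous[OF F(1)] Cchain_continuous[OF G(1)]\<close>)
  have 2: "(\<lambda>k. LINT x|lebesgue_on Omega. g x * tensor (b k) (c k) x) \<longlonglongrightarrow> (LINT x|lebesgue_on Omega. g x * tensor (F 0) (G 0) x)"
    by (rule lim) (use b c in \<open>auto intro!: g Cchain_continuous[OF F(1)] Cchain_continuous[OF G(1)]\<close>)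
  have "(LINT x|lebesgue_on Omega. u x * tensor ((deriv ^^ fst a) (b k)) ((deriv ^^ snd a) (c k)) x) =
      (-1) ^ order_of a * (LINT x|lebesgue_on Omega. g x * tensor (b k) (c k) x)" for k
    using wd test[of k] by (auto simp: is_weak_deriv_def mixed_partial_tensor[OF b(1) c(1)])
  with 1 tendsto_mult[OF tendsto_const 2, of "(-1) ^ order_of a"] show ?thesis
    by (simp add: LIMSEQ_unique)
qed

section \<open>Tensor splines as weakly differentiable functions on the plane\<close>

lemma plane_integral_zero_if_slices_zero:
  fixes f :: "plane \<Rightarrow> real"
  assumes "integrable lborel f"
  shows "(\<And>y. (LINT x|lborel. f (x, y)) = 0) \<Longrightarrow> (LINT z|lborel. f z) = 0"
    "(\<And>x. (LINT y|lborel. f (x, y)) = 0) \<Longrightarrow> (LINT z|lborel. f z) = 0"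
proof -
  have f: "integrable (lborel \<Otimes>\<^sub>M lborel) (\<lambda>(x, y). f (x, y))" using assms by (simp add: lborel_prod)
  show "(LINT z|lborel. f z) = 0" if "\<And>y. (LINT x|lborel. f (x, y)) = 0"
    using lborel_pair.integral_snd[OF f] that by (simp add: lborel_prod)
  show "(LINT z|lborel. f z) = 0" if "\<And>x. (LINT y|lborel. f (x, y)) = 0"
    using lborel_pair.integral_fst[OF f] that by (simp add: lborel_prod)
qed

lemma C_k_partial_derivs:
  assumes "C_k (Suc k) H"
  shows "((\<lambda>x. H (x, y)) has_real_derivative dir_deriv (1, 0) H (x, y)) (at x)"
    "((\<lambda>y. H (x, y)) has_real_derivative dir_deriv (0, 1) H (x, y)) (at y)"
proof -
  have H: "(H has_derivative frechet_derivative H (at (x, y))) (at (x, y))"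
    using assms by (simp add: differentiable_on_def frechet_derivative_works)
  note lin = has_derivative_linear[OF H]
  have "((\<lambda>x. H (x, y)) has_derivative (\<lambda>h. frechet_derivative H (at (x, y)) (h, 0))) (at x)"
    by (rule has_derivative_compose[where f = "\<lambda>x. (x, y)", OF _ H]) (auto intro!: derivative_eq_intros)
  moreover have "frechet_derivative H (at (x, y)) (h, 0) = h * dir_deriv (1, 0) H (x, y)" for h
    using linear_cmul[OF lin, of h "(1, 0)"] by (simp add: dir_deriv_def)
  ultimately show "((\<lambda>x. H (x, y)) has_real_derivative dir_deriv (1, 0) H (x, y)) (at x)"
    by (simp add: has_field_derivative_def mult_commute_abs)
  have "((\<lambda>y. H (x, y)) has_derivative (\<lambda>h. frechet_derivative H (at (x, y)) (0, h))) (at y)"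
    by (rule has_derivative_compose[where f = "\<lambda>y. (x, y)", OF _ H]) (auto intro!: derivative_eq_intros)
  moreover have "frechet_derivative H (at (x, y)) (0, h) = h * dir_deriv (0, 1) H (x, y)" for h
    using linear_cmul[OF lin, of h "(0, 1)"] by (simp add: dir_deriv_def)
  ultimately show "((\<lambda>y. H (x, y)) has_real_derivative dir_deriv (0, 1) H (x, y)) (at y)"
    by (simp add: has_field_derivative_def mult_commute_abs)
qed

lemma C_k_continuous: "C_k k H \<Longrightarrow> continuous_on UNIV H"
  by (cases k) (auto intro: differentiable_imp_continuous_on)

lemma continuous_on_tensor:
  assumes "continuous_on UNIV f" "continuous_on UNIV g" shows "continuous_on UNIV (tensor f g)"
  unfolding tensor_def
  by (intro continuous_on_mult continuous_on_compose2[OF assms(1)]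
        continuous_on_compose2[OF assms(2)] continuous_on_fst continuous_on_snd continuous_on_id) auto

lemma tensor_mult_integrable:
  fixes H :: "plane \<Rightarrow> real"
  assumes "continuous_on UNIV f" "continuous_on UNIV g" "continuous_on UNIV H"
    and "\<And>x. x \<notin> {-R..R} \<Longrightarrow> f x = 0" "\<And>x. x \<notin> {-R..R} \<Longrightarrow> g x = 0"
  shows "integrable lborel (\<lambda>z. tensor f g z * H z)"
proof (rule continuous_bounded_support_integrable)
  show "continuous_on UNIV (\<lambda>z. tensor f g z * H z)" by (intro continuous_on_mult continuous_on_tensor assms)
  show "bounded ({-R..R} \<times> {-R..R})" by (intro bounded_Times) auto
  show "tensor f g z * H z = 0" if "z \<notin> {-R..R} \<times> {-R..R}" for z
    using that assms(4)[of "fst z"] assms(5)[of "snd z"] by (auto simp: tensor_def mem_Times_iff)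
qed

text \<open>The two integrands add up to the derivative of \<open>G y * (F x * H (x, y))\<close> in
  the first variable, so every horizontal slice of the sum integrates to zero.\<close>

lemma tensor_ibp_fst:
  assumes F: "\<And>x. (F has_real_derivative F' x) (at x)" "continuous_on UNIV F'" "\<And>x. x \<notin> {-R..R} \<Longrightarrow> F x = 0" "\<And>x. x \<notin> {-R..R} \<Longrightarrow> F' x = 0"
    and G: "continuous_on UNIV G" "\<And>x. x \<notin> {-R..R} \<Longrightarrow> G x = 0" and H: "C_k (Suc k) H"
  shows "(LINT z|lborel. tensor F G z * dir_deriv (1, 0) H z) = - (LINT z|lborel. tensor F' G z * H z)"
proof -
  have Fc: "continuous_on UNIV F" using F(1) by (meson DERIV_isCont continuous_at_imp_continuous_on)
  have Hc: "continuous_on UNIV H" "continuous_on UNIV (dir_deriv (1, 0) H)"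
    using H C_k_continuous[OF H] C_k_continuous by auto
  have i: "integrable lborel (\<lambda>z. tensor F G z * dir_deriv (1, 0) H z)" "integrable lborel (\<lambda>z. tensor F' G z * H z)"
    by (rule tensor_mult_integrable[where R = R]; use Fc Hc F G in auto)+
  have "(LINT z|lborel. tensor F G z * dir_deriv (1, 0) H z + tensor F' G z * H z) = 0"
  proof (rule plane_integral_zero_if_slices_zero(1)[OF Bochner_Integration.integrable_add[OF i]])
    fix y
    have Hc': "continuous_on UNIV (\<lambda>x. H (x, y))" "continuous_on UNIV (\<lambda>x. dir_deriv (1, 0) H (x, y))"
      by (intro continuous_on_compose2[OF Hc(1)] continuous_on_compose2[OF Hc(2)] continuous_intros; simp)+
    have "(LINT x|lborel. G y * (F x * dir_deriv (1, 0) H (x, y) + F' x * H (x, y))) = 0"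
    proof (rule integral_deriv_bounded_support[where F = "\<lambda>x. G y * (F x * H (x, y))" and a = "-R" and b = R])
      show "((\<lambda>x. G y * (F x * H (x, y))) has_real_derivative G y * (F x * dir_deriv (1, 0) H (x, y) + F' x * H (x, y))) (at x)" for x
        by (rule DERIV_cong[OF DERIV_cmult[OF DERIV_mult[OF F(1) C_k_partial_derivs(1)[OF H]]]]) (simp add: algebra_simps)
      show "continuous_on UNIV (\<lambda>x. G y * (F x * dir_deriv (1, 0) H (x, y) + F' x * H (x, y)))"
        by (intro continuous_intros Fc F Hc')
    qed (use F(3) in auto)
    then show "(LINT x|lborel. tensor F G (x, y) * dir_deriv (1, 0) H (x, y) + tensor F' G (x, y) * H (x, y)) = 0"
      by (simp add: tensor_def algebra_simps)
  qed
  with i show ?thesis by (simp add: Bochner_Integration.integral_add)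
qed

lemma tensor_ibp_snd:
  assumes F: "\<And>x. (F has_real_derivative F' x) (at x)" "continuous_on UNIV F'" "\<And>x. x \<notin> {-R..R} \<Longrightarrow> F x = 0" "\<And>x. x \<notin> {-R..R} \<Longrightarrow> F' x = 0"
    and G: "continuous_on UNIV G" "\<And>x. x \<notin> {-R..R} \<Longrightarrow> G x = 0" and H: "C_k (Suc k) H"
  shows "(LINT z|lborel. tensor G F z * dir_deriv (0, 1) H z) = - (LINT z|lborel. tensor G F' z * H z)"
proof -
  have Fc: "continuous_on UNIV F" using F(1) by (meson DERIV_isCont continuous_at_imp_continuous_on)
  have Hc: "continuous_on UNIV H" "continuous_on UNIV (dir_deriv (0, 1) H)"
    using H C_k_continuous[OF H] C_k_continuous by auto
  have i: "integrable lborel (\<lambda>z. tensor G F z * dir_deriv (0, 1) H z)" "integrable lborel (\<lambda>z. tensor G F' z * H z)"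
    by (rule tensor_mult_integrable[where R = R]; use Fc Hc F G in auto)+
  have "(LINT z|lborel. tensor G F z * dir_deriv (0, 1) H z + tensor G F' z * H z) = 0"
  proof (rule plane_integral_zero_if_slices_zero(2)[OF Bochner_Integration.integrable_add[OF i]])
    fix x
    have Hc': "continuous_on UNIV (\<lambda>y. H (x, y))" "continuous_on UNIV (\<lambda>y. dir_deriv (0, 1) H (x, y))"
      by (intro continuous_on_compose2[OF Hc(1)] continuous_on_compose2[OF Hc(2)] continuous_intros; simp)+
    have "(LINT y|lborel. G x * (F y * dir_deriv (0, 1) H (x, y) + F' y * H (x, y))) = 0"
    proof (rule integral_deriv_bounded_support[where F = "\<lambda>y. G x * (F y * H (x, y))" and a = "-R" and b = R])
      show "((\<lambda>y. G x * (F y * H (x, y))) has_real_derivative G x * (F y * dir_deriv (0, 1) H (x, y) + F' y * H (x, y))) (at y)" for y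
        by (rule DERIV_cong[OF DERIV_cmult[OF DERIV_mult[OF F(1) C_k_partial_derivs(2)[OF H]]]]) (simp add: algebra_simps)
      show "continuous_on UNIV (\<lambda>y. G x * (F y * dir_deriv (0, 1) H (x, y) + F' y * H (x, y)))"
        by (intro continuous_intros Fc F Hc')
    qed (use F(3) in auto)
    then show "(LINT y|lborel. tensor G F (x, y) * dir_deriv (0, 1) H (x, y) + tensor G F' (x, y) * H (x, y)) = 0"
      by (simp add: tensor_def algebra_simps)
  qed
  with i show ?thesis by (simp add: Bochner_Integration.integral_add)
qed

text \<open>Here the tensor is the function being differentiated, and the test function is arbitrary
  instead of a tensor. Derivatives are taken off \<open>h\<close> one at a time, those in the first
  variable before those in the second, following the nesting in
  \<open>mixed_partial\<close>.\<close>

lemma tensor_is_weak_deriv: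
  assumes F: "Cchain (fst a) F" "\<And>i x. i \<le> fst a \<Longrightarrow> x \<notin> {-R..R} \<Longrightarrow> F i x = 0"
    and G: "Cchain (snd a) G" "\<And>i x. i \<le> snd a \<Longrightarrow> x \<notin> {-R..R} \<Longrightarrow> G i x = 0"
  shows "is_weak_deriv UNIV a (tensor (F 0) (G 0)) (tensor (F (fst a)) (G (snd a)))"
proof -
  have cF: "continuous_on UNIV (F i)" if "i \<le> fst a" for i using Cchain_continuous[OF F(1) that] .
  have cG: "continuous_on UNIV (G i)" if "i \<le> snd a" for i using Cchain_continuous[OF G(1) that] .
  have li: "locally_integrable UNIV (tensor (F i) (G j))" if "i \<le> fst a" "j \<le> snd a" for i j
    unfolding locally_integrable_def
  proof safe
    fix K :: "plane set" assume K: "compact K"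
    have Ks: "K \<in> sets lebesgue" using K by (simp add: lmeasurable_compact fmeasurableD)
    have "integrable lborel (\<lambda>z. tensor (F i) (G j) z * 1)"
      by (rule tensor_mult_integrable[where R = R]) (use that cF cG F(2) G(2) in auto)
    then have "integrable lebesgue (tensor (F i) (G j))"
      by (simp add: integrable_completion)
    then have "integrable lebesgue (\<lambda>x. indicator K x *\<^sub>R tensor (F i) (G j) x)"
      by (rule integrable_mult_indicator[OF Ks])
    then show "integrable (lebesgue_on K) (tensor (F i) (G j))"
      using Ks by (subst integrable_restrict_space) auto
  qed
  have "(LINT x|lebesgue_on UNIV. tensor (F 0) (G 0) x * mixed_partial a h x) =
     (- 1) ^ order_of a * (LINT x|lebesgue_on UNIV. tensor (F (fst a)) (G (snd a)) x * h x)"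
    if h: "h \<in> test_functions UNIV" for h
  proof -
    define D1 where "D1 i = (dir_deriv (1, 0) ^^ i)" for i
    define D2 where "D2 i = (dir_deriv (0, 1) ^^ i)" for i
    have hC: "\<forall>k. C_k k h" using h by (simp add: test_functions_def)
    have D2C: "\<forall>k. C_k k (D2 n h)" for n
      using mixed_partial_C_k[OF hC, of "(0, n)"] by (simp add: mixed_partial_def D2_def)
    have D1C: "\<forall>k. C_k k (D1 n (D2 m h))" for n m
      using mixed_partial_C_k[OF hC, of "(n, m)"] by (simp add: mixed_partial_def D2_def D1_def)
    have 1: "(LINT z|lborel. tensor (F 0) (G 0) z * D1 (fst a) (D2 (snd a) h) z) =
        (-1) ^ i * (LINT z|lborel. tensor (F i) (G 0) z * D1 (fst a - i) (D2 (snd a) h) z)" if "i \<le> fst a" for i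
      using that
    proof (induction i)
      case (Suc i)
      have "D1 (fst a - i) (D2 (snd a) h) = dir_deriv (1, 0) (D1 (fst a - Suc i) (D2 (snd a) h))"
        using Suc.prems by (simp add: D1_def Suc_diff_Suc[symmetric])
      moreover have "(LINT z|lborel. tensor (F i) (G 0) z * dir_deriv (1, 0) (D1 (fst a - Suc i) (D2 (snd a) h)) z) =
         - (LINT z|lborel. tensor (F (Suc i)) (G 0) z * D1 (fst a - Suc i) (D2 (snd a) h) z)"
      proof (rule tensor_ibp_fst[where R = R])
        show "(F i has_real_derivative F (Suc i) x) (at x)" for x using F(1) Suc.prems by (auto simp: Cchain_def)
        show "C_k (Suc 0) (D1 (fst a - Suc i) (D2 (snd a) h))" using D1C by blast
      qed (use Suc.prems F(2) G(2) cF cG in auto)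
      ultimately show ?case using Suc by simp
    qed simp
    have 2: "(LINT z|lborel. tensor (F (fst a)) (G 0) z * D2 (snd a) h z) =
        (-1) ^ i * (LINT z|lborel. tensor (F (fst a)) (G i) z * D2 (snd a - i) h z)" if "i \<le> snd a" for i
      using that
    proof (induction i)
      case (Suc i)
      have "D2 (snd a - i) h = dir_deriv (0, 1) (D2 (snd a - Suc i) h)"
        using Suc.prems by (simp add: D2_def Suc_diff_Suc[symmetric])
      moreover have "(LINT z|lborel. tensor (F (fst a)) (G i) z * dir_deriv (0, 1) (D2 (snd a - Suc i) h) z) =
         - (LINT z|lborel. tensor (F (fst a)) (G (Suc i)) z * D2 (snd a - Suc i) h z)"
      proof (rule tensor_ibp_snd[where R = R])
        show "(G i has_real_derivative G (Suc i) x) (at x)" for x using G(1) Suc.prems by (auto simp: Cchain_def)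
        show "C_k (Suc 0) (D2 (snd a - Suc i) h)" using D2C by blast
      qed (use Suc.prems F(2) G(2) cF cG in auto)
      ultimately show ?case using Suc by simp
    qed simp
    have leb: "(LINT x|lebesgue_on UNIV. tensor (F i) (G j) x * H x) = (LINT z|lborel. tensor (F i) (G j) z * H z)"
      if "i \<le> fst a" "j \<le> snd a" "continuous_on UNIV H" for i j H
    proof -
      have "(\<lambda>z. tensor (F i) (G j) z * H z) \<in> borel_measurable lborel"
        using that by (simp, intro borel_measurable_continuous_onI continuous_on_mult continuous_on_tensor cF cG)
      then show ?thesis by (simp add: lebesgue_on_UNIV_eq integral_completion)
    qed
    show ?thesis
      using 1[of "fst a"] 2[of "snd a"] C_k_continuous[OF D1C[rule_format]] C_k_continuous[OF hC[rule_format]]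
      by (simp add: leb mixed_partial_def D1_def[symmetric] D2_def[symmetric] order_of_power)
        (simp add: D1_def D2_def)
  qed
  with li show ?thesis by (simp add: is_weak_deriv_def)
qed

text \<open>The complement of the essential support is a union of possibly uncountably many open
  sets. By the Lindelof property countably many of them suffice, so only countably many null sets
  accumulate.\<close>

lemma AE_zero_outside_ess_support: "AE x in lebesgue. x \<notin> ess_support f \<longrightarrow> f x = 0"
proof -
  define VV where "VV = {V. open V \<and> (AE x in lebesgue. x \<in> V \<longrightarrow> f x = 0)}"
  obtain VV' where V: "VV' \<subseteq> VV" "countable VV'" "\<Union>VV' = \<Union>VV"
    by (rule Lindelof_openin[of VV UNIV]) (auto simp: VV_def)
  have "AE x in lebesgue. \<forall>V\<in>VV'. x \<in> V \<longrightarrow> f x = 0"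
    using V(1) by (intro AE_ball_countable[THEN iffD2]) (auto simp: V(2) VV_def)
  then show ?thesis
  proof eventually_elim
    case (elim x)
    then have "x \<in> \<Union>VV' \<longrightarrow> f x = 0" by blast
    then show ?case unfolding V(3) by (auto simp: ess_support_def VV_def)
  qed
qed

text \<open>On a box that contains \<open>K\<close>, every tensor bump is the derivative of order
  \<open>a\<close> of some test function. Hence \<open>f\<close> integrates to zero against all
  bumps in the box.\<close>

lemma compact_primitive_unique:
  assumes f: "integrable lebesgue f" "bounded K" "AE x in lebesgue. x \<notin> K \<longrightarrow> f x = 0"
    and test: "\<And>h. h \<in> test_functions UNIV \<Longrightarrow> (LINT x|lebesgue. f x * mixed_partial a h x) = 0"
  shows "AE x in lebesgue. f x = 0"
proof -
  obtain R0 where R0: "\<And>x. x \<in> K \<Longrightarrow> norm x \<le> R0"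
    using f(2) by (auto simp: bounded_iff)
  define R where "R = max R0 0 + 1"
  have R: "R > 0" "R > R0" by (auto simp: R_def)
  define U where "U = box (-R, -R) (R, R)"
  have out: "x \<in> U" if "x \<in> K" for x
    using R0[OF that] R norm_fst_le[of "fst x" "snd x"] norm_snd_le[of "snd x" "fst x"]
    by (auto simp: U_def box_prod mem_Times_iff abs_less_iff)
  have AE_out: "AE x in lebesgue. indicator U x * f x = f x"
    using f(3) by eventually_elim (use out in \<open>auto simp: indicator_def\<close>)
  have "AE x in lebesgue. indicator U x * f x = 0"
  proof (rule AE_zero_if_bump_integrals_zero[where ?p1.0 = "-R" and ?q1.0 = "-R" and ?p2.0 = R and ?q2.0 = R])
    have "U \<in> sets lebesgue" by (auto simp: U_def)
    from integrable_mult_indicator[OF this f(1)] show "integrable lebesgue (\<lambda>x. indicator U x * f x)" by simp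
    show "indicator U x * f x = 0" if "x \<notin> box (-R, -R) (R, R)" for x using that by (simp add: U_def)
    fix u v w z k assume *: "-R \<le> u" "u < v" "v \<le> R" "-R \<le> w" "w < z" "z \<le> R"
    have z: "\<And>x. x \<notin> {-R..R} \<Longrightarrow> bump u v k x = 0" "\<And>x. x \<notin> {-R..R} \<Longrightarrow> bump w z k x = 0"
      by (rule bump_zero; use * in auto)+
    \<comment> \<open>The compensating copies that come with these iterated primitives lie beyond
      \<open>R\<close>, hence outside \<open>U\<close>, where \<open>f\<close> vanishes almost
      everywhere.\<close>
    obtain h1 R1 where h1: "smooth h1" "\<And>x. x \<notin> {-R..R1} \<Longrightarrow> h1 x = 0" "\<And>x. x \<le> R \<Longrightarrow> (deriv ^^ fst a) h1 x = bump u v k x"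
      using smooth_iterated_primitive[OF smooth_bump z(1) R(1), of "fst a"] by blast
    obtain h2 R2 where h2: "smooth h2" "\<And>x. x \<notin> {-R..R2} \<Longrightarrow> h2 x = 0" "\<And>x. x \<le> R \<Longrightarrow> (deriv ^^ snd a) h2 x = bump w z k x"
      using smooth_iterated_primitive[OF smooth_bump z(2) R(1), of "snd a"] by blast
    have t: "tensor h1 h2 \<in> test_functions UNIV"
      by (rule tensor_test_function[OF h1(1) h2(1) h1(2) h2(2)]) auto
    have "(LINT x|lebesgue. indicator U x * f x * tensor (bump u v k) (bump w z k) x) =
       (LINT x|lebesgue. f x * mixed_partial a (tensor h1 h2) x)"
    proof (rule integral_cong_AE)
      have m: "tensor (bump u v k) (bump w z k) \<in> borel_measurable lebesgue"
        by (intro continuous_imp_lebesgue_measurable continuous_on_tensor smooth_continuous smooth_bump)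
      have m': "mixed_partial a (tensor h1 h2) \<in> borel_measurable lebesgue"
        by (intro continuous_imp_lebesgue_measurable test_function_continuous[OF test_function_mixed_partial[OF t]])
      have [measurable]: "U \<in> sets lebesgue" by (auto simp: U_def)
      note [measurable] = m m' borel_measurable_integrable[OF f(1)]
      show "(\<lambda>x. indicat_real U x * f x * tensor (bump u v k) (bump w z k) x) \<in> borel_measurable lebesgue"
        "(\<lambda>x. f x * mixed_partial a (tensor h1 h2) x) \<in> borel_measurable lebesgue" by measurable
      show "AE x in lebesgue. indicat_real U x * f x * tensor (bump u v k) (bump w z k) x = f x * mixed_partial a (tensor h1 h2) x"
        using AE_out
      proof eventually_elim
        case (elim x)
        show ?case
        proof (cases "x \<in> U")
          case True
          then have "fst x \<le> R" "snd x \<le> R" by (auto simp: U_def box_prod mem_Times_iff)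
          with True show ?thesis
            unfolding mixed_partial_tensor[OF h1(1) h2(1)] by (simp add: tensor_def h1(3) h2(3))
        qed (use elim in auto)
      qed
    qed
    with test[OF t] show "(LINT x|lebesgue. indicator U x * f x * tensor (bump u v k) (bump w z k) x) = 0" by simp
  qed
  with AE_out show ?thesis by eventually_elim simp
qed

section \<open>B-splines and their filters\<close>

text \<open>A polynomial acts on functions with the indeterminate as the unit translation.\<close>

definition shift_poly :: "real poly \<Rightarrow> (real \<Rightarrow> 'a::real_vector) \<Rightarrow> real \<Rightarrow> 'a" where
  "shift_poly p g y = (\<Sum>i\<le>degree p. coeff p i *\<^sub>R g (y - real i))"

lemma shift_poly_upto: "degree p \<le> n \<Longrightarrow> shift_poly p g y = (\<Sum>i\<le>n. coeff p i *\<^sub>R g (y - real i))"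
  unfolding shift_poly_def by (rule sum.mono_neutral_left) (auto simp: coeff_eq_0)

lemma shift_poly_0 [simp]: "shift_poly 0 g = (\<lambda>y. 0)"
  by (simp add: shift_poly_def fun_eq_iff)

lemma shift_poly_1 [simp]: "shift_poly 1 g = g"
  by (simp add: shift_poly_def fun_eq_iff)

lemma shift_poly_pCons: "shift_poly (pCons a p) g y = a *\<^sub>R g y + shift_poly p g (y - 1)"
proof -
  have "degree (pCons a p) \<le> Suc (degree p)" by (simp add: degree_pCons_le)
  then have "shift_poly (pCons a p) g y = (\<Sum>i\<le>Suc (degree p). coeff (pCons a p) i *\<^sub>R g (y - real i))" by (rule shift_poly_upto)
  also have "\<dots> = a *\<^sub>R g y + shift_poly p g (y - 1)"
    by (subst sum.atMost_Suc_shift) (simp add: shift_poly_def algebra_simps)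
  finally show ?thesis .
qed

lemma shift_poly_add: "shift_poly (p + q) g y = shift_poly p g y + shift_poly q g y"
proof -
  have "shift_poly (p + q) g y = (\<Sum>i\<le>max (degree p) (degree q). coeff (p + q) i *\<^sub>R g (y - real i))"
    by (rule shift_poly_upto) (rule degree_add_le_max)
  then show ?thesis
    by (simp add: shift_poly_upto[of p "max (degree p) (degree q)"] shift_poly_upto[of q "max (degree p) (degree q)"]
        scaleR_add_left sum.distrib)
qed

lemma shift_poly_smult: "shift_poly (smult c p) g y = c *\<^sub>R shift_poly p g y"
  by (subst shift_poly_upto[OF degree_smult_le]) (simp add: shift_poly_def scaleR_right.sum)

text \<open>The polynomial ring acts, so identities between filters become identities between
  commuting polynomials.\<close>

lemma shift_poly_mult: "shift_poly (p * q) g = shift_poly p (shift_poly q g)"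
proof (rule ext)
  show "shift_poly (p * q) g y = shift_poly p (shift_poly q g) y" for y
  proof (induction p arbitrary: y)
    case (pCons a p)
    show ?case by (simp add: shift_poly_add shift_poly_smult shift_poly_pCons pCons)
  qed simp
qed

lemma shift_poly_deriv:
  assumes "\<And>y. (f has_real_derivative f' y) (at y)"
  shows "(shift_poly p f has_real_derivative shift_poly p f' y) (at y)"
  unfolding shift_poly_def[abs_def]
  by (auto intro!: derivative_eq_intros DERIV_chain2[OF assms] simp: mult.commute)

lemma shift_poly_continuous:
  fixes f :: "real \<Rightarrow> real"
  assumes "continuous_on UNIV f" shows "continuous_on UNIV (shift_poly p f)"
  unfolding shift_poly_def[abs_def]
  by (intro continuous_intros continuous_on_compose2[OF assms]) auto

text \<open>The numbering starts at the box: \<open>box_spline n\<close> is the cardinal B-spline of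
  order n + 1, supported on [0, n + 1] and not centred.\<close>

primrec box_spline :: "nat \<Rightarrow> real \<Rightarrow> real" where
  "box_spline 0 = indicator {0..1}"
| "box_spline (Suc n) = (\<lambda>y. LINT t|lborel. indicator {0..1} t * box_spline n (y - t))"

declare box_spline.simps(2) [simp del]

lemma box_spline_basic:
  shows box_spline_measurable [measurable]: "box_spline n \<in> borel_measurable borel"
    and box_spline_nonneg: "0 \<le> box_spline n y" and box_spline_le_1: "box_spline n y \<le> 1"
    and box_spline_zero: "y \<notin> {0..real (Suc n)} \<Longrightarrow> box_spline n y = 0"
proof -
  have "box_spline n \<in> borel_measurable borel \<and> (\<forall>y. 0 \<le> box_spline n y \<and> box_spline n y \<le> 1) \<and> (\<forall>y. y \<notin> {0..real (Suc n)} \<longrightarrow> box_spline n y = 0)"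
  proof (induction n)
    case (Suc n)
    then have m[measurable]: "box_spline n \<in> borel_measurable borel" and b: "\<And>y. 0 \<le> box_spline n y" "\<And>y. box_spline n y \<le> 1"
      and z: "\<And>y. y \<notin> {0..real (Suc n)} \<Longrightarrow> box_spline n y = 0" by auto
    have "integrable lborel (\<lambda>t. indicator {0..1} t * box_spline n (y - t))" for y
      by (rule Bochner_Integration.integrable_bound[of _ "indicator {0..1::real} :: real \<Rightarrow> real"])
         (use b in \<open>auto simp: indicator_def\<close>)
    then have "box_spline (Suc n) y \<le> (LINT t|lborel. indicator {0..1::real} t)" for y
      unfolding box_spline.simps by (rule integral_mono) (use b in \<open>auto intro!: integrable_real_indicator mult_left_le\<close>)
    then have "box_spline (Suc n) y \<le> 1" for y by simp
    moreover have "box_spline (Suc n) y \<ge> 0" for y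
      unfolding box_spline.simps by (intro Bochner_Integration.integral_nonneg) (use b in auto)
    moreover have "box_spline (Suc n) y = 0" if "y \<notin> {0..real (Suc (Suc n))}" for y
    proof -
      have "indicator {0..1} t * box_spline n (y - t) = 0" for t
        using that z[of "y - t"] by (auto simp: indicator_def)
      then show ?thesis by (simp only: box_spline.simps Bochner_Integration.integral_zero)
    qed
    moreover have "box_spline (Suc n) \<in> borel_measurable borel"
    proof -
      have "(\<lambda>y. LINT t|lborel. indicator {0..1} t * box_spline n (y - t)) \<in> borel_measurable lborel"
        by (rule lborel.borel_measurable_lebesgue_integral) measurable
      then show ?thesis by (simp add: box_spline.simps(2))
    qed
    ultimately show ?case by blast
  qed auto
  then show "box_spline n \<in> borel_measurable borel" "0 \<le> box_spline n y" "box_spline n y \<le> 1"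
    "y \<notin> {0..real (Suc n)} \<Longrightarrow> box_spline n y = 0" by auto
qed

lemma box_spline_integrable: "integrable lborel (box_spline n)"
proof (rule Bochner_Integration.integrable_bound)
  show "integrable lborel (indicator {0..real (Suc n)} :: real \<Rightarrow> real)"
    by (rule integrable_real_indicator) auto
  show "AE x in lborel. norm (box_spline n x) \<le> norm (indicator {0..real (Suc n)} x :: real)"
  proof (rule AE_I2)
    show "norm (box_spline n x) \<le> norm (indicator {0..real (Suc n)} x :: real)" for x
      using box_spline_nonneg[of n x] box_spline_le_1[of n x] box_spline_zero[of x n] by (cases "x \<in> {0..real (Suc n)}") auto
  qed
qed simp

lemma box_spline_Suc_window: "box_spline (Suc n) y = (LINT t|lborel. indicator {y - 1..y} t * box_spline n t)"
proof -
  have "(LINT t|lborel. indicator {y - 1..y} t * box_spline n t) = \<bar>-1\<bar> *\<^sub>R (LINT t|lborel. indicator {y - 1..y} (y + (-1) * t) * box_spline n (y + (-1) * t))"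
    by (rule lborel_integral_real_affine) simp
  also have "\<dots> = box_spline (Suc n) y"
    by (auto intro!: Bochner_Integration.integral_cong simp: box_spline.simps(2) indicator_def)
  finally show ?thesis ..
qed

text \<open>Strict positivity is what makes essential supports computable exactly. If the window
  integral vanished, the previous spline would vanish almost everywhere on the overlap of the window
  with its own open support interval, which has positive length and on which that spline is
  positive.\<close>

lemma box_spline_pos: "0 < y \<Longrightarrow> y < real (Suc n) \<Longrightarrow> 0 < box_spline n y"
proof (induction n arbitrary: y)
  case (Suc n)
  let ?f = "\<lambda>t. indicator {y - 1..y} t * box_spline n t"
  have i: "integrable lborel ?f"
    using integrable_mult_indicator[OF _ box_spline_integrable[of n], of "{y - 1..y}"] by simp
  have "box_spline (Suc n) y \<noteq> 0"
  proof
    assume "box_spline (Suc n) y = 0"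
    then have AE: "AE t in lborel. ?f t = 0"
      using integral_nonneg_eq_0_iff_AE[OF i] box_spline_nonneg[of n] unfolding box_spline_Suc_window by auto
    define a b where "a = max 0 (y - 1)" and "b = min (real (Suc n)) y"
    have ab: "a < b" using Suc.prems by (auto simp: a_def b_def)
    have "AE t in lborel. t \<notin> {a<..<b}"
      using AE
    proof eventually_elim
      case (elim t)
      show ?case
      proof
        assume "t \<in> {a<..<b}"
        then have "t \<in> {y - 1..y}" "box_spline n t > 0" by (auto simp: a_def b_def intro!: Suc.IH)
        with elim show False by simp
      qed
    qed
    then have "emeasure lborel {a<..<b} = 0"
      by (subst (asm) AE_iff_measurable[where N = "{a<..<b}"]) auto
    then show False using ab by (simp del: greaterThanLessThan_iff)
  qed
  with box_spline_nonneg[of "Suc n" y] show ?case by simp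
qed (auto simp: indicator_def)

text \<open>The window meets the unit interval in an interval of this length. This is the hat
  function, the first continuous spline and the start of the induction on continuity.\<close>

lemma box_spline_1: "box_spline (Suc 0) y = max 0 (min 1 y - max 0 (y - 1))"
proof -
  have "box_spline (Suc 0) y = (LINT t|lborel. indicator {max 0 (y - 1)..min 1 y} t)"
    unfolding box_spline_Suc_window by (intro Bochner_Integration.integral_cong) (auto simp: indicator_def)
  then show ?thesis by (auto simp: max_def)
qed

lemma box_spline_Suc_Suc_window:
  assumes "continuous_on UNIV (box_spline n)" shows "box_spline (Suc n) y = integral {y - 1..y} (box_spline n)"
proof -
  have "set_integrable lborel {y - 1..y} (box_spline n)"
    unfolding set_integrable_def by (intro integrable_mult_indicator box_spline_integrable) auto
  from set_borel_integral_eq_integral(2)[OF this] show ?thesis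
    by (simp add: box_spline_Suc_window set_lebesgue_integral_def)
qed

lemma box_spline_continuous: "continuous_on UNIV (box_spline (Suc n))"
proof (induction n)
  case 0
  have "box_spline (Suc 0) = (\<lambda>y. max 0 (min 1 y - max 0 (y - 1)))" using box_spline_1 by blast
  then show ?case by (simp only:) (intro continuous_intros)
next
  case (Suc n)
  have eq: "box_spline (Suc (Suc n)) = (\<lambda>y. integral {y - 1..y} (box_spline (Suc n)))"
    by (rule ext) (rule box_spline_Suc_Suc_window[OF Suc])
  have "isCont (box_spline (Suc (Suc n))) y" for y
    unfolding eq by (rule DERIV_isCont[OF window_integral_deriv[OF Suc]]) simp
  then show ?case by (simp add: continuous_at_imp_continuous_on del: box_spline.simps)
qed

text \<open>Differentiating the window integral leaves a backward difference, which is the action of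
  1 - X. The index starts at \<open>Suc (Suc n)\<close> because the integrand must be continuous,
  and the box is not.\<close>

lemma box_spline_deriv: "(box_spline (Suc (Suc n)) has_real_derivative shift_poly [:1, -1:] (box_spline (Suc n)) y) (at y)"
proof -
  have eq: "box_spline (Suc (Suc n)) = (\<lambda>y. integral {y - 1..y} (box_spline (Suc n)))"
    by (rule ext) (rule box_spline_Suc_Suc_window[OF box_spline_continuous])
  show ?thesis
    unfolding eq using window_integral_deriv[OF box_spline_continuous, of 1 n y] by (simp add: shift_poly_pCons)
qed

section \<open>Fourier transform and identification of the B-splines\<close>

lemma unit_interval_fourier:
  "(LINT t|lborel. complex_of_real (indicator {0..1} t) * cis (- (w * t))) = cis (- (w / 2)) * complex_of_real (sinc (w / 2))"
proof (cases "w = 0")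
  case True
  have "(LINT t|lborel. complex_of_real (indicator {0..1::real} t)) = complex_of_real (LINT t|lborel. indicator {0..1::real} t)"
    by (rule integral_complex_of_real)
  then show ?thesis using True by simp
next
  case False
  have "(LINT t|lborel. complex_of_real (indicator {0..1} t) * cis (- (w * t))) = (LINT t|lborel. indicator {0..1} t *\<^sub>R cis (- (w * t)))"
    by (intro Bochner_Integration.integral_cong) (auto simp: indicator_def)
  also have "\<dots> = (\<i> / w) * cis (- (w * 1)) - (\<i> / w) * cis (- (w * 0))"
  proof (rule integral_FTC_Icc)
    show "((\<lambda>t. (\<i> / w) * cis (- (w * t))) has_vector_derivative cis (- (w * x))) (at x within {0..1})" for x
    proof -
      have "((\<lambda>z. (\<i> / w) * exp (- (\<i> * (w * z)))) has_field_derivative exp (- (\<i> * (w * complex_of_real x)))) (at (complex_of_real x))"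
        using False by (auto intro!: derivative_eq_intros)
      from has_vector_derivative_real_field[OF this] show ?thesis by (simp add: cis_conv_exp)
    qed
    show "continuous_on {0..1} (\<lambda>x. cis (- (w * x)))" unfolding cis_conv_exp by (intro continuous_intros)
  qed simp
  also have "\<dots> = cis (- (w / 2)) * complex_of_real (sinc (w / 2))"
  proof -
    have "complex_of_real (sin (w / 2)) = (cis (w / 2) - cis (- (w / 2))) / (2 * \<i>)"
      by (simp add: complex_eq_iff cis.ctr)
    then have "cis (- (w / 2)) * complex_of_real (sinc (w / 2)) = (cis (- (w / 2)) * cis (w / 2) - cis (- (w / 2)) * cis (- (w / 2))) / (\<i> * w)"
    proof -
      assume eq: "complex_of_real (sin (w / 2)) = (cis (w / 2) - cis (- (w / 2))) / (2 * \<i>)"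
      have "complex_of_real (sinc (w / 2)) = complex_of_real (sin (w / 2)) / (w / 2)" using False by simp
      also have "\<dots> = (cis (w / 2) - cis (- (w / 2))) / (\<i> * w)"
        unfolding eq using False by (simp add: divide_simps) (simp add: algebra_simps)
      finally have "complex_of_real (sinc (w / 2)) = (cis (w / 2) - cis (- (w / 2))) / (\<i> * w)" .
      then show ?thesis by (simp only: right_diff_distrib times_divide_eq_right)
    qed
    also have "\<dots> = (1 - cis (- w)) / (\<i> * w)" by (simp add: cis_mult)
    finally have E: "cis (- (w / 2)) * complex_of_real (sinc (w / 2)) = (1 - cis (- w)) / (\<i> * w)" .
    have "(1 - X) / (\<i> * w) = (\<i> / w) * X - \<i> / w" for X
      using False by (simp add: divide_simps) (simp add: algebra_simps)
    with E show ?thesis by (simp only: mult_1_right mult_zero_right minus_zero cis_zero)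
  qed
  finally show ?thesis .
qed

text \<open>The convolution theorem: by Fubini the double integral separates, and each further box
  contributes one factor.\<close>

lemma box_spline_fourier:
  "(LINT x|lborel. complex_of_real (box_spline n x) * cis (- (w * x))) = (cis (- (w / 2)) * complex_of_real (sinc (w / 2))) ^ Suc n"
proof (induction n)
  case 0
  show ?case using unit_interval_fourier[of w] by simp
next
  case (Suc n)
  let ?f = "\<lambda>(x, t). complex_of_real (indicator {0..1} t * box_spline n (x - t)) * cis (- (w * x))"
  have int: "integrable (lborel \<Otimes>\<^sub>M lborel) ?f"
  proof (rule Bochner_Integration.integrable_bound)
    show "integrable (lborel \<Otimes>\<^sub>M lborel) (indicator ({0..real n + 2} \<times> {0..1}) :: real \<times> real \<Rightarrow> real)"
      by (intro integrable_real_indicator)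
         (auto simp: lborel.emeasure_pair_measure_Times ennreal_mult_less_top[symmetric] ennreal_mult[symmetric])
    have [measurable]: "(\<lambda>x. cis (- (w * x))) \<in> borel_measurable borel"
      unfolding cis_conv_exp by measurable
    show "?f \<in> borel_measurable (lborel \<Otimes>\<^sub>M lborel)" by measurable
    show "AE x in lborel \<Otimes>\<^sub>M lborel. norm (?f x) \<le> norm (indicator ({0..real n + 2} \<times> {0..1}) x :: real)"
    proof (rule AE_I2)
      fix z :: "real \<times> real"
      obtain x t where z: "z = (x, t)" by (cases z)
      have "box_spline n (x - t) = 0" if "t \<in> {0..1}" "x \<notin> {0..real n + 2}" using that by (intro box_spline_zero) auto
      then show "norm (?f z) \<le> norm (indicator ({0..real n + 2} \<times> {0..1}) z :: real)"
        using box_spline_nonneg[of n "x - t"] box_spline_le_1[of n "x - t"] by (auto simp: z indicator_def norm_mult)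
    qed
  qed
  have "(LINT x|lborel. complex_of_real (box_spline (Suc n) x) * cis (- (w * x))) =
        (LINT x|lborel. LINT t|lborel. complex_of_real (indicator {0..1} t * box_spline n (x - t)) * cis (- (w * x)))"
    by (simp only: box_spline.simps integral_complex_of_real[symmetric] integral_mult_left_zero)
  also have "\<dots> = (LINT t|lborel. LINT x|lborel. complex_of_real (indicator {0..1} t * box_spline n (x - t)) * cis (- (w * x)))"
    by (rule lborel_pair.Fubini_integral[OF int, symmetric])
  also have "\<dots> = (LINT t|lborel. (complex_of_real (indicator {0..1} t) * cis (- (w * t))) * (LINT x|lborel. complex_of_real (box_spline n x) * cis (- (w * x))))"
  proof (intro Bochner_Integration.integral_cong refl)
    fix t
    have "(LINT x|lborel. complex_of_real (box_spline n (x - t)) * cis (- (w * x))) =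
       \<bar>1\<bar> *\<^sub>R (LINT x|lborel. complex_of_real (box_spline n ((t + 1 * x) - t)) * cis (- (w * (t + 1 * x))))"
      by (rule lborel_integral_real_affine) simp
    also have "\<dots> = (LINT x|lborel. cis (- (w * t)) * (complex_of_real (box_spline n x) * cis (- (w * x))))"
      by (auto intro!: Bochner_Integration.integral_cong simp: cis_mult algebra_simps)
    finally show "(LINT x|lborel. complex_of_real (indicator {0..1} t * box_spline n (x - t)) * cis (- (w * x))) =
       (complex_of_real (indicator {0..1} t) * cis (- (w * t))) * (LINT x|lborel. complex_of_real (box_spline n x) * cis (- (w * x)))"
      by (simp add: mult.assoc)
  qed
  also have "\<dots> = (cis (- (w / 2)) * complex_of_real (sinc (w / 2))) ^ Suc (Suc n)"
    by (simp only: integral_mult_left_zero Suc unit_interval_fourier power_Suc)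
  finally show ?case .
qed

lemma box_spline_integral: "(LINT x|lborel. box_spline n x) = 1"
  using box_spline_fourier[of n 0] by (simp add: integral_complex_of_real)

text \<open>The positive and the negative part of \<open>f\<close> have the same Fourier transform,
  in particular the same mass, read off at frequency zero. If that mass is positive, normalisation
  turns both into probability densities with equal characteristic functions, and Levy's uniqueness
  theorem identifies them.\<close>

lemma fourier_zero_imp_AE_zero:
  fixes f :: "real \<Rightarrow> real"
  assumes f: "integrable lborel f" and zero: "\<And>w. (LINT x|lborel. complex_of_real (f x) * cis (- (w * x))) = 0"
  shows "AE x in lborel. f x = 0"
proof -
  define P where "P x = max 0 (f x)" for x
  define Q where "Q x = max 0 (- f x)" for x
  have PQ: "integrable lborel P" "integrable lborel Q" using f by (auto simp: P_def[abs_def] Q_def[abs_def])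
  have nn: "P x \<ge> 0" "Q x \<ge> 0" for x by (auto simp: P_def Q_def)
  have f_eq: "f x = P x - Q x" for x by (auto simp: P_def Q_def)
  have FI: "integrable lborel (\<lambda>x. complex_of_real (h x) * cis (w * x))" if "integrable lborel h" for h :: "real \<Rightarrow> real" and w
  proof (rule Bochner_Integration.integrable_bound[OF that])
    have [measurable]: "(\<lambda>x. cis (w * x)) \<in> borel_measurable borel" unfolding cis_conv_exp by measurable
    note [measurable] = borel_measurable_integrable[OF that]
    show "(\<lambda>x. complex_of_real (h x) * cis (w * x)) \<in> borel_measurable lborel" by measurable
  qed (auto simp: norm_mult)
  have F: "(LINT x|lborel. complex_of_real (P x) * cis (w * x)) = (LINT x|lborel. complex_of_real (Q x) * cis (w * x))" for w
  proof -
    have "(LINT x|lborel. complex_of_real (P x) * cis (w * x)) - (LINT x|lborel. complex_of_real (Q x) * cis (w * x)) =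
      (LINT x|lborel. complex_of_real (f x) * cis (- ((-w) * x)))"
      by (subst Bochner_Integration.integral_diff[symmetric]) (auto intro!: FI PQ simp: f_eq left_diff_distrib)
    then show ?thesis using zero[of "-w"] by simp
  qed
  define c where "c = (LINT x|lborel. P x)"
  have c': "(LINT x|lborel. Q x) = c"
    using F[of 0] by (simp add: c_def integral_complex_of_real)
  show ?thesis
  proof (cases "c = 0")
    case True
    have "AE x in lborel. P x = 0" "AE x in lborel. Q x = 0"
      using integral_nonneg_eq_0_iff_AE[OF PQ(1)] integral_nonneg_eq_0_iff_AE[OF PQ(2)] True c' nn by (auto simp: c_def)
    then show ?thesis by eventually_elim (simp add: f_eq)
  next
    case False
    moreover have "c \<ge> 0" unfolding c_def by (intro Bochner_Integration.integral_nonneg nn)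
    ultimately have c: "c > 0" by simp
    have m[measurable]: "P \<in> borel_measurable borel" "Q \<in> borel_measurable borel" using PQ by auto
    have rd: "real_distribution (density lborel (\<lambda>x. ennreal (h x / c)))"
      if h: "integrable lborel h" "\<And>x. h x \<ge> 0" "(LINT x|lborel. h x) = c" for h
    proof -
      have "prob_space (density lborel (\<lambda>x. ennreal (h x / c)))"
      proof
        have "(\<integral>\<^sup>+x. ennreal (h x / c) \<partial>lborel) = ennreal (LINT x|lborel. h x / c)"
          by (rule nn_integral_eq_integral) (use h c in auto)
        moreover have "h \<in> borel_measurable borel" using h by auto
        ultimately show "emeasure (density lborel (\<lambda>x. ennreal (h x / c))) (space (density lborel (\<lambda>x. ennreal (h x / c)))) = 1"
          using h c by (simp add: emeasure_density)
      qed
      then show ?thesis by (simp add: real_distribution_def real_distribution_axioms_def)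
    qed
    have ch: "char (density lborel (\<lambda>x. ennreal (h x / c))) w = (LINT x|lborel. complex_of_real (h x) * cis (w * x)) / c"
      if h: "h \<in> borel_measurable borel" "\<And>x. h x \<ge> 0" for h w
    proof -
      have "char (density lborel (\<lambda>x. ennreal (h x / c))) w = (LINT x|lborel. (h x / c) *\<^sub>R iexp (w * x))"
        unfolding char_def by (rule integral_density) (use h c in auto)
      also have "\<dots> = (LINT x|lborel. complex_of_real (h x) * cis (w * x) / c)"
        by (intro Bochner_Integration.integral_cong) (auto simp: cis_conv_exp scaleR_conv_of_real)
      finally show ?thesis by simp
    qed
    have "density lborel (\<lambda>x. ennreal (P x / c)) = density lborel (\<lambda>x. ennreal (Q x / c))"
      by (intro Levy_uniqueness rd PQ nn c' c_def[symmetric] ext) (simp add: ch nn F)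
    then have "AE x in lborel. ennreal (P x / c) = ennreal (Q x / c)"
      by (intro sigma_finite_measure.density_unique[OF lborel.sigma_finite_measure_axioms]) measurable
    then show ?thesis
      by eventually_elim (use c nn in \<open>simp add: f_eq\<close>)
  qed
qed

text \<open>The shifted box spline satisfies the defining equation, so the choice is meaningful;
  injectivity of the Fourier transform makes any chosen function agree with it almost
  everywhere.\<close>

lemma bspline_AE_eq:
  assumes "m \<ge> 1"
  shows "bspline m \<in> borel_measurable borel" "AE x in lborel. bspline m x = box_spline (m - 1) (x + real (m div 2))"
proof -
  define B where "B x = box_spline (m - 1) (x + real (m div 2))" for x
  have B: "integrable lborel B"
    unfolding B_def[abs_def] using lborel_integrable_real_affine[OF box_spline_integrable, of 1 "m - 1" "real (m div 2)"] by (simp add: add.commute)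
  \<comment> \<open>The \<open>m\<close>-fold convolution of the box is centred at m/2; moving it by
    the integer \<open>m div 2\<close> leaves half the parity of \<open>m\<close>, the centre
    prescribed for the B-spline.\<close>
  have shift: "real (parity m) / 2 = real m / 2 - real (m div 2)"
  proof -
    have "m = 2 * (m div 2) + m mod 2" by simp
    then have "real m = 2 * real (m div 2) + real (m mod 2)" by (metis of_nat_add of_nat_mult of_nat_numeral)
    then show ?thesis unfolding parity_def by linarith
  qed
  have BF: "(LINT x|lborel. complex_of_real (B x) * cis (- (w * x))) = cis (- (real (parity m) * w / 2)) * complex_of_real (sinc (w / 2) ^ m)" for w
  proof -
    have "(LINT x|lborel. complex_of_real (B x) * cis (- (w * x))) =
       \<bar>1\<bar> *\<^sub>R (LINT x|lborel. complex_of_real (B (- real (m div 2) + 1 * x)) * cis (- (w * (- real (m div 2) + 1 * x))))"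
      by (rule lborel_integral_real_affine) simp
    also have "\<dots> = (LINT x|lborel. cis (w * real (m div 2)) * (complex_of_real (box_spline (m - 1) x) * cis (- (w * x))))"
      by (auto intro!: Bochner_Integration.integral_cong simp: B_def cis_mult algebra_simps)
    also have "\<dots> = cis (w * real (m div 2)) * (cis (- (w / 2)) * complex_of_real (sinc (w / 2))) ^ m"
      using assms by (simp add: box_spline_fourier del: power_Suc)
    also have "\<dots> = (cis (w * real (m div 2)) * cis (- (w / 2)) ^ m) * complex_of_real (sinc (w / 2) ^ m)"
      by (simp add: power_mult_distrib)
    also have "cis (w * real (m div 2)) * cis (- (w / 2)) ^ m = cis (- (real (parity m) * w / 2))"
    proof -
      have "cis (w * real (m div 2)) * cis (- (w / 2)) ^ m = cis (w * real (m div 2) + real m * (- (w / 2)))"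
        by (subst Complex.DeMoivre) (rule cis_mult)
      also have "w * real (m div 2) + real m * (- (w / 2)) = - ((real (parity m) / 2) * w)"
        unfolding shift by (simp add: algebra_simps)
      finally show ?thesis by simp
    qed
    finally show ?thesis .
  qed
  let ?P = "\<lambda>B. integrable lborel B \<and> (\<forall>w. (LINT x|lborel. complex_of_real (B x) * cis (- (w * x)))
            = cis (- (real (parity m) * w / 2)) * complex_of_real (sinc (w / 2) ^ m))"
  have P: "?P (bspline m)"
    unfolding bspline_def by (rule someI[where P = ?P and x = B]) (use B BF in blast)
  then show "bspline m \<in> borel_measurable borel" by auto
  have FI: "integrable lborel (\<lambda>x. complex_of_real (h x) * cis (- (w * x)))" if "integrable lborel h" for h :: "real \<Rightarrow> real" and w
  proof (rule Bochner_Integration.integrable_bound[OF that])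
    have [measurable]: "(\<lambda>x. cis (- (w * x))) \<in> borel_measurable borel" unfolding cis_conv_exp by measurable
    note [measurable] = borel_measurable_integrable[OF that]
    show "(\<lambda>x. complex_of_real (h x) * cis (- (w * x))) \<in> borel_measurable lborel" by measurable
  qed (auto simp: norm_mult)
  have "AE x in lborel. bspline m x - B x = 0"
  proof (rule fourier_zero_imp_AE_zero)
    show "integrable lborel (\<lambda>x. bspline m x - B x)" using P B by auto
    show "(LINT x|lborel. complex_of_real (bspline m x - B x) * cis (- (w * x))) = 0" for w
      unfolding of_real_diff left_diff_distrib using P B BF by (subst Bochner_Integration.integral_diff) (auto intro: FI)
  qed
  then show "AE x in lborel. bspline m x = box_spline (m - 1) (x + real (m div 2))"
    by eventually_elim (simp add: B_def)
qed

text \<open>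
  The factor \<open>(1 + X) / 2\<close> is the symbol \<open>cos (w / 2)\<close> and \<open>1 - X\<close> the symbol \<open>2\<i> sin (w / 2)\<close>,
  each up to the phase \<open>cis (- w / 2)\<close>.
\<close>

definition mask_poly :: "nat \<Rightarrow> nat \<Rightarrow> real poly" where
  "mask_poly M r = [:1/2, 1/2:] ^ M * [:1, -1:] ^ r"

lemma degree_mask_poly: "degree (mask_poly M r) = M + r"
  unfolding mask_poly_def by (subst degree_mult_eq) (auto simp: degree_power_eq)

lemma coeff_mask_poly_nonzero: "coeff (mask_poly M r) 0 \<noteq> 0" "coeff (mask_poly M r) (M + r) \<noteq> 0"
proof -
  have "coeff (mask_poly M r) 0 = poly (mask_poly M r) 0" by (simp add: poly_0_coeff_0)
  also have "\<dots> = (1/2) ^ M" by (simp add: mask_poly_def poly_power)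
  finally show "coeff (mask_poly M r) 0 \<noteq> 0" by simp
  have "mask_poly M r \<noteq> 0" by (simp add: mask_poly_def)
  then show "coeff (mask_poly M r) (M + r) \<noteq> 0" using degree_mask_poly[of M r] leading_coeff_0_iff by metis
qed

lemma mask_poly_Suc: "mask_poly M (Suc r) = mask_poly M r * [:1, -1:]" "mask_poly (M + M') r = mask_poly M r * mask_poly M' 0"
  by (simp_all add: mask_poly_def power_add mult_ac del: mult_pCons_left mult_pCons_right)

text \<open>The closed form of the filter. Indices start at \<open>- (m div 2)\<close>, matching the
  position of the B-spline, and the divisor \<open>2 ^ r\<close> compensates for 1 - X being twice a
  sine.\<close>

definition mask_coeff :: "nat \<Rightarrow> nat \<Rightarrow> int \<Rightarrow> real" where
  "mask_coeff m r k = (if k + int (m div 2) \<ge> 0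
     then sqrt (real (m choose r)) / 2 ^ r * coeff (mask_poly (m - r) r) (nat (k + int (m div 2))) else 0)"

lemma mask_coeff_sum:
  fixes g :: "int \<Rightarrow> 'a::real_vector"
  shows "finite {k. mask_coeff m r k \<noteq> 0}"
    "(\<Sum>k | mask_coeff m r k \<noteq> 0. mask_coeff m r k *\<^sub>R g k) =
     (sqrt (real (m choose r)) / 2 ^ r) *\<^sub>R (\<Sum>i\<le>degree (mask_poly (m - r) r). coeff (mask_poly (m - r) r) i *\<^sub>R g (int i - int (m div 2)))"
proof -
  let ?S = "(\<lambda>i. int i - int (m div 2)) ` {..degree (mask_poly (m - r) r)}"
  have sub: "{k. mask_coeff m r k \<noteq> 0} \<subseteq> ?S"
  proof
    fix k assume "k \<in> {k. mask_coeff m r k \<noteq> 0}"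
    then have "k + int (m div 2) \<ge> 0" "coeff (mask_poly (m - r) r) (nat (k + int (m div 2))) \<noteq> 0"
      by (auto simp: mask_coeff_def split: if_splits)
    then show "k \<in> ?S"
      by (intro image_eqI[of _ _ "nat (k + int (m div 2))"]) (auto intro: le_degree)
  qed
  then show "finite {k. mask_coeff m r k \<noteq> 0}" by (rule finite_subset) auto
  have "(\<Sum>k | mask_coeff m r k \<noteq> 0. mask_coeff m r k *\<^sub>R g k) = (\<Sum>k\<in>?S. mask_coeff m r k *\<^sub>R g k)"
    by (rule sum.mono_neutral_left) (use sub in auto)
  also have "\<dots> = (\<Sum>i\<le>degree (mask_poly (m - r) r). mask_coeff m r (int i - int (m div 2)) *\<^sub>R g (int i - int (m div 2)))"
    by (subst sum.reindex) (auto simp: inj_on_def)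
  finally show "(\<Sum>k | mask_coeff m r k \<noteq> 0. mask_coeff m r k *\<^sub>R g k) =
     (sqrt (real (m choose r)) / 2 ^ r) *\<^sub>R (\<Sum>i\<le>degree (mask_poly (m - r) r). coeff (mask_poly (m - r) r) i *\<^sub>R g (int i - int (m div 2)))"
    by (simp add: mask_coeff_def scaleR_right.sum)
qed

text \<open>Exponentials are eigenfunctions of translation, so a polynomial acts on them through its
  value at \<open>cis (- w)\<close>.\<close>

lemma shift_poly_cis: "shift_poly (mask_poly M r) (\<lambda>y. cis (w * y)) y = ((1 + cis (- w)) / 2) ^ M * (1 - cis (- w)) ^ r * cis (w * y)"
proof -
  have scale: "shift_poly p (\<lambda>y. c * g y) = (\<lambda>y. c * shift_poly p g y)" for p and c :: complex and g
    by (simp add: shift_poly_def fun_eq_iff sum_distrib_left)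
  have 1: "shift_poly [:1/2, 1/2:] (\<lambda>y. cis (w * y)) = (\<lambda>y. ((1 + cis (- w)) / 2) * cis (w * y))"
    by (simp add: shift_poly_pCons fun_eq_iff scaleR_conv_of_real field_simps cis_mult)
  have 2: "shift_poly [:1, -1:] (\<lambda>y. cis (w * y)) = (\<lambda>y. (1 - cis (- w)) * cis (w * y))"
    by (simp add: shift_poly_pCons fun_eq_iff scaleR_conv_of_real field_simps cis_mult)
  have 3: "shift_poly ([:1, -1:] ^ r) (\<lambda>y. cis (w * y)) = (\<lambda>y. (1 - cis (- w)) ^ r * cis (w * y))"
  proof (induction r)
    case (Suc r)
    then show ?case by (simp add: shift_poly_mult scale 2 del: mult_pCons_left mult_pCons_right) (simp add: mult_ac)
  qed simp
  have "shift_poly ([:1/2, 1/2:] ^ M) (\<lambda>y. cis (w * y)) = (\<lambda>y. ((1 + cis (- w)) / 2) ^ M * cis (w * y))"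
  proof (induction M)
    case (Suc M)
    then show ?case by (simp add: shift_poly_mult scale 1 del: mult_pCons_left mult_pCons_right) (simp add: mult_ac)
  qed simp
  then show ?thesis by (simp add: mask_poly_def shift_poly_mult 3 scale)
qed

lemma integral_cis_int:
  fixes n :: int
  shows "integral {-pi..pi} (\<lambda>x. cis (n * x)) = (if n = 0 then 2 * pi else 0)"
    "(\<lambda>x. cis (real_of_int n * x)) integrable_on {-pi..pi}"
proof -
  show "(\<lambda>x. cis (real_of_int n * x)) integrable_on {-pi..pi}"
    unfolding cis_conv_exp by (intro integrable_continuous_real continuous_intros)
  show "integral {-pi..pi} (\<lambda>x. cis (n * x)) = (if n = 0 then 2 * pi else 0)"
  proof (cases "n = 0")
    case False
    have "((\<lambda>x. cis (n * x)) has_integral ((1 / (\<i> * n)) * cis (n * pi) - (1 / (\<i> * n)) * cis (n * (- pi)))) {-pi..pi}"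
    proof (rule fundamental_theorem_of_calculus)
      fix x
      have "((\<lambda>z. (1 / (\<i> * n)) * exp (\<i> * (n * z))) has_field_derivative exp (\<i> * (n * complex_of_real x))) (at (complex_of_real x))"
        using False by (auto intro!: derivative_eq_intros) (simp add: algebra_simps)
      from has_vector_derivative_real_field[OF this]
      show "((\<lambda>x. (1 / (\<i> * n)) * cis (n * x)) has_vector_derivative cis (n * x)) (at x within {-pi..pi})" by (simp add: cis_conv_exp)
    qed simp
    moreover have "cis (n * pi) = cis (n * (- pi))"
      by (simp add: complex_eq_iff sin_int_times_real mult.commute)
    ultimately show ?thesis using False by (simp add: integral_unique)
  qed (simp add: scaleR_conv_of_real)
qed

text \<open>Integrating over a period against the exponential of frequency \<open>j\<close> isolates
  the coefficient \<open>q j\<close>.\<close>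

lemma trigonometric_polynomial_zero:
  fixes q :: "int \<Rightarrow> real"
  assumes "finite S" and zero: "\<And>w. (\<Sum>k\<in>S. complex_of_real (q k) * cis (- (real_of_int k * w))) = 0" and "j \<in> S"
  shows "q j = 0"
proof -
  have "0 = (\<Sum>k\<in>S. complex_of_real (q k) * cis (- (real_of_int k * w))) * cis (real_of_int j * w)" for w
    by (simp add: zero)
  also have "\<dots> w = (\<Sum>k\<in>S. complex_of_real (q k) * cis (real_of_int (j - k) * w))" for w
    unfolding sum_distrib_right by (intro sum.cong refl) (simp add: mult.assoc cis_mult left_diff_distrib)
  finally have "integral {-pi..pi} (\<lambda>w. \<Sum>k\<in>S. complex_of_real (q k) * cis (real_of_int (j - k) * w)) = integral {-pi..pi} (\<lambda>w. 0)"
    by metis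
  also have "integral {-pi..pi} (\<lambda>w. \<Sum>k\<in>S. complex_of_real (q k) * cis (real_of_int (j - k) * w)) =
     (\<Sum>k\<in>S. complex_of_real (q k) * integral {-pi..pi} (\<lambda>w. cis (real_of_int (j - k) * w)))"
    by (subst Henstock_Kurzweil_Integration.integral_sum[OF \<open>finite S\<close>])
       (intro integrable_on_mult_right integral_cis_int(2), simp only: Henstock_Kurzweil_Integration.integral_mult_right)
  also have "\<dots> = (\<Sum>k\<in>S. if k = j then complex_of_real (q j) * (2 * pi) else 0)"
    by (intro sum.cong refl) (simp only: integral_cis_int, auto)
  also have "\<dots> = complex_of_real (q j) * (2 * pi)" using assms by simp
  finally show ?thesis by simp
qed

text \<open>A definite description needs both halves: the symbol of \<open>mask_coeff\<close> has
  the prescribed form, and a finite filter is determined by its symbol.\<close>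

lemma bspline_filter_eq:
  assumes "r \<le> m" shows "bspline_filter m r = mask_coeff m r"
proof -
  define RHS where "RHS w = \<i> ^ r * complex_of_real (sqrt (real (m choose r)))
              * cis (- (real (parity m) * w / 2))
              * complex_of_real (cos (w / 2) ^ (m - r) * sin (w / 2) ^ r)" for w
  have F: "(\<Sum>k | mask_coeff m r k \<noteq> 0. complex_of_real (mask_coeff m r k) * cis (- (real_of_int k * w))) = RHS w" for w
  proof -
    have "(\<Sum>k | mask_coeff m r k \<noteq> 0. complex_of_real (mask_coeff m r k) * cis (- (real_of_int k * w))) =
       (\<Sum>k | mask_coeff m r k \<noteq> 0. mask_coeff m r k *\<^sub>R cis (- (real_of_int k * w)))"
      by (simp add: scaleR_conv_of_real)
    also have "\<dots> = (sqrt (real (m choose r)) / 2 ^ r) *\<^sub>R shift_poly (mask_poly (m - r) r) (\<lambda>y. cis (w * y)) (real (m div 2))"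
      unfolding mask_coeff_sum(2) shift_poly_def
      by (intro arg_cong2[of _ _ _ _ scaleR] refl sum.cong) (simp add: algebra_simps)
    also have "\<dots> = complex_of_real (sqrt (real (m choose r)) / 2 ^ r) *
       (((1 + cis (- w)) / 2) ^ (m - r) * (1 - cis (- w)) ^ r * cis (w * real (m div 2)))"
      by (simp add: shift_poly_cis scaleR_conv_of_real)
    also have "(1 + cis (- w)) / 2 = complex_of_real (cos (w / 2)) * cis (- (w / 2))"
    proof -
      have "complex_of_real (cos (w / 2)) = (cis (w / 2) + cis (- (w / 2))) / 2" by (simp add: complex_eq_iff)
      then show ?thesis by (simp only:) (simp add: distrib_right cis_mult add_divide_distrib)
    qed
    also have "1 - cis (- w) = 2 * \<i> * complex_of_real (sin (w / 2)) * cis (- (w / 2))"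
    proof -
      have "2 * \<i> * complex_of_real (sin (w / 2)) = cis (w / 2) - cis (- (w / 2))" by (simp add: complex_eq_iff)
      then show ?thesis by (simp only:) (simp add: left_diff_distrib cis_mult)
    qed
    also have "complex_of_real (sqrt (real (m choose r)) / 2 ^ r) *
       ((complex_of_real (cos (w / 2)) * cis (- (w / 2))) ^ (m - r) * (2 * \<i> * complex_of_real (sin (w / 2)) * cis (- (w / 2))) ^ r * cis (w * real (m div 2)))
      = \<i> ^ r * complex_of_real (sqrt (real (m choose r))) * ((cis (- (w / 2)) ^ (m - r) * cis (- (w / 2)) ^ r) * cis (w * real (m div 2)))
        * complex_of_real (cos (w / 2) ^ (m - r) * sin (w / 2) ^ r)"
      by (simp add: power_mult_distrib field_simps)
    \<comment> \<open>Each of the \<open>m\<close> linear factors carries half a step of phase;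
      shifting back by \<open>m div 2\<close> whole steps leaves the parity phase.\<close>
    also have "(cis (- (w / 2)) ^ (m - r) * cis (- (w / 2)) ^ r) * cis (w * real (m div 2)) = cis (- (real (parity m) * w / 2))"
    proof -
      have "cis (- (w / 2)) ^ (m - r) * cis (- (w / 2)) ^ r = cis (real m * (- (w / 2)))"
        by (simp only: power_add[symmetric] le_add_diff_inverse2[OF assms]) (rule Complex.DeMoivre)
      then have "(cis (- (w / 2)) ^ (m - r) * cis (- (w / 2)) ^ r) * cis (w * real (m div 2)) = cis (real m * (- (w / 2)) + w * real (m div 2))"
        by (simp only: cis_mult)
      moreover have "m = 2 * (m div 2) + m mod 2" by simp
      then have "real m = 2 * real (m div 2) + real (parity m)" unfolding parity_def by (metis of_nat_add of_nat_mult of_nat_numeral)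
      then have "real m * (- (w / 2)) + w * real (m div 2) = - (real (parity m) * w / 2)" by (simp add: algebra_simps)
      ultimately show ?thesis by simp
    qed
    finally show ?thesis by (simp only: RHS_def)
  qed
  show ?thesis
    unfolding bspline_filter_def
  proof (rule the_equality)
    show "finite {k. mask_coeff m r k \<noteq> 0} \<and> (\<forall>w. (\<Sum>k | mask_coeff m r k \<noteq> 0. complex_of_real (mask_coeff m r k) * cis (- (real_of_int k * w)))
            = \<i> ^ r * complex_of_real (sqrt (real (m choose r)))
              * cis (- (real (parity m) * w / 2))
              * complex_of_real (cos (w / 2) ^ (m - r) * sin (w / 2) ^ r))"
      using F mask_coeff_sum(1) by (simp only: RHS_def) blast
    fix q assume q: "finite {k. q k \<noteq> 0} \<and> (\<forall>w. (\<Sum>k | q k \<noteq> 0. complex_of_real (q k) * cis (- (real_of_int k * w)))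
            = \<i> ^ r * complex_of_real (sqrt (real (m choose r)))
              * cis (- (real (parity m) * w / 2))
              * complex_of_real (cos (w / 2) ^ (m - r) * sin (w / 2) ^ r))"
    define S where "S = {k. q k \<noteq> 0} \<union> {k. mask_coeff m r k \<noteq> 0}"
    have S: "finite S" using q mask_coeff_sum(1)[of m r] by (simp add: S_def)
    have "(\<Sum>k\<in>S. complex_of_real (q k - mask_coeff m r k) * cis (- (real_of_int k * w))) = 0" for w
    proof -
      have "(\<Sum>k\<in>S. complex_of_real (q k) * cis (- (real_of_int k * w))) = RHS w"
        unfolding RHS_def q[THEN conjunct2, rule_format, symmetric]
        by (rule sum.mono_neutral_right[OF S]) (auto simp: S_def)
      moreover have "(\<Sum>k\<in>S. complex_of_real (mask_coeff m r k) * cis (- (real_of_int k * w))) = RHS w"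
        unfolding F[symmetric] by (rule sum.mono_neutral_right[OF S]) (auto simp: S_def)
      ultimately show ?thesis by (simp add: left_diff_distrib sum_subtractf)
    qed
    from trigonometric_polynomial_zero[OF S this] have "q k - mask_coeff m r k = 0" if "k \<in> S" for k using that by blast
    then show "q = mask_coeff m r" by (force simp: S_def fun_eq_iff)
  qed
qed

lemma bspline_filter_shift_sum:
  assumes "r \<le> m"
  shows "(\<Sum>k | bspline_filter m r k \<noteq> 0. bspline_filter m r k * g (y - real_of_int k)) =
    sqrt (real (m choose r)) / 2 ^ r * shift_poly (mask_poly (m - r) r) g (y + real (m div 2))"
  using mask_coeff_sum(2)[of m r "\<lambda>k. g (y - real_of_int k)"]
  by (simp add: bspline_filter_eq[OF assms] shift_poly_def algebra_simps)

text \<open>The constant and the leading coefficient of the mask are nonzero, so the filter reaches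
  both ends of its index range. This is what allows conditions on all filter indices to be tested at
  the extreme ones.\<close>

lemma bspline_filter_corners:
  assumes "r \<le> m"
  shows "bspline_filter m r (- int (m div 2)) \<noteq> 0" "bspline_filter m r (int m - int (m div 2)) \<noteq> 0"
    "bspline_filter m r k \<noteq> 0 \<Longrightarrow> k \<in> {- int (m div 2)..int m - int (m div 2)}"
proof -
  have b: "sqrt (real (m choose r)) / 2 ^ r \<noteq> 0" using assms by simp
  show "bspline_filter m r (- int (m div 2)) \<noteq> 0"
    using b coeff_mask_poly_nonzero(1)[of "m - r" r] by (simp add: bspline_filter_eq[OF assms] mask_coeff_def)
  show "bspline_filter m r (int m - int (m div 2)) \<noteq> 0"
    using b coeff_mask_poly_nonzero(2)[of "m - r" r] assms by (simp add: bspline_filter_eq[OF assms] mask_coeff_def)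
  assume k: "bspline_filter m r k \<noteq> 0"
  then have "k + int (m div 2) \<ge> 0" "coeff (mask_poly (m - r) r) (nat (k + int (m div 2))) \<noteq> 0"
    by (auto simp: bspline_filter_eq[OF assms] mask_coeff_def split: if_splits)
  then have "nat (k + int (m div 2)) \<le> m" using le_degree[of "mask_poly (m - r) r"] assms by (simp add: degree_mask_poly)
  with \<open>k + int (m div 2) \<ge> 0\<close> show "k \<in> {- int (m div 2)..int m - int (m div 2)}" by auto
qed

lemma filter_support_tensor:
  "filter_support (tensor_filter m r) = {k. bspline_filter m (fst r) k \<noteq> 0} \<times> {k. bspline_filter m (snd r) k \<noteq> 0}"
  by (auto simp: filter_support_def tensor_filter_def)

lemma tensor_filter_sum:
  "(\<Sum>k\<in>filter_support (tensor_filter m r). tensor_filter m r k * (F (fst k) * G (snd k))) =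
   (\<Sum>k | bspline_filter m (fst r) k \<noteq> 0. bspline_filter m (fst r) k * F k) *
   (\<Sum>k | bspline_filter m (snd r) k \<noteq> 0. bspline_filter m (snd r) k * G k)"
  unfolding filter_support_tensor sum_product sum.cartesian_product
  by (intro sum.cong refl) (auto simp: tensor_filter_def)

lemma finite_filter_support:
  assumes "fst r \<le> m" "snd r \<le> m" shows "finite (filter_support (tensor_filter m r))"
  unfolding filter_support_tensor bspline_filter_eq[OF assms(1)] bspline_filter_eq[OF assms(2)]
  by (intro finite_cartesian_product mask_coeff_sum)

text \<open>A factor (1 + X) / 2 averages a function with its unit translate. Each one keeps mass
  one, nonnegativity and the bound one, and lengthens the support by one.\<close>

definition mask_spline :: "nat \<Rightarrow> nat \<Rightarrow> real \<Rightarrow> real" where "mask_spline N M = shift_poly (mask_poly M 0) (box_spline N)"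

lemma mask_spline_0: "mask_spline N 0 = box_spline N"
  by (simp add: mask_spline_def mask_poly_def)

lemma mask_spline_Suc: "mask_spline N (Suc M) y = (mask_spline N M y + mask_spline N M (y - 1)) / 2"
proof -
  have "mask_poly (Suc M) 0 = [:1/2, 1/2:] * mask_poly M 0" by (simp add: mask_poly_def)
  then show ?thesis by (simp add: mask_spline_def shift_poly_mult shift_poly_pCons del: mult_pCons_left)
qed

lemma mask_spline_continuous: "N \<ge> 1 \<Longrightarrow> continuous_on UNIV (mask_spline N M)"
  unfolding mask_spline_def by (cases N) (auto intro!: shift_poly_continuous box_spline_continuous)

lemma mask_spline_bounds: "0 \<le> mask_spline N M y" "mask_spline N M y \<le> 1"
proof -
  have "0 \<le> mask_spline N M y \<and> mask_spline N M y \<le> 1" for y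
  proof (induction M arbitrary: y)
    case (Suc M)
    from Suc[of y] Suc[of "y - 1"] show ?case by (simp add: mask_spline_Suc)
  qed (simp add: mask_spline_0 box_spline_nonneg box_spline_le_1)
  then show "0 \<le> mask_spline N M y" "mask_spline N M y \<le> 1" by auto
qed

lemma mask_spline_zero: "y \<notin> {0..real (N + M + 1)} \<Longrightarrow> mask_spline N M y = 0"
proof (induction M arbitrary: y)
  case (Suc M)
  from Suc.IH[of y] Suc.IH[of "y - 1"] Suc.prems show ?case by (auto simp: mask_spline_Suc)
qed (auto simp: mask_spline_0 intro!: box_spline_zero)

lemma mask_spline_pos: "N \<ge> 1 \<Longrightarrow> y \<in> {0<..<real (N + M + 1)} \<Longrightarrow> 0 < mask_spline N M y"
proof (induction M arbitrary: y)
  case (Suc M)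
  show ?case
  proof (cases "y < real (N + M + 1)")
    case True
    then have "0 < mask_spline N M y" using Suc by auto
    then show ?thesis using mask_spline_bounds(1)[of N M "y - 1"] by (simp add: mask_spline_Suc)
  next
    case False
    then have "0 < mask_spline N M (y - 1)" using Suc.prems by (intro Suc.IH) auto
    then show ?thesis using mask_spline_bounds(1)[of N M y] by (simp add: mask_spline_Suc)
  qed
qed (auto simp: mask_spline_0 intro!: box_spline_pos)

lemma mask_spline_integral: "integrable lborel (mask_spline N M)" "(LINT y|lborel. mask_spline N M y) = 1"
proof -
  have "integrable lborel (mask_spline N M) \<and> (LINT y|lborel. mask_spline N M y) = 1"
  proof (induction M)
    case (Suc M)
    have i: "integrable lborel (\<lambda>y. mask_spline N M (-1 + 1 * y))" by (rule lborel_integrable_real_affine) (use Suc in auto)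
    have "(LINT y|lborel. mask_spline N M (-1 + 1 * y)) = 1"
      using lborel_integral_real_affine[of 1 "mask_spline N M" "-1"] Suc by simp
    with Suc i show ?case by (simp add: mask_spline_Suc[abs_def] add.commute)
  qed (simp add: mask_spline_0 box_spline_integrable box_spline_integral)
  then show "integrable lborel (mask_spline N M)" "(LINT y|lborel. mask_spline N M y) = 1" by auto
qed

text \<open>
  The \<open>i\<close>-th derivative: each differentiation trades one convolution with the box for one difference.
\<close>

definition spline_chain :: "real \<Rightarrow> real \<Rightarrow> real \<Rightarrow> nat \<Rightarrow> nat \<Rightarrow> nat \<Rightarrow> nat \<Rightarrow> real \<Rightarrow> real" where
  "spline_chain A s t M N r i x = A * s ^ i * shift_poly (mask_poly M i) (box_spline (N + r - i)) (s * x + t)"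

lemma spline_chain_0: "spline_chain A s t M N r 0 x = A * mask_spline (N + r) M (s * x + t)"
  by (simp add: spline_chain_def mask_spline_def)

lemma spline_chain_last: "spline_chain A s t M N r r x = A * s ^ r * shift_poly (mask_poly M r) (box_spline N) (s * x + t)"
  by (simp add: spline_chain_def)

text \<open>After \<open>r\<close> differentiations the spline \<open>box_spline N\<close> is left,
  which is continuous because \<open>N \<ge> 1\<close>. The powers of \<open>s\<close> are the inner
  derivatives.\<close>

lemma Cchain_spline_chain:
  assumes "N \<ge> 1" shows "Cchain r (spline_chain A s t M N r)"
  unfolding Cchain_def
proof safe
  fix i x assume i: "i < r"
  define n where "n = N + r - i - 2"
  have n: "N + r - i = Suc (Suc n)" "N + r - Suc i = Suc n" using assms i by (auto simp: n_def)
  have "(shift_poly (mask_poly M i) (box_spline (Suc (Suc n))) has_real_derivative shift_poly (mask_poly M i) (shift_poly [:1, -1:] (box_spline (Suc n))) y) (at y)" for y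
    by (rule shift_poly_deriv) (rule box_spline_deriv)
  then have D: "(shift_poly (mask_poly M i) (box_spline (Suc (Suc n))) has_real_derivative shift_poly (mask_poly M (Suc i)) (box_spline (Suc n)) y) (at y)" for y
    by (simp only: mask_poly_Suc shift_poly_mult)
  show "(spline_chain A s t M N r i has_real_derivative spline_chain A s t M N r (Suc i) x) (at x)"
    unfolding spline_chain_def[abs_def] n
    by (auto intro!: derivative_eq_intros DERIV_chain2[OF D])
next
  obtain n where n: "N = Suc n" using assms by (cases N) auto
  have eq: "spline_chain A s t M N r r = (\<lambda>x. A * s ^ r * shift_poly (mask_poly M r) (box_spline N) (s * x + t))"
    by (rule ext) (rule spline_chain_last)
  show "continuous_on UNIV (spline_chain A s t M N r r)"
    unfolding eq unfolding n
    by (intro continuous_intros continuous_on_compose2[OF shift_poly_continuous[OF box_spline_continuous]]) auto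
qed

lemma spline_chain_zero:
  assumes "i \<le> r" "s * x + t \<notin> {0..real (M + N + r + 1)}" shows "spline_chain A s t M N r i x = 0"
proof -
  have "box_spline (N + r - i) (s * x + t - real k) = 0" if "k \<le> M + i" for k
    by (rule box_spline_zero) (use assms that in \<open>auto simp: of_nat_diff\<close>)
  then show ?thesis by (simp add: spline_chain_def shift_poly_def degree_mask_poly)
qed

section \<open>Sampling functions and transforms\<close>

text \<open>By completeness, preimages may be altered arbitrarily inside the exceptional null
  set.\<close>

lemma lebesgue_measurable_AE_cong:
  fixes f g :: "plane \<Rightarrow> real"
  assumes f: "f \<in> borel_measurable lebesgue" and AE: "AE x in lebesgue. g x = f x"
  shows "g \<in> borel_measurable lebesgue"
proof -
  define N where "N = {x. g x \<noteq> f x}"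
  obtain Z where Z: "N \<subseteq> Z" "Z \<in> null_sets lebesgue"
    using AE by (auto simp: eventually_ae_filter N_def)
  then have N: "S \<in> sets lebesgue" if "S \<subseteq> N" for S
    using that by (meson negligible_iff_null_sets negligible_imp_sets negligible_subset order_trans)
  show ?thesis
  proof (rule borel_measurableI)
    fix S :: "real set" assume "open S"
    then have fS: "f -` S \<inter> space lebesgue \<in> sets lebesgue" using f by (intro measurable_sets) auto
    have "g -` S \<inter> space lebesgue = (f -` S \<inter> space lebesgue - N) \<union> (g -` S \<inter> N)"
      by (auto simp: N_def)
    also have "\<dots> \<in> sets lebesgue" using fS N[of N] N[of "g -` S \<inter> N"] by auto
    finally show "g -` S \<inter> space lebesgue \<in> sets lebesgue" .
  qed
qed

lemma AE_plane_affine: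
  fixes P :: "plane \<Rightarrow> bool"
  assumes P: "AE x in lebesgue. P x" and c: "c \<noteq> 0"
  shows "AE x in lebesgue. P (c *\<^sub>R x + t)"
proof -
  obtain N where N: "{x. \<not> P x} \<subseteq> N" "N \<in> null_sets lborel"
    using P[unfolded AE_completion_iff] by (auto simp: eventually_ae_filter)
  have [measurable]: "N \<in> sets borel" using N by auto
  have "AE x in lborel. x \<notin> N" using N(2) by (rule AE_not_in)
  then have "AE x in lborel. c *\<^sub>R x + t \<notin> N"
    using c by (subst lborel_affine[of "1 / c" "- (1 / c) *\<^sub>R t"])
      (auto simp: AE_density AE_distr_iff scaleR_diff_right scaleR_add_right)
  then have "AE x in lborel. P (c *\<^sub>R x + t)" by eventually_elim (use N(1) in auto)
  then show ?thesis by (rule AE_completion)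
qed

lemma AE_plane_coordinates:
  fixes P :: "real \<Rightarrow> bool"
  assumes "AE x in lborel. P x"
  shows "AE z in (lebesgue :: plane measure). P (fst z)" "AE z in (lebesgue :: plane measure). P (snd z)"
proof -
  obtain N where N: "{x. \<not> P x} \<subseteq> N" "N \<in> null_sets lborel"
    using assms by (auto simp: eventually_ae_filter)
  have [measurable]: "N \<in> sets borel" using N by auto
  have A: "AE x in lborel. x \<notin> N" using N(2) by (rule AE_not_in)
  have "AE z in lborel \<Otimes>\<^sub>M lborel. fst z \<notin> N"
  proof (rule lborel_pair.AE_pair_measure)
    show "{z \<in> space (lborel \<Otimes>\<^sub>M lborel). fst z \<notin> N} \<in> sets (lborel \<Otimes>\<^sub>M lborel)" by measurable
  qed (use A in auto)
  then have "AE z in lborel. P (fst z)" unfolding lborel_prod by eventually_elim (use N(1) in auto)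
  then show "AE z in (lebesgue :: plane measure). P (fst z)" by (rule AE_completion)
  have "AE z in lborel \<Otimes>\<^sub>M lborel. snd z \<notin> N"
  proof (rule lborel_pair.AE_pair_measure)
    show "{z \<in> space (lborel \<Otimes>\<^sub>M lborel). snd z \<notin> N} \<in> sets (lborel \<Otimes>\<^sub>M lborel)" by measurable
  qed (use A in auto)
  then have "AE z in lborel. P (snd z)" unfolding lborel_prod by eventually_elim (use N(1) in auto)
  then show "AE z in (lebesgue :: plane measure). P (snd z)" by (rule AE_completion)
qed

lemma scaling_fn_AE:
  assumes "m \<ge> 1"
  shows "AE z in lebesgue. scaling_fn m z =
    tensor (\<lambda>x. box_spline (m - 1) (x + real (m div 2))) (\<lambda>x. box_spline (m - 1) (x + real (m div 2))) z"
  using AE_plane_coordinates[OF bspline_AE_eq(2)[OF assms]]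
  by eventually_elim (auto simp: scaling_fn_def tensor_def split: prod.split)

text \<open>A continuous function that vanishes almost everywhere on an open set vanishes everywhere
  on it. With a continuous representative, inclusion of the essential support in a closed set can
  therefore be tested pointwise.\<close>

lemma ess_support_subset_iff:
  assumes G: "continuous_on UNIV G" and AE: "AE z in lebesgue. F z = G z" and S: "closed S"
  shows "ess_support F \<subseteq> S \<longleftrightarrow> (\<forall>z. G z \<noteq> 0 \<longrightarrow> z \<in> S)"
proof safe
  fix a b :: real assume sub: "ess_support F \<subseteq> S" and nz: "G (a, b) \<noteq> 0"
  show "(a, b) \<in> S"
  proof (rule ccontr)
    assume "(a, b) \<notin> S"
    then obtain V where V: "open V" "AE x in lebesgue. x \<in> V \<longrightarrow> F x = 0" "(a, b) \<in> V"
      using sub by (auto simp: ess_support_def)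
    have "AE x in lebesgue. x \<in> V \<longrightarrow> x \<in> {z. G z = 0}"
      using V(2) AE by eventually_elim auto
    moreover have "closed {z. G z = 0}"
      using G by (intro closed_Collect_eq continuous_on_const) 
    ultimately have "V \<subseteq> {z. G z = 0}"
      using mem_closed_if_AE_lebesgue_open[of V "{z. G z = 0}"] V(1) by blast
    with V(3) nz show False by auto
  qed
next
  fix a b :: real assume *: "\<forall>z. G z \<noteq> 0 \<longrightarrow> z \<in> S" and "(a, b) \<in> ess_support F"
  moreover have "AE x in lebesgue. x \<in> - S \<longrightarrow> F x = 0" using AE by eventually_elim (use * in \<open>metis ComplD\<close>)
  moreover have "open (- S)" using S by auto
  ultimately have "(a, b) \<notin> - S" unfolding ess_support_def by blast
  then show "(a, b) \<in> S" by simp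
qed

lemma closure_Omega: "closure Omega = {0..1} \<times> {0..1}"
  by (simp add: Omega_def closure_Times)

text \<open>Since the splines are positive on their open support intervals, the inclusion says
  exactly that both endpoints lie in [0, 1] on each axis. A violated inequality is refuted by a
  point of positivity close to the offending endpoint.\<close>

lemma mask_spline_affine_support:
  assumes "N1 \<ge> 1" "N2 \<ge> 1" "s > 0"
  shows "(\<forall>z. tensor (\<lambda>x. mask_spline N1 M1 (s * x + t1)) (\<lambda>y. mask_spline N2 M2 (s * y + t2)) z \<noteq> 0 \<longrightarrow> z \<in> closure Omega) \<longleftrightarrow>
    t1 \<le> 0 \<and> real (N1 + M1 + 1) - t1 \<le> s \<and> t2 \<le> 0 \<and> real (N2 + M2 + 1) - t2 \<le> s" (is "?L \<longleftrightarrow> ?R")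
proof
  assume L: ?L
  have nz: "u \<in> {0<..<real (N1 + M1 + 1)} \<Longrightarrow> w \<in> {0<..<real (N2 + M2 + 1)} \<Longrightarrow>
      0 \<le> u - t1 \<and> u - t1 \<le> s \<and> 0 \<le> w - t2 \<and> w - t2 \<le> s" for u w
  proof -
    assume u: "u \<in> {0<..<real (N1 + M1 + 1)}" and w: "w \<in> {0<..<real (N2 + M2 + 1)}"
    have "tensor (\<lambda>x. mask_spline N1 M1 (s * x + t1)) (\<lambda>y. mask_spline N2 M2 (s * y + t2)) ((u - t1) / s, (w - t2) / s) \<noteq> 0"
      using mask_spline_pos[OF assms(1) u] mask_spline_pos[OF assms(2) w] assms(3) by (simp add: tensor_def)
    then have "((u - t1) / s, (w - t2) / s) \<in> closure Omega" using L by blast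
    then show ?thesis using assms(3) by (simp add: closure_Omega field_simps)
  qed
  define L1 L2 where "L1 = real (N1 + M1 + 1)" and "L2 = real (N2 + M2 + 1)"
  have L12: "L1 > 0" "L2 > 0" by (auto simp: L1_def L2_def)
  note nz = nz[folded L1_def L2_def]
  have "\<not> t1 > 0"
  proof
    assume *: "t1 > 0"
    \<comment> \<open>A point of the open support interval that the change of variables sends left
      of 0; the three other cases choose their points in the same way.\<close>
    define u where "u = min t1 L1 / 2"
    have "u \<in> {0<..<L1}" "u < t1" using * L12 by (auto simp: u_def min_def)
    then show False using nz[of u "L2 / 2"] L12 by auto
  qed
  moreover have "\<not> t2 > 0"
  proof
    assume *: "t2 > 0"
    define u where "u = min t2 L2 / 2"
    have "u \<in> {0<..<L2}" "u < t2" using * L12 by (auto simp: u_def min_def)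
    then show False using nz[of "L1 / 2" u] L12 by auto
  qed
  moreover have "\<not> L1 - t1 > s"
  proof
    assume *: "L1 - t1 > s"
    define u where "u = max (L1 / 2) ((L1 + (s + t1)) / 2)"
    have "u \<in> {0<..<L1}" "u - t1 > s" using * L12 by (auto simp: u_def max_def field_simps)
    then show False using nz[of u "L2 / 2"] L12 by auto
  qed
  moreover have "\<not> L2 - t2 > s"
  proof
    assume *: "L2 - t2 > s"
    define u where "u = max (L2 / 2) ((L2 + (s + t2)) / 2)"
    have "u \<in> {0<..<L2}" "u - t2 > s" using * L12 by (auto simp: u_def max_def field_simps)
    then show False using nz[of "L1 / 2" u] L12 by auto
  qed
  ultimately show ?R by (auto simp: L1_def L2_def)
next
  assume R: ?R
  show ?L
  proof safe
    fix x y assume "tensor (\<lambda>x. mask_spline N1 M1 (s * x + t1)) (\<lambda>y. mask_spline N2 M2 (s * y + t2)) (x, y) \<noteq> 0"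
    then have "mask_spline N1 M1 (s * x + t1) \<noteq> 0" "mask_spline N2 M2 (s * y + t2) \<noteq> 0" by (auto simp: tensor_def)
    then have "s * x + t1 \<in> {0..real (N1 + M1 + 1)}" "s * y + t2 \<in> {0..real (N2 + M2 + 1)}"
      using mask_spline_zero by blast+
    then have "0 \<le> s * x" "s * x \<le> s * 1" "0 \<le> s * y" "s * y \<le> s * 1"
      using R unfolding atLeastAtMost_iff mult_1_right by linarith+
    then have "x \<le> 1" "y \<le> 1" "0 \<le> x" "0 \<le> y"
      using assms(3) mult_left_le_imp_le[of s x 1] mult_left_le_imp_le[of s y 1] by (auto simp: zero_le_mult_iff)
    then show "(x, y) \<in> closure Omega" by (simp add: closure_Omega)
  qed
qed

lemma LINT_tensor:
  assumes "continuous_on UNIV f" "continuous_on UNIV g"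
    and "\<And>x. x \<notin> {-R..R} \<Longrightarrow> f x = 0" "\<And>x. x \<notin> {-R..R} \<Longrightarrow> g x = 0"
  shows "integrable lebesgue (tensor f g)" "(LINT z|lebesgue. tensor f g z) = (LINT x|lborel. f x) * (LINT y|lborel. g y)"
proof -
  have i: "integrable lborel (tensor f g)" using tensor_mult_integrable[OF assms(1,2) continuous_on_const[of _ 1] assms(3,4)] by simp
  then show "integrable lebesgue (tensor f g)" by (simp add: integrable_completion)
  have "(LINT z|lebesgue. tensor f g z) = (LINT z|lborel. tensor f g z)"
    using i by (intro integral_completion) auto
  also have "\<dots> = (LINT x|lborel. LINT y|lborel. tensor f g (x, y))"
    using i lborel_pair.integral_fst[of "\<lambda>x y. tensor f g (x, y)"] by (simp add: lborel_prod)
  also have "\<dots> = (LINT x|lborel. f x) * (LINT y|lborel. g y)" by (simp add: tensor_def)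
  finally show "(LINT z|lebesgue. tensor f g z) = (LINT x|lborel. f x) * (LINT y|lborel. g y)" .
qed

lemma is_weak_deriv_AE_cong:
  assumes wd: "is_weak_deriv UNIV a f g" and AE: "AE z in lebesgue. g' z = g z" and g: "g \<in> borel_measurable lebesgue"
  shows "is_weak_deriv UNIV a f g'"
proof -
  have g': "g' \<in> borel_measurable lebesgue" using g AE by (rule lebesgue_measurable_AE_cong)
  have "locally_integrable UNIV g'"
    unfolding locally_integrable_def
  proof safe
    fix K :: "plane set" assume K: "compact K"
    then have Ks: "K \<in> sets lebesgue" by (simp add: lmeasurable_compact fmeasurableD)
    have "AE x in lebesgue_on K. g x = g' x" using AE Ks by (subst AE_restrict_space_iff) auto
    moreover have "integrable (lebesgue_on K) g" using wd K by (auto simp: is_weak_deriv_def locally_integrable_def)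
    ultimately show "integrable (lebesgue_on K) g'"
      using g g' by (subst Bochner_Integration.integrable_cong_AE[of g' _ g]) (auto intro: measurable_restrict_space1)
  qed
  moreover have "(LINT x|lebesgue_on UNIV. g' x * h x) = (LINT x|lebesgue_on UNIV. g x * h x)" if "h \<in> test_functions UNIV" for h
    unfolding lebesgue_on_UNIV_eq
  proof (rule integral_cong_AE)
    note [measurable] = g g' continuous_imp_lebesgue_measurable[OF test_function_continuous[OF that]]
    show "(\<lambda>x. g' x * h x) \<in> borel_measurable lebesgue" "(\<lambda>x. g x * h x) \<in> borel_measurable lebesgue" by measurable
  qed (use AE in auto)
  ultimately show ?thesis using wd by (auto simp: is_weak_deriv_def)
qed

text \<open>The heads of the two chains form a legitimate value of the choice, so a chosen function
  exists, and uniqueness of compactly supported primitives identifies it with this tensor whatever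
  was chosen.\<close>

lemma compact_primitive_tensor:
  assumes F: "Cchain (fst a) F" "\<And>i x. i \<le> fst a \<Longrightarrow> x \<notin> {-R..R} \<Longrightarrow> F i x = 0"
    and G: "Cchain (snd a) G" "\<And>i x. i \<le> snd a \<Longrightarrow> x \<notin> {-R..R} \<Longrightarrow> G i x = 0"
    and g: "AE z in lebesgue. g z = tensor (F (fst a)) (G (snd a)) z"
  shows "AE z in lebesgue. compact_primitive a g z = tensor (F 0) (G 0) z"
    "(LINT z|lebesgue. compact_primitive a g z) = (LINT x|lborel. F 0 x) * (LINT y|lborel. G 0 y)"
proof -
  have cF: "continuous_on UNIV (F i)" if "i \<le> fst a" for i using Cchain_continuous[OF F(1) that] .
  have cG: "continuous_on UNIV (G i)" if "i \<le> snd a" for i using Cchain_continuous[OF G(1) that] .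
  let ?P = "\<lambda>f. integrable lebesgue f \<and> compact (ess_support f) \<and> is_weak_deriv UNIV a f g"
  let ?t = "tensor (F 0) (G 0)"
  have ti: "integrable lebesgue ?t" and tI: "(LINT z|lebesgue. ?t z) = (LINT x|lborel. F 0 x) * (LINT y|lborel. G 0 y)"
    by (rule LINT_tensor[where R = R]; use cF cG F(2) G(2) in auto)+
  have tz: "?t z = 0" if "z \<notin> {-R..R} \<times> {-R..R}" for z
    using that F(2)[of 0 "fst z"] G(2)[of 0 "snd z"] by (auto simp: tensor_def mem_Times_iff)
  have "ess_support ?t \<subseteq> {-R..R} \<times> {-R..R}"
  proof (subst ess_support_subset_iff)
    show "continuous_on UNIV ?t" by (intro continuous_on_tensor cF cG) auto
    show "closed ({-R..R} \<times> {-R..R})" by (intro closed_Times) auto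
    show "\<forall>z. ?t z \<noteq> 0 \<longrightarrow> z \<in> {-R..R} \<times> {-R..R}" using tz by blast
  qed simp
  moreover have "closed (ess_support ?t)" unfolding ess_support_def by (intro closed_Compl open_Union) auto
  moreover have "bounded ({-R..R} \<times> {-R..R})" by (intro bounded_Times) auto
  ultimately have "compact (ess_support ?t)" by (meson bounded_subset compact_eq_bounded_closed)
  moreover have wt: "is_weak_deriv UNIV a ?t g"
  proof (rule is_weak_deriv_AE_cong[OF _ g])
    show "is_weak_deriv UNIV a ?t (tensor (F (fst a)) (G (snd a)))"
      by (rule tensor_is_weak_deriv[where R = R]) (use F G in auto)
    show "tensor (F (fst a)) (G (snd a)) \<in> borel_measurable lebesgue"
      by (intro continuous_imp_lebesgue_measurable continuous_on_tensor cF cG order_refl)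
  qed
  ultimately have "?P ?t" using ti by blast
  then have P: "?P (compact_primitive a g)" unfolding compact_primitive_def by (rule someI[where P = ?P])
  let ?h = "compact_primitive a g"
  have "AE z in lebesgue. ?h z - ?t z = 0"
  proof (rule compact_primitive_unique)
    show "integrable lebesgue (\<lambda>z. ?h z - ?t z)" using P ti by auto
    show "bounded (ess_support ?h \<union> {-R..R} \<times> {-R..R})"
      using P \<open>bounded ({-R..R} \<times> {-R..R})\<close> by (auto simp: compact_imp_bounded)
    show "AE z in lebesgue. z \<notin> ess_support ?h \<union> {-R..R} \<times> {-R..R} \<longrightarrow> ?h z - ?t z = 0"
      using AE_zero_outside_ess_support[of ?h] by eventually_elim (use tz in auto)
    show "(LINT z|lebesgue. (?h z - ?t z) * mixed_partial a \<phi> z) = 0" if "\<phi> \<in> test_functions UNIV" for \<phi>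
    proof -
      have "is_weak_deriv UNIV a (\<lambda>z. ?h z - ?t z) (\<lambda>z. g z - g z)"
        by (rule is_weak_deriv_diff[OF _ wt]) (use P in auto)
      then show ?thesis using that by (auto simp: is_weak_deriv_def lebesgue_on_UNIV_eq)
    qed
  qed
  then show AE: "AE z in lebesgue. ?h z = ?t z" by eventually_elim simp
  show "(LINT z|lebesgue. ?h z) = (LINT x|lborel. F 0 x) * (LINT y|lborel. G 0 y)"
    unfolding tI[symmetric] by (rule integral_cong_AE) (use P ti AE in auto)
qed

lemma spline_chain_bounded_support:
  assumes "s > 0" "i \<le> r" "x \<notin> {-R..R}" "R \<ge> (real (M + N + r + 1) + \<bar>t\<bar>) / s"
  shows "spline_chain A s t M N r i x = 0"
proof (rule spline_chain_zero[OF assms(2)])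
  have "real (M + N + r + 1) + \<bar>t\<bar> \<le> s * R" using assms by (simp add: field_simps)
  moreover have "\<bar>x\<bar> > R" using assms(3) by auto
  then have "s * R < s * \<bar>x\<bar>" using assms(1) by (rule mult_strict_left_mono)
  moreover have "\<bar>s * x\<bar> = s * \<bar>x\<bar>" using assms(1) by (simp add: abs_mult)
  ultimately have "real (M + N + r + 1) + \<bar>t\<bar> < \<bar>s * x\<bar>" by linarith
  then show "s * x + t \<notin> {0..real (M + N + r + 1)}" by auto
qed

lemma spline_chain_0_integral: "s > 0 \<Longrightarrow> (LINT x|lborel. spline_chain A s t M N r 0 x) = A / s"
  using lborel_integral_real_affine[of s "mask_spline (N + r) M" t] mask_spline_integral(2)[of "N + r" M]
  by (simp add: spline_chain_0 add.commute field_simps)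

lemma compact_primitive_spline_chain:
  assumes s: "s > 0" "N1 \<ge> 1" "N2 \<ge> 1"
    and g: "AE z in lebesgue. g z = tensor (spline_chain A1 s t M1 N1 (fst a) (fst a)) (spline_chain A2 s t M2 N2 (snd a) (snd a)) z"
  shows "AE z in lebesgue. compact_primitive a g z = tensor (spline_chain A1 s t M1 N1 (fst a) 0) (spline_chain A2 s t M2 N2 (snd a) 0) z"
    "(LINT z|lebesgue. compact_primitive a g z) = (A1 / s) * (A2 / s)"
proof -
  define R where "R = max ((real (M1 + N1 + fst a + 1) + \<bar>t\<bar>) / s) ((real (M2 + N2 + snd a + 1) + \<bar>t\<bar>) / s)"
  have z1: "i \<le> fst a \<Longrightarrow> x \<notin> {-R..R} \<Longrightarrow> spline_chain A1 s t M1 N1 (fst a) i x = 0" for i x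
    by (rule spline_chain_bounded_support[OF s(1)]) (auto simp: R_def)
  have z2: "i \<le> snd a \<Longrightarrow> x \<notin> {-R..R} \<Longrightarrow> spline_chain A2 s t M2 N2 (snd a) i x = 0" for i x
    by (rule spline_chain_bounded_support[OF s(1)]) (auto simp: R_def)
  note C = compact_primitive_tensor[OF Cchain_spline_chain[OF s(2)] z1 Cchain_spline_chain[OF s(3)] z2 g]
  show "AE z in lebesgue. compact_primitive a g z = tensor (spline_chain A1 s t M1 N1 (fst a) 0) (spline_chain A2 s t M2 N2 (snd a) 0) z"
    using C(1) by simp
  show "(LINT z|lebesgue. compact_primitive a g z) = (A1 / s) * (A2 / s)"
    using C(2) s(1) by (simp add: spline_chain_0_integral)
qed

text \<open>
  All sampling functions have this form up to a constant factor; \<open>N\<close> counts box convolutions, \<open>M\<close> counts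
  averaging factors \<open>(1 + X) / 2\<close>, and the kernel has integral \<open>4\<^sup>-\<^sup>n\<close>.
\<close>

definition spline_kernel :: "real \<Rightarrow> nat \<Rightarrow> nat \<Rightarrow> nat \<Rightarrow> nat \<Rightarrow> nat \<Rightarrow> int \<times> int \<Rightarrow> fn" where
  "spline_kernel e N1 M1 N2 M2 n k = tensor (\<lambda>x. mask_spline N1 M1 (2 ^ n * x + (e - of_int (fst k))))
     (\<lambda>y. mask_spline N2 M2 (2 ^ n * y + (e - of_int (snd k))))"

definition sample :: "real \<Rightarrow> nat \<Rightarrow> nat \<Rightarrow> nat \<Rightarrow> nat \<Rightarrow> nat \<Rightarrow> fn \<Rightarrow> array" where
  "sample e N1 M1 N2 M2 n g k = 4 ^ n * (LINT x|lebesgue_on Omega. g x * spline_kernel e N1 M1 N2 M2 n k x)"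

text \<open>The root of the binomial coefficient over \<open>2 ^ r\<close> comes from the filter.
  The divisor \<open>(2 ^ n) ^ r\<close> cancels the inner derivatives of a chain at scale
  \<open>2 ^ n\<close>, so a filtered kernel is the last member of a chain with exactly this
  amplitude.\<close>

definition filter_const :: "nat \<Rightarrow> nat \<Rightarrow> nat \<Rightarrow> real" where
  "filter_const m n r = sqrt (real (m choose r)) / 2 ^ r / (2 ^ n) ^ r"

lemma filter_const_pos: "r \<le> m \<Longrightarrow> filter_const m n r > 0"
  by (simp add: filter_const_def)

lemma spline_kernel_continuous: "N1 \<ge> 1 \<Longrightarrow> N2 \<ge> 1 \<Longrightarrow> continuous_on UNIV (spline_kernel e N1 M1 N2 M2 n k)"
  unfolding spline_kernel_def
  by (intro continuous_on_tensor continuous_on_compose2[OF mask_spline_continuous] continuous_intros) auto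

lemma spline_kernel_bounds: "0 \<le> spline_kernel e N1 M1 N2 M2 n k z" "spline_kernel e N1 M1 N2 M2 n k z \<le> 1"
  by (auto simp: spline_kernel_def tensor_def mask_spline_bounds intro!: mult_le_one)

text \<open>The \<open>r\<close> difference factors of a filter act like an \<open>r\<close>-th
  derivative of a spline with \<open>r\<close> more box convolutions, and its averaging factors join
  the mask. Because the filter starts at \<open>- (m div 2)\<close>, the offset \<open>e\<close>
  grows by \<open>m div 2\<close>.\<close>

lemma filter_spline_kernel_sum:
  assumes "fst a \<le> m" "snd a \<le> m"
  shows "(\<Sum>l\<in>filter_support (tensor_filter m a). tensor_filter m a l * spline_kernel e N1 M1 N2 M2 n (k + l) z) =
    tensor (spline_chain (filter_const m n (fst a)) (2 ^ n) (e + real (m div 2) - of_int (fst k)) (m - fst a + M1) N1 (fst a) (fst a))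
           (spline_chain (filter_const m n (snd a)) (2 ^ n) (e + real (m div 2) - of_int (snd k)) (m - snd a + M2) N2 (snd a) (snd a)) z"
proof -
  have 1: "(\<Sum>l | bspline_filter m r l \<noteq> 0. bspline_filter m r l * mask_spline N M (2 ^ n * x + (e - (of_int k + of_int l)))) =
    spline_chain (filter_const m n r) (2 ^ n) (e + real (m div 2) - of_int k) (m - r + M) N r r x" if "r \<le> m" for r N M x k
  proof -
    have "(\<Sum>l | bspline_filter m r l \<noteq> 0. bspline_filter m r l * mask_spline N M (2 ^ n * x + (e - (of_int k + of_int l)))) =
      (\<Sum>l | bspline_filter m r l \<noteq> 0. bspline_filter m r l * mask_spline N M ((2 ^ n * x + e - of_int k) - of_int l))"
      by (simp add: algebra_simps)
    also have "\<dots> = sqrt (real (m choose r)) / 2 ^ r * shift_poly (mask_poly (m - r) r) (mask_spline N M) ((2 ^ n * x + e - of_int k) + real (m div 2))"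
      by (rule bspline_filter_shift_sum[OF that])
    also have "shift_poly (mask_poly (m - r) r) (mask_spline N M) = shift_poly (mask_poly (m - r + M) r) (box_spline N)"
      by (simp add: mask_spline_def shift_poly_mult[symmetric] mask_poly_Suc(2)[symmetric] mask_poly_def power_add mult_ac del: mult_pCons_left mult_pCons_right)
    finally show ?thesis
      by (simp add: spline_chain_last filter_const_def algebra_simps)
  qed
  show ?thesis
    using tensor_filter_sum[of m a "\<lambda>l. mask_spline N1 M1 (2 ^ n * fst z + (e - of_int (fst k + l)))" "\<lambda>l. mask_spline N2 M2 (2 ^ n * snd z + (e - of_int (snd k + l)))"]
    by (simp add: spline_kernel_def tensor_def 1[OF assms(1)] 1[OF assms(2)])
qed

lemma spline_kernel_mult_integrable:
  assumes u: "integrable (lebesgue_on Omega) u" and N: "N1 \<ge> 1" "N2 \<ge> 1"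
  shows "integrable (lebesgue_on Omega) (\<lambda>x. u x * spline_kernel e N1 M1 N2 M2 n k x)"
proof (rule Bochner_Integration.integrable_bound[OF u])
  have "spline_kernel e N1 M1 N2 M2 n k \<in> borel_measurable (lebesgue_on Omega)"
    by (intro measurable_restrict_space1 continuous_imp_lebesgue_measurable spline_kernel_continuous N)
  then show "(\<lambda>x. u x * spline_kernel e N1 M1 N2 M2 n k x) \<in> borel_measurable (lebesgue_on Omega)"
    using borel_measurable_integrable[OF u] by (intro borel_measurable_times)
qed (auto simp: abs_mult spline_kernel_bounds intro!: mult_left_le)

lemma Omega_finite_measure: "finite_measure (lebesgue_on Omega)"
proof
  have "Omega = box (0, 0) (1, 1)" by (auto simp: Omega_def box_prod)
  then have "Omega \<in> lmeasurable"
    using bounded_set_imp_lmeasurable[OF bounded_box, of "(0, 0) :: plane" "(1, 1)"] by auto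
  then have "emeasure lebesgue Omega < \<infinity>" by (metis fmeasurableD2 infinity_ennreal_def top.not_eq_extremum)
  then show "emeasure (lebesgue_on Omega) (space (lebesgue_on Omega)) \<noteq> \<infinity>"
    by (simp add: emeasure_restrict_space space_restrict_space)
qed

text \<open>The core of both transforms: filtering the samples means integrating \<open>u\<close>
  against the last member of a chain, and the weak derivative passes to \<open>g\<close> against its
  head. The bounds on \<open>k\<close> keep the chain in the closed square. In each variable the box
  convolutions and averages increase by \<open>m\<close> in total, so all filters lengthen the
  support equally.\<close>

lemma filter_spline_kernel_ibp:
  assumes a: "fst a \<le> m" "snd a \<le> m" and N: "N1 \<ge> 1" "N2 \<ge> 1"
    and wd: "is_weak_deriv Omega a u g" and u: "integrable (lebesgue_on Omega) u" and g: "integrable (lebesgue_on Omega) g"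
    and k1: "e + real (m div 2) - of_int (fst k) \<le> 0" "real (m + M1 + N1 + 1) - (e + real (m div 2) - of_int (fst k)) \<le> 2 ^ n"
    and k2: "e + real (m div 2) - of_int (snd k) \<le> 0" "real (m + M2 + N2 + 1) - (e + real (m div 2) - of_int (snd k)) \<le> 2 ^ n"
  shows "(\<Sum>l | tensor_filter m a (l - k) \<noteq> 0. tensor_filter m a (l - k) * sample e N1 M1 N2 M2 n u l) =
    (-1) ^ order_of a * (filter_const m n (fst a) * filter_const m n (snd a)) *
      sample (e + real (m div 2)) (N1 + fst a) (m - fst a + M1) (N2 + snd a) (m - snd a + M2) n g k"
proof -
  let ?F = "spline_chain (filter_const m n (fst a)) (2 ^ n) (e + real (m div 2) - of_int (fst k)) (m - fst a + M1) N1 (fst a)"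
  let ?G = "spline_chain (filter_const m n (snd a)) (2 ^ n) (e + real (m div 2) - of_int (snd k)) (m - snd a + M2) N2 (snd a)"
  have "{l. tensor_filter m a (l - k) \<noteq> 0} = (+) k ` filter_support (tensor_filter m a)"
    by (force simp: filter_support_def image_iff intro!: exI[of _ "_ - k"])
  then have "(\<Sum>l | tensor_filter m a (l - k) \<noteq> 0. tensor_filter m a (l - k) * sample e N1 M1 N2 M2 n u l) =
     (\<Sum>l\<in>filter_support (tensor_filter m a). tensor_filter m a l * sample e N1 M1 N2 M2 n u (k + l))"
    by (simp add: sum.reindex inj_on_def)
  also have "\<dots> = 4 ^ n * (\<Sum>l\<in>filter_support (tensor_filter m a). LINT x|lebesgue_on Omega. tensor_filter m a l * (u x * spline_kernel e N1 M1 N2 M2 n (k + l) x))"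
    unfolding sample_def sum_distrib_left
    by (intro sum.cong refl) (simp only: integral_mult_right_zero, simp only: mult.left_commute)
  also have "(\<Sum>l\<in>filter_support (tensor_filter m a). LINT x|lebesgue_on Omega. tensor_filter m a l * (u x * spline_kernel e N1 M1 N2 M2 n (k + l) x)) =
     (LINT x|lebesgue_on Omega. (\<Sum>l\<in>filter_support (tensor_filter m a). tensor_filter m a l * (u x * spline_kernel e N1 M1 N2 M2 n (k + l) x)))"
    by (intro Bochner_Integration.integral_sum[symmetric] integrable_mult_right spline_kernel_mult_integrable u N)
  also have "\<dots> = (LINT x|lebesgue_on Omega. u x * tensor (?F (fst a)) (?G (snd a)) x)"
  proof (intro Bochner_Integration.integral_cong refl)
    fix x
    have "(\<Sum>l\<in>filter_support (tensor_filter m a). tensor_filter m a l * (u x * spline_kernel e N1 M1 N2 M2 n (k + l) x)) =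
       u x * (\<Sum>l\<in>filter_support (tensor_filter m a). tensor_filter m a l * spline_kernel e N1 M1 N2 M2 n (k + l) x)"
      by (simp add: sum_distrib_left mult_ac)
    then show "(\<Sum>l\<in>filter_support (tensor_filter m a). tensor_filter m a l * (u x * spline_kernel e N1 M1 N2 M2 n (k + l) x)) =
       u x * tensor (?F (fst a)) (?G (snd a)) x"
      by (simp only: filter_spline_kernel_sum[OF a])
  qed
  also have "\<dots> = (-1) ^ order_of a * (LINT x|lebesgue_on Omega. g x * tensor (?F 0) (?G 0) x)"
  proof (rule is_weak_deriv_tensor_Cchain[OF wd u g])
    have out: "s * x + t \<notin> {0..L}" if "x \<notin> {0..1::real}" "s > 0" "t \<le> 0" "L - t \<le> s" for s t x L :: real
    proof -
      have "x < 0 \<or> x > 1" using that(1) by auto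
      then have "s * x < 0 \<or> s * x > s * 1" using that(2) by (simp only: mult_less_cancel_left_pos mult_less_0_iff) auto
      then have "s * x < 0 \<or> s * x > s" by (simp only: mult_1_right)
      with that(3,4) show ?thesis unfolding atLeastAtMost_iff by linarith
    qed
    show "?F i x = 0" if "i \<le> fst a" "x \<notin> {0..1}" for i x
      using k1 a by (intro spline_chain_zero[OF that(1)] out[OF that(2)]) (simp_all add: of_nat_diff)
    show "?G i x = 0" if "i \<le> snd a" "x \<notin> {0..1}" for i x
      using k2 a by (intro spline_chain_zero[OF that(1)] out[OF that(2)]) (simp_all add: of_nat_diff)
  qed (intro Cchain_spline_chain N)+
  also have "(LINT x|lebesgue_on Omega. g x * tensor (?F 0) (?G 0) x) = (filter_const m n (fst a) * filter_const m n (snd a)) *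
      (LINT x|lebesgue_on Omega. g x * spline_kernel (e + real (m div 2)) (N1 + fst a) (m - fst a + M1) (N2 + snd a) (m - snd a + M2) n k x)"
    unfolding integral_mult_right_zero[symmetric]
    by (intro Bochner_Integration.integral_cong refl) (simp add: spline_kernel_def tensor_def spline_chain_0 add_diff_eq mult_ac)
  finally show ?thesis by (simp add: sample_def)
qed

lemma scaling_fn_spline_kernel_AE:
  assumes "m \<ge> 1"
  shows "AE z in lebesgue. scaling_fn m ((2 ^ n) *\<^sub>R z - ivec k) = spline_kernel (real (m div 2)) (m - 1) 0 (m - 1) 0 n k z"
  using AE_plane_affine[OF scaling_fn_AE[OF assms], of "2 ^ n" "- ivec k"]
  by simp (erule eventually_mono, simp add: spline_kernel_def tensor_def mask_spline_0 ivec_def algebra_simps)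

lemma spline_chain_scale: "c * spline_chain A s t M N r i x = spline_chain (c * A) s t M N r i x"
  by (simp add: spline_chain_def)

text \<open>The factor 4 of the framelet is shared evenly by the two variables. One
  \<open>m div 2\<close> in the offset stems from the position of the B-spline, the other from that
  of the filter.\<close>

lemma framelet_AE:
  assumes "m \<ge> 1" and a: "fst a \<le> m" "snd a \<le> m"
  shows "AE z in lebesgue. framelet m a z =
    tensor (spline_chain (2 * filter_const m 1 (fst a)) 2 (2 * real (m div 2)) (m - fst a) (m - 1) (fst a) (fst a))
           (spline_chain (2 * filter_const m 1 (snd a)) 2 (2 * real (m div 2)) (m - snd a) (m - 1) (snd a) (snd a)) z"
proof -
  have "AE z in lebesgue. \<forall>k\<in>filter_support (tensor_filter m a). scaling_fn m ((2 ^ 1) *\<^sub>R z - ivec k) = spline_kernel (real (m div 2)) (m - 1) 0 (m - 1) 0 1 k z"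
    using finite_filter_support[OF a] by (subst AE_finite_all) (auto intro: scaling_fn_spline_kernel_AE[OF assms(1), of 1, simplified])
  then show ?thesis
  proof eventually_elim
    case (elim z)
    have "framelet m a z = 4 * (\<Sum>k\<in>filter_support (tensor_filter m a). tensor_filter m a k * spline_kernel (real (m div 2)) (m - 1) 0 (m - 1) 0 1 (0 + k) z)"
      unfolding framelet_def using elim by (auto intro!: sum.cong)
    then show ?case
      unfolding filter_spline_kernel_sum[OF a] by (simp add: tensor_def spline_chain_scale[symmetric])
  qed
qed

context
  fixes m J :: nat and al :: "nat \<Rightarrow> multi_index" and psi :: "nat \<Rightarrow> fn"
  assumes m: "m \<ge> 2" and al: "\<And>j. j \<in> {1..J} \<Longrightarrow> fst (al j) \<le> m \<and> snd (al j) \<le> m"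
    and psi: "\<And>j. psi j = framelet m (al j)"
begin

abbreviation "dd \<equiv> real (m div 2)"
abbreviation "kern1 j \<equiv> spline_kernel (2 * dd) (m - 1 + fst (al j)) (m - fst (al j)) (m - 1 + snd (al j)) (m - snd (al j))"

text \<open>The primitive is the head of the chain whose last member is the framelet. With amplitude
  twice \<open>filter_const\<close> and scale 2, each variable contributes
  \<open>filter_const\<close> to the mean, and the two amplitudes together give the factor
  4.\<close>

lemma prim1_mean1:
  assumes j: "j \<in> {1..J}"
  shows "mean1 al psi j = filter_const m 1 (fst (al j)) * filter_const m 1 (snd (al j))"
    "AE z in lebesgue. prim1 al psi j z = 4 * mean1 al psi j * kern1 j 1 0 z"
proof -
  note C = compact_primitive_spline_chain[OF _ _ _ framelet_AE[OF _ al[OF j, THEN conjunct1] al[OF j, THEN conjunct2]]]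
  show M: "mean1 al psi j = filter_const m 1 (fst (al j)) * filter_const m 1 (snd (al j))"
    unfolding mean1_def prim1_def psi by (subst C(2)) (use m in auto)
  have "AE z in lebesgue. prim1 al psi j z =
     tensor (spline_chain (2 * filter_const m 1 (fst (al j))) 2 (2 * dd) (m - fst (al j)) (m - 1) (fst (al j)) 0)
            (spline_chain (2 * filter_const m 1 (snd (al j))) 2 (2 * dd) (m - snd (al j)) (m - 1) (snd (al j)) 0) z"
    unfolding prim1_def psi by (rule C(1)) (use m in auto)
  then show "AE z in lebesgue. prim1 al psi j z = 4 * mean1 al psi j * kern1 j 1 0 z"
    by eventually_elim (simp add: spline_kernel_def tensor_def spline_chain_0 M)
qed

lemma mean1_pos: "j \<in> {1..J} \<Longrightarrow> mean1 al psi j > 0"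
  using al[of j] by (simp add: prim1_mean1 filter_const_pos)

lemma powi_two: "2 powi (int n - 1) = 2 ^ n / (2 :: real)" "2 powi (int n - 2) = 2 ^ n / (4 :: real)"
  "2 powi ((int n - 1) * int s) = (2 ^ n / (2 :: real)) ^ s" "2 powi ((int n - 2) * int s) = (2 ^ n / (4 :: real)) ^ s"
proof -
  show 1: "2 powi (int n - 1) = 2 ^ n / (2 :: real)" and 2: "2 powi (int n - 2) = 2 ^ n / (4 :: real)"
    by (simp_all add: power_int_diff)
  show "2 powi ((int n - 1) * int s) = (2 ^ n / (2 :: real)) ^ s" "2 powi ((int n - 2) * int s) = (2 ^ n / (4 :: real)) ^ s"
    by (simp_all add: power_int_mult 1 2)
qed

text \<open>As the primitive is already a kernel at scale 2, dilating by 2^(n-1) and shifting by k/2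
  yields a kernel at scale 2^n with integer shift. The prefactors 2^(n-2) and 4 combine to
  2^n.\<close>

lemma prim1_at_AE:
  assumes j: "j \<in> {1..J}"
  shows "AE z in lebesgue. prim1_at al psi j n k z = mean1 al psi j * 2 ^ n * kern1 j n k z"
proof -
  have "AE z in lebesgue. prim1 al psi j ((2 powi (int n - 1)) *\<^sub>R z + (- (1 / 2) *\<^sub>R ivec k)) =
     4 * mean1 al psi j * kern1 j 1 0 ((2 powi (int n - 1)) *\<^sub>R z + (- (1 / 2) *\<^sub>R ivec k))"
    by (rule AE_plane_affine[OF prim1_mean1(2)[OF j]]) simp
  then show ?thesis
  proof eventually_elim
    case (elim z)
    have "kern1 j 1 0 ((2 powi (int n - 1)) *\<^sub>R z - (1 / 2) *\<^sub>R ivec k) = kern1 j n k z"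
      by (simp add: spline_kernel_def tensor_def ivec_def powi_two algebra_simps)
    with elim show ?case by (simp add: prim1_at_def powi_two(2) del: One_nat_def)
  qed
qed

text \<open>The half-integer shifts turn the summands into kernels at scale 4 with integer shifts,
  on which the filter acts as before. The factor 4 in front and the 4 of the primitive give 16,
  shared by the two variables, and a third \<open>m div 2\<close> enters the offset.\<close>

lemma filt_sum_prim1:
  assumes i: "i \<in> {1..J}" and j: "j \<in> {1..J}"
  shows "AE z in lebesgue. 4 * inverse (mean1 al psi j) *
        (\<Sum>k \<in> filter_support (filt m al i).
           filt m al i k * prim1 al psi j (2 *\<^sub>R z - (1 / 2) *\<^sub>R ivec k)) =
    tensor (spline_chain (4 * filter_const m 2 (fst (al i))) 4 (3 * dd) (m - fst (al i) + (m - fst (al j))) (m - 1 + fst (al j)) (fst (al i)) (fst (al i)))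
           (spline_chain (4 * filter_const m 2 (snd (al i))) 4 (3 * dd) (m - snd (al i) + (m - snd (al j))) (m - 1 + snd (al j)) (snd (al i)) (snd (al i))) z"
proof -
  have f: "filt m al i = tensor_filter m (al i)" using i by (simp add: filt_def)
  note a = al[OF i, THEN conjunct1] al[OF i, THEN conjunct2]
  have "AE z in lebesgue. \<forall>k\<in>filter_support (tensor_filter m (al i)).
      prim1 al psi j (2 *\<^sub>R z + (- (1 / 2) *\<^sub>R ivec k)) = 4 * mean1 al psi j * kern1 j 1 0 (2 *\<^sub>R z + (- (1 / 2) *\<^sub>R ivec k))"
    using finite_filter_support[OF a] by (subst AE_finite_all) (auto intro!: AE_plane_affine[OF prim1_mean1(2)[OF j], of 2 "- (1 / 2) *\<^sub>R ivec _", simplified])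
  then show ?thesis
  proof eventually_elim
    case (elim z)
    have k: "kern1 j 1 0 (2 *\<^sub>R z - (1 / 2) *\<^sub>R ivec k) = kern1 j 2 k z" for k
      by (simp add: spline_kernel_def tensor_def ivec_def algebra_simps)
    have "4 * inverse (mean1 al psi j) * (\<Sum>k \<in> filter_support (filt m al i).
           filt m al i k * prim1 al psi j (2 *\<^sub>R z - (1 / 2) *\<^sub>R ivec k)) =
       4 * inverse (mean1 al psi j) * (\<Sum>k \<in> filter_support (tensor_filter m (al i)).
           tensor_filter m (al i) k * (4 * mean1 al psi j * kern1 j 2 (0 + k) z))"
      unfolding f using elim by (intro arg_cong2[of _ _ _ _ "(*)"] refl sum.cong) (simp add: k del: One_nat_def)
    also have "\<dots> = (4 * inverse (mean1 al psi j)) * (4 * mean1 al psi j) * (\<Sum>k \<in> filter_support (tensor_filter m (al i)).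
           tensor_filter m (al i) k * kern1 j 2 (0 + k) z)"
      by (simp add: sum_distrib_left mult_ac)
    also have "(4 * inverse (mean1 al psi j)) * (4 * mean1 al psi j) = 4 * 4"
      using mean1_pos[OF j] by simp
    finally show ?case
      unfolding filter_spline_kernel_sum[OF a] by (simp add: tensor_def spline_chain_scale[symmetric])
  qed
qed

lemma mean2_eq:
  assumes i: "i \<in> {1..J}" and j: "j \<in> {1..J}"
  shows "mean2 m al psi i j = filter_const m 2 (fst (al i)) * filter_const m 2 (snd (al i))"
  unfolding mean2_def prim2_def by (subst compact_primitive_spline_chain(2)[OF _ _ _ filt_sum_prim1[OF i j]]) (use m in auto)

lemma LINT_Omega_AE_cong:
  fixes v f g :: fn
  assumes "v \<in> borel_measurable (lebesgue_on Omega)" "continuous_on UNIV g" "AE z in lebesgue. f z = g z"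
  shows "(LINT x|lebesgue_on Omega. v x * f x) = (LINT x|lebesgue_on Omega. v x * g x)"
proof (rule integral_cong_AE)
  have g: "g \<in> borel_measurable lebesgue" using assms(2) by (rule continuous_imp_lebesgue_measurable)
  have f: "f \<in> borel_measurable lebesgue" using g assms(3) by (rule lebesgue_measurable_AE_cong)
  show "(\<lambda>x. v x * f x) \<in> borel_measurable (lebesgue_on Omega)" "(\<lambda>x. v x * g x) \<in> borel_measurable (lebesgue_on Omega)"
    using assms(1) f g by (auto intro: borel_measurable_times measurable_restrict_space1)
  show "AE x in lebesgue_on Omega. v x * f x = v x * g x"
    unfolding AE_Omega_iff using assms(3) by eventually_elim simp
qed

section \<open>Sampling operators, their supports, and the weighted transforms\<close>

lemma T_op_eq:
  assumes "u \<in> borel_measurable (lebesgue_on Omega)"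
  shows "T_op m n u k = sample dd (m - 1) 0 (m - 1) 0 n u k"
proof -
  have "AE z in lebesgue. scaling_fn_at m n k z = 2 ^ n * spline_kernel dd (m - 1) 0 (m - 1) 0 n k z"
    using scaling_fn_spline_kernel_AE[of m n k] m by (auto simp: scaling_fn_at_def elim!: eventually_mono)
  then have "inner_L2 Omega u (scaling_fn_at m n k) = (LINT x|lebesgue_on Omega. u x * (2 ^ n * spline_kernel dd (m - 1) 0 (m - 1) 0 n k x))"
    unfolding inner_L2_def using m by (intro LINT_Omega_AE_cong assms continuous_intros spline_kernel_continuous) auto
  also have "\<dots> = 2 ^ n * (LINT x|lebesgue_on Omega. u x * spline_kernel dd (m - 1) 0 (m - 1) 0 n k x)"
    unfolding integral_mult_right_zero[symmetric] by (intro Bochner_Integration.integral_cong refl) simp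
  finally have "T_op m n u k = (2 ^ n * 2 ^ n) * (LINT x|lebesgue_on Omega. u x * spline_kernel dd (m - 1) 0 (m - 1) 0 n k x)"
    by (simp add: T_op_def)
  then show ?thesis by (simp add: sample_def power_mult_distrib[symmetric])
qed

lemma S_op_eq:
  assumes j: "j \<in> {1..J}" and v: "v j \<in> borel_measurable (lebesgue_on Omega)"
  shows "S_op al psi n v j k = sample (2 * dd) (m - 1 + fst (al j)) (m - fst (al j)) (m - 1 + snd (al j)) (m - snd (al j)) n (v j) k"
proof -
  have "AE z in lebesgue. inverse (mean1 al psi j) * prim1_at al psi j n k z = 2 ^ n * kern1 j n k z"
    using prim1_at_AE[OF j, of n k] by eventually_elim (use mean1_pos[OF j] in simp)
  then have "inner_L2 Omega (v j) (\<lambda>x. inverse (mean1 al psi j) * prim1_at al psi j n k x) = (LINT x|lebesgue_on Omega. v j x * (2 ^ n * kern1 j n k x))"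
    unfolding inner_L2_def using m by (intro LINT_Omega_AE_cong v continuous_intros spline_kernel_continuous) auto
  also have "\<dots> = 2 ^ n * (LINT x|lebesgue_on Omega. v j x * kern1 j n k x)"
    unfolding integral_mult_right_zero[symmetric] by (intro Bochner_Integration.integral_cong refl) simp
  finally have "S_op al psi n v j k = (2 ^ n * 2 ^ n) * (LINT x|lebesgue_on Omega. v j x * kern1 j n k x)"
    by (simp add: S_op_def)
  then show ?thesis by (simp add: sample_def power_mult_distrib[symmetric])
qed

lemma ess_support_scaling:
  "ess_support (scaling_fn_at m n k) \<subseteq> closure Omega \<longleftrightarrow>
     int (m div 2) \<le> fst k \<and> int m - int (m div 2) + fst k \<le> 2 ^ n \<and> int (m div 2) \<le> snd k \<and> int m - int (m div 2) + snd k \<le> 2 ^ n"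
proof -
  have "AE z in lebesgue. scaling_fn_at m n k z = 2 ^ n * spline_kernel dd (m - 1) 0 (m - 1) 0 n k z"
    using scaling_fn_spline_kernel_AE[of m n k] m by (auto simp: scaling_fn_at_def elim!: eventually_mono)
  then have "ess_support (scaling_fn_at m n k) \<subseteq> closure Omega \<longleftrightarrow> (\<forall>z. 2 ^ n * spline_kernel dd (m - 1) 0 (m - 1) 0 n k z \<noteq> 0 \<longrightarrow> z \<in> closure Omega)"
    using m by (intro ess_support_subset_iff continuous_intros spline_kernel_continuous) auto
  also have "\<dots> \<longleftrightarrow> (\<forall>z. spline_kernel dd (m - 1) 0 (m - 1) 0 n k z \<noteq> 0 \<longrightarrow> z \<in> closure Omega)" by simp
  also have "\<dots> \<longleftrightarrow> dd - of_int (fst k) \<le> 0 \<and> real (m - 1 + 0 + 1) - (dd - of_int (fst k)) \<le> 2 ^ n \<and> dd - of_int (snd k) \<le> 0 \<and> real (m - 1 + 0 + 1) - (dd - of_int (snd k)) \<le> 2 ^ n"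
    unfolding spline_kernel_def using m by (intro mask_spline_affine_support) auto
  also have "\<dots> \<longleftrightarrow> real_of_int (int (m div 2)) \<le> of_int (fst k) \<and> real_of_int (int m - int (m div 2) + fst k) \<le> of_int (2 ^ n) \<and>
      real_of_int (int (m div 2)) \<le> of_int (snd k) \<and> real_of_int (int m - int (m div 2) + snd k) \<le> of_int (2 ^ n)"
    using m by (auto simp: of_nat_diff)
  finally show ?thesis unfolding of_int_le_iff .
qed

lemma ess_support_prim1:
  assumes j: "j \<in> {1..J}"
  shows "ess_support (prim1_at al psi j n k) \<subseteq> closure Omega \<longleftrightarrow>
     2 * int (m div 2) \<le> fst k \<and> 2 * int m - 2 * int (m div 2) + fst k \<le> 2 ^ n \<and> 2 * int (m div 2) \<le> snd k \<and> 2 * int m - 2 * int (m div 2) + snd k \<le> 2 ^ n"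
proof -
  have "ess_support (prim1_at al psi j n k) \<subseteq> closure Omega \<longleftrightarrow> (\<forall>z. mean1 al psi j * 2 ^ n * kern1 j n k z \<noteq> 0 \<longrightarrow> z \<in> closure Omega)"
    using m prim1_at_AE[OF j] by (intro ess_support_subset_iff continuous_intros spline_kernel_continuous) auto
  also have "\<dots> \<longleftrightarrow> (\<forall>z. kern1 j n k z \<noteq> 0 \<longrightarrow> z \<in> closure Omega)" using mean1_pos[OF j] by simp
  also have "\<dots> \<longleftrightarrow> 2 * dd - of_int (fst k) \<le> 0 \<and> real (m - 1 + fst (al j) + (m - fst (al j)) + 1) - (2 * dd - of_int (fst k)) \<le> 2 ^ n \<and>
      2 * dd - of_int (snd k) \<le> 0 \<and> real (m - 1 + snd (al j) + (m - snd (al j)) + 1) - (2 * dd - of_int (snd k)) \<le> 2 ^ n"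
    unfolding spline_kernel_def using m by (intro mask_spline_affine_support) auto
  also have "\<dots> \<longleftrightarrow> real_of_int (2 * int (m div 2)) \<le> of_int (fst k) \<and> real_of_int (2 * int m - 2 * int (m div 2) + fst k) \<le> of_int (2 ^ n) \<and>
      real_of_int (2 * int (m div 2)) \<le> of_int (snd k) \<and> real_of_int (2 * int m - 2 * int (m div 2) + snd k) \<le> of_int (2 ^ n)"
    using m al[OF j] by (auto simp: of_nat_diff)
  finally show ?thesis unfolding of_int_le_iff .
qed

text \<open>In each variable the filter constant at level \<open>n\<close> is the mean of the
  primitive times (2 / 2^n)^r, so the weight of the transform reduces the whole prefactor to one,
  and the two signs cancel. The resulting kernel is the one in \<open>S_op_eq\<close>, which is what
  makes the two arrays comparable.\<close>

lemma W1_op_eq: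
  assumes j: "j \<in> {1..J}" and wd: "is_weak_deriv Omega (al j) u g"
    and u: "integrable (lebesgue_on Omega) u" and g: "integrable (lebesgue_on Omega) g"
    and k: "2 * int (m div 2) \<le> fst k \<and> 2 * int m - 2 * int (m div 2) + fst k \<le> 2 ^ n \<and> 2 * int (m div 2) \<le> snd k \<and> 2 * int m - 2 * int (m div 2) + snd k \<le> 2 ^ n"
  shows "W1_op m al psi n (T_op m n u) j k =
     sample (2 * dd) (m - 1 + fst (al j)) (m - fst (al j)) (m - 1 + snd (al j)) (m - snd (al j)) n g k"
proof -
  have f: "filt m al j = tensor_filter m (al j)" using j by (simp add: filt_def)
  note a = al[OF j, THEN conjunct1] al[OF j, THEN conjunct2]
  have kr: "real_of_int (2 * int (m div 2)) \<le> of_int (fst k)" "real_of_int (2 * int m - 2 * int (m div 2) + fst k) \<le> of_int (2 ^ n)"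
    "real_of_int (2 * int (m div 2)) \<le> of_int (snd k)" "real_of_int (2 * int m - 2 * int (m div 2) + snd k) \<le> of_int (2 ^ n)"
    using k by (simp_all only: of_int_le_iff)
  have T: "T_op m n u l = sample dd (m - 1) 0 (m - 1) 0 n u l" for l
    using u by (intro T_op_eq) auto
  have S: "(\<Sum>l | filt m al j (l - k) \<noteq> 0. filt m al j (l - k) * T_op m n u l) =
      (-1) ^ order_of (al j) * (filter_const m n (fst (al j)) * filter_const m n (snd (al j))) *
      sample (dd + dd) (m - 1 + fst (al j)) (m - fst (al j) + 0) (m - 1 + snd (al j)) (m - snd (al j) + 0) n g k"
    unfolding f T using m kr by (intro filter_spline_kernel_ibp a wd u g) (auto simp: of_nat_diff)
  \<comment> \<open>Here \<open>s\<close> stands for the root of the binomial coefficient,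
    \<open>a\<close> for \<open>2 ^ r\<close> and \<open>b\<close> for
    \<open>(2 ^ n) ^ r\<close>.\<close>
  have cancel: "inverse (s / a / a) * (b / a) * (s / a / b) = 1" if "s \<noteq> 0" "a \<noteq> 0" "b \<noteq> 0" for s a b :: real
    using that by simp
  have one: "inverse (filter_const m 1 r) * (2 ^ n / 2) ^ r * filter_const m n r = 1" if "r \<le> m" for r
    unfolding filter_const_def power_divide power_one_right by (rule cancel) (use that in simp_all)
  have "W1_op m al psi n (T_op m n u) j k =
     ((-1) ^ order_of (al j) * (-1) ^ order_of (al j)) * (inverse (filter_const m 1 (fst (al j))) * (2 ^ n / 2) ^ fst (al j) * filter_const m n (fst (al j))) *
      (inverse (filter_const m 1 (snd (al j))) * (2 ^ n / 2) ^ snd (al j) * filter_const m n (snd (al j))) *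
      sample (dd + dd) (m - 1 + fst (al j)) (m - fst (al j) + 0) (m - 1 + snd (al j)) (m - snd (al j) + 0) n g k"
    unfolding W1_op_def S prim1_mean1(1)[OF j] powi_two by (simp add: order_of_def power_add mult_ac)
  then show ?thesis by (simp only: one[OF a(1)] one[OF a(2)] power_mult_distrib[symmetric]) simp
qed

text \<open>The same cancellation one level deeper: the mean of the second primitive belongs to
  scale 4, in agreement with the weight of exponent \<open>n - 2\<close>. Offset and support length
  of the kernel are three times those of the scaling function, hence the bounds on
  \<open>k\<close>.\<close>

lemma W2_op_eq:
  assumes i: "i \<in> {1..J}" and j: "j \<in> {1..J}" and wd: "is_weak_deriv Omega (al i) (v j) g"
    and u: "integrable (lebesgue_on Omega) (v j)" and g: "integrable (lebesgue_on Omega) g"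
    and k: "3 * int (m div 2) \<le> fst k \<and> 3 * int m - 3 * int (m div 2) + fst k \<le> 2 ^ n \<and> 3 * int (m div 2) \<le> snd k \<and> 3 * int m - 3 * int (m div 2) + snd k \<le> 2 ^ n"
  shows "W2_op m al psi n (S_op al psi n v) (i, j) k =
     sample (3 * dd) (m - 1 + fst (al j) + fst (al i)) (m - fst (al i) + (m - fst (al j)))
       (m - 1 + snd (al j) + snd (al i)) (m - snd (al i) + (m - snd (al j))) n g k"
proof -
  have f: "filt m al i = tensor_filter m (al i)" using i by (simp add: filt_def)
  note a = al[OF i, THEN conjunct1] al[OF i, THEN conjunct2]
  have kr: "real_of_int (3 * int (m div 2)) \<le> of_int (fst k)" "real_of_int (3 * int m - 3 * int (m div 2) + fst k) \<le> of_int (2 ^ n)"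
    "real_of_int (3 * int (m div 2)) \<le> of_int (snd k)" "real_of_int (3 * int m - 3 * int (m div 2) + snd k) \<le> of_int (2 ^ n)"
    using k by (simp_all only: of_int_le_iff)
  have T: "S_op al psi n v j l = sample (2 * dd) (m - 1 + fst (al j)) (m - fst (al j)) (m - 1 + snd (al j)) (m - snd (al j)) n (v j) l" for l
    using u by (intro S_op_eq j) auto
  let ?T = "sample (2 * dd + dd) (m - 1 + fst (al j) + fst (al i)) (m - fst (al i) + (m - fst (al j)))
       (m - 1 + snd (al j) + snd (al i)) (m - snd (al i) + (m - snd (al j))) n g k"
  have S: "(\<Sum>l | filt m al i (l - k) \<noteq> 0. filt m al i (l - k) * S_op al psi n v j l) =
      (-1) ^ order_of (al i) * (filter_const m n (fst (al i)) * filter_const m n (snd (al i))) * ?T"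
    unfolding f T using m kr al[OF j] by (intro filter_spline_kernel_ibp a wd u g) (auto simp: of_nat_diff)
  have cancel: "inverse (s / a / c) * (b / c) * (s / a / b) = 1" if "s \<noteq> 0" "a \<noteq> 0" "b \<noteq> 0" "c \<noteq> 0" for s a b c :: real
    using that by simp
  have four: "(2::real) ^ 2 = 4" by simp
  have one: "inverse (filter_const m 2 r) * (2 ^ n / 4) ^ r * filter_const m n r = 1" if "r \<le> m" for r
    unfolding filter_const_def power_divide four by (rule cancel) (use that in simp_all)
  have "W2_op m al psi n (S_op al psi n v) (i, j) k =
     ((-1) ^ order_of (al i) * (-1) ^ order_of (al i)) * (inverse (filter_const m 2 (fst (al i))) * (2 ^ n / 4) ^ fst (al i) * filter_const m n (fst (al i))) *
      (inverse (filter_const m 2 (snd (al i))) * (2 ^ n / 4) ^ snd (al i) * filter_const m n (snd (al i))) * ?T"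
    unfolding W2_op_def prod.case S mean2_eq[OF i j] powi_two by (simp add: order_of_def power_add mult_ac)
  then show ?thesis by (simp only: one[OF a(1)] one[OF a(2)] power_mult_distrib[symmetric]) simp
qed
end

section \<open>Convergence of samples\<close>

abbreviation "MO \<equiv> lebesgue_on Omega"

text \<open>The functionals contain only powers of norms with the exponent of the space, so this
  power replaces the norm throughout and roots are avoided. For null sequences a triangle inequality
  with a constant is enough.\<close>

definition Lp_int :: "real \<Rightarrow> fn \<Rightarrow> real" where "Lp_int p f = (LINT x|MO. \<bar>f x\<bar> powr p)"

lemma Lp_int_nonneg: "Lp_int p f \<ge> 0"
  unfolding Lp_int_def by (intro Bochner_Integration.integral_nonneg) simp

text \<open>The sum is at most twice the larger modulus, and 2^p is at most 4 for exponents up to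
  2.\<close>

lemma abs_add_powr_le:
  fixes a b :: real assumes p: "1 \<le> p" "p \<le> 2"
  shows "\<bar>a + b\<bar> powr p \<le> 4 * (\<bar>a\<bar> powr p + \<bar>b\<bar> powr p)"
proof -
  have "\<bar>a + b\<bar> powr p \<le> (2 * max \<bar>a\<bar> \<bar>b\<bar>) powr p" by (intro powr_mono2) (use p in auto)
  also have "\<dots> = 2 powr p * (max \<bar>a\<bar> \<bar>b\<bar>) powr p" by (simp add: powr_mult)
  also have "\<dots> \<le> 4 * (max \<bar>a\<bar> \<bar>b\<bar>) powr p"
  proof (intro mult_right_mono)
    have "(2::real) powr p \<le> 2 powr 2" using p by (intro powr_mono) auto
    then show "(2::real) powr p \<le> 4" by simp
  qed auto
  also have "(max \<bar>a\<bar> \<bar>b\<bar>) powr p \<le> \<bar>a\<bar> powr p + \<bar>b\<bar> powr p" by (auto simp: max_def)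
  finally show ?thesis by simp
qed

lemma Lp_measurable: "f \<in> Lp_space Omega p \<Longrightarrow> f \<in> borel_measurable MO"
  and Lp_integrable: "f \<in> Lp_space Omega p \<Longrightarrow> integrable MO (\<lambda>x. \<bar>f x\<bar> powr p)"
  by (auto simp: Lp_space_def)

lemma Lp_dominated:
  assumes f: "f \<in> borel_measurable MO" and g: "integrable MO g" and le: "\<And>x. \<bar>f x\<bar> powr p \<le> g x"
  shows "f \<in> Lp_space Omega p" "Lp_int p f \<le> (LINT x|MO. g x)"
proof -
  have "integrable MO (\<lambda>x. \<bar>f x\<bar> powr p)"
  proof (rule Bochner_Integration.integrable_bound[OF g])
    show "(\<lambda>x. \<bar>f x\<bar> powr p) \<in> borel_measurable MO" using f by measurable
    show "AE x in MO. norm (\<bar>f x\<bar> powr p) \<le> norm (g x)"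
      using order_trans[OF le abs_ge_self] by (intro AE_I2) simp
  qed
  then show "f \<in> Lp_space Omega p" using f by (simp add: Lp_space_def)
  show "Lp_int p f \<le> (LINT x|MO. g x)"
    unfolding Lp_int_def by (rule integral_mono) (use \<open>integrable MO (\<lambda>x. \<bar>f x\<bar> powr p)\<close> g le in auto)
qed

lemma Lp_add:
  assumes p: "1 \<le> p" "p \<le> 2" and f: "f \<in> Lp_space Omega p" and g: "g \<in> Lp_space Omega p"
  shows "(\<lambda>x. f x + g x) \<in> Lp_space Omega p" "Lp_int p (\<lambda>x. f x + g x) \<le> 4 * (Lp_int p f + Lp_int p g)"
proof -
  have i: "integrable MO (\<lambda>x. 4 * (\<bar>f x\<bar> powr p + \<bar>g x\<bar> powr p))" using f g by (auto simp: Lp_space_def)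
  have m: "(\<lambda>x. f x + g x) \<in> borel_measurable MO" using f g by (auto simp: Lp_space_def)
  note D = Lp_dominated[OF m i abs_add_powr_le[OF p]]
  show "(\<lambda>x. f x + g x) \<in> Lp_space Omega p" by (rule D)
  have "(LINT x|MO. 4 * (\<bar>f x\<bar> powr p + \<bar>g x\<bar> powr p)) = 4 * (Lp_int p f + Lp_int p g)"
    using f g by (simp add: Lp_int_def Lp_space_def)
  with D(2) show "Lp_int p (\<lambda>x. f x + g x) \<le> 4 * (Lp_int p f + Lp_int p g)" by simp
qed

lemma Lp_uminus: "f \<in> Lp_space Omega p \<Longrightarrow> (\<lambda>x. - f x) \<in> Lp_space Omega p" "Lp_int p (\<lambda>x. - f x) = Lp_int p f"
  by (auto simp: Lp_space_def Lp_int_def)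

lemma Lp_diff:
  assumes p: "1 \<le> p" "p \<le> 2" and f: "f \<in> Lp_space Omega p" and g: "g \<in> Lp_space Omega p"
  shows "(\<lambda>x. f x - g x) \<in> Lp_space Omega p" "Lp_int p (\<lambda>x. f x - g x) \<le> 4 * (Lp_int p f + Lp_int p g)"
  using Lp_add[OF p f Lp_uminus(1)[OF g]] by (simp_all add: Lp_uminus)

lemma Lp_cmult:
  assumes f: "f \<in> Lp_space Omega p"
  shows "(\<lambda>x. c * f x) \<in> Lp_space Omega p" "Lp_int p (\<lambda>x. c * f x) = \<bar>c\<bar> powr p * Lp_int p f"
  using f by (auto simp: Lp_space_def Lp_int_def abs_mult powr_mult)

lemma Lp_zero: "(\<lambda>x. 0) \<in> Lp_space Omega p" "Lp_int p (\<lambda>x. 0) = 0"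
  by (auto simp: Lp_space_def Lp_int_def)

lemma Lp_abs: "f \<in> Lp_space Omega p \<Longrightarrow> (\<lambda>x. \<bar>f x\<bar>) \<in> Lp_space Omega p" "Lp_int p (\<lambda>x. \<bar>f x\<bar>) = Lp_int p f"
  by (auto simp: Lp_space_def Lp_int_def)

lemma Lp_sum:
  assumes p: "1 \<le> p" "p \<le> 2" and I: "finite I" and f: "\<And>i. i \<in> I \<Longrightarrow> f i \<in> Lp_space Omega p"
  shows "(\<lambda>x. \<Sum>i\<in>I. f i x) \<in> Lp_space Omega p"
  using I f by (induction I rule: finite_induct) (auto intro: Lp_zero Lp_add[OF p])

lemma Lp_int_sum_tendsto_zero:
  assumes p: "1 \<le> p" "p \<le> 2" and I: "finite I" and f: "\<And>i n. i \<in> I \<Longrightarrow> f i n \<in> Lp_space Omega p"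
    and lim: "\<And>i. i \<in> I \<Longrightarrow> (\<lambda>n. Lp_int p (f i n)) \<longlonglongrightarrow> 0"
  shows "(\<lambda>n. Lp_int p (\<lambda>x. \<Sum>i\<in>I. f i n x)) \<longlonglongrightarrow> 0"
  using I f lim
proof (induction I rule: finite_induct)
  case (insert i I)
  have "(\<lambda>n. 4 * (Lp_int p (f i n) + Lp_int p (\<lambda>x. \<Sum>i\<in>I. f i n x))) \<longlonglongrightarrow> 4 * (0 + 0)"
    using insert by (intro tendsto_intros) auto
  then have "(\<lambda>n. 4 * (Lp_int p (f i n) + Lp_int p (\<lambda>x. \<Sum>i\<in>I. f i n x))) \<longlonglongrightarrow> 0" by simp
  then show ?case
  proof (rule tendsto_sandwich[OF _ _ tendsto_const, rotated -1])
    show "eventually (\<lambda>n. Lp_int p (\<lambda>x. \<Sum>i\<in>insert i I. f i n x) \<le> 4 * (Lp_int p (f i n) + Lp_int p (\<lambda>x. \<Sum>i\<in>I. f i n x))) sequentially"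
    proof (intro always_eventually allI)
      fix n
      have "Lp_int p (\<lambda>x. f i n x + (\<Sum>i\<in>I. f i n x)) \<le> 4 * (Lp_int p (f i n) + Lp_int p (\<lambda>x. \<Sum>i\<in>I. f i n x))"
        using insert by (intro Lp_add(2)[OF p] Lp_sum[OF p]) auto
      then show "Lp_int p (\<lambda>x. \<Sum>i\<in>insert i I. f i n x) \<le> 4 * (Lp_int p (f i n) + Lp_int p (\<lambda>x. \<Sum>i\<in>I. f i n x))"
        using insert by simp
    qed
  qed (auto intro: Lp_int_nonneg always_eventually)
qed (auto simp: Lp_zero)

lemma Lp_int_AE_cong:
  assumes "AE x in MO. f x = g x" "f \<in> borel_measurable MO" "g \<in> borel_measurable MO"
  shows "Lp_int p f = Lp_int p g"
  unfolding Lp_int_def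
proof (rule integral_cong_AE)
  show "(\<lambda>x. \<bar>f x\<bar> powr p) \<in> borel_measurable MO" "(\<lambda>x. \<bar>g x\<bar> powr p) \<in> borel_measurable MO"
    using assms by measurable
  show "AE x in MO. \<bar>f x\<bar> powr p = \<bar>g x\<bar> powr p" using assms(1) by eventually_elim simp
qed

lemma Lp_AE_cong:
  assumes "AE x in MO. f x = g x" "f \<in> Lp_space Omega p" "g \<in> borel_measurable MO"
  shows "g \<in> Lp_space Omega p"
proof -
  have "integrable MO (\<lambda>x. \<bar>g x\<bar> powr p)"
  proof (subst Bochner_Integration.integrable_cong_AE)
    show "(\<lambda>x. \<bar>g x\<bar> powr p) \<in> borel_measurable MO" "(\<lambda>x. \<bar>f x\<bar> powr p) \<in> borel_measurable MO"
      using Lp_measurable[OF assms(2)] assms(3) by measurable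
    show "AE x in MO. \<bar>g x\<bar> powr p = \<bar>f x\<bar> powr p" using assms(1) by eventually_elim simp
  qed (use assms(2) Lp_integrable in auto)
  with assms(3) show ?thesis by (simp add: Lp_space_def)
qed

lemma MO_const_integrable [simp]: "integrable MO (\<lambda>x. c :: real)"
  using finite_measure.integrable_const[OF Omega_finite_measure] .

text \<open>Values below \<open>\<epsilon>\<close> are bounded trivially, values above it by trading
  exponents. Integrated over a set of finite measure, the inequality turns smallness in L_b into
  smallness in L_a.\<close>

lemma abs_powr_exponent_mono:
  fixes t \<epsilon> a b :: real
  assumes "0 < a" "a \<le> b" "\<epsilon> > 0"
  shows "\<bar>t\<bar> powr a \<le> \<epsilon> powr a + \<epsilon> powr (a - b) * \<bar>t\<bar> powr b"
proof (cases "\<bar>t\<bar> \<le> \<epsilon>")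
  case True
  then have "\<bar>t\<bar> powr a \<le> \<epsilon> powr a" using assms by (intro powr_mono2) auto
  then show ?thesis by (simp add: add_increasing2)
next
  case False
  then have t: "\<bar>t\<bar> > 0" using assms by auto
  have "\<bar>t\<bar> powr (a - b) \<le> \<epsilon> powr (a - b)" using False assms by (intro powr_mono2') auto
  then have "\<bar>t\<bar> powr (a - b) * \<bar>t\<bar> powr b \<le> \<epsilon> powr (a - b) * \<bar>t\<bar> powr b" by (intro mult_right_mono) auto
  moreover have "\<bar>t\<bar> powr (a - b) * \<bar>t\<bar> powr b = \<bar>t\<bar> powr a" using t by (simp add: powr_add[symmetric])
  ultimately show ?thesis by (simp add: add_increasing)
qed

lemma Lp_exponent_mono:
  assumes ab: "0 < a" "a \<le> b" and f: "f \<in> Lp_space Omega b"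
  shows "f \<in> Lp_space Omega a" "\<epsilon> > 0 \<Longrightarrow> Lp_int a f \<le> \<epsilon> powr a * measure MO (space MO) + \<epsilon> powr (a - b) * Lp_int b f"
proof -
  have i: "integrable MO (\<lambda>x. \<epsilon> powr a + \<epsilon> powr (a - b) * \<bar>f x\<bar> powr b)" for \<epsilon>
    using f by (auto simp: Lp_space_def)
  note D = Lp_dominated[OF Lp_measurable[OF f] i abs_powr_exponent_mono[OF ab]]
  show "f \<in> Lp_space Omega a" using D(1)[of 1] by simp
  assume e: "\<epsilon> > 0"
  have "(LINT x|MO. \<epsilon> powr a + \<epsilon> powr (a - b) * \<bar>f x\<bar> powr b) = \<epsilon> powr a * measure MO (space MO) + \<epsilon> powr (a - b) * Lp_int b f"
    using f by (simp add: Lp_int_def Lp_space_def)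
  with D(2)[OF e] show "Lp_int a f \<le> \<epsilon> powr a * measure MO (space MO) + \<epsilon> powr (a - b) * Lp_int b f" by simp
qed

lemma Lp_int_tendsto_zero_exponent_mono:
  assumes ab: "1 \<le> a" "a \<le> b" and f: "\<And>n. f n \<in> Lp_space Omega b" and lim: "(\<lambda>n. Lp_int b (f n)) \<longlonglongrightarrow> 0"
  shows "(\<lambda>n. Lp_int a (f n)) \<longlonglongrightarrow> 0"
proof (rule order_tendstoI)
  fix y :: real assume "y < 0"
  then show "eventually (\<lambda>n. y < Lp_int a (f n)) sequentially" using Lp_int_nonneg by (intro always_eventually) (auto intro: less_le_trans)
next
  fix y :: real assume y: "0 < y"
  define c where "c = measure MO (space MO)"
  have "c \<ge> 0" by (simp add: c_def)
  \<comment> \<open>Makes the constant part of the bound at most y/2; for this fixed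
    \<open>\<epsilon>\<close> the other part tends to zero.\<close>
  define \<epsilon> where "\<epsilon> = min 1 (y / (2 * (c + 1)))"
  have \<epsilon>: "\<epsilon> > 0" "\<epsilon> \<le> 1" using y \<open>c \<ge> 0\<close> by (auto simp: \<epsilon>_def)
  have "\<epsilon> powr a \<le> \<epsilon> powr 1" using \<epsilon> ab by (intro powr_mono') auto
  then have "\<epsilon> powr a * c \<le> \<epsilon> * c" using \<open>c \<ge> 0\<close> \<epsilon> by (intro mult_right_mono) auto
  also have "\<epsilon> * c \<le> y / (2 * (c + 1)) * (c + 1)" using \<open>c \<ge> 0\<close> \<epsilon> y by (intro mult_mono) (auto simp: \<epsilon>_def)
  also have "\<dots> = y / 2" using \<open>c \<ge> 0\<close> by (simp add: field_simps)
  finally have 1: "\<epsilon> powr a * c \<le> y / 2" .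
  have "(\<lambda>n. \<epsilon> powr (a - b) * Lp_int b (f n)) \<longlonglongrightarrow> \<epsilon> powr (a - b) * 0" by (intro tendsto_intros lim)
  then have "eventually (\<lambda>n. \<epsilon> powr (a - b) * Lp_int b (f n) < y / 2) sequentially" using y by (intro order_tendstoD(2)) auto
  then show "eventually (\<lambda>n. Lp_int a (f n) < y) sequentially"
  proof eventually_elim
    case (elim n)
    then show ?case using 1 Lp_exponent_mono(2)[OF _ ab(2) f \<epsilon>(1), of n] ab by (simp add: c_def)
  qed
qed

text \<open>Convexity with weights 1 - t and t. Unlike the constant 4, the factor in front of
  \<open>x powr p\<close> tends to 1 as t tends to 0, which is what convergence of norms
  requires.\<close>

lemma convex_powr_split:
  fixes x y t p :: real
  assumes "p \<ge> 1" "0 \<le> x" "0 \<le> y" "0 < t" "t < 1"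
  shows "(x + y) powr p \<le> (1 - t) powr (1 - p) * x powr p + t powr (1 - p) * y powr p"
proof (cases "x = 0 \<or> y = 0")
  case True
  have "s powr 0 \<le> s powr (1 - p)" if "0 < s" "s < 1" for s :: real
    using that assms(1) by (intro powr_mono') auto
  from this[of t] this[of "1 - t"] have "1 \<le> t powr (1 - p)" "1 \<le> (1 - t) powr (1 - p)" using assms by auto
  then have "1 * y powr p \<le> t powr (1 - p) * y powr p" "1 * x powr p \<le> (1 - t) powr (1 - p) * x powr p"
    by (intro mult_right_mono; simp)+
  with True show ?thesis by auto
next
  case False
  have "convex_on {0<..} (\<lambda>x. x powr p)" using assms(1) by (rule powr_convex)
  from convex_onD[OF this, of t "x / (1 - t)" "y / t"]
  have "((1 - t) * (x / (1 - t)) + t * (y / t)) powr p \<le> (1 - t) * (x / (1 - t)) powr p + t * (y / t) powr p"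
    using assms False by auto
  also have "(1 - t) * (x / (1 - t)) + t * (y / t) = x + y" using assms by simp
  also have "(1 - t) * (x / (1 - t)) powr p = (1 - t) powr (1 - p) * x powr p"
    using assms by (simp add: powr_divide powr_diff)
  also have "t * (y / t) powr p = t powr (1 - p) * y powr p"
    using assms by (simp add: powr_divide powr_diff)
  finally show ?thesis .
qed

lemma Lp_int_split:
  assumes p: "1 \<le> p" "p \<le> 2" and f: "f \<in> Lp_space Omega p" and g: "g \<in> Lp_space Omega p" and t: "0 < t" "t < 1"
  shows "Lp_int p f \<le> (1 - t) powr (1 - p) * Lp_int p g + t powr (1 - p) * Lp_int p (\<lambda>x. f x - g x)"
proof -
  have d: "(\<lambda>x. f x - g x) \<in> Lp_space Omega p" by (rule Lp_diff[OF p f g])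
  have i: "integrable MO (\<lambda>x. (1 - t) powr (1 - p) * \<bar>g x\<bar> powr p + t powr (1 - p) * \<bar>f x - g x\<bar> powr p)"
    using g d by (auto simp: Lp_space_def)
  have le: "\<bar>f x\<bar> powr p \<le> (1 - t) powr (1 - p) * \<bar>g x\<bar> powr p + t powr (1 - p) * \<bar>f x - g x\<bar> powr p" for x
  proof -
    have "\<bar>f x\<bar> powr p \<le> (\<bar>g x\<bar> + \<bar>f x - g x\<bar>) powr p" using p by (intro powr_mono2) auto
    also have "\<dots> \<le> (1 - t) powr (1 - p) * \<bar>g x\<bar> powr p + t powr (1 - p) * \<bar>f x - g x\<bar> powr p"
      using p t by (intro convex_powr_split) auto
    finally show ?thesis .
  qed
  have "(LINT x|MO. (1 - t) powr (1 - p) * \<bar>g x\<bar> powr p + t powr (1 - p) * \<bar>f x - g x\<bar> powr p) =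
    (1 - t) powr (1 - p) * Lp_int p g + t powr (1 - p) * Lp_int p (\<lambda>x. f x - g x)"
    using g d by (simp add: Lp_int_def Lp_space_def)
  with Lp_dominated(2)[OF Lp_measurable[OF f] i le] show ?thesis by simp
qed

text \<open>For fixed \<open>k\<close> the error term vanishes in the limit, while the leading
  factor is close to 1 once \<open>k\<close> is large. Exchanging the roles of \<open>F n\<close>
  and \<open>G\<close> gives the bound from below.\<close>

lemma Lp_int_tendsto:
  assumes p: "1 \<le> p" "p \<le> 2" and F: "\<And>n. F n \<in> Lp_space Omega p" and G: "G \<in> Lp_space Omega p"
    and lim: "(\<lambda>n. Lp_int p (\<lambda>x. F n x - G x)) \<longlonglongrightarrow> 0"
  shows "(\<lambda>n. Lp_int p (F n)) \<longlonglongrightarrow> Lp_int p G"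
proof -
  define A where "A = Lp_int p G"
  define c where "c k = 1 / real (k + 2)" for k
  have c: "0 < c k" "c k < 1" for k by (auto simp: c_def)
  have c1: "(\<lambda>k. (1 - c k) powr (1 - p)) \<longlonglongrightarrow> 1" "(\<lambda>k. (1 - c k) powr (p - 1)) \<longlonglongrightarrow> 1"
  proof -
    have "(\<lambda>k. 1 - c k) \<longlonglongrightarrow> 1" unfolding c_def by real_asymp
    from tendsto_powr[OF this tendsto_const, of "1 - p"] tendsto_powr[OF this tendsto_const, of "p - 1"]
    show "(\<lambda>k. (1 - c k) powr (1 - p)) \<longlonglongrightarrow> 1" "(\<lambda>k. (1 - c k) powr (p - 1)) \<longlonglongrightarrow> 1" by simp_all
  qed
  have err: "(\<lambda>n. c k powr (1 - p) * Lp_int p (\<lambda>x. F n x - G x)) \<longlonglongrightarrow> 0" for k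
    using tendsto_mult[OF tendsto_const lim, of "c k powr (1 - p)"] by simp
  have "(\<lambda>n. Lp_int p (F n)) \<longlonglongrightarrow> A"
  proof (rule order_tendstoI)
    fix y assume y: "A < y"
    have "(\<lambda>k. (1 - c k) powr (1 - p) * A) \<longlonglongrightarrow> 1 * A" by (intro tendsto_intros c1)
    then have "eventually (\<lambda>k. (1 - c k) powr (1 - p) * A < y) sequentially" using y by (intro order_tendstoD(2)) auto
    then obtain k where k: "(1 - c k) powr (1 - p) * A < y" by (auto simp: eventually_sequentially)
    have "eventually (\<lambda>n. c k powr (1 - p) * Lp_int p (\<lambda>x. F n x - G x) < y - (1 - c k) powr (1 - p) * A) sequentially"
      using k by (intro order_tendstoD(2)[OF err]) auto
    then show "eventually (\<lambda>n. Lp_int p (F n) < y) sequentially"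
    proof eventually_elim
      case (elim n)
      then show ?case using Lp_int_split[OF p F G c, of n k] by (simp add: A_def)
    qed
  next
    fix y assume y: "y < A"
    have "(\<lambda>k. (1 - c k) powr (p - 1) * A) \<longlonglongrightarrow> 1 * A" by (intro tendsto_intros c1)
    then have "eventually (\<lambda>k. y < (1 - c k) powr (p - 1) * A) sequentially" using y by (intro order_tendstoD(1)) auto
    then obtain k where k: "y < (1 - c k) powr (p - 1) * A" by (auto simp: eventually_sequentially)
    have "eventually (\<lambda>n. c k powr (1 - p) * Lp_int p (\<lambda>x. F n x - G x) < (1 - c k) powr (p - 1) * A - y) sequentially"
      using k by (intro order_tendstoD(2)[OF err]) auto
    then show "eventually (\<lambda>n. y < Lp_int p (F n)) sequentially"
    proof eventually_elim
      case (elim n)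
      have sym: "Lp_int p (\<lambda>x. G x - F n x) = Lp_int p (\<lambda>x. F n x - G x)"
        using Lp_uminus(2)[of p "\<lambda>x. F n x - G x"] by simp
      have "A \<le> (1 - c k) powr (1 - p) * Lp_int p (F n) + c k powr (1 - p) * Lp_int p (\<lambda>x. F n x - G x)"
        using Lp_int_split[OF p G F c, of k n] by (simp add: A_def sym)
      then have "(1 - c k) powr (p - 1) * A \<le> (1 - c k) powr (p - 1) * ((1 - c k) powr (1 - p) * Lp_int p (F n) + c k powr (1 - p) * Lp_int p (\<lambda>x. F n x - G x))"
        by (intro mult_left_mono) auto
      also have "\<dots> = Lp_int p (F n) + (1 - c k) powr (p - 1) * (c k powr (1 - p) * Lp_int p (\<lambda>x. F n x - G x))"
        using c(2)[of k] by (simp add: distrib_left mult.assoc[symmetric] powr_add[symmetric])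
      also have "(1 - c k) powr (p - 1) * (c k powr (1 - p) * Lp_int p (\<lambda>x. F n x - G x)) \<le> 1 * (c k powr (1 - p) * Lp_int p (\<lambda>x. F n x - G x))"
        using c[of k] p by (intro mult_right_mono powr_le1) (auto simp: Lp_int_nonneg)
      finally show ?case using elim by simp
    qed
  qed
  then show ?thesis by (simp add: A_def)
qed

lemma bounded_in_Lp:
  assumes "f \<in> borel_measurable MO" "\<And>x. \<bar>f x\<bar> \<le> B" "p > 0"
  shows "f \<in> Lp_space Omega p"
  by (rule Lp_dominated(1)[OF assms(1), of "\<lambda>x. B powr p"]) (use assms in \<open>auto intro!: powr_mono2\<close>)

lemma Lp_int_dominated_convergence:
  assumes p: "p \<ge> 1" and f: "\<And>n. f n \<in> borel_measurable MO" and w: "integrable MO w"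
    and lim: "AE x in MO. (\<lambda>n. f n x) \<longlonglongrightarrow> 0" and bound: "\<And>n. AE x in MO. \<bar>f n x\<bar> powr p \<le> w x"
  shows "(\<lambda>n. Lp_int p (f n)) \<longlonglongrightarrow> 0"
proof -
  have "(\<lambda>n. LINT x|MO. \<bar>f n x\<bar> powr p) \<longlonglongrightarrow> (LINT x|MO. 0 :: real)"
  proof (rule integral_dominated_convergence[where w = w])
    show "(\<lambda>x. \<bar>f n x\<bar> powr p) \<in> borel_measurable MO" for n using f[of n] by measurable
    show "AE x in MO. (\<lambda>n. \<bar>f n x\<bar> powr p) \<longlonglongrightarrow> 0"
      using lim
    proof eventually_elim
      case (elim x)
      have "(\<lambda>n. \<bar>f n x\<bar> powr p) \<longlonglongrightarrow> \<bar>0\<bar> powr p"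
        using p by (intro tendsto_powr' tendsto_rabs elim tendsto_const) auto
      then show ?case using p by simp
    qed
  qed (use w bound in auto)
  then show ?thesis by (simp add: Lp_int_def)
qed

text \<open>First \<open>g\<close> is truncated at a high level. A measurable function is a
  pointwise limit of continuous functions off a null set, and truncating these at the same level
  supplies the bound for dominated convergence.\<close>

lemma Lp_continuous_dense:
  assumes p: "1 \<le> p" "p \<le> 2" and g: "g \<in> Lp_space Omega p" and "\<epsilon> > 0"
  shows "\<exists>h B. continuous_on UNIV h \<and> (\<forall>x. \<bar>h x\<bar> \<le> B) \<and> Lp_int p (\<lambda>x. g x - h x) < \<epsilon>"
proof -
  note gm = Lp_measurable[OF g]
  define cl where "cl N t = max (- real N) (min (real N) t)" for N and t :: real
  have cl_bound: "\<bar>cl N t\<bar> \<le> real N" for N t by (auto simp: cl_def)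
  have clm: "(\<lambda>x. cl N (g x)) \<in> borel_measurable MO" for N unfolding cl_def using gm by measurable
  have "(\<lambda>N. Lp_int p (\<lambda>x. g x - cl N (g x))) \<longlonglongrightarrow> 0"
  proof (rule Lp_int_dominated_convergence[OF p(1) _ Lp_integrable[OF g]])
    show "AE x in MO. (\<lambda>N. g x - cl N (g x)) \<longlonglongrightarrow> 0"
    proof (rule AE_I2, rule tendsto_eventually)
      fix x
      have "eventually (\<lambda>N. real N \<ge> \<bar>g x\<bar>) sequentially" using filterlim_real_sequentially by (auto simp: filterlim_at_top)
      then show "eventually (\<lambda>N. g x - cl N (g x) = 0) sequentially" by eventually_elim (auto simp: cl_def)
    qed
    show "AE x in MO. \<bar>g x - cl N (g x)\<bar> powr p \<le> \<bar>g x\<bar> powr p" for N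
      using p by (intro AE_I2 powr_mono2) (auto simp: cl_def)
  qed (use gm clm in auto)
  \<comment> \<open>Two errors below an eighth of \<open>\<epsilon>\<close> suffice in view of the
    factor 4 in \<open>Lp_add\<close>.\<close>
  then have "eventually (\<lambda>N. Lp_int p (\<lambda>x. g x - cl N (g x)) < \<epsilon> / 8) sequentially" using \<open>\<epsilon> > 0\<close> by (intro order_tendstoD(2)) auto
  then obtain N where N: "Lp_int p (\<lambda>x. g x - cl N (g x)) < \<epsilon> / 8" by (auto simp: eventually_sequentially)
  have "g measurable_on Omega"
    using measurable_on_iff_borel_measurable[of Omega g] gm by simp
  then obtain Z h where Z: "negligible Z" and h: "\<And>n. continuous_on UNIV (h n)"
    and hl: "\<And>x. x \<notin> Z \<Longrightarrow> (\<lambda>n. h n x) \<longlonglongrightarrow> (if x \<in> Omega then g x else 0)"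
    unfolding measurable_on_def by blast
  have hc: "continuous_on UNIV (\<lambda>x. cl N (h n x))" for n unfolding cl_def by (intro continuous_intros h)
  have hm: "(\<lambda>x. cl N (h n x)) \<in> borel_measurable MO" for n
    by (intro measurable_restrict_space1 continuous_imp_lebesgue_measurable hc)
  have "(\<lambda>n. Lp_int p (\<lambda>x. cl N (g x) - cl N (h n x))) \<longlonglongrightarrow> 0"
  proof (rule Lp_int_dominated_convergence[OF p(1), where w = "\<lambda>x. (2 * real N) powr p"])
    have "AE x in lebesgue. x \<notin> Z" using Z by (intro AE_not_in) (simp add: negligible_iff_null_sets)
    then show "AE x in MO. (\<lambda>n. cl N (g x) - cl N (h n x)) \<longlonglongrightarrow> 0"
      unfolding AE_Omega_iff
    proof eventually_elim
      case (elim x)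
      show ?case
      proof
        assume "x \<in> Omega"
        then have l: "(\<lambda>n. h n x) \<longlonglongrightarrow> g x" using hl[OF elim] by simp
        have "(\<lambda>n. cl N (g x) - cl N (h n x)) \<longlonglongrightarrow> cl N (g x) - cl N (g x)"
          unfolding cl_def by (intro tendsto_intros l)
        then show "(\<lambda>n. cl N (g x) - cl N (h n x)) \<longlonglongrightarrow> 0" by simp
      qed
    qed
    show "AE x in MO. \<bar>cl N (g x) - cl N (h n x)\<bar> powr p \<le> (2 * real N) powr p" for n
    proof (intro AE_I2 powr_mono2)
      show "\<bar>cl N (g x) - cl N (h n x)\<bar> \<le> 2 * real N" for x
        using cl_bound[of N "g x"] cl_bound[of N "h n x"] by linarith
    qed (use p in auto)
  qed (use clm hm in auto)
  then have "eventually (\<lambda>n. Lp_int p (\<lambda>x. cl N (g x) - cl N (h n x)) < \<epsilon> / 8) sequentially" using \<open>\<epsilon> > 0\<close> by (intro order_tendstoD(2)) auto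
  then obtain n where n: "Lp_int p (\<lambda>x. cl N (g x) - cl N (h n x)) < \<epsilon> / 8" by (auto simp: eventually_sequentially)
  have L: "(\<lambda>x. cl N (g x)) \<in> Lp_space Omega p" "(\<lambda>x. cl N (h n x)) \<in> Lp_space Omega p"
    using p cl_bound by (auto intro!: bounded_in_Lp[of _ "real N"] clm hm)
  have "Lp_int p (\<lambda>x. (g x - cl N (g x)) + (cl N (g x) - cl N (h n x))) \<le> 4 * (Lp_int p (\<lambda>x. g x - cl N (g x)) + Lp_int p (\<lambda>x. cl N (g x) - cl N (h n x)))"
    by (intro Lp_add(2)[OF p] Lp_diff(1)[OF p] g L)
  also have "\<dots> < \<epsilon>" using N n by simp
  finally have "Lp_int p (\<lambda>x. g x - cl N (h n x)) < \<epsilon>" by simp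
  then show ?thesis using hc cl_bound by blast
qed

lemma powr_above_tangent:
  fixes t b p :: real assumes "p \<ge> 1" "t \<ge> 0" "b > 0"
  shows "b powr p + p * b powr (p - 1) * (t - b) \<le> t powr p"
proof (cases "t = 0")
  case True
  have "b powr (p - 1) * b = b powr p" using assms by (simp add: powr_diff)
  then have "b powr p + p * b powr (p - 1) * (t - b) = (1 - p) * b powr p" using True by (simp add: algebra_simps)
  also have "\<dots> \<le> 0" using assms by (simp add: mult_nonpos_nonneg)
  finally show ?thesis using True assms by simp
next
  case False
  have "t powr p - b powr p \<ge> p * b powr (p - 1) * (t - b)"
  proof (rule convex_on_imp_above_tangent[of "{0<..}"])
    show "convex_on {0<..} (\<lambda>x. x powr p)" using assms(1) by (rule powr_convex)
    show "((\<lambda>x. x powr p) has_field_derivative p * b powr (p - 1)) (at b within {0<..})"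
      using assms by (auto intro!: derivative_eq_intros simp: powr_diff)
  qed (use assms False in \<open>auto simp: interior_open\<close>)
  then show ?thesis by simp
qed

text \<open>The tangent to the p-th power at the weighted mean \<open>b\<close> of |g| is integrated
  against the weight. A total mass m below one leaves the nonnegative surplus
  \<open>(p - 1) * b powr p * (1 - m)\<close>; such weights arise from kernels cut off by the
  square.\<close>

lemma jensen_powr:
  fixes g w :: "'a \<Rightarrow> real" and p :: real
  assumes p: "p \<ge> 1" and w: "integrable M w" "\<And>x. w x \<ge> 0" "(LINT x|M. w x) \<le> 1"
    and g: "integrable M (\<lambda>x. g x * w x)" "integrable M (\<lambda>x. \<bar>g x\<bar> powr p * w x)"
  shows "\<bar>LINT x|M. g x * w x\<bar> powr p \<le> (LINT x|M. \<bar>g x\<bar> powr p * w x)"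
proof -
  define b where "b = (LINT x|M. \<bar>g x\<bar> * w x)"
  have gi: "integrable M (\<lambda>x. \<bar>g x\<bar> * w x)" using integrable_abs[OF g(1)] w(2) by (simp add: abs_mult)
  have "\<bar>LINT x|M. g x * w x\<bar> \<le> b"
    unfolding b_def using integral_abs_bound[of M "\<lambda>x. g x * w x"] w(2) by (simp add: abs_mult)
  then have le: "\<bar>LINT x|M. g x * w x\<bar> powr p \<le> b powr p" using p by (intro powr_mono2) auto
  have b: "b \<ge> 0" unfolding b_def by (intro Bochner_Integration.integral_nonneg) (simp add: w)
  show ?thesis
  proof (cases "b = 0")
    case True
    have "0 \<le> (LINT x|M. \<bar>g x\<bar> powr p * w x)" by (intro Bochner_Integration.integral_nonneg) (simp add: w)
    with le True p show ?thesis by simp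
  next
    case False
    then have b: "b > 0" using b by simp
    define m where "m = (LINT x|M. w x)"
    have "(LINT x|M. (b powr p - p * b powr (p - 1) * b) * w x + (p * b powr (p - 1)) * (\<bar>g x\<bar> * w x)) \<le> (LINT x|M. \<bar>g x\<bar> powr p * w x)"
    proof (rule integral_mono)
      show "integrable M (\<lambda>x. (b powr p - p * b powr (p - 1) * b) * w x + (p * b powr (p - 1)) * (\<bar>g x\<bar> * w x))"
        using w gi by auto
      show "(b powr p - p * b powr (p - 1) * b) * w x + (p * b powr (p - 1)) * (\<bar>g x\<bar> * w x) \<le> \<bar>g x\<bar> powr p * w x" for x
        using mult_right_mono[OF powr_above_tangent[OF p abs_ge_zero b, of "g x"] w(2)[of x]] by (simp add: algebra_simps)
    qed (rule g)
    also have "(LINT x|M. (b powr p - p * b powr (p - 1) * b) * w x + (p * b powr (p - 1)) * (\<bar>g x\<bar> * w x)) =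
       (b powr p - p * b powr (p - 1) * b) * m + (p * b powr (p - 1)) * b"
      using w gi by (simp add: m_def b_def)
    also have "(b powr p - p * b powr (p - 1) * b) * m + (p * b powr (p - 1)) * b = b powr p + (p - 1) * b powr p * (1 - m)"
    proof -
      have "b powr p = b powr (p - 1) * b" using b by (simp add: powr_diff)
      then show ?thesis by (simp only:) (simp add: algebra_simps)
    qed
    finally have "b powr p + (p - 1) * b powr p * (1 - m) \<le> (LINT x|M. \<bar>g x\<bar> powr p * w x)" .
    moreover have "0 \<le> (p - 1) * b powr p * (1 - m)" using p w(3) by (simp add: m_def)
    ultimately show ?thesis using le by linarith
  qed
qed

section \<open>Piecewise constant functions on dyadic cells\<close>

definition cell :: "nat \<Rightarrow> plane \<Rightarrow> int \<times> int" where
  "cell n x = (\<lfloor>2 ^ n * fst x\<rfloor>, \<lfloor>2 ^ n * snd x\<rfloor>)"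

text \<open>The piecewise constant extension turns the norms of arrays into norms of functions.\<close>

definition cell_fn :: "nat \<Rightarrow> (int \<times> int) set \<Rightarrow> array \<Rightarrow> fn" where
  "cell_fn n K t x = (if cell n x \<in> K then t (cell n x) else 0)"

text \<open>The part of a cell in the open square is squeezed between an open and a closed box of
  equal measure, which disposes of the edges.\<close>

lemma cell_preimage_measure:
  assumes "k \<in> {0..<2 ^ n} \<times> {0..<2 ^ n}"
  shows "{x. cell n x = k} \<in> sets lebesgue" "measure lebesgue ({x. cell n x = k} \<inter> Omega) = 1 / 4 ^ n"
proof -
  define a b :: plane where "a = (of_int (fst k) / 2 ^ n, of_int (snd k) / 2 ^ n)"
    and "b = ((of_int (fst k) + 1) / 2 ^ n, (of_int (snd k) + 1) / 2 ^ n)"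
  have cell: "cell n x = k \<longleftrightarrow> of_int (fst k) \<le> 2 ^ n * fst x \<and> 2 ^ n * fst x < of_int (fst k) + 1 \<and>
      of_int (snd k) \<le> 2 ^ n * snd x \<and> 2 ^ n * snd x < of_int (snd k) + 1" for x
    by (cases k) (auto simp: cell_def floor_eq_iff)
  have half: "{x :: plane. c \<le> 2 ^ n * fst x} \<in> sets borel" "{x :: plane. 2 ^ n * fst x < c} \<in> sets borel"
    "{x :: plane. c \<le> 2 ^ n * snd x} \<in> sets borel" "{x :: plane. 2 ^ n * snd x < c} \<in> sets borel" for c :: real
    by ((rule borel_closed[OF closed_Collect_le] borel_open[OF open_Collect_less]; intro continuous_intros)+)
  have "{x. cell n x = k} = {x. of_int (fst k) \<le> 2 ^ n * fst x} \<inter> {x. 2 ^ n * fst x < of_int (fst k) + 1} \<inter>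
      {x. of_int (snd k) \<le> 2 ^ n * snd x} \<inter> {x. 2 ^ n * snd x < of_int (snd k) + 1}"
    unfolding cell by auto
  then have "{x. cell n x = k} \<in> sets borel" by (simp only: sets.Int half)
  then show Q: "{x. cell n x = k} \<in> sets lebesgue" by simp
  have "0 \<le> real_of_int (fst k)" "0 \<le> real_of_int (snd k)" using assms by auto
  moreover have "real_of_int (fst k + 1) \<le> of_int (2 ^ n)" "real_of_int (snd k + 1) \<le> of_int (2 ^ n)"
    using assms unfolding of_int_le_iff by auto
  ultimately have kb: "0 \<le> real_of_int (fst k)" "0 \<le> real_of_int (snd k)" "real_of_int (fst k) + 1 \<le> 2 ^ n" "real_of_int (snd k) + 1 \<le> 2 ^ n" by auto
  have unit: "0 < t \<and> t < 1 \<and> j \<le> 2 ^ n * t \<and> 2 ^ n * t < j + 1"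
    if "j / 2 ^ n < t" "t < (j + 1) / 2 ^ n" "0 \<le> j" "j + 1 \<le> 2 ^ n" for j t :: real
  proof -
    have *: "j < 2 ^ n * t" "2 ^ n * t < j + 1" using that by (simp_all add: field_simps)
    have "0 < 2 ^ n * t" "2 ^ n * t < 2 ^ n * 1" using * that unfolding mult_1_right by linarith+
    then have "0 < t" "t < 1" by (simp_all only: zero_less_mult_iff mult_less_cancel_left_pos zero_less_power zero_less_numeral) auto
    with * show ?thesis by auto
  qed
  have sub: "box a b \<subseteq> {x. cell n x = k} \<inter> Omega"
  proof
    fix x assume "x \<in> box a b"
    then have "of_int (fst k) / 2 ^ n < fst x" "fst x < (of_int (fst k) + 1) / 2 ^ n" "of_int (snd k) / 2 ^ n < snd x" "snd x < (of_int (snd k) + 1) / 2 ^ n"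
      by (auto simp: box_prod a_def b_def)
    then show "x \<in> {x. cell n x = k} \<inter> Omega"
      using unit[of "of_int (fst k)" "fst x"] unit[of "of_int (snd k)" "snd x"] kb by (cases x) (simp add: cell Omega_def)
  qed
  have sub2: "{x. cell n x = k} \<inter> Omega \<subseteq> cbox a b"
    by (auto simp: cell cbox_Pair_eq a_def b_def field_simps)
  have fin: "cbox a b \<in> lmeasurable" by simp
  have "measure lebesgue (box a b) = 1 / 4 ^ n" "measure lebesgue (cbox a b) = 1 / 4 ^ n"
    by (auto simp: measure_lborel_box_eq measure_lborel_cbox_eq content_cbox_plus Basis_prod_def a_def b_def
         field_simps power_mult_distrib[symmetric] prod.union_disjoint)
  moreover have "measure lebesgue (box a b) \<le> measure lebesgue ({x. cell n x = k} \<inter> Omega)"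
    by (intro measure_mono_fmeasurable sub) (use fmeasurableI2[OF fin sub2] Q in auto)
  moreover have "measure lebesgue ({x. cell n x = k} \<inter> Omega) \<le> measure lebesgue (cbox a b)"
    by (intro measure_mono_fmeasurable sub2 fin) (use Q in auto)
  ultimately show "measure lebesgue ({x. cell n x = k} \<inter> Omega) = 1 / 4 ^ n" by simp
qed

text \<open>A general \<open>H\<close> with value 0 at 0 covers the identity, used for
  measurability, and the p-th power, used for norms.\<close>

lemma cell_fn_integral:
  assumes K: "K \<subseteq> {0..<2 ^ n} \<times> {0..<2 ^ n}" and H: "H 0 = 0"
  shows "integrable MO (\<lambda>x. H (cell_fn n K t x))" "(LINT x|MO. H (cell_fn n K t x)) = (\<Sum>k\<in>K. H (t k)) / (4 ^ n :: real)"
proof -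
  have fin: "finite K" using K by (rule finite_subset) auto
  have eq: "H (cell_fn n K t x) = (\<Sum>k\<in>K. H (t k) * indicator {x. cell n x = k} x)" for x
  proof -
    have "(\<Sum>k\<in>K. H (t k) * indicator {x. cell n x = k} x) = (\<Sum>k\<in>K. if k = cell n x then H (t (cell n x)) else 0)"
      by (intro sum.cong) (auto simp: indicator_def)
    then show ?thesis using fin by (simp add: cell_fn_def H)
  qed
  have s: "{x. cell n x = k} \<inter> Omega \<in> sets lebesgue" "measure lebesgue ({x. cell n x = k} \<inter> Omega) = 1 / 4 ^ n" if "k \<in> K" for k
    using cell_preimage_measure[of k n] that K by auto
  have ms: "measure MO ({x. cell n x = k} \<inter> space MO) = 1 / 4 ^ n" "{x. cell n x = k} \<inter> space MO \<in> sets MO" if "k \<in> K" for k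
    using s[OF that] by (auto simp: space_restrict_space sets_restrict_space_iff measure_restrict_space)
  have ii: "integrable MO (indicator {x. cell n x = k} :: plane \<Rightarrow> real)" if "k \<in> K" for k
  proof -
    have "integrable MO (indicator ({x. cell n x = k} \<inter> space MO) :: plane \<Rightarrow> real)"
      using ms[OF that] finite_measure.emeasure_finite[OF Omega_finite_measure] by (intro integrable_real_indicator) (auto simp: less_top)
    then show ?thesis by (rule Bochner_Integration.integrable_cong[THEN iffD1, rotated -1]) (auto simp: indicator_def)
  qed
  have "(LINT x|MO. indicator {x. cell n x = k} x) = (1 / 4 ^ n :: real)" if "k \<in> K" for k
  proof -
    have "(LINT x|MO. indicator {x. cell n x = k} x) = (LINT x|MO. indicator ({x. cell n x = k} \<inter> space MO) x :: real)"
      by (intro Bochner_Integration.integral_cong) (auto simp: indicator_def)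
    then show ?thesis using ms[OF that] by simp
  qed
  then show "(LINT x|MO. H (cell_fn n K t x)) = (\<Sum>k\<in>K. H (t k)) / (4 ^ n :: real)"
    unfolding eq using ii by (subst Bochner_Integration.integral_sum) (auto simp: sum_divide_distrib)
  show "integrable MO (\<lambda>x. H (cell_fn n K t x))" unfolding eq using ii by auto
qed

lemma cell_fn_Lp:
  assumes "K \<subseteq> {0..<2 ^ n} \<times> {0..<2 ^ n}" "p \<ge> 1"
  shows "cell_fn n K t \<in> Lp_space Omega p" "Lp_int p (cell_fn n K t) = (\<Sum>k\<in>K. \<bar>t k\<bar> powr p) / 4 ^ n"
  using cell_fn_integral[OF assms(1), of "\<lambda>x. x" t] cell_fn_integral[OF assms(1), of "\<lambda>x. \<bar>x\<bar> powr p" t] assms(2)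
  by (auto simp: Lp_space_def Lp_int_def)

lemma Lp_1_integrable: "g \<in> Lp_space Omega 1 \<longleftrightarrow> integrable MO g"
  by (auto simp: Lp_space_def integrable_abs_iff)

section \<open>Uniform bounds and convergence of samples\<close>

context
  fixes e :: real and N1 M1 N2 M2 :: nat
  assumes N: "N1 \<ge> 1" "N2 \<ge> 1"
begin

abbreviation "KK \<equiv> spline_kernel e N1 M1 N2 M2"
abbreviation "TT \<equiv> sample e N1 M1 N2 M2"

text \<open>In units of 2^-n, a bound in each coordinate for how far the support of a kernel extends
  from the points of its cell. The final 1 pays for rounding down to the cell.\<close>

definition "kernel_radius = real (N1 + M1 + 1) + real (N2 + M2 + 1) + \<bar>e\<bar> + 1"
text \<open>Bounds how many kernels of one level are nonzero at a point: an interval of integer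
  length L contains at most L + 1 integers, and L is the support length in each variable.\<close>

definition "overlap_bound = real (N1 + M1 + 2) * real (N2 + M2 + 2)"

lemma spline_kernel_integral: "integrable lebesgue (KK n k)" "(LINT z|lebesgue. KK n k z) = 1 / 4 ^ n"
proof -
  have sc: "continuous_on UNIV (\<lambda>x. mask_spline N' M' (2 ^ n * x + t))" if "N' \<ge> 1" for N' M' t
    by (intro continuous_on_compose2[OF mask_spline_continuous[OF that]] continuous_intros) auto
  define R where "R = max (real (N1 + M1 + 1) + \<bar>e - of_int (fst k)\<bar>) (real (N2 + M2 + 1) + \<bar>e - of_int (snd k)\<bar>)"
  have z: "mask_spline N' M' (2 ^ n * x + t) = 0" if "x \<notin> {-R..R}" "R \<ge> real (N' + M' + 1) + \<bar>t\<bar>" for N' M' t x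
  proof (rule mask_spline_zero)
    have "R < \<bar>x\<bar>" using that(1) by auto
    also have "\<bar>x\<bar> \<le> \<bar>2 ^ n * x\<bar>" by (simp add: abs_mult mult_le_cancel_right1)
    finally show "2 ^ n * x + t \<notin> {0..real (N' + M' + 1)}" using that(2) by auto
  qed
  have I: "(LINT x|lborel. mask_spline N' M' (2 ^ n * x + t)) = 1 / 2 ^ n" for N' M' t
    using lborel_integral_real_affine[of "2 ^ n" "mask_spline N' M'" t] mask_spline_integral(2)[of N' M'] by (simp add: add.commute field_simps)
  note L = LINT_tensor[OF sc[OF N(1)] sc[OF N(2)], of R M1 "e - of_int (fst k)" M2 "e - of_int (snd k)"]
  show "integrable lebesgue (KK n k)" unfolding spline_kernel_def by (rule L(1)) (rule z; simp add: R_def)+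
  have "(LINT z|lebesgue. KK n k z) = (LINT x|lborel. mask_spline N1 M1 (2 ^ n * x + (e - of_int (fst k)))) *
      (LINT x|lborel. mask_spline N2 M2 (2 ^ n * x + (e - of_int (snd k))))"
    unfolding spline_kernel_def by (rule L(2)) (rule z; simp add: R_def)+
  then have "(LINT z|lebesgue. KK n k z) = (1 / 2 ^ n) * (1 / 2 ^ n)" unfolding I .
  then show "(LINT z|lebesgue. KK n k z) = 1 / 4 ^ n" by (simp add: power_mult_distrib[symmetric])
qed

lemma spline_kernel_integral_MO: "integrable MO (KK n k)" "(LINT z|MO. KK n k z) \<le> 1 / 4 ^ n"
proof -
  have i: "integrable lebesgue (\<lambda>x. indicator Omega x *\<^sub>R KK n k x)" by (intro integrable_mult_indicator spline_kernel_integral) simp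
  then show "integrable MO (KK n k)" by (subst integrable_restrict_space) auto
  have "(LINT z|MO. KK n k z) \<le> (LINT z|lebesgue. KK n k z)"
    unfolding integral_Omega using i spline_kernel_integral by (intro integral_mono) (auto simp: indicator_def spline_kernel_bounds)
  then show "(LINT z|MO. KK n k z) \<le> 1 / 4 ^ n" by (simp add: spline_kernel_integral)
qed

lemma spline_kernel_sum_le: assumes "finite K" shows "(\<Sum>k\<in>K. KK n k z) \<le> overlap_bound"
proof -
  define S where "S = (\<lambda>L y. {j :: int. 2 ^ n * y + (e - of_int j) \<in> {0..real L}})"
  have S: "finite (S L y) \<and> card (S L y) \<le> L + 1" for L y
  proof -
    have "S L y \<subseteq> {\<lceil>2 ^ n * y + e - real L\<rceil>..\<lfloor>2 ^ n * y + e\<rfloor>}" (is "_ \<subseteq> ?J")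
      by (auto simp: S_def le_floor_iff ceiling_le_iff)
    moreover have "card ?J \<le> L + 1"
    proof -
      have "\<lceil>2 ^ n * y + e - real L\<rceil> = \<lceil>2 ^ n * y + e\<rceil> - int L"
        using ceiling_diff_of_int[of "2 ^ n * y + e" "int L"] by simp
      then show ?thesis using floor_le_ceiling[of "2 ^ n * y + e"] unfolding card_atLeastAtMost_int by linarith
    qed
    ultimately show ?thesis by (meson card_mono finite_atLeastAtMost_int finite_subset order_trans)
  qed
  let ?P = "S (N1 + M1 + 1) (fst z) \<times> S (N2 + M2 + 1) (snd z)"
  have "(\<Sum>k\<in>K. KK n k z) = (\<Sum>k\<in>K \<inter> ?P. KK n k z)"
  proof (rule sum.mono_neutral_right[OF assms])
    show "\<forall>k\<in>K - K \<inter> ?P. KK n k z = 0"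
    proof
      fix k assume "k \<in> K - K \<inter> ?P"
      then consider "fst k \<notin> S (N1 + M1 + 1) (fst z)" | "snd k \<notin> S (N2 + M2 + 1) (snd z)" by (cases k) auto
      then show "KK n k z = 0"
      proof cases
        case 1
        have "mask_spline N1 M1 (2 ^ n * fst z + (e - of_int (fst k))) = 0" by (rule mask_spline_zero) (use 1 in \<open>simp add: S_def\<close>)
        then show ?thesis by (simp add: spline_kernel_def tensor_def)
      next
        case 2
        have "mask_spline N2 M2 (2 ^ n * snd z + (e - of_int (snd k))) = 0" by (rule mask_spline_zero) (use 2 in \<open>simp add: S_def\<close>)
        then show ?thesis by (simp add: spline_kernel_def tensor_def)
      qed
    qed
  qed auto
  also have "\<dots> \<le> real (card (K \<inter> ?P)) * 1" using sum_bounded_above[of "K \<inter> ?P" "\<lambda>k. KK n k z" 1] spline_kernel_bounds by simp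
  also have "card (K \<inter> ?P) \<le> card ?P" using S by (intro card_mono finite_cartesian_product) auto
  also have "card ?P \<le> (N1 + M1 + 2) * (N2 + M2 + 2)"
    unfolding card_cartesian_product using S[of "N1 + M1 + 1" "fst z"] S[of "N2 + M2 + 1" "snd z"] by (intro mult_le_mono) auto
  finally show ?thesis by (simp add: overlap_bound_def algebra_simps)
qed

lemma sample_diff:
  assumes "integrable MO f" "integrable MO g"
  shows "TT n (\<lambda>x. f x - g x) k = TT n f k - TT n g k"
  unfolding sample_def left_diff_distrib
  by (subst Bochner_Integration.integral_diff) (auto intro!: spline_kernel_mult_integrable N assms simp: algebra_simps)

text \<open>A sample is an average with weight \<open>4 ^ n\<close> times a kernel, so Jensen bounds
  its p-th power by the average of |g|^p. Summation over the indices then costs only the overlap,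
  independently of the level.\<close>

lemma sample_contraction:
  assumes p: "1 \<le> p" "p \<le> 2" and g: "g \<in> Lp_space Omega p" and K: "finite K"
  shows "(\<Sum>k\<in>K. \<bar>TT n g k\<bar> powr p) / 4 ^ n \<le> overlap_bound * Lp_int p g"
proof -
  have g1: "integrable MO g" using Lp_exponent_mono(1)[OF _ p(1) g] by (simp add: Lp_1_integrable)
  have gp: "integrable MO (\<lambda>x. \<bar>g x\<bar> powr p)" using g by (rule Lp_integrable)
  have J: "\<bar>TT n g k\<bar> powr p \<le> 4 ^ n * (LINT x|MO. \<bar>g x\<bar> powr p * KK n k x)" for k
  proof -
    have "\<bar>LINT x|MO. g x * (4 ^ n * KK n k x)\<bar> powr p \<le> (LINT x|MO. \<bar>g x\<bar> powr p * (4 ^ n * KK n k x))"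
    proof (rule jensen_powr[OF p(1)])
      show "integrable MO (\<lambda>x. 4 ^ n * KK n k x)" using spline_kernel_integral_MO by auto
      show "(LINT x|MO. 4 ^ n * KK n k x) \<le> 1" using spline_kernel_integral_MO(2)[of n k] by (simp add: field_simps)
      show "integrable MO (\<lambda>x. g x * (4 ^ n * KK n k x))"
        using integrable_mult_right[OF spline_kernel_mult_integrable[OF g1 N, of e M1 M2 n k], of "4 ^ n"] by (simp add: mult_ac)
      show "integrable MO (\<lambda>x. \<bar>g x\<bar> powr p * (4 ^ n * KK n k x))"
        using integrable_mult_right[OF spline_kernel_mult_integrable[OF gp N, of e M1 M2 n k], of "4 ^ n"] by (simp add: mult_ac)
    qed (simp add: spline_kernel_bounds)
    then show ?thesis by (simp add: sample_def mult.left_commute[of _ "4 ^ n"])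
  qed
  have "(\<Sum>k\<in>K. \<bar>TT n g k\<bar> powr p) / 4 ^ n \<le> (\<Sum>k\<in>K. 4 ^ n * (LINT x|MO. \<bar>g x\<bar> powr p * KK n k x)) / 4 ^ n"
    by (intro divide_right_mono sum_mono J) auto
  also have "\<dots> = (\<Sum>k\<in>K. LINT x|MO. \<bar>g x\<bar> powr p * KK n k x)" by (simp add: sum_distrib_left[symmetric])
  also have "\<dots> = (LINT x|MO. (\<Sum>k\<in>K. \<bar>g x\<bar> powr p * KK n k x))"
    by (intro Bochner_Integration.integral_sum[symmetric] spline_kernel_mult_integrable gp N)
  also have "\<dots> \<le> (LINT x|MO. overlap_bound * \<bar>g x\<bar> powr p)"
  proof (rule integral_mono)
    show "(\<Sum>k\<in>K. \<bar>g x\<bar> powr p * KK n k x) \<le> overlap_bound * \<bar>g x\<bar> powr p" for x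
      unfolding sum_distrib_left[symmetric] using mult_left_mono[OF spline_kernel_sum_le[OF K, of n x], of "\<bar>g x\<bar> powr p"] by (simp add: mult.commute)
    show "integrable MO (\<lambda>x. \<Sum>k\<in>K. \<bar>g x\<bar> powr p * KK n k x)"
      by (intro Bochner_Integration.integrable_sum spline_kernel_mult_integrable gp N)
  qed (use gp in auto)
  also have "\<dots> = overlap_bound * Lp_int p g" by (simp add: Lp_int_def)
  finally show ?thesis .
qed

lemma sample_bounded:
  assumes h: "h \<in> borel_measurable MO" "\<And>x. \<bar>h x\<bar> \<le> B"
  shows "\<bar>TT n h k\<bar> \<le> B"
proof -
  have B: "B \<ge> 0" using h(2)[of 0] by linarith
  have hi: "integrable MO h" by (rule Bochner_Integration.integrable_bound[of _ "\<lambda>_. B"]) (use h B in auto)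
  have "\<bar>LINT x|MO. h x * KK n k x\<bar> \<le> (LINT x|MO. B * KK n k x)"
    by (rule integral_abs_bound_integral)
       (use spline_kernel_mult_integrable[OF hi N] spline_kernel_integral_MO h in \<open>auto simp: abs_mult spline_kernel_bounds intro!: mult_right_mono\<close>)
  also have "\<dots> \<le> B * (1 / 4 ^ n)" using mult_left_mono[OF spline_kernel_integral_MO(2) B] by simp
  finally show ?thesis by (simp add: sample_def abs_mult field_simps)
qed

lemma spline_kernel_support:
  assumes "KK n (cell n x) z \<noteq> 0"
  shows "\<bar>fst z - fst x\<bar> \<le> kernel_radius / 2 ^ n" "\<bar>snd z - snd x\<bar> \<le> kernel_radius / 2 ^ n"
proof -
  have *: "\<bar>b - a\<bar> \<le> kernel_radius / 2 ^ n" if "2 ^ n * b + (e - of_int \<lfloor>2 ^ n * a\<rfloor>) \<in> {0..L}" "L + \<bar>e\<bar> + 1 \<le> kernel_radius" for a b L :: real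
  proof -
    have "of_int \<lfloor>2 ^ n * a\<rfloor> \<le> 2 ^ n * a" "2 ^ n * a < of_int \<lfloor>2 ^ n * a\<rfloor> + 1" by linarith+
    then have "\<bar>2 ^ n * b - 2 ^ n * a\<bar> \<le> kernel_radius" using that unfolding atLeastAtMost_iff by linarith
    then have "2 ^ n * \<bar>b - a\<bar> \<le> kernel_radius" by (simp add: right_diff_distrib[symmetric] abs_mult)
    then show ?thesis by (simp add: field_simps)
  qed
  have "mask_spline N1 M1 (2 ^ n * fst z + (e - of_int (fst (cell n x)))) \<noteq> 0" "mask_spline N2 M2 (2 ^ n * snd z + (e - of_int (snd (cell n x)))) \<noteq> 0"
    using assms by (auto simp: spline_kernel_def tensor_def)
  then have c: "2 ^ n * fst z + (e - of_int \<lfloor>2 ^ n * fst x\<rfloor>) \<in> {0..real (N1 + M1 + 1)}"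
    "2 ^ n * snd z + (e - of_int \<lfloor>2 ^ n * snd x\<rfloor>) \<in> {0..real (N2 + M2 + 1)}"
    using mask_spline_zero unfolding cell_def fst_conv snd_conv by blast+
  show "\<bar>fst z - fst x\<bar> \<le> kernel_radius / 2 ^ n" by (rule *[OF c(1)]) (simp add: kernel_radius_def)
  show "\<bar>snd z - snd x\<bar> \<le> kernel_radius / 2 ^ n" by (rule *[OF c(2)]) (simp add: kernel_radius_def)
qed

lemma sample_tendsto_continuous:
  assumes h: "continuous_on UNIV h" "\<And>x. \<bar>h x\<bar> \<le> B" and x: "x \<in> Omega"
  shows "(\<lambda>n. TT n h (cell n x)) \<longlonglongrightarrow> h x"
proof (rule LIMSEQ_I)
  fix r :: real assume r: "r > 0"
  obtain d1 where d1: "d1 > 0" "\<And>z. dist z x < d1 \<Longrightarrow> \<bar>h z - h x\<bar> < r / 2"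
    using h(1) r half_gt_zero[OF r] unfolding continuous_on_iff dist_real_def by (metis UNIV_I)
  obtain d2 where d2: "d2 > 0" "\<And>z. dist z x < d2 \<Longrightarrow> z \<in> Omega"
    using open_Omega x unfolding open_dist by metis
  define d where "d = min d1 d2"
  have "(\<lambda>n. kernel_radius / 2 ^ n) \<longlonglongrightarrow> 0" by real_asymp
  then have "eventually (\<lambda>n. kernel_radius / 2 ^ n < d / 2) sequentially" using d1 d2 by (intro order_tendstoD(2)) (auto simp: d_def)
  then obtain n0 where n0: "\<And>n. n \<ge> n0 \<Longrightarrow> kernel_radius / 2 ^ n < d / 2" by (auto simp: eventually_sequentially)
  have "norm (TT n h (cell n x) - h x) < r" if "n \<ge> n0" for n
  proof -
    let ?k = "cell n x"
    have near: "\<bar>h z - h x\<bar> < r / 2 \<and> z \<in> Omega" if "KK n ?k z \<noteq> 0" for z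
    proof -
      have "dist z x \<le> \<bar>fst z - fst x\<bar> + \<bar>snd z - snd x\<bar>"
        using sqrt_sum_squares_le_sum_abs[of "fst z - fst x" "snd z - snd x"] by (simp add: dist_prod_def dist_real_def)
      also have "\<dots> < d" using spline_kernel_support[OF that] n0[OF \<open>n \<ge> n0\<close>] by linarith
      finally show ?thesis using d1(2) d2(2) by (simp add: d_def)
    qed
    \<comment> \<open>For such \<open>n\<close> the kernel of the cell of \<open>x\<close> is
      supported inside the square, so restricting it there loses no mass.\<close>
    have one: "(LINT z|MO. KK n ?k z) = 1 / 4 ^ n"
    proof -
      have "(LINT z|MO. KK n ?k z) = (LINT z|lebesgue. KK n ?k z)"
        unfolding integral_Omega by (intro Bochner_Integration.integral_cong refl) (use near in \<open>auto simp: indicator_def\<close>)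
      then show ?thesis by (simp add: spline_kernel_integral)
    qed
    have B: "B \<ge> 0" using h(2)[of 0] by linarith
    have hm: "h \<in> borel_measurable MO" by (intro measurable_restrict_space1 continuous_imp_lebesgue_measurable h)
    have hi: "integrable MO h" by (rule Bochner_Integration.integrable_bound[of _ "\<lambda>_. B"]) (use h B hm in auto)
    have hi2: "integrable MO (\<lambda>z. (h z - h x) * KK n ?k z)"
      by (intro spline_kernel_mult_integrable N Bochner_Integration.integrable_diff hi MO_const_integrable)
    have "TT n h ?k - h x = 4 ^ n * (LINT z|MO. h z * KK n ?k z) - 4 ^ n * (LINT z|MO. h x * KK n ?k z)"
      by (simp add: sample_def one)
    also have "\<dots> = 4 ^ n * (LINT z|MO. (h z - h x) * KK n ?k z)"
      unfolding left_diff_distrib using spline_kernel_mult_integrable[OF hi N] spline_kernel_integral_MO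
      by (subst Bochner_Integration.integral_diff) (auto simp: algebra_simps)
    finally have eq: "TT n h ?k - h x = 4 ^ n * (LINT z|MO. (h z - h x) * KK n ?k z)" .
    have "\<bar>LINT z|MO. (h z - h x) * KK n ?k z\<bar> \<le> (LINT z|MO. r / 2 * KK n ?k z)"
    proof (rule integral_abs_bound_integral[OF hi2])
      show "\<bar>(h z - h x) * KK n ?k z\<bar> \<le> r / 2 * KK n ?k z" for z
        using near[of z] spline_kernel_bounds(1)[of e N1 M1 N2 M2 n ?k z]
        by (cases "KK n ?k z = 0") (auto simp: abs_mult intro!: mult_right_mono)
    qed (use spline_kernel_integral_MO in auto)
    also have "\<dots> = r / 2 * (1 / 4 ^ n)" by (simp add: one)
    finally have "4 ^ n * \<bar>LINT z|MO. (h z - h x) * KK n ?k z\<bar> \<le> r / 2" by (simp add: field_simps)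
    then show ?thesis using r by (simp add: eq abs_mult)
  qed
  then show "\<exists>n0. \<forall>n\<ge>n0. norm (TT n h (cell n x) - h x) < r" by blast
qed

lemma cell_fn_sample_tendsto:
  assumes p: "1 \<le> p" "p \<le> 2"
    and K: "\<And>n. K n \<subseteq> {0..<2 ^ n} \<times> {0..<2 ^ n}" "\<And>x. x \<in> Omega \<Longrightarrow> eventually (\<lambda>n. cell n x \<in> K n) sequentially"
    and g: "\<And>n. g n \<in> Lp_space Omega p" "G \<in> Lp_space Omega p" "(\<lambda>n. Lp_int p (\<lambda>x. g n x - G x)) \<longlonglongrightarrow> 0"
  shows "(\<lambda>n. Lp_int p (\<lambda>x. cell_fn n (K n) (TT n (g n)) x - G x)) \<longlonglongrightarrow> 0"
proof -
  have fin: "finite (K n)" for n using K(1) by (rule finite_subset) auto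
  have L1: "f \<in> Lp_space Omega p \<Longrightarrow> integrable MO f" for f using Lp_exponent_mono(1)[OF _ p(1)] by (simp add: Lp_1_integrable)
  have contr: "Lp_int p (cell_fn n (K n) (TT n f)) \<le> overlap_bound * Lp_int p f" if "f \<in> Lp_space Omega p" for n f
    using sample_contraction[OF p that fin] cell_fn_Lp(2)[OF K(1) p(1)] by simp
  have overlap_bound: "overlap_bound \<ge> 0" by (simp add: overlap_bound_def)
  show ?thesis
  proof (rule order_tendstoI)
    fix y :: real assume "y < 0"
    then show "eventually (\<lambda>n. y < Lp_int p (\<lambda>x. cell_fn n (K n) (TT n (g n)) x - G x)) sequentially"
      using Lp_int_nonneg by (intro always_eventually) (auto intro: less_le_trans)
  next
    fix y :: real assume y: "0 < y"
    \<comment> \<open>The error splits into samples of \<open>g n - h\<close>, the error of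
      \<open>h\<close> itself, and \<open>h - G\<close>. The constant 256 absorbs the nested factors
      4: the three parts end up below y/8, y/4 and y/16.\<close>
    define \<epsilon> where "\<epsilon> = y / (256 * (overlap_bound + 1))"
    have \<epsilon>: "\<epsilon> > 0" "overlap_bound * \<epsilon> \<le> y / 256" "\<epsilon> \<le> y / 256" using y overlap_bound by (auto simp: \<epsilon>_def field_simps)
    obtain h B where h: "continuous_on UNIV h" "\<And>x. \<bar>h x\<bar> \<le> B" "Lp_int p (\<lambda>x. G x - h x) < \<epsilon>"
      using Lp_continuous_dense[OF p g(2) \<epsilon>(1)] by blast
    have hm: "h \<in> borel_measurable MO" by (intro measurable_restrict_space1 continuous_imp_lebesgue_measurable h)
    have hL: "h \<in> Lp_space Omega p" using p by (intro bounded_in_Lp[OF hm h(2)]) auto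
    have Pm: "cell_fn n (K n) t \<in> Lp_space Omega p" for n t by (rule cell_fn_Lp(1)[OF K(1) p(1)])
    have B: "B \<ge> 0" using h(2)[of 0] by linarith
    have "(\<lambda>n. Lp_int p (\<lambda>x. cell_fn n (K n) (TT n h) x - h x)) \<longlonglongrightarrow> 0"
    proof (rule Lp_int_dominated_convergence[OF p(1), where w = "\<lambda>x. (2 * B) powr p"])
      show "(\<lambda>x. cell_fn n (K n) (TT n h) x - h x) \<in> borel_measurable MO" for n using Lp_measurable[OF Pm] hm by measurable
      show "AE x in MO. \<bar>cell_fn n (K n) (TT n h) x - h x\<bar> powr p \<le> (2 * B) powr p" for n
      proof (intro AE_I2 powr_mono2)
        fix x
        have "\<bar>cell_fn n (K n) (TT n h) x\<bar> \<le> B" using sample_bounded[OF hm h(2)] B by (simp add: cell_fn_def)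
        then show "\<bar>cell_fn n (K n) (TT n h) x - h x\<bar> \<le> 2 * B" using h(2)[of x] by linarith
      qed (use p in auto)
      show "AE x in MO. (\<lambda>n. cell_fn n (K n) (TT n h) x - h x) \<longlonglongrightarrow> 0"
        unfolding AE_Omega_iff
      proof (intro AE_I2 impI)
        fix x assume x: "x \<in> Omega"
        have "(\<lambda>n. TT n h (cell n x) - h x) \<longlonglongrightarrow> h x - h x" by (intro tendsto_intros sample_tendsto_continuous[OF h(1,2) x])
        moreover have "eventually (\<lambda>n. TT n h (cell n x) - h x = cell_fn n (K n) (TT n h) x - h x) sequentially"
          using K(2)[OF x] by eventually_elim (simp add: cell_fn_def)
        ultimately show "(\<lambda>n. cell_fn n (K n) (TT n h) x - h x) \<longlonglongrightarrow> 0" using Lim_transform_eventually by fastforce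
      qed
    qed simp
    then have 1: "eventually (\<lambda>n. Lp_int p (\<lambda>x. cell_fn n (K n) (TT n h) x - h x) < y / 64) sequentially" using y by (intro order_tendstoD(2)) auto
    have 2: "eventually (\<lambda>n. Lp_int p (\<lambda>x. g n x - G x) < \<epsilon>) sequentially" using \<epsilon> by (intro order_tendstoD(2)[OF g(3)])
    show "eventually (\<lambda>n. Lp_int p (\<lambda>x. cell_fn n (K n) (TT n (g n)) x - G x) < y) sequentially"
      using 1 2
    proof eventually_elim
      case (elim n)
      have s1: "Lp_int p (\<lambda>x. (g n x - G x) + (G x - h x)) \<le> 4 * (Lp_int p (\<lambda>x. g n x - G x) + Lp_int p (\<lambda>x. G x - h x))"
        by (intro Lp_add(2)[OF p] Lp_diff(1)[OF p] g hL)
      then have gh: "Lp_int p (\<lambda>x. g n x - h x) \<le> 8 * \<epsilon>" using elim h(3) by simp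
      have "Lp_int p (\<lambda>x. cell_fn n (K n) (TT n (g n)) x - cell_fn n (K n) (TT n h) x) = Lp_int p (cell_fn n (K n) (TT n (\<lambda>x. g n x - h x)))"
        by (rule arg_cong[of _ _ "Lp_int p"], rule ext) (simp add: cell_fn_def sample_diff[OF L1[OF g(1)] L1[OF hL]])
      also have "\<dots> \<le> overlap_bound * Lp_int p (\<lambda>x. g n x - h x)" by (intro contr Lp_diff(1)[OF p] g hL)
      also have "\<dots> \<le> overlap_bound * (8 * \<epsilon>)" by (intro mult_left_mono gh overlap_bound)
      also have "\<dots> \<le> y / 32" using \<epsilon>(2) by simp
      finally have a: "Lp_int p (\<lambda>x. cell_fn n (K n) (TT n (g n)) x - cell_fn n (K n) (TT n h) x) \<le> y / 32" .
      have hG: "Lp_int p (\<lambda>x. h x - G x) < \<epsilon>" using h(3) Lp_uminus(2)[of p "\<lambda>x. G x - h x"] by simp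
      have "Lp_int p (\<lambda>x. (cell_fn n (K n) (TT n (g n)) x - cell_fn n (K n) (TT n h) x) + ((cell_fn n (K n) (TT n h) x - h x) + (h x - G x))) \<le>
        4 * (Lp_int p (\<lambda>x. cell_fn n (K n) (TT n (g n)) x - cell_fn n (K n) (TT n h) x) + Lp_int p (\<lambda>x. (cell_fn n (K n) (TT n h) x - h x) + (h x - G x)))"
        by (intro Lp_add[OF p] Lp_diff(1)[OF p] g hL Pm)
      moreover have "Lp_int p (\<lambda>x. (cell_fn n (K n) (TT n h) x - h x) + (h x - G x)) \<le> 4 * (Lp_int p (\<lambda>x. cell_fn n (K n) (TT n h) x - h x) + Lp_int p (\<lambda>x. h x - G x))"
        by (intro Lp_add(2)[OF p] Lp_diff(1)[OF p] g hL Pm)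
      ultimately show ?case using a hG elim \<epsilon>(3) y by simp
    qed
  qed
qed
end

lemma Lp_abs_mono:
  assumes "p > 0" and f: "f \<in> borel_measurable MO" and g: "g \<in> Lp_space Omega p" and le: "\<And>x. \<bar>f x\<bar> \<le> \<bar>g x\<bar>"
  shows "f \<in> Lp_space Omega p" "Lp_int p f \<le> Lp_int p g"
  using Lp_dominated[OF f Lp_integrable[OF g], of p] powr_mono2[OF less_imp_le[OF assms(1)] abs_ge_zero le]
  by (auto simp: Lp_int_def)

lemma powr_inverse_powr: "p > 0 \<Longrightarrow> x \<ge> 0 \<Longrightarrow> (x powr (1 / p)) powr p = (x :: real)"
  by (simp add: powr_powr)

lemma arr_norm_powr: "p > 0 \<Longrightarrow> arr_norm n K p a powr p = (\<Sum>k\<in>K. \<bar>a k\<bar> powr p) / 4 ^ n"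
proof -
  assume p: "p > 0"
  have "2 powi (- 2 * int n) = (1 / 4 ^ n :: real)"
  proof -
    have "2 powi (- 2 * int n) = inverse (2 powi (int (2 * n)) :: real)" by (simp only: mult_minus_left power_int_minus) simp
    also have "\<dots> = 1 / 4 ^ n" by (simp only: power_int_of_nat power_mult) (simp add: inverse_eq_divide)
    finally show ?thesis .
  qed
  then show ?thesis unfolding arr_norm_def using p by (subst powr_inverse_powr) (auto intro!: divide_nonneg_nonneg sum_nonneg)
qed

lemma Lp_norm_powr: "p > 0 \<Longrightarrow> Lp_norm Omega p f powr p = Lp_int p f"
  unfolding Lp_norm_def by (subst powr_inverse_powr) (auto simp: Lp_int_def intro!: Bochner_Integration.integral_nonneg)

lemma L2_set_measurable [measurable (raw)]:
  assumes "\<And>i. i \<in> I \<Longrightarrow> f i \<in> borel_measurable M"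
  shows "(\<lambda>x. L2_set (\<lambda>i. f i x) I) \<in> borel_measurable M"
  unfolding L2_set_def using assms by measurable

lemma L2_set_Lp:
  assumes p: "1 \<le> p" "p \<le> 2" and I: "finite I" and f: "\<And>i. i \<in> I \<Longrightarrow> f i \<in> Lp_space Omega p"
  shows "(\<lambda>x. L2_set (\<lambda>i. f i x) I) \<in> Lp_space Omega p"
proof (rule Lp_abs_mono(1))
  show "(\<lambda>x. \<Sum>i\<in>I. \<bar>f i x\<bar>) \<in> Lp_space Omega p" by (intro Lp_sum[OF p I] Lp_abs f)
  show "(\<lambda>x. L2_set (\<lambda>i. f i x) I) \<in> borel_measurable MO" using f by (intro L2_set_measurable Lp_measurable)
  show "\<bar>L2_set (\<lambda>i. f i x) I\<bar> \<le> \<bar>\<Sum>i\<in>I. \<bar>f i x\<bar>\<bar>" for x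
    using L2_set_le_sum_abs[of "\<lambda>i. f i x" I] by (simp add: abs_of_nonneg L2_set_nonneg sum_nonneg)
qed (use p in auto)

lemma L2_set_diff_le: "\<bar>L2_set f I - L2_set g I\<bar> \<le> (\<Sum>i\<in>I. \<bar>f i - g i\<bar>)"
proof -
  have "L2_set f I \<le> L2_set (\<lambda>i. f i - g i) I + L2_set g I" using L2_set_triangle_ineq[of "\<lambda>i. f i - g i" g I] by simp
  moreover have "L2_set g I \<le> L2_set (\<lambda>i. g i - f i) I + L2_set f I" using L2_set_triangle_ineq[of "\<lambda>i. g i - f i" f I] by simp
  moreover have "L2_set (\<lambda>i. g i - f i) I = L2_set (\<lambda>i. f i - g i) I" unfolding L2_set_def by (simp add: power2_commute)
  moreover have "L2_set (\<lambda>i. f i - g i) I \<le> (\<Sum>i\<in>I. \<bar>f i - g i\<bar>)" by (rule L2_set_le_sum_abs)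
  ultimately show ?thesis by linarith
qed

text \<open>The Euclidean norm changes by at most the sum of the componentwise differences, so
  convergence of the components passes to the pointwise norm. Since cell functions reproduce array
  norms, convergence of the p-th powers follows from convergence in L_p.\<close>

lemma arr_vnorm_tendsto:
  assumes p: "1 \<le> p" "p \<le> 2" and I: "finite I"
    and K: "\<And>n. K n \<subseteq> {0..<2 ^ n} \<times> {0..<2 ^ n}"
    and G: "\<And>i. i \<in> I \<Longrightarrow> G i \<in> Lp_space Omega p"
    and lim: "\<And>i. i \<in> I \<Longrightarrow> (\<lambda>n. Lp_int p (\<lambda>x. cell_fn n (K n) (a n i) x - G i x)) \<longlonglongrightarrow> 0"
  shows "(\<lambda>n. arr_vnorm n (K n) p I (a n) powr p) \<longlonglongrightarrow> Lp_vnorm Omega p I G powr p"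
proof -
  let ?F = "\<lambda>n x. L2_set (\<lambda>i. cell_fn n (K n) (a n i) x) I"
  let ?G = "\<lambda>x. L2_set (\<lambda>i. G i x) I"
  have PL: "cell_fn n (K n) t \<in> Lp_space Omega p" for n t by (rule cell_fn_Lp(1)[OF K p(1)])
  have F: "?F n \<in> Lp_space Omega p" for n by (intro L2_set_Lp[OF p I] PL)
  have GL: "?G \<in> Lp_space Omega p" by (intro L2_set_Lp[OF p I] G)
  have s: "(\<lambda>n. Lp_int p (\<lambda>x. \<Sum>i\<in>I. \<bar>cell_fn n (K n) (a n i) x - G i x\<bar>)) \<longlonglongrightarrow> 0"
  proof (rule Lp_int_sum_tendsto_zero[OF p I])
    show "(\<lambda>x. \<bar>cell_fn n (K n) (a n i) x - G i x\<bar>) \<in> Lp_space Omega p" if "i \<in> I" for i n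
      by (intro Lp_abs Lp_diff[OF p] PL G that)
    show "(\<lambda>n. Lp_int p (\<lambda>x. \<bar>cell_fn n (K n) (a n i) x - G i x\<bar>)) \<longlonglongrightarrow> 0" if "i \<in> I" for i
      using lim[OF that] by (simp add: Lp_abs(2))
  qed
  have "(\<lambda>n. Lp_int p (\<lambda>x. ?F n x - ?G x)) \<longlonglongrightarrow> 0"
  proof (rule tendsto_sandwich[OF _ _ tendsto_const s])
    show "eventually (\<lambda>n. Lp_int p (\<lambda>x. ?F n x - ?G x) \<le> Lp_int p (\<lambda>x. \<Sum>i\<in>I. \<bar>cell_fn n (K n) (a n i) x - G i x\<bar>)) sequentially"
    proof (intro always_eventually allI Lp_abs_mono(2))
      show "(\<lambda>x. \<Sum>i\<in>I. \<bar>cell_fn n (K n) (a n i) x - G i x\<bar>) \<in> Lp_space Omega p" for n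
        by (intro Lp_sum[OF p I] Lp_abs Lp_diff[OF p] PL G)
      show "(\<lambda>x. ?F n x - ?G x) \<in> borel_measurable MO" for n by (intro Lp_measurable[where p = p] Lp_diff[OF p] F GL)
      show "\<bar>?F n x - ?G x\<bar> \<le> \<bar>\<Sum>i\<in>I. \<bar>cell_fn n (K n) (a n i) x - G i x\<bar>\<bar>" for n x
        using L2_set_diff_le[of "\<lambda>i. cell_fn n (K n) (a n i) x" I "\<lambda>i. G i x"] by (simp add: abs_of_nonneg sum_nonneg)
    qed (use p in auto)
  qed (auto intro!: always_eventually Lp_int_nonneg)
  from Lp_int_tendsto[OF p F GL this] have "(\<lambda>n. Lp_int p (?F n)) \<longlonglongrightarrow> Lp_int p ?G" .
  moreover have "Lp_int p (?F n) = arr_vnorm n (K n) p I (a n) powr p" for n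
  proof -
    have "?F n = cell_fn n (K n) (\<lambda>k. L2_set (\<lambda>i. a n i k) I)"
    proof (rule ext)
      fix x show "?F n x = cell_fn n (K n) (\<lambda>k. L2_set (\<lambda>i. a n i k) I) x"
        by (cases "cell n x \<in> K n") (simp_all add: cell_fn_def L2_set_def)
    qed
    then show ?thesis using cell_fn_Lp(2)[OF K p(1)] p by (simp add: arr_vnorm_def arr_norm_powr)
  qed
  moreover have "Lp_int p ?G = Lp_vnorm Omega p I G powr p" using p by (simp add: Lp_vnorm_def Lp_norm_powr)
  ultimately show ?thesis by simp
qed

section \<open>Uniform boundedness on L_2\<close>

lemma L2_series:
  fixes z :: "nat \<Rightarrow> fn"
  assumes z: "\<And>i. z i \<in> Lp_space Omega 2" and c: "c \<ge> 0" "\<And>i. Lp_int 2 (z i) \<le> c / 16 ^ Suc i"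
  shows "AE x in MO. summable (\<lambda>i. z i x)" "(\<lambda>x. \<Sum>i. z i x) \<in> Lp_space Omega 2" "Lp_int 2 (\<lambda>x. \<Sum>i. z i x) \<le> c"
proof -
  have zm[measurable]: "z i \<in> borel_measurable MO" for i using z by (rule Lp_measurable)
  have z2: "integrable MO (\<lambda>x. (z i x)\<^sup>2)" "Lp_int 2 (z i) = (LINT x|MO. (z i x)\<^sup>2)" for i
    using Lp_integrable[OF z[of i]] by (auto simp: Lp_int_def)
  \<comment> \<open>The reciprocals of the weights 2^(i+1) have sum at most 1, so Cauchy-Schwarz
    bounds the square of a partial sum by the sum of the \<open>h i\<close>. Their integrals are at
    most c / 8^(i+1), with sum c/7, so the sum of the \<open>h i\<close> is finite almost
    everywhere.\<close>
  define h where "h i x = 2 ^ Suc i * (z i x)\<^sup>2" for i x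
  have hn: "h i x \<ge> 0" for i x by (simp add: h_def)
  have hi: "integrable MO (h i)" for i unfolding h_def[abs_def] using z2 by auto
  have geo: "(\<lambda>i. c / 8 ^ Suc i) sums (c / 7)"
    using sums_mult[OF geometric_sums[of "1 / 8 :: real"], of "c / 8"] by (simp add: power_divide field_simps)
  have "(\<integral>\<^sup>+x. (\<Sum>i. ennreal (h i x)) \<partial>MO) = (\<Sum>i. \<integral>\<^sup>+x. ennreal (h i x) \<partial>MO)"
    by (rule nn_integral_suminf) (auto simp: h_def)
  also have "\<dots> \<le> (\<Sum>i. ennreal (c / 8 ^ Suc i))"
  proof (intro suminf_le allI)
    fix i
    have "(\<integral>\<^sup>+x. ennreal (h i x) \<partial>MO) = ennreal (LINT x|MO. h i x)" using hi hn by (intro nn_integral_eq_integral) auto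
    also have "(LINT x|MO. h i x) = 2 ^ Suc i * Lp_int 2 (z i)" unfolding h_def z2 by simp
    also have "\<dots> \<le> 2 ^ Suc i * (c / 16 ^ Suc i)" by (intro mult_left_mono c) auto
    also have "\<dots> = c / 8 ^ Suc i"
    proof -
      have "(16::real) ^ Suc i = 2 ^ Suc i * 8 ^ Suc i" by (simp only: power_mult_distrib[symmetric]) simp
      then show ?thesis by simp
    qed
    finally show "(\<integral>\<^sup>+x. ennreal (h i x) \<partial>MO) \<le> ennreal (c / 8 ^ Suc i)" by (simp add: ennreal_leI)
  qed auto
  also have "\<dots> = ennreal (c / 7)" using geo c by (subst suminf_ennreal2) (auto simp: sums_iff)
  finally have H: "(\<integral>\<^sup>+x. (\<Sum>i. ennreal (h i x)) \<partial>MO) \<le> ennreal (c / 7)" .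
  then have "(\<integral>\<^sup>+x. (\<Sum>i. ennreal (h i x)) \<partial>MO) \<noteq> \<infinity>" by (auto simp: top_unique)
  then have "AE x in MO. (\<Sum>i. ennreal (h i x)) \<noteq> \<infinity>"
    by (intro nn_integral_PInf_AE) (auto simp: h_def)
  then have AEh: "AE x in MO. summable (\<lambda>i. h i x)"
  proof eventually_elim
    case (elim x)
    then show ?case using summable_suminf_not_top[of "\<lambda>i. h i x"] hn by simp
  qed
  have CS: "(\<Sum>i<n. \<bar>z i x\<bar>)\<^sup>2 \<le> (\<Sum>i<n. h i x)" for n x
  proof -
    have "(\<Sum>i<n. \<bar>z i x\<bar>)\<^sup>2 = (\<Sum>i<n. sqrt (1 / 2 ^ Suc i) * (sqrt (2 ^ Suc i) * \<bar>z i x\<bar>))\<^sup>2"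
      by (simp add: mult.assoc[symmetric] real_sqrt_mult[symmetric] del: power_Suc)
    also have "\<dots> \<le> (\<Sum>i<n. (sqrt (1 / 2 ^ Suc i))\<^sup>2) * (\<Sum>i<n. (sqrt (2 ^ Suc i) * \<bar>z i x\<bar>)\<^sup>2)"
      by (rule Cauchy_Schwarz_ineq_sum)
    also have "(\<Sum>i<n. (sqrt (2 ^ Suc i) * \<bar>z i x\<bar>)\<^sup>2) = (\<Sum>i<n. h i x)"
      by (simp add: h_def power_mult_distrib del: power_Suc)
    also have "(\<Sum>i<n. (sqrt (1 / 2 ^ Suc i))\<^sup>2) = 1 - 1 / (2::real) ^ n"
      by (induction n) (auto simp: field_simps)
    also have "(1 - 1 / 2 ^ n) * (\<Sum>i<n. h i x) \<le> 1 * (\<Sum>i<n. h i x)"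
      by (intro mult_right_mono sum_nonneg hn) auto
    finally show ?thesis by simp
  qed
  have key: "summable (\<lambda>i. \<bar>z i x\<bar>) \<and> (\<Sum>i. z i x)\<^sup>2 \<le> (\<Sum>i. h i x)" if "summable (\<lambda>i. h i x)" for x
  proof -
    have b: "(\<Sum>i<n. \<bar>z i x\<bar>) \<le> sqrt (\<Sum>i. h i x)" for n
    proof (rule real_le_rsqrt)
      have "(\<Sum>i<n. h i x) \<le> (\<Sum>i. h i x)" using that hn by (intro sum_le_suminf) auto
      with CS[of x n] show "(\<Sum>i<n. \<bar>z i x\<bar>)\<^sup>2 \<le> (\<Sum>i. h i x)" by linarith
    qed
    have s: "summable (\<lambda>i. \<bar>z i x\<bar>)" by (rule summableI_nonneg_bounded[OF _ b]) simp
    have "\<bar>\<Sum>i. z i x\<bar> \<le> (\<Sum>i. \<bar>z i x\<bar>)" by (rule summable_rabs[OF s])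
    also have "\<dots> \<le> sqrt (\<Sum>i. h i x)" using b s by (intro suminf_le_const) auto
    finally have "(\<bar>\<Sum>i. z i x\<bar>)\<^sup>2 \<le> (sqrt (\<Sum>i. h i x))\<^sup>2" by (intro power_mono) auto
    then show ?thesis using s suminf_nonneg[OF that hn] by simp
  qed
  show "AE x in MO. summable (\<lambda>i. z i x)" 
    using AEh
  proof eventually_elim
    case (elim x)
    then show ?case using key[of x] summable_rabs_cancel[of "\<lambda>i. z i x"] by blast
  qed
  have Ym: "(\<lambda>x. \<Sum>i. z i x) \<in> borel_measurable MO" by measurable
  have "(\<integral>\<^sup>+x. ennreal ((\<Sum>i. z i x)\<^sup>2) \<partial>MO) \<le> (\<integral>\<^sup>+x. (\<Sum>i. ennreal (h i x)) \<partial>MO)"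
  proof (rule nn_integral_mono_AE)
    show "AE x in MO. ennreal ((\<Sum>i. z i x)\<^sup>2) \<le> (\<Sum>i. ennreal (h i x))"
      using AEh
    proof eventually_elim
      case (elim x)
      have "(\<Sum>i. ennreal (h i x)) = ennreal (\<Sum>i. h i x)" by (rule suminf_ennreal2[OF hn elim])
      then show ?case using key[OF elim] by (simp add: ennreal_leI)
    qed
  qed
  then have N: "(\<integral>\<^sup>+x. ennreal ((\<Sum>i. z i x)\<^sup>2) \<partial>MO) \<le> ennreal (c / 7)" using H by (rule order_trans)
  have i: "integrable MO (\<lambda>x. (\<Sum>i. z i x)\<^sup>2)"
    by (rule integrableI_nonneg) (use Ym N in \<open>auto simp: top_unique less_top[symmetric]\<close>)
  then show "(\<lambda>x. \<Sum>i. z i x) \<in> Lp_space Omega 2" using Ym by (simp add: Lp_space_def)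
  have "ennreal (LINT x|MO. (\<Sum>i. z i x)\<^sup>2) \<le> ennreal (c / 7)"
    using N nn_integral_eq_integral[OF i] by simp
  then have "(LINT x|MO. (\<Sum>i. z i x)\<^sup>2) \<le> c / 7" using c by (simp add: ennreal_le_iff)
  then show "Lp_int 2 (\<lambda>x. \<Sum>i. z i x) \<le> c" using c by (simp add: Lp_int_def)
qed

text \<open>
  The gliding hump argument, so that only summability of one explicit series is needed and no
  quotient by almost everywhere equality.
\<close>

lemma L2_pointwise_bounded_seminorms_tendsto_zero:
  fixes S :: "nat \<Rightarrow> fn \<Rightarrow> real" and w :: "nat \<Rightarrow> fn"
  assumes nn: "\<And>n f. S n f \<ge> 0"
    and add: "\<And>n f g. f \<in> Lp_space Omega 2 \<Longrightarrow> g \<in> Lp_space Omega 2 \<Longrightarrow> S n (\<lambda>x. f x + g x) \<le> S n f + S n g"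
    and scale: "\<And>n f c. f \<in> Lp_space Omega 2 \<Longrightarrow> S n (\<lambda>x. c * f x) = \<bar>c\<bar> * S n f"
    and bounded: "\<And>n. \<exists>L. \<forall>f\<in>Lp_space Omega 2. (S n f)\<^sup>2 \<le> L * Lp_int 2 f"
    and pointwise: "\<And>f. f \<in> Lp_space Omega 2 \<Longrightarrow> \<exists>B. \<forall>n. S n f \<le> B"
    and w: "\<And>n. w n \<in> Lp_space Omega 2" "(\<lambda>n. Lp_int 2 (w n)) \<longlonglongrightarrow> 0"
  shows "(\<lambda>n. S n (w n)) \<longlonglongrightarrow> 0"
proof (rule ccontr)
  let ?L = "Lp_space Omega 2"
  have p2: "(1::real) \<le> 2" "(2::real) \<le> 2" by auto
  assume "\<not> (\<lambda>n. S n (w n)) \<longlonglongrightarrow> 0"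
  then obtain \<epsilon> where \<epsilon>: "\<epsilon> > 0" "\<And>N. \<exists>n\<ge>N. S n (w n) \<ge> \<epsilon>"
    unfolding LIMSEQ_iff using nn by (auto simp: not_less abs_of_nonneg)
  \<comment> \<open>A state consists of a partial sum, the index of a seminorm and a tolerance. A
    step changes the sum by little compared with the old tolerance, makes the new seminorm of the
    new sum at least \<open>k\<close>, and chooses the new tolerance such that later changes move
    this seminorm by at most 1.\<close>
  define R where "R k s s' \<longleftrightarrow> (case (s, s') of ((x, n, \<delta>), (x', n', \<delta>')) \<Rightarrow>
     (\<lambda>t. x' t - x t) \<in> ?L \<and> Lp_int 2 (\<lambda>t. x' t - x t) \<le> \<delta> / 16 \<and> \<delta>' \<le> \<delta> / 16 \<and> real k \<le> S n' x' \<and>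
     (\<forall>y\<in>?L. Lp_int 2 y \<le> \<delta>' \<longrightarrow> S n' y \<le> 1))" for k and s s' :: "fn \<times> nat \<times> real"
  define P where "P s \<longleftrightarrow> (case s of (x, n, \<delta>) \<Rightarrow> x \<in> ?L \<and> \<delta> > 0)" for s :: "fn \<times> nat \<times> real"
  have step: "\<exists>s'. P s' \<and> R k s s'" if "P s" for s k
  proof -
    obtain x n \<delta> where s: "s = (x, n, \<delta>)" by (cases s) auto
    have x: "x \<in> ?L" and \<delta>: "\<delta> > 0" using that by (auto simp: P_def s)
    \<comment> \<open>Scales \<open>w n'\<close>, whose seminorm is at least
      \<open>\<epsilon>\<close>, to seminorm at least \<open>k\<close>; the index \<open>n'\<close>
      is taken so late that the scaled function is still small.\<close>
    define A where "A = real k / \<epsilon>"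
    have "(\<lambda>n. A\<^sup>2 * Lp_int 2 (w n)) \<longlonglongrightarrow> A\<^sup>2 * 0" by (intro tendsto_intros w)
    then have "eventually (\<lambda>n. A\<^sup>2 * Lp_int 2 (w n) < \<delta> / 16) sequentially" using \<delta> by (intro order_tendstoD(2)) auto
    then obtain N where N: "\<And>n. n \<ge> N \<Longrightarrow> A\<^sup>2 * Lp_int 2 (w n) < \<delta> / 16" by (auto simp: eventually_sequentially)
    obtain n' where n': "n' \<ge> N" "S n' (w n') \<ge> \<epsilon>" using \<epsilon>(2) by blast
    define z where "z = (\<lambda>t. A * w n' t)"
    have z: "z \<in> ?L" "Lp_int 2 z \<le> \<delta> / 16" using Lp_cmult[OF w(1)[of n'], of A] N[OF n'(1)] by (auto simp: z_def)
    have Sz: "S n' z \<ge> real k"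
    proof -
      have "A \<ge> 0" using \<epsilon> by (simp add: A_def)
      have "real k = A * \<epsilon>" using \<epsilon> by (simp add: A_def)
      also have "\<dots> \<le> A * S n' (w n')" by (intro mult_left_mono n' \<open>A \<ge> 0\<close>)
      finally show ?thesis using scale[OF w(1)[of n'], of n' A] \<open>A \<ge> 0\<close> by (simp add: z_def)
    qed
    have mz: "(\<lambda>t. - z t) \<in> ?L" "Lp_int 2 (\<lambda>t. - z t) \<le> \<delta> / 16" using Lp_uminus(1)[OF z(1)] z by (auto simp: Lp_uminus(2))
    have mx: "(\<lambda>t. - 1 * (x t - z t)) \<in> ?L" "(\<lambda>t. x t - z t) \<in> ?L" "(\<lambda>t. x t + z t) \<in> ?L"
      using Lp_diff(1)[OF p2 x z(1)] Lp_add(1)[OF p2 x z(1)] Lp_uminus(1)[OF Lp_diff(1)[OF p2 x z(1)]] by auto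
    \<comment> \<open>Twice \<open>z\<close> is the difference of x + z and x - z, so one of the two
      has at least the seminorm of \<open>z\<close>. Choosing the sign accordingly prevents
      cancellation with what was built before.\<close>
    have "2 * S n' z = S n' (\<lambda>t. (x t + z t) + (- 1 * (x t - z t)))"
      using scale[OF z(1), of n' 2] by (simp add: algebra_simps)
    also have "\<dots> \<le> S n' (\<lambda>t. x t + z t) + S n' (\<lambda>t. - 1 * (x t - z t))" by (intro add mx)
    also have "S n' (\<lambda>t. - 1 * (x t - z t)) = S n' (\<lambda>t. x t - z t)" using scale[OF mx(2), of n' "-1"] by simp
    finally have "S n' (\<lambda>t. x t + z t) \<ge> S n' z \<or> S n' (\<lambda>t. x t - z t) \<ge> S n' z" by linarith
    then obtain x' where x': "x' \<in> ?L" "(\<lambda>t. x' t - x t) \<in> ?L" "Lp_int 2 (\<lambda>t. x' t - x t) \<le> \<delta> / 16" "real k \<le> S n' x'"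
    proof
      assume "S n' z \<le> S n' (\<lambda>t. x t + z t)"
      with that[of "\<lambda>t. x t + z t"] mx z Sz show thesis by simp
    next
      assume "S n' z \<le> S n' (\<lambda>t. x t - z t)"
      with that[of "\<lambda>t. x t - z t"] mx mz Sz show thesis by simp
    qed
    obtain L where L: "\<And>f. f \<in> ?L \<Longrightarrow> (S n' f)\<^sup>2 \<le> L * Lp_int 2 f" using bounded[of n'] by blast
    \<comment> \<open>Continuity of the single seminorm with index \<open>n'\<close> provides a ball
      on which it is at most 1.\<close>
    define \<delta>' where "\<delta>' = min (\<delta> / 16) (1 / (\<bar>L\<bar> + 1))"
    have "S n' y \<le> 1" if "y \<in> ?L" "Lp_int 2 y \<le> \<delta>'" for y
    proof -
      have "(S n' y)\<^sup>2 \<le> L * Lp_int 2 y" by (rule L[OF that(1)])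
      also have "\<dots> \<le> (\<bar>L\<bar> + 1) * (1 / (\<bar>L\<bar> + 1))" using that(2) by (intro mult_mono) (auto simp: \<delta>'_def Lp_int_nonneg)
      also have "\<dots> = 1" by (simp add: add_nonneg_eq_0_iff)
      finally have "(S n' y)\<^sup>2 \<le> 1\<^sup>2" by simp
      then show ?thesis by (rule power2_le_imp_le) simp
    qed
    then have "P (x', n', \<delta>') \<and> R k s (x', n', \<delta>')"
      using x' \<delta> by (auto simp: P_def R_def s \<delta>'_def)
    then show ?thesis by blast
  qed
  have "\<exists>f. \<forall>k. P (f k) \<and> R k (f k) (f (Suc k))"
  proof (rule dependent_nat_choice)
    show "\<exists>s. P s" by (rule exI[of _ "(\<lambda>x. 0, 0, 1)"]) (auto simp: P_def Lp_zero)
    show "\<exists>s'. P s' \<and> R k s s'" if "P s" for s k using step[OF that] .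
  qed
  then obtain f where f: "\<And>k. P (f k)" "\<And>k. R k (f k) (f (Suc k))" by blast
  define x where "x k = fst (f k)" for k
  define m where "m k = fst (snd (f k))" for k
  define \<delta> where "\<delta> k = snd (snd (f k))" for k
  have feq: "f k = (x k, m k, \<delta> k)" for k by (simp add: x_def m_def \<delta>_def)
  have xL: "x k \<in> ?L" and \<delta>0: "\<delta> k > 0" for k using f(1)[of k] by (auto simp: P_def feq)
  define d where "d i = (\<lambda>t. x (Suc i) t - x i t)" for i
  have dL: "d k \<in> ?L" and dI: "Lp_int 2 (d k) \<le> \<delta> k / 16" and \<delta>S: "\<delta> (Suc k) \<le> \<delta> k / 16"
    and big: "real k \<le> S (m (Suc k)) (x (Suc k))"
    and small: "\<And>y. y \<in> ?L \<Longrightarrow> Lp_int 2 y \<le> \<delta> (Suc k) \<Longrightarrow> S (m (Suc k)) y \<le> 1" for k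
    using f(2)[of k] by (auto simp: R_def feq d_def)
  have \<delta>pow: "\<delta> (k + i) \<le> \<delta> k / 16 ^ i" for k i
  proof (induction i)
    case (Suc i)
    have "\<delta> (k + Suc i) \<le> \<delta> (k + i) / 16" using \<delta>S[of "k + i"] by simp
    also have "\<dots> \<le> (\<delta> k / 16 ^ i) / 16" using Suc by (intro divide_right_mono) auto
    finally show ?case by (simp add: field_simps)
  qed simp
  have dI2: "Lp_int 2 (d (i + k)) \<le> \<delta> k / 16 ^ Suc i" for i k
  proof -
    have "Lp_int 2 (d (i + k)) \<le> \<delta> (k + i) / 16" using dI[of "k + i"] by (simp add: add.commute)
    also have "\<dots> \<le> (\<delta> k / 16 ^ i) / 16" by (intro divide_right_mono \<delta>pow) simp
    finally show ?thesis by (simp add: mult.commute)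
  qed
  \<comment> \<open>Starting the series at \<open>k\<close> shows that every tail, not just the full
    series, stays within the tolerance \<open>\<delta> k\<close>.\<close>
  note ser = L2_series[of "\<lambda>i. d (i + k)" "\<delta> k" for k, OF dL less_imp_le[OF \<delta>0] dI2]
  define X where "X = (\<lambda>t. x 0 t + (\<Sum>i. d i t))"
  have XL: "X \<in> ?L" unfolding X_def using Lp_add(1)[OF p2 xL ser(2)[of 0]] by simp
  have tel: "(\<Sum>i<k. d i t) = x k t - x 0 t" for k t unfolding d_def by (rule sum_lessThan_telescope)
  have tail: "AE t in MO. (\<Sum>i. d (i + k) t) = X t - x k t" for k
    using ser(1)[of 0]
  proof eventually_elim
    case (elim t)
    have "(\<Sum>i. d i t) = (\<Sum>i. d (i + k) t) + (\<Sum>i<k. d i t)"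
      by (rule suminf_split_initial_segment) (use elim in simp)
    then show ?case by (simp add: X_def tel)
  qed
  have XxL: "(\<lambda>t. X t - x k t) \<in> ?L" for k by (rule Lp_diff(1)[OF p2 XL xL])
  have XxI: "Lp_int 2 (\<lambda>t. X t - x k t) \<le> \<delta> k" for k
    using ser(3)[of k] Lp_int_AE_cong[OF tail[of k] Lp_measurable[OF ser(2)[of k]] Lp_measurable[OF XxL], of 2] by simp
  \<comment> \<open>All later humps together are within the tolerance, so they reduce the seminorm
    of \<open>x (Suc k)\<close> by at most 1. The seminorms of \<open>X\<close> are then
    unbounded.\<close>
  have "real k \<le> S (m (Suc k)) X + 1" for k
  proof -
    have "S (m (Suc k)) (x (Suc k)) = S (m (Suc k)) (\<lambda>t. X t + (- 1) * (X t - x (Suc k) t))" by simp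
    also have "\<dots> \<le> S (m (Suc k)) X + S (m (Suc k)) (\<lambda>t. (- 1) * (X t - x (Suc k) t))"
      by (rule add[OF XL]) (rule Lp_cmult(1)[OF XxL])
    also have "S (m (Suc k)) (\<lambda>t. (- 1) * (X t - x (Suc k) t)) = S (m (Suc k)) (\<lambda>t. X t - x (Suc k) t)"
      using scale[OF XxL, of "m (Suc k)" "-1"] by simp
    also have "\<dots> \<le> 1" by (rule small[OF XxL XxI])
    finally show ?thesis using big[of k] by linarith
  qed
  moreover obtain B where "\<And>n. S n X \<le> B" using pointwise[OF XL] by blast
  ultimately have "real k \<le> B + 1" for k by (meson add_right_mono order_trans)
  then show False using reals_Archimedean2[of "B + 1"] by (meson not_less)
qed

text \<open>Any two values differ by at most the total variation; averaging over the second one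
  leaves the mean. This is the one-dimensional embedding into bounded functions.\<close>

lemma abs_le_average_plus_variation:
  fixes b :: "nat \<Rightarrow> real"
  assumes "i < L"
  shows "\<bar>b i\<bar> \<le> (\<Sum>l<L. \<bar>b l\<bar>) / real L + (\<Sum>l<L - 1. \<bar>b (Suc l) - b l\<bar>)"
proof -
  let ?D = "\<Sum>l<L - 1. \<bar>b (Suc l) - b l\<bar>"
  have up: "\<bar>b j - b l\<bar> \<le> (\<Sum>t\<in>{l..<j}. \<bar>b (Suc t) - b t\<bar>)" if "l \<le> j" for l j
    using that
  proof (induction j rule: dec_induct)
    case (step j)
    have "\<bar>b (Suc j) - b l\<bar> \<le> \<bar>b (Suc j) - b j\<bar> + \<bar>b j - b l\<bar>" by linarith
    also have "\<dots> \<le> \<bar>b (Suc j) - b j\<bar> + (\<Sum>t\<in>{l..<j}. \<bar>b (Suc t) - b t\<bar>)" using step by simp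
    finally show ?case using step by simp
  qed simp
  have D: "\<bar>b j - b l\<bar> \<le> ?D" if "l \<le> j" "j < L" for l j
  proof -
    have "(\<Sum>t\<in>{l..<j}. \<bar>b (Suc t) - b t\<bar>) \<le> ?D" by (rule sum_mono2) (use that in auto)
    with up[OF that(1)] show ?thesis by linarith
  qed
  have "\<bar>b i\<bar> \<le> \<bar>b l\<bar> + ?D" if "l < L" for l
    using D[of l i] D[of i l] assms that by (cases "l \<le> i") auto
  then have "(\<Sum>l<L. \<bar>b i\<bar>) \<le> (\<Sum>l<L. \<bar>b l\<bar> + ?D)" by (intro sum_mono) auto
  then have "real L * \<bar>b i\<bar> \<le> (\<Sum>l<L. \<bar>b l\<bar>) + real L * ?D" by (simp add: sum.distrib)
  then show ?thesis using assms by (simp add: field_simps)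
qed

section \<open>Sobolev embedding\<close>

text \<open>The argument of Gagliardo: an entry is bounded by a quantity that depends on its second
  index only and by one that depends on its first index only. The sum of the squares is thus at most
  a product of two single sums.\<close>

lemma discrete_sobolev:
  fixes a :: "nat \<Rightarrow> nat \<Rightarrow> real"
  assumes "L > 0"
  shows "(\<Sum>i<L. \<Sum>j<L. (a i j)\<^sup>2) \<le>
    ((\<Sum>i<L. \<Sum>j<L. \<bar>a i j\<bar>) / real L + (\<Sum>i<L - 1. \<Sum>j<L. \<bar>a (Suc i) j - a i j\<bar>)) *
    ((\<Sum>i<L. \<Sum>j<L. \<bar>a i j\<bar>) / real L + (\<Sum>i<L. \<Sum>j<L - 1. \<bar>a i (Suc j) - a i j\<bar>))"
proof -
  define \<alpha> where "\<alpha> j = (\<Sum>l<L. \<bar>a l j\<bar>) / real L + (\<Sum>l<L - 1. \<bar>a (Suc l) j - a l j\<bar>)" for j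
  define \<beta> where "\<beta> i = (\<Sum>l<L. \<bar>a i l\<bar>) / real L + (\<Sum>l<L - 1. \<bar>a i (Suc l) - a i l\<bar>)" for i
  have nn: "\<alpha> j \<ge> 0" "\<beta> i \<ge> 0" for i j by (auto simp: \<alpha>_def \<beta>_def intro!: add_nonneg_nonneg sum_nonneg divide_nonneg_nonneg)
  have "(a i j)\<^sup>2 \<le> \<beta> i * \<alpha> j" if "i < L" "j < L" for i j
  proof -
    have "\<bar>a i j\<bar> \<le> \<alpha> j" "\<bar>a i j\<bar> \<le> \<beta> i"
      using abs_le_average_plus_variation[OF that(1), of "\<lambda>l. a l j"] abs_le_average_plus_variation[OF that(2), of "\<lambda>l. a i l"]
      by (auto simp: \<alpha>_def \<beta>_def)
    then have "\<bar>a i j\<bar> * \<bar>a i j\<bar> \<le> \<beta> i * \<alpha> j" by (intro mult_mono nn) auto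
    then show ?thesis by (simp add: power2_eq_square)
  qed
  then have "(\<Sum>i<L. \<Sum>j<L. (a i j)\<^sup>2) \<le> (\<Sum>i<L. \<Sum>j<L. \<beta> i * \<alpha> j)" by (intro sum_mono) auto
  also have "\<dots> = (\<Sum>j<L. \<Sum>i<L. \<beta> i * \<alpha> j)" by (rule sum.swap)
  also have "\<dots> = (\<Sum>j<L. \<alpha> j) * (\<Sum>i<L. \<beta> i)" by (simp add: sum_product mult.commute)
  also have "(\<Sum>j<L. \<alpha> j) = (\<Sum>i<L. \<Sum>j<L. \<bar>a i j\<bar>) / real L + (\<Sum>i<L - 1. \<Sum>j<L. \<bar>a (Suc i) j - a i j\<bar>)"
    unfolding \<alpha>_def sum.distrib sum_divide_distrib[symmetric] by (intro arg_cong2[of _ _ _ _ "(+)"] arg_cong2[of _ _ _ _ "(/)"] sum.swap refl)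
  also have "(\<Sum>i<L. \<beta> i) = (\<Sum>i<L. \<Sum>j<L. \<bar>a i j\<bar>) / real L + (\<Sum>i<L. \<Sum>j<L - 1. \<bar>a i (Suc j) - a i j\<bar>)"
    unfolding \<beta>_def sum.distrib sum_divide_distrib[symmetric] ..
  finally show ?thesis .
qed

text \<open>The difference of two neighbouring hat kernels is, up to sign and the factor 2^n, the
  derivative of a kernel with one more box convolution in that variable. The bounds with 3
  accommodate the support of the quadratic spline.\<close>

lemma sample_difference:
  assumes u: "integrable MO u" and g: "integrable MO g" and k: "0 \<le> k1" "k1 + 3 \<le> 2 ^ n" "0 \<le> k2" "k2 + 3 \<le> 2 ^ n"
  shows "is_weak_deriv Omega (1, 0) u g \<Longrightarrow> sample 0 1 0 1 0 n u (k1 + 1, k2) - sample 0 1 0 1 0 n u (k1, k2) = (1 / 2 ^ n) * sample 0 2 0 1 0 n g (k1, k2)"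
    and "is_weak_deriv Omega (0, 1) u g \<Longrightarrow> sample 0 1 0 1 0 n u (k1, k2 + 1) - sample 0 1 0 1 0 n u (k1, k2) = (1 / 2 ^ n) * sample 0 1 0 2 0 n g (k1, k2)"
proof -
  let ?F = "\<lambda>j r. spline_chain 1 (2 ^ n) (- of_int j) 0 1 r"
  have kr: "real_of_int (k1 + 3) \<le> of_int (2 ^ n)" "real_of_int (k2 + 3) \<le> of_int (2 ^ n)" using k unfolding of_int_le_iff by auto
  have zero: "?F j r i x = 0" if "i \<le> r" "r \<le> 1" "0 \<le> j" "j + 3 \<le> 2 ^ n" "x \<notin> {0..1}" for j r i x
  proof (rule spline_chain_zero[OF that(1)])
    have jr: "real_of_int (j + 3) \<le> of_int (2 ^ n)" "real_of_int 0 \<le> real_of_int j" using that unfolding of_int_le_iff by auto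
    have "x < 0 \<or> x > 1" using that(5) by auto
    then have "2 ^ n * x < 0 \<or> 2 ^ n * x > 2 ^ n * 1" by (simp only: mult_less_cancel_left_pos mult_less_0_iff zero_less_power zero_less_numeral) auto
    then have "2 ^ n * x < 0 \<or> 2 ^ n * x > 2 ^ n" by (simp only: mult_1_right)
    moreover have "real_of_int j + 3 \<le> 2 ^ n" "0 \<le> real_of_int j" "real r \<le> 1" using jr that(2) by simp_all
    moreover have "real (0 + 1 + r + 1) = real r + 2" by simp
    ultimately show "2 ^ n * x + - of_int j \<notin> {0..real (0 + 1 + r + 1)}" unfolding atLeastAtMost_iff by linarith
  qed
  have F1: "?F j 1 1 x = 2 ^ n * (mask_spline 1 0 (2 ^ n * x - of_int j) - mask_spline 1 0 (2 ^ n * x - of_int (j + 1)))" for j x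
    by (simp add: spline_chain_def mask_poly_def shift_poly_pCons mask_spline_0 algebra_simps)
  have F0: "?F j r 0 x = mask_spline (1 + r) 0 (2 ^ n * x - of_int j)" for j r x by (simp add: spline_chain_0)
  have cancel: "q * X1 - q * X0 = (1 / p) * (q * Y)" if "p \<noteq> 0" "p * X0 - p * X1 = - Y" for p q X0 X1 Y :: real
  proof -
    have "X1 - X0 = Y / p" using that by (simp add: field_simps)
    then have "q * (X1 - X0) = q * (Y / p)" by simp
    then show ?thesis by (simp add: right_diff_distrib)
  qed
  have I: "integrable MO (\<lambda>x. u x * spline_kernel 0 1 0 1 0 n k x)" for k by (intro spline_kernel_mult_integrable u) auto
  {
    assume wd: "is_weak_deriv Omega (1, 0) u g"
    have "(LINT x|MO. u x * tensor (?F k1 1 1) (?F k2 0 0) x) = - (LINT x|MO. g x * tensor (?F k1 1 0) (?F k2 0 0) x)"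
      using is_weak_deriv_tensor_Cchain[OF wd u g, of "?F k1 1" "?F k2 0"] Cchain_spline_chain[of 1 1] Cchain_spline_chain[of 1 0] zero k by (simp add: order_of_def)
    also have "(LINT x|MO. g x * tensor (?F k1 1 0) (?F k2 0 0) x) = (LINT x|MO. g x * spline_kernel 0 2 0 1 0 n (k1, k2) x)"
      by (simp add: tensor_def spline_kernel_def F0[unfolded One_nat_def] numeral_2_eq_2)
    also have "(LINT x|MO. u x * tensor (?F k1 1 1) (?F k2 0 0) x) =
        (LINT x|MO. 2 ^ n * (u x * spline_kernel 0 1 0 1 0 n (k1, k2) x) - 2 ^ n * (u x * spline_kernel 0 1 0 1 0 n (k1 + 1, k2) x))"
      by (intro Bochner_Integration.integral_cong refl) (simp add: tensor_def spline_kernel_def F0[unfolded One_nat_def] F1[unfolded One_nat_def] algebra_simps)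
    also have "\<dots> = 2 ^ n * (LINT x|MO. u x * spline_kernel 0 1 0 1 0 n (k1, k2) x) - 2 ^ n * (LINT x|MO. u x * spline_kernel 0 1 0 1 0 n (k1 + 1, k2) x)"
      using I by (subst Bochner_Integration.integral_diff) auto
    finally show "sample 0 1 0 1 0 n u (k1 + 1, k2) - sample 0 1 0 1 0 n u (k1, k2) = (1 / 2 ^ n) * sample 0 2 0 1 0 n g (k1, k2)"
      unfolding sample_def by (rule cancel[rotated]) simp
  }
  {
    assume wd: "is_weak_deriv Omega (0, 1) u g"
    have "(LINT x|MO. u x * tensor (?F k1 0 0) (?F k2 1 1) x) = - (LINT x|MO. g x * tensor (?F k1 0 0) (?F k2 1 0) x)"
      using is_weak_deriv_tensor_Cchain[OF wd u g, of "?F k1 0" "?F k2 1"] Cchain_spline_chain[of 1 1] Cchain_spline_chain[of 1 0] zero k by (simp add: order_of_def)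
    also have "(LINT x|MO. g x * tensor (?F k1 0 0) (?F k2 1 0) x) = (LINT x|MO. g x * spline_kernel 0 1 0 2 0 n (k1, k2) x)"
      by (simp add: tensor_def spline_kernel_def F0[unfolded One_nat_def] numeral_2_eq_2)
    also have "(LINT x|MO. u x * tensor (?F k1 0 0) (?F k2 1 1) x) =
        (LINT x|MO. 2 ^ n * (u x * spline_kernel 0 1 0 1 0 n (k1, k2) x) - 2 ^ n * (u x * spline_kernel 0 1 0 1 0 n (k1, k2 + 1) x))"
      by (intro Bochner_Integration.integral_cong refl) (simp add: tensor_def spline_kernel_def F0[unfolded One_nat_def] F1[unfolded One_nat_def] algebra_simps)
    also have "\<dots> = 2 ^ n * (LINT x|MO. u x * spline_kernel 0 1 0 1 0 n (k1, k2) x) - 2 ^ n * (LINT x|MO. u x * spline_kernel 0 1 0 1 0 n (k1, k2 + 1) x)"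
      using I by (subst Bochner_Integration.integral_diff) auto
    finally show "sample 0 1 0 1 0 n u (k1, k2 + 1) - sample 0 1 0 1 0 n u (k1, k2) = (1 / 2 ^ n) * sample 0 1 0 2 0 n g (k1, k2)"
      unfolding sample_def by (rule cancel[rotated]) simp
  }
qed

lemma cell_eventually:
  assumes "x \<in> Omega"
  shows "eventually (\<lambda>n. int C \<le> fst (cell n x) \<and> fst (cell n x) + int C \<le> 2 ^ n \<and> int C \<le> snd (cell n x) \<and> snd (cell n x) + int C \<le> 2 ^ n) sequentially"
proof -
  have 1: "eventually (\<lambda>n. int C \<le> \<lfloor>2 ^ n * t\<rfloor> \<and> \<lfloor>2 ^ n * t\<rfloor> + int C \<le> 2 ^ n) sequentially" if "0 < t" "t < 1" for t :: real
  proof -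
    have lim: "filterlim (\<lambda>n. 2 ^ n * s) at_top sequentially" if "s > 0" for s :: real using that by real_asymp
    have "eventually (\<lambda>n. real C \<le> 2 ^ n * t) sequentially" "eventually (\<lambda>n. real C \<le> 2 ^ n * (1 - t)) sequentially"
      using lim[of t] lim[of "1 - t"] that by (auto simp: filterlim_at_top)
    then show ?thesis
    proof eventually_elim
      case (elim n)
      have "of_int (\<lfloor>2 ^ n * t\<rfloor> + int C) \<le> (of_int (2 ^ n) :: real)" using elim(2) by (simp add: right_diff_distrib) linarith
      then show ?case using elim(1) by (simp only: of_int_le_iff le_floor_iff) simp
    qed
  qed
  have "0 < fst x" "fst x < 1" "0 < snd x" "snd x < 1" using assms by (auto simp: Omega_def)
  from 1[OF this(1,2)] 1[OF this(3,4)] show ?thesis by eventually_elim (simp add: cell_def)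
qed

text \<open>Fatou's lemma along a subsequence that converges almost everywhere.\<close>

lemma L2_of_L1_limit:
  assumes F: "\<And>n. F n \<in> Lp_space Omega 2" and u: "u \<in> Lp_space Omega 1"
    and lim: "(\<lambda>n. Lp_int 1 (\<lambda>x. F n x - u x)) \<longlonglongrightarrow> 0" and B: "eventually (\<lambda>n. Lp_int 2 (F n) \<le> B) sequentially"
  shows "u \<in> Lp_space Omega 2" "Lp_int 2 u \<le> B"
proof -
  have F1: "F n \<in> Lp_space Omega 1" for n by (rule Lp_exponent_mono(1)[OF _ _ F]) auto
  have i: "integrable MO (\<lambda>x. F n x - u x)" for n using Lp_diff(1)[OF _ _ F1 u] by (simp add: Lp_1_integrable)
  have "(\<lambda>n. LINT x|MO. norm (F n x - u x)) \<longlonglongrightarrow> 0" using lim by (simp add: Lp_int_def)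
  from tendsto_L1_AE_subseq[OF i this] obtain r where r: "strict_mono r" "AE x in MO. (\<lambda>n. F (r n) x - u x) \<longlonglongrightarrow> 0" by blast
  have um[measurable]: "u \<in> borel_measurable MO" and Fm[measurable]: "F n \<in> borel_measurable MO" for n
    using u F Lp_measurable by auto
  have F2: "integrable MO (\<lambda>x. (F n x)\<^sup>2)" "Lp_int 2 (F n) = (LINT x|MO. (F n x)\<^sup>2)" for n
    using Lp_integrable[OF F[of n]] by (auto simp: Lp_int_def)
  have Bn: "B \<ge> 0" using B by (auto simp: eventually_sequentially intro: order_trans[OF Lp_int_nonneg])
  have "(\<integral>\<^sup>+x. ennreal ((u x)\<^sup>2) \<partial>MO) = (\<integral>\<^sup>+x. liminf (\<lambda>n. ennreal ((F (r n) x)\<^sup>2)) \<partial>MO)"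
  proof (rule nn_integral_cong_AE)
    show "AE x in MO. ennreal ((u x)\<^sup>2) = liminf (\<lambda>n. ennreal ((F (r n) x)\<^sup>2))"
      using r(2)
    proof eventually_elim
      case (elim x)
      have "(\<lambda>n. F (r n) x) \<longlonglongrightarrow> u x" using elim by (simp add: LIM_zero_iff)
      then have "(\<lambda>n. ennreal ((F (r n) x)\<^sup>2)) \<longlonglongrightarrow> ennreal ((u x)\<^sup>2)" by (intro tendsto_ennrealI tendsto_power)
      then show ?case by (intro lim_imp_Liminf[symmetric]) auto
    qed
  qed
  also have "\<dots> \<le> liminf (\<lambda>n. \<integral>\<^sup>+x. ennreal ((F (r n) x)\<^sup>2) \<partial>MO)" by (rule nn_integral_liminf) measurable
  also have "\<dots> = liminf (\<lambda>n. ennreal (Lp_int 2 (F (r n))))"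
    unfolding F2(2) by (intro arg_cong[of _ _ liminf] ext nn_integral_eq_integral F2(1)) auto
  also have "\<dots> \<le> liminf (\<lambda>n. ennreal B)"
    by (intro Liminf_mono eventually_mono[OF eventually_subseq[OF r(1) B]] ennreal_leI)
  also have "\<dots> = ennreal B" by (simp add: Liminf_const)
  finally have N: "(\<integral>\<^sup>+x. ennreal ((u x)\<^sup>2) \<partial>MO) \<le> ennreal B" .
  have iu: "integrable MO (\<lambda>x. (u x)\<^sup>2)"
    by (rule integrableI_nonneg) (use N in \<open>auto simp: top_unique less_top[symmetric]\<close>)
  then show "u \<in> Lp_space Omega 2" by (simp add: Lp_space_def)
  have "ennreal (LINT x|MO. (u x)\<^sup>2) \<le> ennreal B" using N nn_integral_eq_integral[OF iu] by simp
  then show "Lp_int 2 u \<le> B" using Bn by (simp add: ennreal_le_iff Lp_int_def)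
qed

text \<open>The constant 18 is twice the overlap 9 of the hat kernels, the factor 2 arising from
  \<open>L n\<close> being at least half of 2^n. The difference terms cost only the overlap 12 of
  kernels with one more box convolution.\<close>

lemma gagliardo_nirenberg:
  assumes u: "integrable MO u" and g: "integrable MO g1" "integrable MO g2"
    and wd: "is_weak_deriv Omega (1, 0) u g1" "is_weak_deriv Omega (0, 1) u g2"
  shows "u \<in> Lp_space Omega 2" "Lp_int 2 u \<le> (18 * (Lp_int 1 u + Lp_int 1 g1 + Lp_int 1 g2))\<^sup>2"
proof -
  let ?T = "sample 0 1 0 1 0"
  let ?X = "Lp_int 1 u + Lp_int 1 g1 + Lp_int 1 g2"
  \<comment> \<open>The number of nonnegative indices k with k + 3 \<le> 2^n, the range in which
    differences of samples are samples of the derivative.\<close>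
  define L :: "nat \<Rightarrow> nat" where "L n = 2 ^ n - 2" for n
  define \<iota> where "\<iota> = (\<lambda>(i :: nat, j :: nat). (int i, int j))"
  have inj: "inj_on \<iota> S" for S by (auto simp: inj_on_def \<iota>_def)
  define K where "K n = \<iota> ` ({..<L n} \<times> {..<L n})" for n
  have sumK: "(\<Sum>k\<in>\<iota> ` ({..<A} \<times> {..<B}). h k) = (\<Sum>i<A. \<Sum>j<B. h (int i, int j))" for A B and h :: "int \<times> int \<Rightarrow> real"
    unfolding sum.reindex[OF inj] sum.cartesian_product by (simp add: \<iota>_def split_def)
  have Ksub: "K n \<subseteq> {0..<2 ^ n} \<times> {0..<2 ^ n}" for n
  proof -
    have "int i < 2 ^ n" if "i < 2 ^ n - 2" for i
    proof -
      have "i < 2 ^ n" using that by simp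
      then show ?thesis by (metis of_nat_less_iff of_nat_numeral of_nat_power)
    qed
    then show ?thesis by (auto simp: K_def \<iota>_def L_def)
  qed
  have Kev: "eventually (\<lambda>n. cell n x \<in> K n) sequentially" if "x \<in> Omega" for x
    using cell_eventually[OF that, of 3]
  proof eventually_elim
    case (elim n)
    have "nat t < 2 ^ n - 2" if "3 \<le> t" "t + 3 \<le> 2 ^ n" for t :: int
    proof -
      have "int (nat t + 3) \<le> int (2 ^ n)" using that by simp
      then have "nat t + 3 \<le> 2 ^ n" by (simp only: of_nat_le_iff)
      then show ?thesis by linarith
    qed
    then have "cell n x = \<iota> (nat (fst (cell n x)), nat (snd (cell n x)))" "nat (fst (cell n x)) < L n" "nat (snd (cell n x)) < L n"
      using elim by (auto simp: \<iota>_def L_def prod_eq_iff)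
    then show ?case unfolding K_def by blast
  qed
  have u1: "u \<in> Lp_space Omega 1" "g1 \<in> Lp_space Omega 1" "g2 \<in> Lp_space Omega 1" using u g by (auto simp: Lp_1_integrable)
  have lim: "(\<lambda>n. Lp_int 1 (\<lambda>x. cell_fn n (K n) (?T n u) x - u x)) \<longlonglongrightarrow> 0"
    by (rule cell_fn_sample_tendsto[OF _ _ _ _ Ksub Kev]) (use u1 in \<open>auto simp: Lp_zero\<close>)
  have con: "(\<Sum>k\<in>\<iota> ` ({..<A} \<times> {..<B}). \<bar>sample 0 N1 0 N2 0 n h k\<bar>) / 4 ^ n \<le> real (N1 + 2) * real (N2 + 2) * Lp_int 1 h"
    if "h \<in> Lp_space Omega 1" "N1 \<ge> 1" "N2 \<ge> 1" for A B N1 N2 n h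
    using sample_contraction[OF that(2,3), of 1 h "\<iota> ` ({..<A} \<times> {..<B})" 0 0 0 n] that by (simp add: overlap_bound_def)
  have bound: "Lp_int 2 (cell_fn n (K n) (?T n u)) \<le> (18 * ?X)\<^sup>2" if n: "n \<ge> 2" for n
  proof -
    define a where "a i j = ?T n u (int i, int j)" for i j
    define A where "A = (\<Sum>i<L n. \<Sum>j<L n. \<bar>a i j\<bar>)"
    define D1 where "D1 = (\<Sum>i<L n - 1. \<Sum>j<L n. \<bar>a (Suc i) j - a i j\<bar>)"
    define D2 where "D2 = (\<Sum>i<L n. \<Sum>j<L n - 1. \<bar>a i (Suc j) - a i j\<bar>)"
    have two: "(4 :: nat) \<le> 2 ^ n" using power_increasing[OF n, of "2::nat"] by simp
    have "real (L n) = 2 ^ n - 2" using two by (simp add: L_def of_nat_diff)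
    moreover have "(4 :: real) \<le> 2 ^ n" using power_increasing[OF n, of "2::real"] by simp
    ultimately have Lr: "real (L n) > 0" "2 ^ n \<le> 2 * real (L n)" by auto
    have bnd: "int i + 3 \<le> 2 ^ n" if "i < L n" for i
    proof -
      have "i + 3 \<le> 2 ^ n" using that two by (simp add: L_def)
      then have "int (i + 3) \<le> int (2 ^ n)" by (simp only: of_nat_le_iff)
      then show ?thesis by simp
    qed
    have A: "A / 4 ^ n \<le> 9 * Lp_int 1 u"
      using con[OF u1(1), of 1 1 n "L n" "L n"] by (simp add: sumK A_def a_def)
    have A0: "A \<ge> 0" by (simp add: A_def sum_nonneg)
    have "A / real (L n) / 2 ^ n \<le> 2 * (A / 4 ^ n)"
    proof -
      have "A / real (L n) \<le> A / (2 ^ n / 2)" using Lr A0 by (intro divide_left_mono) auto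
      then have "A / real (L n) / 2 ^ n \<le> A / (2 ^ n / 2) / 2 ^ n" by (intro divide_right_mono) auto
      also have "\<dots> = 2 * (A / (2 ^ n * 2 ^ n))" by simp
      also have "(2::real) ^ n * 2 ^ n = 4 ^ n" by (simp add: power_mult_distrib[symmetric])
      finally show ?thesis .
    qed
    with A have A': "A / real (L n) / 2 ^ n \<le> 18 * Lp_int 1 u" by linarith
    have four: "x / 2 ^ n / 2 ^ n = x / 4 ^ n" for x :: real by (simp add: power_mult_distrib[symmetric])
    have "D1 = (\<Sum>i<L n - 1. \<Sum>j<L n. \<bar>sample 0 2 0 1 0 n g1 (int i, int j)\<bar> / 2 ^ n)"
      unfolding D1_def
    proof (intro sum.cong refl)
      fix i j assume "i \<in> {..<L n - 1}" "j \<in> {..<L n}"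
      then have "int i + 3 \<le> 2 ^ n" "int j + 3 \<le> 2 ^ n" using bnd[of i] bnd[of j] by auto
      then show "\<bar>a (Suc i) j - a i j\<bar> = \<bar>sample 0 2 0 1 0 n g1 (int i, int j)\<bar> / 2 ^ n"
        using sample_difference(1)[OF u g(1) _ _ _ _ wd(1), of "int i" n "int j"] by (simp add: a_def add.commute)
    qed
    then have "D1 / 2 ^ n = (\<Sum>k\<in>\<iota> ` ({..<L n - 1} \<times> {..<L n}). \<bar>sample 0 2 0 1 0 n g1 k\<bar>) / 4 ^ n"
      by (simp only: sumK sum_divide_distrib[symmetric] four)
    then have D1: "D1 / 2 ^ n \<le> 12 * Lp_int 1 g1"
      using con[OF u1(2), of 2 1 n "L n - 1" "L n"] by simp
    have "D2 = (\<Sum>i<L n. \<Sum>j<L n - 1. \<bar>sample 0 1 0 2 0 n g2 (int i, int j)\<bar> / 2 ^ n)"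
      unfolding D2_def
    proof (intro sum.cong refl)
      fix i j assume "i \<in> {..<L n}" "j \<in> {..<L n - 1}"
      then have "int i + 3 \<le> 2 ^ n" "int j + 3 \<le> 2 ^ n" using bnd[of i] bnd[of j] by auto
      then show "\<bar>a i (Suc j) - a i j\<bar> = \<bar>sample 0 1 0 2 0 n g2 (int i, int j)\<bar> / 2 ^ n"
        using sample_difference(2)[OF u g(2) _ _ _ _ wd(2), of "int i" n "int j"] by (simp add: a_def add.commute)
    qed
    then have "D2 / 2 ^ n = (\<Sum>k\<in>\<iota> ` ({..<L n} \<times> {..<L n - 1}). \<bar>sample 0 1 0 2 0 n g2 k\<bar>) / 4 ^ n"
      by (simp only: sumK sum_divide_distrib[symmetric] four)
    then have D2: "D2 / 2 ^ n \<le> 12 * Lp_int 1 g2"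
      using con[OF u1(3), of 1 2 n "L n" "L n - 1"] by simp
    have DD: "D1 \<ge> 0" "D2 \<ge> 0" by (auto simp: D1_def D2_def intro!: sum_nonneg)
    have "Lp_int 2 (cell_fn n (K n) (?T n u)) = (\<Sum>k\<in>K n. \<bar>?T n u k\<bar> powr 2) / 4 ^ n" by (rule cell_fn_Lp(2)[OF Ksub]) simp
    also have "\<dots> = (\<Sum>i<L n. \<Sum>j<L n. (a i j)\<^sup>2) / 4 ^ n" by (simp add: K_def sumK a_def)
    also have "\<dots> \<le> ((A / real (L n) + D1) * (A / real (L n) + D2)) / 4 ^ n"
      unfolding A_def D1_def D2_def using Lr by (intro divide_right_mono discrete_sobolev) auto
    also have "\<dots> = (A / real (L n) / 2 ^ n + D1 / 2 ^ n) * (A / real (L n) / 2 ^ n + D2 / 2 ^ n)"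
      unfolding four[symmetric] by (simp add: field_simps)
    also have "\<dots> \<le> (18 * ?X) * (18 * ?X)"
      using A' D1 D2 DD A0 Lr Lp_int_nonneg[of 1 u] Lp_int_nonneg[of 1 g1] Lp_int_nonneg[of 1 g2]
      by (intro mult_mono) (auto intro!: add_nonneg_nonneg divide_nonneg_nonneg)
    finally show ?thesis by (simp only: power2_eq_square)
  qed
  have ev: "eventually (\<lambda>n. Lp_int 2 (cell_fn n (K n) (?T n u)) \<le> (18 * ?X)\<^sup>2) sequentially"
    using bound by (auto simp: eventually_sequentially)
  have PL: "cell_fn n (K n) (?T n u) \<in> Lp_space Omega 2" for n by (rule cell_fn_Lp(1)[OF Ksub]) simp
  show "u \<in> Lp_space Omega 2" "Lp_int 2 u \<le> (18 * ?X)\<^sup>2"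
    using L2_of_L1_limit[OF PL u1(1) lim ev] by auto
qed

section \<open>Chosen weak derivatives, Sobolev norms and convergence in L_2\<close>

lemma finite_order_le: "finite {a. order_of a \<le> r}"
  by (rule finite_subset[of _ "{..r} \<times> {..r}"]) (auto simp: order_of_def)

lemma sobolev_Lp: "u \<in> sobolev_space Omega r p \<Longrightarrow> u \<in> Lp_space Omega p"
  by (simp add: sobolev_space_def)

lemma Lp_imp_integrable: "f \<in> Lp_space Omega p \<Longrightarrow> 1 \<le> p \<Longrightarrow> integrable MO f"
  using Lp_exponent_mono(1)[of 1 p f] by (simp add: Lp_1_integrable)

text \<open>The derivative picked by \<open>weak_deriv\<close> may differ from the one known to lie
  in L_p; uniqueness almost everywhere together with measurability transfers the membership.\<close>

lemma sobolev_deriv: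
  assumes u: "u \<in> sobolev_space Omega r p" and a: "order_of a \<le> r"
  shows "is_weak_deriv Omega a u (weak_deriv Omega a u)" "weak_deriv Omega a u \<in> Lp_space Omega p"
proof -
  obtain g where g: "g \<in> Lp_space Omega p" "is_weak_deriv Omega a u g"
    using u a unfolding sobolev_space_def by blast
  show wd: "is_weak_deriv Omega a u (weak_deriv Omega a u)"
    unfolding weak_deriv_def by (rule someI[of "is_weak_deriv Omega a u", OF g(2)])
  then have "locally_integrable Omega (weak_deriv Omega a u)" by (simp add: is_weak_deriv_def)
  then show "weak_deriv Omega a u \<in> Lp_space Omega p"
    by (rule Lp_AE_cong[OF is_weak_deriv_unique[OF g(2) wd] g(1) locally_integrable_Omega_measurable])
qed

lemma weak_deriv_AE_eq:
  assumes "is_weak_deriv Omega a u g"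
  shows "AE x in MO. weak_deriv Omega a u x = g x" "weak_deriv Omega a u \<in> borel_measurable MO"
proof -
  have wd: "is_weak_deriv Omega a u (weak_deriv Omega a u)"
    unfolding weak_deriv_def by (rule someI[of "is_weak_deriv Omega a u", OF assms])
  show "AE x in MO. weak_deriv Omega a u x = g x" by (rule is_weak_deriv_unique[OF wd assms])
  show "weak_deriv Omega a u \<in> borel_measurable MO"
    using wd by (intro locally_integrable_Omega_measurable) (simp add: is_weak_deriv_def)
qed

text \<open>Chosen representatives are linear only up to null sets, which integrals do not
  see.\<close>

lemma weak_deriv_diff:
  assumes p: "1 \<le> p" "p \<le> 2"
    and u: "u \<in> sobolev_space Omega r p" and u': "u' \<in> sobolev_space Omega r p" and a: "order_of a \<le> r"
  shows "weak_deriv Omega a (\<lambda>x. u x - u' x) \<in> Lp_space Omega p"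
    "Lp_int p (weak_deriv Omega a (\<lambda>x. u x - u' x)) = Lp_int p (\<lambda>x. weak_deriv Omega a u x - weak_deriv Omega a u' x)"
proof -
  let ?g = "\<lambda>x. weak_deriv Omega a u x - weak_deriv Omega a u' x"
  have wd: "is_weak_deriv Omega a (\<lambda>x. u x - u' x) ?g"
    by (intro is_weak_deriv_diff sobolev_deriv[OF u a] sobolev_deriv[OF u' a] Omega_sets)
  note W = weak_deriv_AE_eq[OF wd]
  have g: "?g \<in> Lp_space Omega p" by (intro Lp_diff[OF p] sobolev_deriv[OF u a] sobolev_deriv[OF u' a])
  have W': "AE x in MO. ?g x = weak_deriv Omega a (\<lambda>x. u x - u' x) x" using W(1) by eventually_elim simp
  show "weak_deriv Omega a (\<lambda>x. u x - u' x) \<in> Lp_space Omega p" by (rule Lp_AE_cong[OF W' g W(2)])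
  show "Lp_int p (weak_deriv Omega a (\<lambda>x. u x - u' x)) = Lp_int p ?g"
    by (rule Lp_int_AE_cong[OF W Lp_measurable[OF g]])
qed

lemma tendsto_zero_powr: "p > 0 \<Longrightarrow> f \<longlonglongrightarrow> 0 \<Longrightarrow> (\<And>n. f n \<ge> 0) \<Longrightarrow> (\<lambda>n. f n powr p) \<longlonglongrightarrow> (0::real)"
  using tendsto_powr'[of f 0 sequentially "\<lambda>_. p" p] by auto

lemma sobolev_norm_tendsto_zero:
  assumes p: "1 \<le> p" "p \<le> 2" and u: "\<And>n. un n \<in> sobolev_space Omega r p" "u \<in> sobolev_space Omega r p"
    and lim: "(\<lambda>n. sobolev_norm Omega r p (\<lambda>x. un n x - u x)) \<longlonglongrightarrow> 0" and a: "order_of a \<le> r"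
  shows "(\<lambda>n. Lp_int p (\<lambda>x. weak_deriv Omega a (un n) x - weak_deriv Omega a u x)) \<longlonglongrightarrow> 0"
proof (rule tendsto_sandwich[OF _ _ tendsto_const])
  show "(\<lambda>n. sobolev_norm Omega r p (\<lambda>x. un n x - u x) powr p) \<longlonglongrightarrow> 0"
    by (rule tendsto_zero_powr[OF _ lim]) (use p in \<open>auto simp: sobolev_norm_def\<close>)
  show "eventually (\<lambda>n. Lp_int p (\<lambda>x. weak_deriv Omega a (un n) x - weak_deriv Omega a u x)
      \<le> sobolev_norm Omega r p (\<lambda>x. un n x - u x) powr p) sequentially"
  proof (intro always_eventually allI)
    fix n
    let ?w = "\<lambda>a. weak_deriv Omega a (\<lambda>x. un n x - u x)"
    have "Lp_int p (?w a) \<le> (\<Sum>a | order_of a \<le> r. Lp_int p (?w a))"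
      by (rule member_le_sum) (use a finite_order_le Lp_int_nonneg in auto)
    also have "\<dots> = sobolev_norm Omega r p (\<lambda>x. un n x - u x) powr p"
      unfolding sobolev_norm_def using p by (subst powr_inverse_powr) (auto simp: Lp_norm_powr intro!: sum_nonneg Lp_int_nonneg)
    finally show "Lp_int p (\<lambda>x. weak_deriv Omega a (un n) x - weak_deriv Omega a u x)
        \<le> sobolev_norm Omega r p (\<lambda>x. un n x - u x) powr p"
      by (simp only: weak_deriv_diff(2)[OF p u(1) u(2) a])
  qed
qed (simp add: Lp_int_nonneg)

lemma sobolev_vnorm_tendsto_zero:
  assumes p: "1 \<le> p" "p \<le> 2" and v: "\<And>n. vn n \<in> sobolev_vspace Omega r p J" "v \<in> sobolev_vspace Omega r p J"
    and lim: "(\<lambda>n. sobolev_vnorm Omega r p J (\<lambda>j x. vn n j x - v j x)) \<longlonglongrightarrow> 0"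
    and a: "order_of a \<le> r" and j: "j \<in> {1..J}"
  shows "(\<lambda>n. Lp_int p (\<lambda>x. weak_deriv Omega a (vn n j) x - weak_deriv Omega a (v j) x)) \<longlonglongrightarrow> 0"
proof (rule tendsto_sandwich[OF _ _ tendsto_const])
  show "(\<lambda>n. sobolev_vnorm Omega r p J (\<lambda>j x. vn n j x - v j x) powr p) \<longlonglongrightarrow> 0"
    by (rule tendsto_zero_powr[OF _ lim]) (use p in \<open>auto simp: sobolev_vnorm_def\<close>)
  show "eventually (\<lambda>n. Lp_int p (\<lambda>x. weak_deriv Omega a (vn n j) x - weak_deriv Omega a (v j) x)
      \<le> sobolev_vnorm Omega r p J (\<lambda>j x. vn n j x - v j x) powr p) sequentially"
  proof (intro always_eventually allI)
    fix n
    let ?w = "\<lambda>a j. weak_deriv Omega a (\<lambda>x. vn n j x - v j x)"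
    have sob: "vn n j \<in> sobolev_space Omega r p" "v j \<in> sobolev_space Omega r p" if "j \<in> {1..J}" for j
      using v that by (auto simp: sobolev_vspace_def)
    have w: "?w a j \<in> Lp_space Omega p" if "j \<in> {1..J}" for j
      using weak_deriv_diff(1)[OF p sob[OF that] a] .
    have "Lp_int p (?w a j) \<le> Lp_int p (\<lambda>x. L2_set (\<lambda>j. ?w a j x) {1..J})"
    proof (rule Lp_abs_mono(2))
      show "(\<lambda>x. L2_set (\<lambda>j. ?w a j x) {1..J}) \<in> Lp_space Omega p" by (rule L2_set_Lp[OF p]) (use w in auto)
      show "\<bar>?w a j x\<bar> \<le> \<bar>L2_set (\<lambda>j. ?w a j x) {1..J}\<bar>" for x
        using member_le_L2_set[of "{1..J}" j "\<lambda>j. \<bar>?w a j x\<bar>"] j by (simp add: L2_set_def)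
    qed (use p w[OF j] Lp_measurable in auto)
    also have "\<dots> \<le> (\<Sum>a | order_of a \<le> r. Lp_int p (\<lambda>x. L2_set (\<lambda>j. ?w a j x) {1..J}))"
      by (rule member_le_sum[where f = "\<lambda>a. Lp_int p (\<lambda>x. L2_set (\<lambda>j. ?w a j x) {1..J})"]) (use a finite_order_le Lp_int_nonneg in auto)
    also have "\<dots> = sobolev_vnorm Omega r p J (\<lambda>j x. vn n j x - v j x) powr p"
      unfolding sobolev_vnorm_def Lp_vnorm_def using p by (subst powr_inverse_powr) (auto simp: Lp_norm_powr intro!: sum_nonneg Lp_int_nonneg)
    finally show "Lp_int p (\<lambda>x. weak_deriv Omega a (vn n j) x - weak_deriv Omega a (v j) x)
        \<le> sobolev_vnorm Omega r p J (\<lambda>j x. vn n j x - v j x) powr p"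
      by (simp only: weak_deriv_diff(2)[OF p sob[OF j] a])
  qed
qed (simp add: Lp_int_nonneg)

text \<open>The Sobolev norm sees a function only through a chosen derivative of order zero; this
  ties the choice back to the function itself.\<close>

lemma weak_deriv_order_0:
  assumes u: "u \<in> sobolev_space Omega r p"
  shows "AE x in MO. weak_deriv Omega (0, 0) u x = u x"
proof -
  have "is_weak_deriv Omega (0, 0) u u"
    using sobolev_deriv(1)[OF u, of "(0, 0)"] by (simp add: is_weak_deriv_def order_of_def mixed_partial_def)
  then show ?thesis by (rule weak_deriv_AE_eq)
qed

lemma Lp_int_order_0:
  assumes p: "1 \<le> p" "p \<le> 2" and u: "u \<in> sobolev_space Omega r p" "u' \<in> sobolev_space Omega r p"
  shows "Lp_int p (\<lambda>x. weak_deriv Omega (0, 0) u x - weak_deriv Omega (0, 0) u' x) = Lp_int p (\<lambda>x. u x - u' x)"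
proof (rule Lp_int_AE_cong)
  show "AE x in MO. weak_deriv Omega (0, 0) u x - weak_deriv Omega (0, 0) u' x = u x - u' x"
    using weak_deriv_order_0[OF u(1)] weak_deriv_order_0[OF u(2)] by eventually_elim simp
  have "order_of (0, 0) \<le> r" by (simp add: order_of_def)
  then show "(\<lambda>x. weak_deriv Omega (0, 0) u x - weak_deriv Omega (0, 0) u' x) \<in> borel_measurable MO" "(\<lambda>x. u x - u' x) \<in> borel_measurable MO"
    by (intro Lp_measurable[of _ p] Lp_diff[OF p] sobolev_deriv[OF u(1)] sobolev_deriv[OF u(2)] sobolev_Lp[OF u(1)] sobolev_Lp[OF u(2)]; assumption)+
qed

lemma sobolev_L2:
  assumes p: "1 \<le> p" "p \<le> 2" and u: "u \<in> sobolev_space Omega r p" and r: "r \<ge> 1"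
  shows "u \<in> Lp_space Omega 2"
proof -
  have a: "order_of (1, 0) \<le> r" "order_of (0, 1) \<le> r" using r by (auto simp: order_of_def)
  show ?thesis
    by (rule gagliardo_nirenberg(1)[OF _ _ _ sobolev_deriv(1)[OF u a(1)] sobolev_deriv(1)[OF u a(2)]])
      (intro Lp_imp_integrable[OF _ p(1)] sobolev_deriv(2)[OF u] sobolev_Lp[OF u] a)+
qed

text \<open>The embedding inequality is applied to \<open>un n - u\<close>. Its right-hand side
  involves L_1 only, and convergence in L_p implies that in L_1 on the square, so all exponents
  between 1 and 2 are treated alike.\<close>

lemma sobolev_L2_tendsto:
  assumes p: "1 \<le> p" "p \<le> 2" and u: "\<And>n. un n \<in> sobolev_space Omega r p" "u \<in> sobolev_space Omega r p" and r: "r \<ge> 1"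
    and lim: "\<And>a. order_of a \<le> r \<Longrightarrow> (\<lambda>n. Lp_int p (\<lambda>x. weak_deriv Omega a (un n) x - weak_deriv Omega a u x)) \<longlonglongrightarrow> 0"
  shows "(\<lambda>n. Lp_int 2 (\<lambda>x. un n x - u x)) \<longlonglongrightarrow> 0"
proof -
  let ?g = "\<lambda>a n x. weak_deriv Omega a (un n) x - weak_deriv Omega a u x"
  have a: "order_of (0, 0) \<le> r" "order_of (1, 0) \<le> r" "order_of (0, 1) \<le> r" using r by (auto simp: order_of_def)
  have gL: "?g a n \<in> Lp_space Omega p" if "order_of a \<le> r" for a n
    by (intro Lp_diff[OF p] sobolev_deriv[OF u(1)] sobolev_deriv[OF u(2)] that)
  have uL: "(\<lambda>x. un n x - u x) \<in> Lp_space Omega p" for n by (intro Lp_diff[OF p] sobolev_Lp[OF u(1)] sobolev_Lp[OF u(2)])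
  have ul: "(\<lambda>n. Lp_int p (\<lambda>x. un n x - u x)) \<longlonglongrightarrow> 0" using lim[OF a(1)] by (simp only: Lp_int_order_0[OF p u])
  have l1: "(\<lambda>n. Lp_int 1 (?g a n)) \<longlonglongrightarrow> 0" if "order_of a \<le> r" for a
    by (rule Lp_int_tendsto_zero_exponent_mono[OF _ p(1) gL[OF that] lim[OF that]]) simp
  have l0: "(\<lambda>n. Lp_int 1 (\<lambda>x. un n x - u x)) \<longlonglongrightarrow> 0"
    by (rule Lp_int_tendsto_zero_exponent_mono[OF _ p(1) uL ul]) simp
  have "(\<lambda>n. (18 * (Lp_int 1 (\<lambda>x. un n x - u x) + Lp_int 1 (?g (1, 0) n) + Lp_int 1 (?g (0, 1) n)))\<^sup>2) \<longlonglongrightarrow> (18 * (0 + 0 + 0))\<^sup>2"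
    by (intro tendsto_intros l0 l1 a)
  then have L: "(\<lambda>n. (18 * (Lp_int 1 (\<lambda>x. un n x - u x) + Lp_int 1 (?g (1, 0) n) + Lp_int 1 (?g (0, 1) n)))\<^sup>2) \<longlonglongrightarrow> 0" by simp
  have "Lp_int 2 (\<lambda>x. un n x - u x) \<le> (18 * (Lp_int 1 (\<lambda>x. un n x - u x) + Lp_int 1 (?g (1, 0) n) + Lp_int 1 (?g (0, 1) n)))\<^sup>2" for n
    by (intro gagliardo_nirenberg(2) is_weak_deriv_diff sobolev_deriv(1)[OF u(1)] sobolev_deriv(1)[OF u(2)] a Omega_sets
        Lp_imp_integrable[OF uL p(1)] Lp_imp_integrable[OF gL p(1)])
  then show ?thesis
    by (intro tendsto_sandwich[OF _ _ tendsto_const L]) (auto simp: Lp_int_nonneg)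
qed

text \<open>Makes a constant sequence convergent to itself. The derivatives of the zero function are
  chosen as well and vanish only almost everywhere.\<close>

lemma sobolev_norm_zero: "sobolev_norm Omega r p (\<lambda>x. 0) = 0"
  and sobolev_vnorm_zero: "sobolev_vnorm Omega r p J (\<lambda>j x. 0) = 0"
proof -
  have wd: "is_weak_deriv Omega a (\<lambda>x. 0) (\<lambda>x. 0)" for a by (simp add: is_weak_deriv_def locally_integrable_def)
  have n0: "Lp_norm Omega p (weak_deriv Omega a (\<lambda>x. 0)) = 0" for a
    using Lp_int_AE_cong[OF weak_deriv_AE_eq[OF wd[of a]], of p] by (simp add: Lp_norm_def Lp_int_def)
  then show "sobolev_norm Omega r p (\<lambda>x. 0) = 0" by (simp add: sobolev_norm_def)
  have "Lp_vnorm Omega p {1..J} (\<lambda>j. weak_deriv Omega a (\<lambda>x. 0)) = 0" for a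
  proof -
    have "Lp_int p (\<lambda>x. L2_set (\<lambda>j. weak_deriv Omega a (\<lambda>x. 0) x) {1..J}) = Lp_int p (\<lambda>x. 0)"
    proof (rule Lp_int_AE_cong)
      show "AE x in MO. L2_set (\<lambda>j. weak_deriv Omega a (\<lambda>x. 0) x) {1..J} = 0"
        using weak_deriv_AE_eq(1)[OF wd[of a]] by eventually_elim (simp add: L2_set_def)
      show "(\<lambda>x. L2_set (\<lambda>j. weak_deriv Omega a (\<lambda>x. 0) x) {1..J}) \<in> borel_measurable MO"
        using weak_deriv_AE_eq(2)[OF wd[of a]] by measurable
    qed simp
    then show ?thesis by (simp add: Lp_vnorm_def Lp_norm_def Lp_int_def)
  qed
  then show "sobolev_vnorm Omega r p J (\<lambda>j x. 0) = 0" by (simp add: sobolev_vnorm_def)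
qed

section \<open>Convergence of the functionals\<close>

lemma Lp_int_add_tendsto_zero:
  assumes p: "1 \<le> p" "p \<le> 2" and F: "\<And>n. F n \<in> Lp_space Omega p" and G: "\<And>n. G n \<in> Lp_space Omega p"
    and lim: "(\<lambda>n. Lp_int p (F n)) \<longlonglongrightarrow> 0" "(\<lambda>n. Lp_int p (G n)) \<longlonglongrightarrow> 0"
  shows "(\<lambda>n. Lp_int p (\<lambda>x. F n x + G n x)) \<longlonglongrightarrow> 0"
proof (rule tendsto_sandwich[OF _ _ tendsto_const])
  show "(\<lambda>n. 4 * (Lp_int p (F n) + Lp_int p (G n))) \<longlonglongrightarrow> 0"
    using tendsto_mult_left[OF tendsto_add[OF lim], of 4] by simp
  show "eventually (\<lambda>n. Lp_int p (\<lambda>x. F n x + G n x) \<le> 4 * (Lp_int p (F n) + Lp_int p (G n))) sequentially"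
    by (intro always_eventually allI Lp_add(2)[OF p F G])
qed (simp add: Lp_int_nonneg)

lemma Lp_int_diff_tendsto_zero:
  assumes p: "1 \<le> p" "p \<le> 2" and F: "\<And>n. F n \<in> Lp_space Omega p" and G: "\<And>n. G n \<in> Lp_space Omega p"
    and lim: "(\<lambda>n. Lp_int p (F n)) \<longlonglongrightarrow> 0" "(\<lambda>n. Lp_int p (G n)) \<longlonglongrightarrow> 0"
  shows "(\<lambda>n. Lp_int p (\<lambda>x. F n x - G n x)) \<longlonglongrightarrow> 0"
  using Lp_int_add_tendsto_zero[OF p F Lp_uminus(1)[OF G] lim(1)] lim(2) by (simp add: Lp_uminus(2))

text \<open>For exponent 2 the array norm is a scaled Euclidean norm, which yields the triangle
  inequality with constant 1 demanded of a seminorm.\<close>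

lemma arr_norm_L2_set: "arr_norm n K 2 a = L2_set a K / 2 ^ n"
proof -
  have "(2::real) powi (- 2 * int n) = inverse (2 powi int (2 * n))" by (simp add: power_int_minus[symmetric])
  also have "\<dots> = (1 / 2 ^ n)\<^sup>2" unfolding power_int_of_nat by (simp add: power_mult[symmetric] mult.commute divide_inverse power_inverse)
  finally have p: "(2::real) powi (- 2 * int n) = (1 / 2 ^ n)\<^sup>2" .
  show ?thesis
    unfolding arr_norm_def p L2_set_def by (simp add: powr_half_sqrt sum_nonneg real_sqrt_mult real_sqrt_divide)
qed

lemma arr_norm_power2: "(arr_norm n K 2 a)\<^sup>2 = (\<Sum>k\<in>K. (a k)\<^sup>2) / 4 ^ n"
  unfolding arr_norm_L2_set L2_set_def
  by (simp add: power_divide sum_nonneg power_mult[symmetric]) (simp add: power_mult mult.commute[of n])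

lemma arr_norm_nonneg: "arr_norm n K p a \<ge> 0"
  by (simp add: arr_norm_def)

lemma arr_norm_triangle: "arr_norm n K 2 (\<lambda>k. a k + b k) \<le> arr_norm n K 2 a + arr_norm n K 2 b"
  unfolding arr_norm_L2_set add_divide_distrib[symmetric] by (intro divide_right_mono L2_set_triangle_ineq) auto

lemma arr_norm_cmult: "arr_norm n K 2 (\<lambda>k. c * a k) = \<bar>c\<bar> * arr_norm n K 2 a"
  by (simp add: arr_norm_L2_set L2_set_def power_mult_distrib sum_distrib_left[symmetric] real_sqrt_mult)

lemma arr_norm_cong: "(\<And>k. k \<in> K \<Longrightarrow> a k = b k) \<Longrightarrow> arr_norm n K p a = arr_norm n K p b"
  by (simp add: arr_norm_def cong: sum.cong)

lemma arr_norm_minus_commute: "arr_norm n K p (\<lambda>k. a k - b k) = arr_norm n K p (\<lambda>k. b k - a k)"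
  by (simp add: arr_norm_def abs_minus_commute)

lemma cell_fn_cong: "(\<And>k. k \<in> K \<Longrightarrow> a k = b k) \<Longrightarrow> cell_fn n K a = cell_fn n K b"
  by (rule ext) (simp add: cell_fn_def)

lemma sample_linear:
  assumes N: "N1 \<ge> 1" "N2 \<ge> 1" and f: "integrable MO f" and g: "integrable MO g"
  shows "sample e N1 M1 N2 M2 n (\<lambda>x. f x + g x) k = sample e N1 M1 N2 M2 n f k + sample e N1 M1 N2 M2 n g k"
    "sample e N1 M1 N2 M2 n (\<lambda>x. c * f x) k = c * sample e N1 M1 N2 M2 n f k"
  using spline_kernel_mult_integrable[OF f N] spline_kernel_mult_integrable[OF g N]
  by (simp_all add: sample_def distrib_right distrib_left mult.assoc)

text \<open>Linearity is assumed for arrays that vanish outside \<open>K\<close>, so the expansion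
  into unit arrays runs through restrictions to subsets of \<open>K\<close>.\<close>

lemma linear_on_arrays_expand:
  assumes L: "linear_on_arrays K L" and F: "finite F" "F \<subseteq> K" and k: "k \<in> K"
  shows "L (restrict_array F a) k = (\<Sum>l\<in>F. a l * L (restrict_array {l} (\<lambda>_. 1)) k)"
proof -
  note lin = L[unfolded linear_on_arrays_def, THEN spec, THEN spec, THEN spec, THEN spec, THEN mp, THEN bspec, OF _ k]
  show ?thesis using F
  proof (induction F rule: finite_induct)
    case empty
    have "L (\<lambda>l. 0 * (\<lambda>_. 0) l + 0 * (\<lambda>_. 0) l) k = 0 * L (\<lambda>_. 0) k + 0 * L (\<lambda>_. 0) k"
      by (rule lin) simp
    then show ?case by (simp add: restrict_array_def)
  next
    case (insert l F)
    have e: "restrict_array (insert l F) a = (\<lambda>i. a l * restrict_array {l} (\<lambda>_. 1) i + 1 * restrict_array F a i)"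
      using insert.hyps by (auto simp: restrict_array_def fun_eq_iff)
    have "\<forall>i. i \<notin> K \<longrightarrow> restrict_array {l} (\<lambda>_. 1) i = 0 \<and> restrict_array F a i = 0"
      using insert.prems by (auto simp: restrict_array_def)
    then have "L (restrict_array (insert l F) a) k = a l * L (restrict_array {l} (\<lambda>_. 1)) k + 1 * L (restrict_array F a) k"
      unfolding e by (rule lin)
    then show ?case using insert by simp
  qed
qed

text \<open>The bound is the squared Frobenius norm of the matrix of \<open>L\<close>. It may depend
  on the level, since the uniform boundedness principle asks only for continuity of each seminorm
  separately.\<close>

lemma linear_on_arrays_bounded:
  assumes L: "linear_on_arrays K L" and K: "finite K"
  shows "\<exists>B\<ge>0. \<forall>a. (\<Sum>k\<in>K. (L (restrict_array K a) k)\<^sup>2) \<le> B * (\<Sum>k\<in>K. (a k)\<^sup>2)"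
proof (intro exI conjI allI)
  let ?c = "\<lambda>k l. L (restrict_array {l} (\<lambda>_. 1)) k"
  show "0 \<le> (\<Sum>k\<in>K. \<Sum>l\<in>K. (?c k l)\<^sup>2)" by (intro sum_nonneg) auto
  fix a
  have "(\<Sum>k\<in>K. (L (restrict_array K a) k)\<^sup>2) = (\<Sum>k\<in>K. (\<Sum>l\<in>K. a l * ?c k l)\<^sup>2)"
    by (intro sum.cong refl) (simp add: linear_on_arrays_expand[OF L K])
  also have "\<dots> \<le> (\<Sum>k\<in>K. (\<Sum>l\<in>K. (a l)\<^sup>2) * (\<Sum>l\<in>K. (?c k l)\<^sup>2))"
    by (intro sum_mono Cauchy_Schwarz_ineq_sum)
  also have "\<dots> = (\<Sum>k\<in>K. \<Sum>l\<in>K. (?c k l)\<^sup>2) * (\<Sum>k\<in>K. (a k)\<^sup>2)"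
    by (simp add: sum_distrib_left[symmetric] mult.commute)
  finally show "(\<Sum>k\<in>K. (L (restrict_array K a) k)\<^sup>2) \<le> (\<Sum>k\<in>K. \<Sum>l\<in>K. (?c k l)\<^sup>2) * (\<Sum>k\<in>K. (a k)\<^sup>2)" .
qed

section \<open>Index sets, margins, and the three terms of the functional\<close>

context
  fixes m J :: nat and al :: "nat \<Rightarrow> multi_index" and psi :: "nat \<Rightarrow> fn"
  assumes m: "m \<ge> 2" and al: "\<And>j. j \<in> {1..J} \<Longrightarrow> fst (al j) \<le> m \<and> snd (al j) \<le> m"
    and psi: "\<And>j. psi j = framelet m (al j)" and J: "J \<ge> 1"
begin

lemma M_set_iff: "k \<in> M_set m n \<longleftrightarrow> int (m div 2) \<le> fst k \<and> int m - int (m div 2) + fst k \<le> 2 ^ n \<and>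
    int (m div 2) \<le> snd k \<and> int m - int (m div 2) + snd k \<le> 2 ^ n"
  unfolding M_set_def mem_Collect_eq by (rule ess_support_scaling[OF m al psi])

lemma prim1_at_support_iff:
  "j \<in> {1..J} \<Longrightarrow> ess_support (prim1_at al psi j n k) \<subseteq> closure Omega \<longleftrightarrow>
     2 * int (m div 2) \<le> fst k \<and> 2 * int m - 2 * int (m div 2) + fst k \<le> 2 ^ n \<and> 2 * int (m div 2) \<le> snd k \<and> 2 * int m - 2 * int (m div 2) + snd k \<le> 2 ^ n"
  by (rule ess_support_prim1[where J = J, OF m _ psi]) (erule al, assumption)

text \<open>A tensor filter inherits both ends of the index range from each factor, so its support
  has the four corners of its bounding square. Shifts by filter indices are thereby controlled by
  the corner shifts.\<close>

lemma filt_support: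
  assumes "j \<le> J"
  shows "{- int (m div 2), int m - int (m div 2)} \<times> {- int (m div 2), int m - int (m div 2)} \<subseteq> filter_support (filt m al j)"
    "filter_support (filt m al j) \<subseteq> {- int (m div 2)..int m - int (m div 2)} \<times> {- int (m div 2)..int m - int (m div 2)}"
proof -
  define a where "a = (if j = 0 then (0, 0) else al j)"
  have a: "fst a \<le> m" "snd a \<le> m" using al[of j] assms by (auto simp: a_def)
  note c = bspline_filter_corners[OF a(1)] bspline_filter_corners[OF a(2)]
  show "{- int (m div 2), int m - int (m div 2)} \<times> {- int (m div 2), int m - int (m div 2)} \<subseteq> filter_support (filt m al j)"
    using c unfolding filt_def a_def[symmetric] filter_support_tensor by auto
  show "filter_support (filt m al j) \<subseteq> {- int (m div 2)..int m - int (m div 2)} \<times> {- int (m div 2)..int m - int (m div 2)}"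
    using c(3,6) unfolding filt_def a_def[symmetric] filter_support_tensor by blast
qed

lemma K_set_subset: "K_set m al J C n \<subseteq> {0..<2 ^ n} \<times> {0..<2 ^ n}"
proof -
  have "int m - int (m div 2) \<ge> 1" using m by linarith
  then show ?thesis by (force simp: K_set_def M_set_iff)
qed

text \<open>The shifts move an index by at most \<open>C * m\<close>, and \<open>M_set\<close> needs
  a further margin of at most \<open>m\<close>; an interior point is eventually farther than that
  many cells from the boundary.\<close>

lemma K_set_eventually:
  assumes "x \<in> Omega"
  shows "eventually (\<lambda>n. cell n x \<in> K_set m al J C n) sequentially"
  using cell_eventually[OF assms, of "m + C * m"]
proof eventually_elim
  case (elim n)
  have "- int (C * m) \<le> int C * t \<and> int C * t \<le> int (C * m)" if "t \<in> {- int (m div 2)..int m - int (m div 2)}" for t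
  proof -
    have "- int m \<le> t" "t \<le> int m" using that by auto
    then have "int C * (- int m) \<le> int C * t" "int C * t \<le> int C * int m" by (intro mult_left_mono; simp)+
    then show ?thesis by simp
  qed
  note b = this
  have "cell n x + (int C * fst l, int C * snd l) \<in> M_set m n" if "j \<le> J" "l \<in> filter_support (filt m al j)" for j l
    using filt_support(2)[OF that(1)] that(2) b[of "fst l"] b[of "snd l"] elim unfolding M_set_iff by (fastforce simp: mem_Times_iff)
  moreover have "cell n x \<in> M_set m n"
  proof -
    have "0 \<le> int C * int m" "0 \<le> int (m div 2)" "int (m div 2) \<le> int m" "int (m + C * m) = int m + int C * int m" by auto
    with elim show ?thesis unfolding M_set_iff by (elim conjE, intro conjI) linarith+
  qed
  ultimately show ?case by (simp add: K_set_def)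
qed

text \<open>Membership of the doubled corner shifts in \<open>M_set\<close> keeps \<open>k\<close>
  three extents of the scaling function away from the edges, one for the function itself and two for
  the shift. A single filter shift consumes one of them, and the primitives need the remaining
  two.\<close>

lemma admissible_margin_2: "admissible_margin m al psi J 2"
  unfolding admissible_margin_def
proof (intro conjI allI ballI)
  fix n k l assume k: "k \<in> K_set m al J 2 n" and l: "l \<in> insert k (\<Union>i\<in>{1..J}. (+) k ` filter_support (filt m al i))"
  let ?d = "int (m div 2)"
  have "k + (2 * t, 2 * t') \<in> M_set m n" if "t \<in> {- ?d, int m - ?d}" "t' \<in> {- ?d, int m - ?d}" for t t'
  proof -
    have "(t, t') \<in> filter_support (filt m al 0)" using filt_support(1)[of 0] that by blast
    then show ?thesis using k by (force simp: K_set_def)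
  qed
  from this[of "- ?d" "- ?d"] this[of "int m - ?d" "int m - ?d"]
  have kk: "3 * ?d \<le> fst k" "3 * ?d \<le> snd k" "3 * (int m - ?d) + fst k \<le> 2 ^ n" "3 * (int m - ?d) + snd k \<le> 2 ^ n"
    by (auto simp: M_set_iff)
  have "- ?d \<le> fst l - fst k \<and> fst l - fst k \<le> int m - ?d \<and> - ?d \<le> snd l - snd k \<and> snd l - snd k \<le> int m - ?d"
  proof (cases "l = k")
    case False
    then obtain i t where "i \<in> {1..J}" "t \<in> filter_support (filt m al i)" "l = k + t" using l by auto
    then show ?thesis using filt_support(2)[of i] by (auto simp: mem_Times_iff)
  qed auto
  with kk have ll: "2 * ?d \<le> fst l" "2 * ?d \<le> snd l" "2 * int m - 2 * ?d + fst l \<le> 2 ^ n" "2 * int m - 2 * ?d + snd l \<le> 2 ^ n"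
    by auto
  then show "ess_support (scaling_fn_at m n l) \<subseteq> closure Omega"
    using M_set_iff[of l n] by (auto simp: M_set_def)
  show "ess_support (prim1_at al psi j n l) \<subseteq> closure Omega" if "j \<in> {1..J}" for j
    using ll by (simp add: prim1_at_support_iff[OF that])
qed simp

text \<open>Any admissible \<open>C\<close> enforces the distance that integration by parts
  requires: a primitive at a corner shift of \<open>k\<close> still lies in the closed square, which
  takes two extents, and the shift adds the third. As \<open>J \<ge> 1\<close>, the framelet with
  index 1 can be used.\<close>

lemma K_set_margin:
  assumes adm: "admissible_margin m al psi J C" and k: "k \<in> K_set m al J C n"
  shows "3 * int (m div 2) \<le> fst k \<and> 3 * int m - 3 * int (m div 2) + fst k \<le> 2 ^ n \<and> 3 * int (m div 2) \<le> snd k \<and> 3 * int m - 3 * int (m div 2) + snd k \<le> 2 ^ n"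
    "2 * int (m div 2) \<le> fst k \<and> 2 * int m - 2 * int (m div 2) + fst k \<le> 2 ^ n \<and> 2 * int (m div 2) \<le> snd k \<and> 2 * int m - 2 * int (m div 2) + snd k \<le> 2 ^ n"
proof -
  let ?d = "int (m div 2)"
  have 1: "1 \<in> {1..J}" using J by simp
  have "ess_support (prim1_at al psi 1 n (k + t)) \<subseteq> closure Omega" if "t \<in> filter_support (filt m al 1)" for t
    using adm k 1 that unfolding admissible_margin_def by blast
  then have "ess_support (prim1_at al psi 1 n (k + (- ?d, - ?d))) \<subseteq> closure Omega" "ess_support (prim1_at al psi 1 n (k + (int m - ?d, int m - ?d))) \<subseteq> closure Omega"
    using filt_support(1)[of 1] J by auto
  then show "3 * ?d \<le> fst k \<and> 3 * int m - 3 * ?d + fst k \<le> 2 ^ n \<and> 3 * ?d \<le> snd k \<and> 3 * int m - 3 * ?d + snd k \<le> 2 ^ n"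
    unfolding prim1_at_support_iff[OF 1] fst_add snd_add fst_conv snd_conv by (elim conjE, intro conjI) linarith+
  then show "2 * ?d \<le> fst k \<and> 2 * int m - 2 * ?d + fst k \<le> 2 ^ n \<and> 2 * ?d \<le> snd k \<and> 2 * int m - 2 * ?d + snd k \<le> 2 ^ n"
    by auto
qed

text \<open>On \<open>K_set\<close> the transform of the samples of u and the samples of v use the
  same kernel, so their difference is a single array of samples of the difference of
  functions.\<close>

lemma first_order_term_tendsto:
  assumes adm: "admissible_margin m al psi J C" and p: "1 \<le> p" "p \<le> 2"
    and wd: "\<And>n j. j \<in> {1..J} \<Longrightarrow> is_weak_deriv Omega (al j) (un n) (gn n j)"
    and un: "\<And>n. un n \<in> Lp_space Omega p"
    and gn: "\<And>n j. j \<in> {1..J} \<Longrightarrow> gn n j \<in> Lp_space Omega p" and g: "\<And>j. j \<in> {1..J} \<Longrightarrow> g j \<in> Lp_space Omega p"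
    and vn: "\<And>n j. j \<in> {1..J} \<Longrightarrow> vn n j \<in> Lp_space Omega p" and v: "\<And>j. j \<in> {1..J} \<Longrightarrow> v j \<in> Lp_space Omega p"
    and lim: "\<And>j. j \<in> {1..J} \<Longrightarrow> (\<lambda>n. Lp_int p (\<lambda>x. gn n j x - g j x)) \<longlonglongrightarrow> 0"
      "\<And>j. j \<in> {1..J} \<Longrightarrow> (\<lambda>n. Lp_int p (\<lambda>x. vn n j x - v j x)) \<longlonglongrightarrow> 0"
  shows "(\<lambda>n. arr_vnorm n (K_set m al J C n) p {1..J}
        (\<lambda>j k. W1_op m al psi n (T_op m n (un n)) j k - S_op al psi n (vn n) j k) powr p)
      \<longlonglongrightarrow> Lp_vnorm Omega p {1..J} (\<lambda>j x. g j x - v j x) powr p"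
proof (rule arr_vnorm_tendsto[OF p _ K_set_subset])
  fix j assume j: "j \<in> {1..J}"
  let ?K = "K_set m al J C"
  let ?T = "sample (2 * real (m div 2)) (m - 1 + fst (al j)) (m - fst (al j)) (m - 1 + snd (al j)) (m - snd (al j))"
  have N: "m - 1 + fst (al j) \<ge> 1" "m - 1 + snd (al j) \<ge> 1" using m by auto
  show "(\<lambda>x. g j x - v j x) \<in> Lp_space Omega p" by (rule Lp_diff[OF p g[OF j] v[OF j]])
  have eq: "cell_fn n (?K n) (\<lambda>k. W1_op m al psi n (T_op m n (un n)) j k - S_op al psi n (vn n) j k)
      = cell_fn n (?K n) (?T n (\<lambda>x. gn n j x - vn n j x))" for n
  proof (rule cell_fn_cong)
    fix k assume k: "k \<in> ?K n"
    have "W1_op m al psi n (T_op m n (un n)) j k = ?T n (gn n j) k"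
      by (rule W1_op_eq[OF m al psi j])
        (assumption | rule wd[OF j] Lp_imp_integrable[OF un p(1)] Lp_imp_integrable[OF gn[OF j] p(1)] K_set_margin(2)[OF adm k])+
    moreover have "S_op al psi n (vn n) j k = ?T n (vn n j) k"
      by (rule S_op_eq[OF m al psi j]) (assumption | rule Lp_measurable[OF vn[OF j]])+
    moreover have "?T n (\<lambda>x. gn n j x - vn n j x) k = ?T n (gn n j) k - ?T n (vn n j) k"
      by (rule sample_diff[OF N Lp_imp_integrable[OF gn[OF j] p(1)] Lp_imp_integrable[OF vn[OF j] p(1)]])
    ultimately show "W1_op m al psi n (T_op m n (un n)) j k - S_op al psi n (vn n) j k = ?T n (\<lambda>x. gn n j x - vn n j x) k" by simp
  qed
  have "(\<lambda>n. Lp_int p (\<lambda>x. (gn n j x - g j x) - (vn n j x - v j x))) \<longlonglongrightarrow> 0"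
    by (intro Lp_int_diff_tendsto_zero[OF p] Lp_diff[OF p] gn[OF j] g[OF j] vn[OF j] v[OF j] lim[OF j])
  then have "(\<lambda>n. Lp_int p (\<lambda>x. (gn n j x - vn n j x) - (g j x - v j x))) \<longlonglongrightarrow> 0" by (simp add: algebra_simps)
  then show "(\<lambda>n. Lp_int p (\<lambda>x. cell_fn n (?K n) (\<lambda>k. W1_op m al psi n (T_op m n (un n)) j k - S_op al psi n (vn n) j k) x - (g j x - v j x))) \<longlonglongrightarrow> 0"
    unfolding eq by (intro cell_fn_sample_tendsto[OF N p K_set_subset K_set_eventually] Lp_diff[OF p] gn[OF j] g[OF j] vn[OF j] v[OF j])
qed simp

lemma second_order_term_tendsto:
  assumes adm: "admissible_margin m al psi J C" and p: "1 \<le> p" "p \<le> 2"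
    and wd: "\<And>n i j. i \<in> {1..J} \<Longrightarrow> j \<in> {1..J} \<Longrightarrow> is_weak_deriv Omega (al i) (vn n j) (gn n i j)"
    and vn: "\<And>n j. j \<in> {1..J} \<Longrightarrow> vn n j \<in> Lp_space Omega p"
    and gn: "\<And>n i j. i \<in> {1..J} \<Longrightarrow> j \<in> {1..J} \<Longrightarrow> gn n i j \<in> Lp_space Omega p"
    and g: "\<And>i j. i \<in> {1..J} \<Longrightarrow> j \<in> {1..J} \<Longrightarrow> g i j \<in> Lp_space Omega p"
    and lim: "\<And>i j. i \<in> {1..J} \<Longrightarrow> j \<in> {1..J} \<Longrightarrow> (\<lambda>n. Lp_int p (\<lambda>x. gn n i j x - g i j x)) \<longlonglongrightarrow> 0"
  shows "(\<lambda>n. arr_vnorm n (K_set m al J C n) p ({1..J} \<times> {1..J}) (W2_op m al psi n (S_op al psi n (vn n))) powr p)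
      \<longlonglongrightarrow> Lp_vnorm Omega p ({1..J} \<times> {1..J}) (\<lambda>(i, j). g i j) powr p"
proof (rule arr_vnorm_tendsto[OF p _ K_set_subset])
  fix ij assume "ij \<in> {1..J} \<times> {1..J}"
  then obtain i j where ij: "ij = (i, j)" "i \<in> {1..J}" "j \<in> {1..J}" by auto
  let ?K = "K_set m al J C"
  let ?T = "sample (3 * real (m div 2)) (m - 1 + fst (al j) + fst (al i)) (m - fst (al i) + (m - fst (al j)))
       (m - 1 + snd (al j) + snd (al i)) (m - snd (al i) + (m - snd (al j)))"
  have N: "m - 1 + fst (al j) + fst (al i) \<ge> 1" "m - 1 + snd (al j) + snd (al i) \<ge> 1" using m by auto
  show "(case ij of (i, j) \<Rightarrow> g i j) \<in> Lp_space Omega p" using g[OF ij(2,3)] by (simp add: ij)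
  have eq: "cell_fn n (?K n) (W2_op m al psi n (S_op al psi n (vn n)) ij) = cell_fn n (?K n) (?T n (gn n i j))" for n
    unfolding ij(1)
    by (rule cell_fn_cong, rule W2_op_eq[OF m al psi ij(2,3)])
      (assumption | rule wd[OF ij(2,3)] Lp_imp_integrable[OF vn[OF ij(3)] p(1)] Lp_imp_integrable[OF gn[OF ij(2,3)] p(1)] K_set_margin(1)[OF adm])+
  show "(\<lambda>n. Lp_int p (\<lambda>x. cell_fn n (?K n) (W2_op m al psi n (S_op al psi n (vn n)) ij) x - (case ij of (i, j) \<Rightarrow> g i j) x)) \<longlonglongrightarrow> 0"
    unfolding eq unfolding ij(1) prod.case
    by (rule cell_fn_sample_tendsto[OF N p K_set_subset K_set_eventually gn[OF ij(2,3)] g[OF ij(2,3)] lim[OF ij(2,3)]])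
qed simp

text \<open>The residual is the sum of the discrete operator applied to the samples of u_n - u, the
  consistency error at u, and the samples of A u - f. The last two concern fixed functions; only the
  first needs uniformity in \<open>n\<close>, and it is a seminorm of a null sequence.\<close>

lemma fidelity_term_tendsto:
  fixes C :: nat
  defines "K \<equiv> K_set m al J C"
  assumes f: "f \<in> Lp_space Omega 2" and A: "linear_operator_L2 Omega A"
    and lin: "\<And>n. linear_on_arrays (K n) (An n)" and cons: "consistent_discretization m K A An"
    and un: "\<And>n. un n \<in> Lp_space Omega 2" and u: "u \<in> Lp_space Omega 2"
    and lim: "(\<lambda>n. Lp_int 2 (\<lambda>x. un n x - u x)) \<longlonglongrightarrow> 0"
  shows "(\<lambda>n. (arr_norm n (K n) 2 (\<lambda>k. An n (restrict_array (K n) (T_op m n (un n))) k - T_op m n f k))\<^sup>2)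
     \<longlonglongrightarrow> (Lp_norm Omega 2 (\<lambda>x. A u x - f x))\<^sup>2"
proof -
  let ?T = "sample (real (m div 2)) (m - 1) 0 (m - 1) 0"
  let ?R = "\<lambda>n h. restrict_array (K n) (T_op m n h)"
  define S where "S n h = arr_norm n (K n) 2 (An n (?R n h))" for n h
  have N: "m - 1 \<ge> 1" using m by simp
  have two: "1 \<le> (2::real)" "(2::real) \<le> 2" by auto
  have Ksub: "K n \<subseteq> {0..<2 ^ n} \<times> {0..<2 ^ n}" for n unfolding K_def by (rule K_set_subset)
  have Kfin: "finite (K n)" for n by (rule finite_subset[OF Ksub]) auto
  have Kev: "eventually (\<lambda>n. cell n x \<in> K n) sequentially" if "x \<in> Omega" for x
    unfolding K_def by (rule K_set_eventually[OF that])
  have AL: "A h \<in> Lp_space Omega 2" if "h \<in> Lp_space Omega 2" for h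
    using A that by (auto simp: linear_operator_L2_def)
  have T: "T_op m n h = ?T n h" if "h \<in> Lp_space Omega 2" for n h
    by (rule ext, rule T_op_eq[where J = J, OF m _ psi], erule al, rule Lp_measurable[OF that])
  have Tlin: "T_op m n (\<lambda>x. g x + h x) k = T_op m n g k + T_op m n h k"
      "T_op m n (\<lambda>x. c * g x) k = c * T_op m n g k"
    if "g \<in> Lp_space Omega 2" "h \<in> Lp_space Omega 2" for g h n k c
    unfolding T[OF that(1)] T[OF that(2)] T[OF Lp_add(1)[OF two that]] T[OF Lp_cmult(1)[OF that(1)]]
    by (rule sample_linear[OF N N Lp_imp_integrable[OF that(1) two(1)] Lp_imp_integrable[OF that(2) two(1)]])+
  have contr: "(arr_norm n (K n) 2 (T_op m n h))\<^sup>2 \<le> overlap_bound (m - 1) 0 (m - 1) 0 * Lp_int 2 h" if "h \<in> Lp_space Omega 2" for n h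
    using sample_contraction[OF N N two that Kfin, of "real (m div 2)" 0 0 n n] unfolding arr_norm_power2 T[OF that] by simp
  note linear = lin[unfolded linear_on_arrays_def, THEN spec, THEN spec, THEN spec, THEN spec, THEN mp, THEN bspec]
  have Aadd: "An n (?R n (\<lambda>x. g x + h x)) k = An n (?R n g) k + An n (?R n h) k"
    if "g \<in> Lp_space Omega 2" "h \<in> Lp_space Omega 2" "k \<in> K n" for n g h k
  proof -
    have e: "?R n (\<lambda>x. g x + h x) = (\<lambda>l. 1 * ?R n g l + 1 * ?R n h l)"
      by (rule ext) (simp add: restrict_array_def Tlin(1)[OF that(1,2)])
    have "An n (?R n (\<lambda>x. g x + h x)) k = 1 * An n (?R n g) k + 1 * An n (?R n h) k"
      unfolding e by (rule linear[OF _ that(3)]) (simp add: restrict_array_def)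
    then show ?thesis by simp
  qed
  have Ascale: "An n (?R n (\<lambda>x. c * g x)) k = c * An n (?R n g) k"
    if "g \<in> Lp_space Omega 2" "k \<in> K n" for n g c k
  proof -
    have e: "?R n (\<lambda>x. c * g x) = (\<lambda>l. c * ?R n g l + 0 * ?R n g l)"
      by (rule ext) (simp add: restrict_array_def Tlin(2)[OF that(1,1)])
    have "An n (?R n (\<lambda>x. c * g x)) k = c * An n (?R n g) k + 0 * An n (?R n g) k"
      unfolding e by (rule linear[OF _ that(2)]) (simp add: restrict_array_def)
    then show ?thesis by simp
  qed
  have d: "(\<lambda>x. un n x - u x) \<in> Lp_space Omega 2" for n by (rule Lp_diff[OF two un u])
  have S0: "(\<lambda>n. S n (\<lambda>x. un n x - u x)) \<longlonglongrightarrow> 0"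
  proof (rule L2_pointwise_bounded_seminorms_tendsto_zero[where S = S and w = "\<lambda>n x. un n x - u x"])
    show "0 \<le> S n h" for n h unfolding S_def by (rule arr_norm_nonneg)
    show "S n (\<lambda>x. g x + h x) \<le> S n g + S n h" if "g \<in> Lp_space Omega 2" "h \<in> Lp_space Omega 2" for n g h
    proof -
      have "S n (\<lambda>x. g x + h x) = arr_norm n (K n) 2 (\<lambda>k. An n (?R n g) k + An n (?R n h) k)"
        unfolding S_def by (rule arr_norm_cong) (rule Aadd[OF that])
      then show ?thesis using arr_norm_triangle[of n "K n" "An n (?R n g)" "An n (?R n h)"] by (simp add: S_def)
    qed
    show "S n (\<lambda>x. c * h x) = \<bar>c\<bar> * S n h" if "h \<in> Lp_space Omega 2" for n h c
    proof -
      have "S n (\<lambda>x. c * h x) = arr_norm n (K n) 2 (\<lambda>k. c * An n (?R n h) k)"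
        unfolding S_def by (rule arr_norm_cong) (rule Ascale[OF that])
      then show ?thesis by (simp add: S_def arr_norm_cmult)
    qed
    show "\<exists>L. \<forall>h\<in>Lp_space Omega 2. (S n h)\<^sup>2 \<le> L * Lp_int 2 h" for n
    proof -
      obtain B where B: "B \<ge> 0" "\<And>a. (\<Sum>k\<in>K n. (An n (restrict_array (K n) a) k)\<^sup>2) \<le> B * (\<Sum>k\<in>K n. (a k)\<^sup>2)"
        using linear_on_arrays_bounded[OF lin Kfin] by blast
      have "(S n h)\<^sup>2 \<le> (B * overlap_bound (m - 1) 0 (m - 1) 0) * Lp_int 2 h" if h: "h \<in> Lp_space Omega 2" for h
      proof -
        have "(S n h)\<^sup>2 \<le> B * (\<Sum>k\<in>K n. (T_op m n h k)\<^sup>2) / 4 ^ n"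
          unfolding S_def arr_norm_power2 by (intro divide_right_mono B) auto
        also have "\<dots> = B * (arr_norm n (K n) 2 (T_op m n h))\<^sup>2" by (simp add: arr_norm_power2)
        also have "\<dots> \<le> B * (overlap_bound (m - 1) 0 (m - 1) 0 * Lp_int 2 h)" by (intro mult_left_mono contr[OF h] B)
        finally show ?thesis by simp
      qed
      then show ?thesis by blast
    qed
    \<comment> \<open>Consistency bounds the distance to the samples of \<open>A h\<close>, which in
      turn are bounded by the L_2 norm of \<open>A h\<close>. The bound depends on \<open>h\<close>,
      as pointwise boundedness allows.\<close>
    show "\<exists>B. \<forall>n. S n h \<le> B" if h: "h \<in> Lp_space Omega 2" for h
    proof -
      have "(\<lambda>n. arr_norm n (K n) 2 (\<lambda>k. T_op m n (A h) k - An n (?R n h) k)) \<longlonglongrightarrow> 0"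
        using cons h by (auto simp: consistent_discretization_def)
      then have "Bseq (\<lambda>n. arr_norm n (K n) 2 (\<lambda>k. T_op m n (A h) k - An n (?R n h) k))"
        by (intro convergent_imp_Bseq convergentI)
      then obtain B where B: "\<And>n. \<bar>arr_norm n (K n) 2 (\<lambda>k. T_op m n (A h) k - An n (?R n h) k)\<bar> \<le> B"
        by (auto simp: Bseq_def)
      have "S n h \<le> sqrt (overlap_bound (m - 1) 0 (m - 1) 0 * Lp_int 2 (A h)) + B" for n
      proof -
        have "S n h = arr_norm n (K n) 2 (\<lambda>k. T_op m n (A h) k + (An n (?R n h) k - T_op m n (A h) k))" by (simp add: S_def)
        also have "\<dots> \<le> arr_norm n (K n) 2 (T_op m n (A h)) + arr_norm n (K n) 2 (\<lambda>k. An n (?R n h) k - T_op m n (A h) k)"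
          by (rule arr_norm_triangle)
        also have "\<dots> \<le> sqrt (overlap_bound (m - 1) 0 (m - 1) 0 * Lp_int 2 (A h)) + B"
          using B[of n] real_le_rsqrt[OF contr[OF AL[OF h], of n]]
          by (simp add: arr_norm_minus_commute[of n "K n" 2 "An n (?R n h)"])
        finally show ?thesis .
      qed
      then show ?thesis by blast
    qed
  qed (rule d lim)+
  have Lp_int_cell_fn: "Lp_int 2 (cell_fn n (K n) a) = (arr_norm n (K n) 2 a)\<^sup>2" for n a
    unfolding cell_fn_Lp(2)[OF Ksub two(1)] arr_norm_power2 by simp
  have PL: "cell_fn n (K n) a \<in> Lp_space Omega 2" for n a by (rule cell_fn_Lp(1)[OF Ksub two(1)])
  have G: "(\<lambda>x. A u x - f x) \<in> Lp_space Omega 2" by (rule Lp_diff[OF two AL[OF u] f])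
  define a where "a n k = An n (?R n (un n)) k - T_op m n f k" for n k
  define b where "b n k = An n (?R n u) k - T_op m n (A u) k" for n k
  have a: "a n k = An n (?R n (\<lambda>x. un n x - u x)) k + b n k + ?T n (\<lambda>x. A u x - f x) k" if k: "k \<in> K n" for n k
  proof -
    have "An n (?R n (un n)) k = An n (?R n (\<lambda>x. (un n x - u x) + u x)) k" by simp
    also have "\<dots> = An n (?R n (\<lambda>x. un n x - u x)) k + An n (?R n u) k" by (rule Aadd[OF d u k])
    finally show ?thesis
      using sample_diff[OF N N Lp_imp_integrable[OF AL[OF u] two(1)] Lp_imp_integrable[OF f two(1)], of "real (m div 2)" 0 0 n k]
      by (simp add: a_def b_def T[OF AL[OF u]] T[OF f])
  qed
  have "(\<lambda>n. Lp_int 2 (\<lambda>x. (cell_fn n (K n) (An n (?R n (\<lambda>x. un n x - u x))) x + cell_fn n (K n) (b n) x)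
      + (cell_fn n (K n) (?T n (\<lambda>x. A u x - f x)) x - (A u x - f x)))) \<longlonglongrightarrow> 0"
  proof (intro Lp_int_add_tendsto_zero[OF two] Lp_add[OF two] Lp_diff(1)[OF two PL G] PL)
    show "(\<lambda>n. Lp_int 2 (\<lambda>x. cell_fn n (K n) (An n (?R n (\<lambda>x. un n x - u x))) x)) \<longlonglongrightarrow> 0"
      unfolding Lp_int_cell_fn using tendsto_power[OF S0, of 2] by (simp add: S_def)
    have "(\<lambda>n. arr_norm n (K n) 2 (b n)) \<longlonglongrightarrow> 0"
      using cons u unfolding consistent_discretization_def b_def[abs_def]
      by (subst arr_norm_minus_commute) auto
    from tendsto_power[OF this, of 2] show "(\<lambda>n. Lp_int 2 (\<lambda>x. cell_fn n (K n) (b n) x)) \<longlonglongrightarrow> 0" unfolding Lp_int_cell_fn by simp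
    show "(\<lambda>n. Lp_int 2 (\<lambda>x. cell_fn n (K n) (?T n (\<lambda>x. A u x - f x)) x - (A u x - f x))) \<longlonglongrightarrow> 0"
      by (rule cell_fn_sample_tendsto[OF N N two Ksub Kev G G]) (simp_all add: Lp_zero)
  qed
  moreover have "(cell_fn n (K n) (An n (?R n (\<lambda>x. un n x - u x))) x + cell_fn n (K n) (b n) x)
      + (cell_fn n (K n) (?T n (\<lambda>x. A u x - f x)) x - (A u x - f x)) = cell_fn n (K n) (a n) x - (A u x - f x)" for n x
    by (simp add: cell_fn_def a)
  ultimately have "(\<lambda>n. Lp_int 2 (\<lambda>x. cell_fn n (K n) (a n) x - (A u x - f x))) \<longlonglongrightarrow> 0" by (simp only:)
  from Lp_int_tendsto[OF two PL G this] have "(\<lambda>n. (arr_norm n (K n) 2 (a n))\<^sup>2) \<longlonglongrightarrow> Lp_int 2 (\<lambda>x. A u x - f x)"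
    by (simp only: Lp_int_cell_fn)
  moreover have "Lp_int 2 (\<lambda>x. A u x - f x) = (Lp_norm Omega 2 (\<lambda>x. A u x - f x))\<^sup>2"
    using Lp_norm_powr[of 2 "\<lambda>x. A u x - f x"] by (simp add: Lp_norm_def)
  ultimately show ?thesis by (simp add: a_def[abs_def])
qed

end

section \<open>Convergence along sequences and Gamma-convergence\<close>

context
  fixes p q nu1 nu2 :: real and f :: fn and J m C :: nat and al :: "nat \<Rightarrow> multi_index"
    and psi :: "nat \<Rightarrow> fn" and A :: "fn \<Rightarrow> fn" and An :: "nat \<Rightarrow> array \<Rightarrow> array"
  assumes p: "1 \<le> p" "p \<le> 2" and q: "1 \<le> q" "q \<le> 2"
    and f: "f \<in> Lp_space Omega 2"
    and J: "J \<ge> 1" and al0: "\<And>j. j \<in> {1..J} \<Longrightarrow> al j \<noteq> (0, 0)"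
    and A: "linear_operator_L2 Omega A"
    and m: "m \<ge> 2" and al: "\<And>j. j \<in> {1..J} \<Longrightarrow> fst (al j) \<le> m \<and> snd (al j) \<le> m"
    and psi: "\<And>j. psi j = framelet m (al j)"
    and adm: "admissible_margin m al psi J C"
    and lin: "\<And>n. linear_on_arrays (K_set m al J C n) (An n)"
    and cons: "consistent_discretization m (K_set m al J C) A An"
begin

lemma E_discrete_tendsto:
  assumes ws: "converges_in (UV_space (max_order J al) p q J) (UV_dist (max_order J al) p q J) ws w"
  shows "(\<lambda>n. E_discrete p q nu1 nu2 f J al m psi (K_set m al J C) An n (ws n)) \<longlonglongrightarrow> E_continuous p q nu1 nu2 f J al A w"
proof -
  define s where "s = max_order J al"
  have ord: "order_of (al j) \<le> s" if "j \<in> {1..J}" for j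
    unfolding s_def max_order_def using that by (intro Max_ge) auto
  \<comment> \<open>A nonzero multi-index makes \<open>s \<ge> 1\<close>, so first derivatives are
    available for the embedding into L_2.\<close>
  have "al 1 \<noteq> (0, 0)" using al0[of 1] J by simp
  then have "order_of (al 1) \<ge> 1" by (cases "al 1") (auto simp: order_of_def)
  then have s1: "s \<ge> 1" using ord[of 1] J by simp
  obtain u v where w: "w = (u, v)" by (cases w)
  define un where "un n = fst (ws n)" for n
  define vn where "vn n = snd (ws n)" for n
  have wsn: "ws n = (un n, vn n)" for n by (simp add: un_def vn_def)
  have un: "un n \<in> sobolev_space Omega (2 * s) p" and vn: "vn n \<in> sobolev_vspace Omega s q J" for n
    using ws by (auto simp: converges_in_def UV_space_def wsn s_def mem_Times_iff)
  have u: "u \<in> sobolev_space Omega (2 * s) p" and v: "v \<in> sobolev_vspace Omega s q J"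
    using ws by (auto simp: converges_in_def UV_space_def w s_def)
  have vnj: "vn n j \<in> sobolev_space Omega s q" and vj: "v j \<in> sobolev_space Omega s q" if "j \<in> {1..J}" for n j
    using vn v that by (auto simp: sobolev_vspace_def)
  let ?a = "\<lambda>n. sobolev_norm Omega (2 * s) p (\<lambda>x. un n x - u x)"
  let ?b = "\<lambda>n. sobolev_vnorm Omega s q J (\<lambda>j x. vn n j x - v j x)"
  have ab: "(\<lambda>n. ?a n + ?b n) \<longlonglongrightarrow> 0" using ws by (simp add: converges_in_def UV_dist_def wsn w s_def)
  have nn: "?a n \<ge> 0" "?b n \<ge> 0" for n by (auto simp: sobolev_norm_def sobolev_vnorm_def)
  have "?a \<longlonglongrightarrow> 0" by (rule tendsto_sandwich[OF _ _ tendsto_const ab]) (use nn in auto)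
  note ulim = sobolev_norm_tendsto_zero[OF p un u this]
  have "?b \<longlonglongrightarrow> 0" by (rule tendsto_sandwich[OF _ _ tendsto_const ab]) (use nn in auto)
  note vlim = sobolev_vnorm_tendsto_zero[OF q vn v this]
  have s2: "1 \<le> 2 * s" using s1 by simp
  have u2: "u \<in> Lp_space Omega 2" "\<And>n. un n \<in> Lp_space Omega 2"
    using sobolev_L2[OF p _ s2] u un by auto
  have u2lim: "(\<lambda>n. Lp_int 2 (\<lambda>x. un n x - u x)) \<longlonglongrightarrow> 0"
    by (rule sobolev_L2_tendsto[OF p un u s2 ulim])
  \<comment> \<open>The first term measures v with exponent \<open>p\<close>, while its convergence
    is given with exponent \<open>q\<close>, possibly smaller. The space L_2 mediates between the
    two.\<close>
  have v2: "v j \<in> Lp_space Omega 2" "\<And>n. vn n j \<in> Lp_space Omega 2" if "j \<in> {1..J}" for j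
    using sobolev_L2[OF q _ s1] vnj vj that by auto
  have v2lim: "(\<lambda>n. Lp_int 2 (\<lambda>x. vn n j x - v j x)) \<longlonglongrightarrow> 0" if "j \<in> {1..J}" for j
    by (rule sobolev_L2_tendsto[OF q vnj[OF that] vj[OF that] s1 vlim[OF _ that]])
  have p0: "0 < p" using p by simp
  have vp: "v j \<in> Lp_space Omega p" "\<And>n. vn n j \<in> Lp_space Omega p" if "j \<in> {1..J}" for j
    using v2[OF that] Lp_exponent_mono(1)[OF p0 p(2)] by auto
  have vplim: "(\<lambda>n. Lp_int p (\<lambda>x. vn n j x - v j x)) \<longlonglongrightarrow> 0" if "j \<in> {1..J}" for j
    by (rule Lp_int_tendsto_zero_exponent_mono[OF p Lp_diff(1) v2lim[OF that]]) (use v2[OF that] in auto)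
  have ord2: "order_of (al j) \<le> 2 * s" if "j \<in> {1..J}" for j using ord[OF that] by simp
  have t1: "(\<lambda>n. arr_vnorm n (K_set m al J C n) p {1..J}
        (\<lambda>j k. W1_op m al psi n (T_op m n (un n)) j k - S_op al psi n (vn n) j k) powr p)
      \<longlonglongrightarrow> Lp_vnorm Omega p {1..J} (\<lambda>j x. weak_deriv Omega (al j) u x - v j x) powr p"
    by (rule first_order_term_tendsto[OF m al psi J adm p sobolev_deriv(1)[OF un ord2] sobolev_Lp[OF un]
          sobolev_deriv(2)[OF un ord2] sobolev_deriv(2)[OF u ord2] vp(2) vp(1) ulim[OF ord2] vplim])
  have t2: "(\<lambda>n. arr_vnorm n (K_set m al J C n) q ({1..J} \<times> {1..J}) (W2_op m al psi n (S_op al psi n (vn n))) powr q)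
      \<longlonglongrightarrow> Lp_vnorm Omega q ({1..J} \<times> {1..J}) (\<lambda>(i, j). weak_deriv Omega (al i) (v j)) powr q"
    by (rule second_order_term_tendsto[OF m al psi J adm q sobolev_deriv(1)[OF vnj ord] sobolev_Lp[OF vnj]
          sobolev_deriv(2)[OF vnj ord] sobolev_deriv(2)[OF vj ord] vlim[OF ord]])
  have t3: "(\<lambda>n. (arr_norm n (K_set m al J C n) 2
        (\<lambda>k. An n (restrict_array (K_set m al J C n) (T_op m n (un n))) k - T_op m n f k))\<^sup>2)
      \<longlonglongrightarrow> (Lp_norm Omega 2 (\<lambda>x. A u x - f x))\<^sup>2"
    by (rule fidelity_term_tendsto[OF m al psi J f A lin cons u2(2) u2(1) u2lim])
  show ?thesis
    unfolding E_discrete_def E_continuous_def wsn w prod.case by (intro tendsto_intros t1 t2 t3)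
qed

lemma E_discrete_gamma_converges:
  "gamma_converges (UV_space (max_order J al) p q J) (UV_dist (max_order J al) p q J)
     (E_discrete p q nu1 nu2 f J al m psi (K_set m al J C) An) (E_continuous p q nu1 nu2 f J al A)"
  unfolding gamma_converges_def
proof (intro conjI allI impI ballI)
  let ?B = "UV_space (max_order J al) p q J" and ?d = "UV_dist (max_order J al) p q J"
  let ?En = "E_discrete p q nu1 nu2 f J al m psi (K_set m al J C) An" and ?E = "E_continuous p q nu1 nu2 f J al A"
  have lim: "(\<lambda>n. ereal (?En n (ws n))) \<longlonglongrightarrow> ereal (?E w)" if "converges_in ?B ?d ws w" for ws w
    using E_discrete_tendsto[OF that] by simp
  show "ereal (?E w) \<le> liminf (\<lambda>n. ereal (?En n (ws n)))" if "converges_in ?B ?d ws w" for ws w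
    using lim_imp_Liminf[OF sequentially_bot lim[OF that]] by simp
  fix w assume w: "w \<in> ?B"
  have c: "converges_in ?B ?d (\<lambda>_. w) w"
    using w by (simp add: converges_in_def UV_dist_def sobolev_norm_zero sobolev_vnorm_zero)
  then show "\<exists>ws. converges_in ?B ?d ws w \<and> limsup (\<lambda>n. ereal (?En n (ws n))) \<le> ereal (?E w)"
    using lim_imp_Limsup[OF sequentially_bot lim[OF c]] by (intro exI[of _ "\<lambda>_. w"]) simp
qed

end

theorem theorem3p1:
  fixes p q nu1 nu2 :: real and f :: fn and J :: nat and al :: "nat \<Rightarrow> multi_index"
    and A :: "fn \<Rightarrow> fn"
  assumes "1 \<le> p" "p \<le> 2" "1 \<le> q" "q \<le> 2"
    and "nu1 > 0" "nu2 > 0"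
    and "f \<in> Lp_space Omega 2"
    and "J \<ge> 1" "\<And>j. j \<in> {1..J} \<Longrightarrow> al j \<noteq> (0, 0)"
    and "linear_operator_L2 Omega A"
  shows "\<exists>m psi. m \<ge> 1 \<and> (\<forall>j \<in> {1..J}. framelet_with_operator m (al j) (psi j)) \<and>
    (\<exists>C. admissible_margin m al psi J C) \<and>
    (\<forall>C An. admissible_margin m al psi J C \<longrightarrow>
       (\<forall>n. linear_on_arrays (K_set m al J C n) (An n)) \<longrightarrow>
       consistent_discretization m (K_set m al J C) A An \<longrightarrow>
       (let s = max_order J al; B = UV_space s p q J; d = UV_dist s p q J;
            En = E_discrete p q nu1 nu2 f J al m psi (K_set m al J C) An;
            E = E_continuous p q nu1 nu2 f J al A
        in (\<forall>ws w. converges_in B d ws w \<longrightarrow> (\<lambda>n. En n (ws n)) \<longlonglongrightarrow> E w) \<and>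
           gamma_converges B d En E))"
proof -
  \<comment> \<open>The summand 2 gives \<open>m - 1 \<ge> 1\<close>, hence continuous kernels; the
    sum dominates every entry of every multi-index, so one system serves all
    \<open>j\<close>.\<close>
  define m where "m = 2 + (\<Sum>j\<in>{1..J}. order_of (al j))"
  define psi where "psi = (\<lambda>j. framelet m (al j))"
  have m: "m \<ge> 2" by (simp add: m_def)
  have al: "fst (al j) \<le> m \<and> snd (al j) \<le> m" if "j \<in> {1..J}" for j
    using member_le_sum[of j "{1..J}" "\<lambda>j. order_of (al j)"] that by (auto simp: m_def order_of_def)
  have psi: "psi j = framelet m (al j)" for j by (simp add: psi_def)
  note A = assms(10) and J = assms(8) and al0 = assms(9)
  show ?thesis
  proof (rule exI[of _ m], rule exI[of _ psi], intro conjI allI impI)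
    show "1 \<le> m" using m by simp
    show "\<forall>j\<in>{1..J}. framelet_with_operator m (al j) (psi j)"
      using al al0 by (auto simp: framelet_with_operator_def psi)
    show "\<exists>C. admissible_margin m al psi J C" by (rule exI, rule admissible_margin_2[OF m al psi J])
    fix C An
    assume "admissible_margin m al psi J C" "\<forall>n. linear_on_arrays (K_set m al J C n) (An n)"
      "consistent_discretization m (K_set m al J C) A An"
    note hyps = assms(1-4,7) J al0 A m al psi this(1) spec[OF this(2)] this(3)
    show "let s = max_order J al; B = UV_space s p q J; d = UV_dist s p q J;
            En = E_discrete p q nu1 nu2 f J al m psi (K_set m al J C) An;
            E = E_continuous p q nu1 nu2 f J al A
        in (\<forall>ws w. converges_in B d ws w \<longrightarrow> (\<lambda>n. En n (ws n)) \<longlonglongrightarrow> E w) \<and>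
           gamma_converges B d En E"
      unfolding Let_def
      by (intro conjI allI impI E_discrete_tendsto[OF hyps] E_discrete_gamma_converges[OF hyps])
  qed
qed

end
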